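(* Let $n\ge 1$, $0<p<q<\infty$ and $\alpha\in\mathbb{R}$. Consider the Hardy spaces $H^p,H^q$ and the weighted Bergman spaces $A^p_\alpha,A^q_\alpha$ on the open unit ball $\mathbb{B}_n$ of $\mathbb{C}^n$. Then: (a) $A^p_\alpha\subset H^q$ if and only if $\dfrac{n+1+\alpha}{p}\le\dfrac{n}{q}$. (b) $H^p\subset A^q_\alpha$ if and only if $\dfrac{n}{p}\le\dfrac{n+1+\alpha}{q}$. (c) Any embedding in (a) or (b) is compact if and only if the corresponding inequality is strict; that is, when $A^p_\alpha\subset H^q$ the embedding is compact if and only if $\frac{n+1+\alpha}{p}<\frac{n}{q}$, and when $H^p\subset A^q_\alpha$ the embedding is compact if and only if $\frac{n}{p}<\frac{n+1+\alpha}{q}$.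
   Context: $\mathbb{B}_n$ is the open unit ball of $\mathbb{C}^n$, $dv$ is Lebesgue volume measure on $\mathbb{B}_n$, and $H(\mathbb{B}_n)$ is the space of holomorphic functions on $\mathbb{B}_n$. For $\alpha\in\mathbb{R}$, $dv_\alpha(z)=(1-|z|^2)^\alpha\,dv(z)$; when $\alpha>-1$ it is multiplied by a positive constant so that $v_\alpha(\mathbb{B}_n)=1$. The radial derivative is $Rf(z)=\sum_{k=1}^n z_k\frac{\partial f}{\partial z_k}(z)$, and $R^N$ denotes its $N$-th iterate. Weighted Bergman spaces: for $0<p<\infty$ and $\alpha\in\mathbb{R}$, $A^p_\alpha$ is the space of all $f\in H(\mathbb{B}_n)$ such that $(1-|z|^2)^N R^N f(z)$ belongs to $L^p(\mathbb{B}_n,dv_\alpha)$, where $N$ is any non-negative integer with $Np+\alpha>-1$ (it is known that the space does not depend on the choice of such $N$). If $\alpha>-1$, then $A^p_\alpha=L^p(\mathbb{B}_n,dv_\alpha)\cap H(\mathbb{B}_n)$ and $\|f\|_{p,\alpha}=\left[\int_{\mathbb{B}_n}|f|^p\,dv_\alpha\right]^{1/p}$. If $\alpha\le-1$, let $N$ be the smallest positive integer with $Np+\alpha>-1$ and put $\|f\|_{p,\alpha}=|f(0)|+\left[\int_{\mathbb{B}_n}|(1-|z|^2)^N R^N f(z)|^p\,dv_\alpha(z)\right]^{1/p}$. Hardy spaces: for $0<p<\infty$, $H^p$ is the space of all $f\in H(\mathbb{B}_n)$ with $\|f\|_{H^p}^p=\sup_{0<r<1}\int_{\mathbb{S}^n}|f(r\zeta)|^p\,d\sigma(\zeta)<\infty$,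 where $\mathbb{S}^n=\partial\mathbb{B}_n$ and $d\sigma$ is normalized Lebesgue measure on $\mathbb{S}^n$. Compact embedding: an inclusion $X\subset Y$ of two of these spaces is called compact if $\|f_k\|_Y\to0$ as $k\to\infty$ whenever $\{f_k\}$ is a bounded sequence in $X$ with $f_k\to0$ uniformly on compact subsets of $\mathbb{B}_n$. *)

theory Defs
  imports "HOL-Analysis.Analysis"
begin

text \<open>
  The space \<open>\<complex>\<^sup>n\<close> is \<^typ>\<open>complex ^ 'n\<close> with \<open>n = CARD('n)\<close>; its norm is the Hermitian one.
  Functions on the unit ball are total functions whose values off the ball are irrelevant:
  nothing below depends on them.
\<close>

abbreviation unit_ball :: "(complex ^ 'n) set" where
  "unit_ball \<equiv> ball 0 1"

text \<open>Holomorphic on an open set: real differentiable with complex linear derivative.\<close>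

definition holomorphic_vec_on :: "(complex ^ 'n \<Rightarrow> complex) \<Rightarrow> (complex ^ 'n) set \<Rightarrow> bool" where
  "holomorphic_vec_on f S \<longleftrightarrow>
     (\<forall>z\<in>S. \<exists>D. (f has_derivative D) (at z) \<and> (\<forall>c v. D (c *s v) = c * D v))"

definition partial_deriv :: "'n \<Rightarrow> (complex ^ 'n \<Rightarrow> complex) \<Rightarrow> complex ^ 'n \<Rightarrow> complex" where
  "partial_deriv k f z = deriv (\<lambda>w. f (z + w *s axis k 1)) 0"

definition radial_deriv :: "(complex ^ 'n \<Rightarrow> complex) \<Rightarrow> complex ^ 'n \<Rightarrow> complex" where
  "radial_deriv f z = (\<Sum>k\<in>UNIV. z $ k * partial_deriv k f z)"

definition Lp_integral :: "real \<Rightarrow> 'a measure \<Rightarrow> ('a \<Rightarrow> complex) \<Rightarrow> ennreal" where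
  "Lp_integral p M f = (\<integral>\<^sup>+z. ennreal (norm (f z) powr p) \<partial>M)"

definition Lp_space :: "real \<Rightarrow> 'a measure \<Rightarrow> ('a \<Rightarrow> complex) set" where
  "Lp_space p M = {f \<in> borel_measurable M. Lp_integral p M f < \<infinity>}"

definition Lp_norm :: "real \<Rightarrow> 'a measure \<Rightarrow> ('a \<Rightarrow> complex) \<Rightarrow> real" where
  "Lp_norm p M f = enn2real (Lp_integral p M f) powr (1 / p)"

definition ball_weight :: "real \<Rightarrow> (complex ^ 'n) measure" where
  "ball_weight \<alpha> =
     density (restrict_space lborel unit_ball) (\<lambda>z. ennreal ((1 - (norm z)\<^sup>2) powr \<alpha>))"

text \<open>
  The measure \<open>v\<^sub>\<alpha>\<close>. It is normalized only for \<open>\<alpha> > -1\<close>, when \<open>ball_weight \<alpha>\<close> has finite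
  positive mass.
\<close>

definition ball_measure :: "real \<Rightarrow> (complex ^ 'n) measure" where
  "ball_measure \<alpha> =
     (if \<alpha> > -1
      then scale_measure (inverse (emeasure (ball_weight \<alpha> :: (complex ^ 'n) measure) unit_ball))
             (ball_weight \<alpha>)
      else ball_weight \<alpha>)"

text \<open>
  The order \<open>N\<close> used for \<open>A\<^sup>p\<^sub>\<alpha>\<close>. The space is known to be the same for every \<open>N\<close> with
  \<open>N p + \<alpha> > -1\<close>. The least such \<open>N\<close> is \<open>0\<close> if \<open>\<alpha> > -1\<close>, so that the
  space is then \<open>L\<^sup>p(v\<^sub>\<alpha>) \<inter> H\<close>; it is positive if \<open>\<alpha> \<le> -1\<close>, and is then the order in
  the definition of the norm.
\<close>

definition bergman_order :: "real \<Rightarrow> real \<Rightarrow> nat" where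
  "bergman_order p \<alpha> = (LEAST N. real N * p + \<alpha> > -1)"

definition weighted_radial :: "nat \<Rightarrow> (complex ^ 'n \<Rightarrow> complex) \<Rightarrow> complex ^ 'n \<Rightarrow> complex" where
  "weighted_radial N f z = of_real ((1 - (norm z)\<^sup>2) ^ N) * (radial_deriv ^^ N) f z"

definition bergman_space :: "real \<Rightarrow> real \<Rightarrow> (complex ^ 'n \<Rightarrow> complex) set" where
  "bergman_space p \<alpha> =
     {f. holomorphic_vec_on f unit_ball \<and>
         weighted_radial (bergman_order p \<alpha>) f \<in> Lp_space p (ball_measure \<alpha>)}"

lemma bergman_space_eq_Lp:
  assumes "\<alpha> > -1"
  shows "(bergman_space p \<alpha> :: (complex ^ 'n \<Rightarrow> complex) set) =
    Lp_space p (ball_measure \<alpha>) \<inter> {f. holomorphic_vec_on f unit_ball}"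
proof -
  have "bergman_order p \<alpha> = 0"
    using assms unfolding bergman_order_def by (intro Least_eq_0) simp
  moreover have "weighted_radial 0 f = f" for f :: "complex ^ 'n \<Rightarrow> complex"
    by (simp add: weighted_radial_def fun_eq_iff)
  ultimately show ?thesis
    by (auto simp: bergman_space_def)
qed

definition bergman_norm :: "real \<Rightarrow> real \<Rightarrow> (complex ^ 'n \<Rightarrow> complex) \<Rightarrow> real" where
  "bergman_norm p \<alpha> f =
     (if \<alpha> > -1 then Lp_norm p (ball_measure \<alpha>) f
      else norm (f 0) + Lp_norm p (ball_measure \<alpha>) (weighted_radial (bergman_order p \<alpha>) f))"

text \<open>
  Normalized surface measure on the unit sphere, in the polar coordinates form: the measure of
  \<open>E\<close> is the volume of the cone \<open>{t \<zeta> | 0 < t < 1, \<zeta> \<in> E}\<close> divided by that of the ball. Here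
  \<^term>\<open>sgn z\<close> is \<open>z / norm z\<close>, and the origin, which it maps to \<open>0\<close>, is a null set.
\<close>

definition sphere_measure :: "(complex ^ 'n) measure" where
  "sphere_measure =
     restrict_space (distr (uniform_measure lborel unit_ball) borel sgn) (sphere 0 1)"

definition hardy_sup :: "real \<Rightarrow> (complex ^ 'n \<Rightarrow> complex) \<Rightarrow> ennreal" where
  "hardy_sup p f = (SUP r\<in>{0<..<1}. Lp_integral p sphere_measure (\<lambda>\<zeta>. f (r *\<^sub>R \<zeta>)))"

definition hardy_space :: "real \<Rightarrow> (complex ^ 'n \<Rightarrow> complex) set" where
  "hardy_space p = {f. holomorphic_vec_on f unit_ball \<and> hardy_sup p f < \<infinity>}"

definition hardy_norm :: "real \<Rightarrow> (complex ^ 'n \<Rightarrow> complex) \<Rightarrow> real" where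
  "hardy_norm p f = enn2real (hardy_sup p f) powr (1 / p)"

definition compact_embedding ::
  "(complex ^ 'n \<Rightarrow> complex) set \<Rightarrow> ((complex ^ 'n \<Rightarrow> complex) \<Rightarrow> real) \<Rightarrow>
   (complex ^ 'n \<Rightarrow> complex) set \<Rightarrow> ((complex ^ 'n \<Rightarrow> complex) \<Rightarrow> real) \<Rightarrow> bool" where
  "compact_embedding X normX Y normY \<longleftrightarrow>
     X \<subseteq> Y \<and>
     (\<forall>F. (\<forall>k. F k \<in> X) \<and> (\<exists>C. \<forall>k. normX (F k) \<le> C) \<and>
          (\<forall>K. compact K \<and> K \<subseteq> unit_ball \<longrightarrow> uniform_limit K F (\<lambda>_. 0) sequentially) \<longrightarrow>
          (\<lambda>k. normY (F k)) \<longlonglongrightarrow> 0)"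

end

theory Submission
  imports Defs "HOL-Complex_Analysis.Complex_Analysis" "HOL-Real_Asymp.Real_Asymp"
begin

text \<open>
  Write \<open>s = 1 - |z|\<close>. All estimates come from one property: \<open>v |f|\<close> is subharmonic on complex lines
  when \<open>t \<mapsto> v (exp t)\<close> is convex. Its circle means therefore increase with the radius, and by
  rotation invariance so do its means over spheres (\<open>sphere_mean_mono\<close>). Applied to \<open>|f|\<^sup>p\<close> on an
  ellipsoid around \<open>z\<close> that has size \<open>s\<close> in the direction of \<open>z\<close> and \<open>sqrt s\<close> in the complex
  tangential directions, and so a volume of the order \<open>s\<^bsup>n+1\<^esup>\<close>, this gives the sharp pointwise
  bounds \<open>|f z|\<^sup>p \<le> C s\<^bsup>-n\<^esup> \<parallel>f\<parallel>\<^sup>p\<close> in \<open>H\<^sup>p\<close> and \<open>|f z|\<^sup>p \<le> C s\<^bsup>-(n+1+\<gamma>)\<^esup> \<parallel>f\<parallel>\<^sup>p\<close> for the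
  weight \<open>s\<^sup>\<gamma>\<close> (\<open>pointwise_integral_mean\<close>, \<open>pointwise_weighted_integral\<close>).

  From \<open>H\<^sup>p\<close> to \<open>A\<^sup>q\<^sub>\<alpha>\<close> (\<open>hardy_bergman_bound\<close>). The pointwise bound \<open>|f z| \<le> L s\<^bsup>-n/p\<^esup>\<close> makes
  \<open>s\<^bsup>nq/p\<^esup> |f|\<^sup>q / L\<^sup>q\<close> at most \<open>1\<close>, hence comparable to \<open>ln (1 + s\<^bsup>nq/p\<^esup> |f|\<^sup>q / L\<^sup>q)\<close>. For fixed
  \<open>s\<close> this is a log-convex function of \<open>|f|\<close>, so its mean over the sphere of radius \<open>1 - s\<close> is at most
  the one over the sphere of a larger radius \<open>R\<close>. There \<open>|f|\<close> no longer depends on \<open>s\<close>, and the integral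
  over \<open>s\<close>, which now comes first, turns the logarithm into a multiple of \<open>|f|\<^sup>p\<close>.

  From \<open>A\<^sup>p\<^sub>\<alpha>\<close> to \<open>H\<^sup>q\<close> (\<open>bergman_hardy_bound\<close>). Here \<open>\<alpha> < -1\<close>, and the condition is on
  \<open>g = R\<^bsup>M+1\<^esup> f\<close>, from which \<open>f\<close> is recovered on each ray by repeated integration. Besides the
  pointwise bound of \<open>g\<close> there is a bound \<open>|g (u \<zeta>)|\<^sup>p \<le> (1 - u)\<^bsup>-(\<gamma>+1)\<^esup> H \<zeta>\<close> on each ray, with the
  integral of \<open>H\<close> over the sphere controlled by the norm (\<open>slice_maximal\<close>). Integrating the smaller of
  the two along the ray bounds \<open>|f|\<close> by \<open>H\<^bsup>1/q\<^esup>\<close>, which is what membership in \<open>H\<^sup>q\<close> requires.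

  Both estimates start at an arbitrary radius \<open>t\<close>, up to which only the size of \<open>f\<close> matters, and the part
  beyond \<open>t\<close> contributes a positive power of \<open>1 - t\<close> when the inequality of the exponents is strict.
  This gives compactness: choose \<open>t\<close> close to \<open>1\<close>, then use uniform convergence inside.

  The converse directions come from \<open>(1 - \<rho> z\<^sub>k)\<^bsup>-b\<^esup>\<close>. For \<open>\<rho> = 1\<close> and \<open>b\<close> strictly between the two sides
  of the inequality it lies in the first space and it, or its derivative of the order
  in the definition of the second space, violates the pointwise bound there. At equality, suitable
  multiples of these functions with \<open>\<rho> \<rightarrow> 1\<close> are bounded in the first space and tend to \<open>0\<close> locally
  uniformly, while the pointwise bound keeps their norms in the second space away from \<open>0\<close>.
\<close>

\<comment> \<open>the dollar sign denotes components of vectors\<close>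
unbundle no fps_syntax

section \<open>Lebesgue measure and the sphere\<close>

lemma nn_integral_lborel_affine:
  fixes F :: "'a::euclidean_space \<Rightarrow> ennreal" and t :: 'a
  assumes [measurable]: "F \<in> borel_measurable borel" and c: "c \<noteq> 0"
  shows "(\<integral>\<^sup>+x. F x \<partial>lborel) = ennreal (\<bar>c\<bar> ^ DIM('a)) * (\<integral>\<^sup>+x. F (t + c *\<^sub>R x) \<partial>lborel)"
  by (subst lborel_affine[OF c, of t])
     (simp add: nn_integral_density nn_integral_distr nn_integral_cmult)

lemma emeasure_unit_ball_pos: "emeasure lborel (ball (0::'a::euclidean_space) 1) > 0"
  and emeasure_unit_ball_finite: "emeasure lborel (ball (0::'a::euclidean_space) 1) < \<infinity>"
proof -
  have "measure lborel (ball (0::'a) 1) > 0" by (simp add: content_ball_pos)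
  then show "emeasure lborel (ball (0::'a) 1) > 0"
    by (metis measure_def enn2real_0 less_irrefl zero_less_iff_neq_zero)
  show "emeasure lborel (ball (0::'a) 1) < \<infinity>"
    using emeasure_lborel_ball_finite[of "0::'a" 1] by simp
qed

text \<open>
  Double counting: with \<open>B\<close> the unit ball, the pairs \<open>(x, y)\<close> such that \<open>T x \<in> A\<close> and \<open>T x + y \<in> B\<close>
  have measure \<open>|T\<^bsup>-1\<^esup> A| |B|\<close> if \<open>y\<close> is integrated first, and \<open>|A| |B|\<close> if \<open>x\<close> is translated by a
  preimage of \<open>y\<close> first, because \<open>T x \<in> B\<close> if and only if \<open>x \<in> B\<close>.
\<close>

lemma lborel_distr_isometry:
  fixes T :: "'a::euclidean_space \<Rightarrow> 'a"
  assumes lin: "linear T" and iso: "\<And>x. norm (T x) = norm x"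
  shows "distr lborel borel T = lborel"
proof (rule measure_eqI)
  interpret linear T by fact
  have cont: "continuous_on UNIV T"
    using lin by (simp add: linear_continuous_on linear_conv_bounded_linear)
  have T[measurable]: "T \<in> borel_measurable borel"
    using cont by (rule borel_measurable_continuous_onI)
  have "inj T"
    using iso by (metis injI diff eq_iff_diff_eq_0 norm_eq_zero)
  then have "surj T"
    using lin linear_injective_imp_surjective by blast
  fix A assume "A \<in> sets (distr lborel borel T)"
  then have A[measurable]: "A \<in> sets borel" by simp
  let ?B = "ball 0 1 :: 'a set"
  have B[measurable]: "?B \<in> sets borel" by simp
  have transl: "(\<integral>\<^sup>+x. F (t + x) \<partial>lborel) = (\<integral>\<^sup>+x. F x \<partial>lborel)"
    if "F \<in> borel_measurable borel" for F :: "'a \<Rightarrow> ennreal" and t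
    using nn_integral_lborel_affine[OF that, of 1 t] by simp
  have reflect: "(\<integral>\<^sup>+x. F (t - x) \<partial>lborel) = (\<integral>\<^sup>+x. F x \<partial>lborel)"
    if "F \<in> borel_measurable borel" for F :: "'a \<Rightarrow> ennreal" and t
    using nn_integral_lborel_affine[OF that, of "-1" t] by simp
  have "emeasure (distr lborel borel T) A * emeasure lborel ?B =
      (\<integral>\<^sup>+x. indicator A (T x) \<partial>lborel) * (\<integral>\<^sup>+y. indicator ?B y \<partial>lborel)"
    using nn_integral_distr[of T lborel borel "indicator A"] by simp
  also have "\<dots> = (\<integral>\<^sup>+x. (\<integral>\<^sup>+y. indicator A (T x) * indicator ?B y \<partial>lborel) \<partial>lborel)"
    by (simp add: nn_integral_cmult nn_integral_multc del: nn_integral_indicator)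
  also have "\<dots> = (\<integral>\<^sup>+x. (\<integral>\<^sup>+y. indicator A (T x) * indicator ?B (T x + y) \<partial>lborel) \<partial>lborel)"
    by (rule nn_integral_cong, rule transl[symmetric]) measurable
  also have "\<dots> = (\<integral>\<^sup>+y. (\<integral>\<^sup>+x. indicator A (T x) * indicator ?B (T x + y) \<partial>lborel) \<partial>lborel)"
    by (rule lborel_pair.Fubini') measurable
  also have "\<dots> = (\<integral>\<^sup>+y. (\<integral>\<^sup>+x. indicator A (T x - y) * indicator ?B (T x) \<partial>lborel) \<partial>lborel)"
  proof (rule nn_integral_cong)
    fix y
    obtain b where b: "y = T b" using \<open>surj T\<close> by blast
    have "(\<integral>\<^sup>+x. indicator A (T x) * indicator ?B (T x + y) \<partial>lborel) =
        (\<integral>\<^sup>+x. indicator A (T (- b + x)) * indicator ?B (T (- b + x) + y) \<partial>lborel)"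
      by (rule transl[symmetric]) measurable
    also have "\<dots> = (\<integral>\<^sup>+x. indicator A (T x - y) * indicator ?B (T x) \<partial>lborel)"
      by (simp add: b diff)
    finally show "(\<integral>\<^sup>+x. indicator A (T x) * indicator ?B (T x + y) \<partial>lborel) =
        (\<integral>\<^sup>+x. indicator A (T x - y) * (indicator ?B (T x) :: ennreal) \<partial>lborel)" .
  qed
  also have "\<dots> = (\<integral>\<^sup>+x. (\<integral>\<^sup>+y. indicator A (T x - y) * indicator ?B (T x) \<partial>lborel) \<partial>lborel)"
    by (rule lborel_pair.Fubini'[symmetric]) measurable
  also have "\<dots> = (\<integral>\<^sup>+x. emeasure lborel A * indicator ?B (T x) \<partial>lborel)"
    using reflect[of "indicator A"] by (intro nn_integral_cong) (simp add: nn_integral_multc)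
  also have "\<dots> = emeasure lborel A * (\<integral>\<^sup>+x. indicator ?B (T x) \<partial>lborel)"
    by (rule nn_integral_cmult) measurable
  also have "(\<integral>\<^sup>+x. indicator ?B (T x) \<partial>lborel) = (\<integral>\<^sup>+x. indicator ?B x \<partial>lborel)"
    by (intro nn_integral_cong) (simp add: indicator_def iso)
  also have "\<dots> = emeasure lborel ?B" by simp
  finally show "emeasure (distr lborel borel T) A = emeasure lborel A"
    using emeasure_unit_ball_pos[where 'a='a] emeasure_unit_ball_finite[where 'a='a]
    by (subst (asm) (1 2) mult.commute, subst (asm) ennreal_mult_cancel_left) auto
qed simp

lemma nn_integral_lborel_isometry:
  fixes T :: "'a::euclidean_space \<Rightarrow> 'a"
  assumes "linear T" and "\<And>x. norm (T x) = norm x" and [measurable]: "F \<in> borel_measurable borel"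
  shows "(\<integral>\<^sup>+x. F (T x) \<partial>lborel) = (\<integral>\<^sup>+x. F x \<partial>lborel)"
proof -
  have [measurable]: "T \<in> borel_measurable borel"
    using assms(1) by (simp add: linear_continuous_on linear_conv_bounded_linear borel_measurable_continuous_onI)
  have "(\<integral>\<^sup>+x. F x \<partial>lborel) = (\<integral>\<^sup>+x. F x \<partial>distr lborel borel T)"
    by (simp add: lborel_distr_isometry assms)
  then show ?thesis by (simp add: nn_integral_distr)
qed

text \<open>
  The non-isotropic dilations of the sphere at its \<open>k\<close>-th coordinate vector: the part of the ball where
  \<open>|1 - z\<^sub>k| < d\<close> extends to the order of \<open>sqrt d\<close> in the other coordinates.
\<close>

definition dilation :: "'n \<Rightarrow> real \<Rightarrow> complex ^ 'n \<Rightarrow> complex ^ 'n" where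
  "dilation k d u = (\<chi> j. (if j = k then d else sqrt d) *\<^sub>R u $ j)"

lemma nn_integral_dilation:
  fixes F :: "complex ^ 'n \<Rightarrow> ennreal" and t :: "complex ^ 'n"
  assumes [measurable]: "F \<in> borel_measurable borel" and d: "d > 0"
  shows "ennreal (d ^ (CARD('n) + 1)) * (\<integral>\<^sup>+u. F (t + dilation k d u) \<partial>lborel) = (\<integral>\<^sup>+u. F u \<partial>lborel)"
proof -
  define c :: "complex ^ 'n \<Rightarrow> real" where "c b = (if b $ k \<noteq> 0 then d else sqrt d)" for b
  have ax: "c (axis i u) = (if i = k then d else sqrt d)" if "u \<in> Basis" for i and u :: complex
    using that nonzero_Basis[of u] by (auto simp: c_def axis_def)
  have Basis_eq: "(Basis :: (complex ^ 'n) set) = (\<lambda>(i, u). axis i u) ` (UNIV \<times> Basis)"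
    by (auto simp: Basis_vec_def)
  have inj: "inj_on (\<lambda>(i, u). axis i u :: complex ^ 'n) (UNIV \<times> Basis)"
    by (auto simp: inj_on_def axis_eq_axis)
  have "dilation k d x = (\<Sum>j\<in>Basis. (c j * (x \<bullet> j)) *\<^sub>R j)" for x :: "complex ^ 'n"
  proof (rule euclidean_eqI)
    fix b :: "complex ^ 'n" assume b: "b \<in> Basis"
    then obtain i u where iu: "b = axis i u" "u \<in> Basis" by (auto simp: Basis_vec_def)
    have "(\<Sum>j\<in>Basis. (c j * (x \<bullet> j)) *\<^sub>R j) \<bullet> b = c b * (x \<bullet> b)"
      using b by simp
    also have "\<dots> = dilation k d x \<bullet> b"
      using iu by (simp add: ax inner_axis dilation_def)
    finally show "dilation k d x \<bullet> b = (\<Sum>j\<in>Basis. (c j * (x \<bullet> j)) *\<^sub>R j) \<bullet> b" by simp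
  qed
  then have T: "(\<lambda>x. t + dilation k d x) = (\<lambda>x. t + (\<Sum>j\<in>Basis. (c j * (x \<bullet> j)) *\<^sub>R j))"
    by (simp add: fun_eq_iff)
  have nz: "c j \<noteq> 0" for j using d by (simp add: c_def)
  have "(\<Prod>j\<in>Basis. \<bar>c j\<bar>) = (\<Prod>p\<in>UNIV \<times> Basis. \<bar>c (case p of (i, u) \<Rightarrow> axis i u)\<bar>)"
    by (subst Basis_eq, subst prod.reindex[OF inj]) (simp add: o_def)
  also have "\<dots> = (\<Prod>i\<in>(UNIV :: 'n set). \<Prod>u\<in>Basis. \<bar>c (axis i (u::complex))\<bar>)"
    by (simp add: prod.cartesian_product case_prod_unfold)
  also have "\<dots> = (\<Prod>i\<in>(UNIV :: 'n set). (if i = k then d else 1) * d)"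
    using d by (intro prod.cong refl) (simp add: ax Basis_complex_def power2_eq_square[symmetric])
  also have "\<dots> = d ^ (CARD('n) + 1)"
    by (simp add: prod.distrib)
  finally have P: "(\<Prod>j\<in>Basis. \<bar>c j\<bar>) = d ^ (CARD('n) + 1)" .
  have "(\<lambda>x. t + (\<Sum>j\<in>Basis. (c j * (x \<bullet> j)) *\<^sub>R j)) \<in> borel_measurable borel"
    by (intro borel_measurable_continuous_onI continuous_intros)
  then show ?thesis
    unfolding T[THEN fun_cong]
    by (subst (2) lborel_affine_euclidean[of c t, OF nz])
       (simp add: nn_integral_density nn_integral_distr nn_integral_cmult P)
qed

lemma borel_measurable_sgn_vec[measurable]: "(sgn :: 'a::euclidean_space \<Rightarrow> 'a) \<in> borel_measurable borel"
  unfolding sgn_div_norm by measurable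

lemma space_sphere_measure[simp]: "space sphere_measure = sphere 0 1"
  by (simp add: sphere_measure_def space_restrict_space)

lemma sets_sphere_measure: "sets sphere_measure = sets (restrict_space borel (sphere 0 1))"
  by (simp add: sphere_measure_def sets_restrict_space)

lemma measurable_ident_sphere_measure[measurable (raw)]: "(\<lambda>\<zeta>. \<zeta>) \<in> measurable sphere_measure borel"
  by (simp add: measurable_cong_sets[OF sets_sphere_measure refl] measurable_restrict_space1)

lemma measurable_snd_sphere_measure[measurable]: "snd \<in> measurable (M \<Otimes>\<^sub>M sphere_measure) borel"
  by (rule measurable_compose[OF measurable_snd measurable_ident_sphere_measure])

lemma measurable_fst_sphere_measure[measurable]: "fst \<in> measurable (sphere_measure \<Otimes>\<^sub>M M) borel"
  by (rule measurable_compose[OF measurable_fst measurable_ident_sphere_measure])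

lemma nn_integral_sphere_measure:
  fixes F :: "complex ^ 'n \<Rightarrow> ennreal"
  assumes [measurable]: "F \<in> borel_measurable borel"
  shows "(\<integral>\<^sup>+\<zeta>. F \<zeta> \<partial>sphere_measure) =
    (\<integral>\<^sup>+z. F (sgn z) * indicator unit_ball z \<partial>lborel) / emeasure lborel (unit_ball :: (complex ^ 'n) set)"
proof -
  have [simp]: "unit_ball \<in> sets lborel" by simp
  have [measurable]: "sphere (0 :: complex ^ 'n) 1 \<in> sets borel" by simp
  have "(\<integral>\<^sup>+\<zeta>. F \<zeta> \<partial>sphere_measure) =
      (\<integral>\<^sup>+z. (F (sgn z) * indicator (sphere 0 1) (sgn z)) * indicator unit_ball z \<partial>lborel) /
        emeasure lborel (unit_ball :: (complex ^ 'n) set)"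
    unfolding sphere_measure_def
    by (simp add: nn_integral_restrict_space nn_integral_distr nn_integral_uniform_measure)
  also have "(\<integral>\<^sup>+z. (F (sgn z) * indicator (sphere 0 1) (sgn z)) * indicator unit_ball z \<partial>lborel) =
      (\<integral>\<^sup>+z. F (sgn z) * indicator unit_ball z \<partial>lborel)"
    by (rule nn_integral_cong_AE, use AE_lborel_singleton[of 0] in eventually_elim)
       (auto simp: indicator_def norm_sgn)
  finally show ?thesis .
qed

lemma emeasure_sphere_measure: "emeasure (sphere_measure :: (complex ^ 'n) measure) (sphere 0 1) = 1"
proof -
  have "emeasure (sphere_measure :: (complex ^ 'n) measure) (space sphere_measure) =
      (\<integral>\<^sup>+\<zeta>. 1 \<partial>(sphere_measure :: (complex ^ 'n) measure))"
    by simp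
  also have "\<dots> = 1"
    using emeasure_unit_ball_pos[where 'a="complex ^ 'n"] emeasure_unit_ball_finite[where 'a="complex ^ 'n"]
    by (subst nn_integral_sphere_measure) (auto intro!: ennreal_divide_self simp: less_top)
  finally show ?thesis by simp
qed

lemma finite_measure_sphere_measure: "finite_measure (sphere_measure :: (complex ^ 'n) measure)"
  by (rule finite_measureI) (simp add: emeasure_sphere_measure)

interpretation sphere: finite_measure "sphere_measure :: (complex ^ 'n) measure"
  by (rule finite_measure_sphere_measure)

lemma nn_integral_sphere_rotation:
  fixes F :: "complex ^ 'n \<Rightarrow> ennreal" and T :: "complex ^ 'n \<Rightarrow> complex ^ 'n"
  assumes lin: "linear T" and iso: "\<And>z. norm (T z) = norm z" and [measurable]: "F \<in> borel_measurable borel"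
  shows "(\<integral>\<^sup>+\<zeta>. F (T \<zeta>) \<partial>sphere_measure) = (\<integral>\<^sup>+\<zeta>. F \<zeta> \<partial>sphere_measure)"
proof -
  have [measurable]: "T \<in> borel_measurable borel"
    using lin by (simp add: linear_continuous_on linear_conv_bounded_linear borel_measurable_continuous_onI)
  have "sgn (T z) = T (sgn z)" for z
    using lin by (simp add: sgn_div_norm iso linear_cmul)
  moreover have "indicator unit_ball (T z) = (indicator unit_ball z :: ennreal)" for z
    by (simp add: indicator_def iso)
  moreover have [measurable]: "unit_ball \<in> sets (borel :: (complex ^ 'n) measure)" by simp
  then have "(\<lambda>z. F (sgn z) * indicator unit_ball z) \<in> borel_measurable borel" by measurable
  note nn_integral_lborel_isometry[OF lin iso this]
  ultimately have "(\<integral>\<^sup>+z. F (T (sgn z)) * indicator unit_ball z \<partial>lborel) =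
      (\<integral>\<^sup>+z. F (sgn z) * indicator unit_ball z \<partial>lborel)"
    by simp
  then show ?thesis by (simp add: nn_integral_sphere_measure)
qed

text \<open>
  Polar coordinates from the scaling of Lebesgue measure: in the double integral on the right, put
  \<open>r = t |z|\<close> for fixed \<open>z\<close> and then \<open>w = t z\<close> for fixed \<open>t\<close>. The integrand becomes \<open>F w\<close> times a function of
  \<open>|w|\<close> and \<open>t\<close> whose integral over \<open>t > |w|\<close> is \<open>1\<close>.
\<close>

lemma nn_integral_polar_sgn:
  fixes F :: "'a::euclidean_space \<Rightarrow> ennreal"
  assumes [measurable]: "F \<in> borel_measurable borel"
  defines "D \<equiv> DIM('a)"
  shows "(\<integral>\<^sup>+z. F z * indicator (ball 0 1) z \<partial>lborel) =
    (\<integral>\<^sup>+r. ennreal (D * r ^ (D - 1)) * indicator {0<..<1} r *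
       (\<integral>\<^sup>+z. F (r *\<^sub>R sgn z) * indicator (ball 0 1) z \<partial>lborel) \<partial>lborel)"
proof -
  have D: "D > 0" by (simp add: D_def)
  then have DS: "D = Suc (D - 1)" by simp
  let ?B = "indicator (ball (0::'a) 1) :: 'a \<Rightarrow> ennreal"
  have [measurable]: "ball (0::'a) 1 \<in> sets borel" by simp
  let ?g = "\<lambda>t z. ennreal (D * norm z ^ D * t ^ (D - 1)) * indicator {0<..} t * indicator {..<1} (t * norm z) * F (t *\<^sub>R z) * ?B z"
  have radial: "(\<integral>\<^sup>+r. ennreal (D * r ^ (D - 1)) * indicator {0<..<1} r * (F (r *\<^sub>R sgn z) * ?B z) \<partial>lborel) =
      (\<integral>\<^sup>+t. ?g t z \<partial>lborel)" if z: "z \<noteq> 0" for z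
  proof -
    have nz: "norm z \<noteq> 0" using z by simp
    have "(\<integral>\<^sup>+r. ennreal (D * r ^ (D - 1)) * indicator {0<..<1} r * (F (r *\<^sub>R sgn z) * ?B z) \<partial>lborel) =
        ennreal (norm z) * (\<integral>\<^sup>+t. ennreal (D * (norm z * t) ^ (D - 1)) * indicator {0<..<1} (norm z * t) *
          (F ((norm z * t) *\<^sub>R sgn z) * ?B z) \<partial>lborel)"
      using nn_integral_lborel_affine[where c="norm z" and t="0::real" and
          F="\<lambda>r. ennreal (D * r ^ (D - 1)) * indicator {0<..<1} r * (F (r *\<^sub>R sgn z) * ?B z)"] nz
      by simp
    also have "\<dots> = (\<integral>\<^sup>+t. ennreal (norm z) * (ennreal (D * (norm z * t) ^ (D - 1)) * indicator {0<..<1} (norm z * t) *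
          (F ((norm z * t) *\<^sub>R sgn z) * ?B z)) \<partial>lborel)"
      by (rule nn_integral_cmult[symmetric]) measurable
    also have "\<dots> = (\<integral>\<^sup>+t. ?g t z \<partial>lborel)"
    proof (rule nn_integral_cong)
      fix t :: real
      show "ennreal (norm z) * (ennreal (D * (norm z * t) ^ (D - 1)) * indicator {0<..<1} (norm z * t) *
          (F ((norm z * t) *\<^sub>R sgn z) * ?B z)) = ?g t z"
      proof (cases "t > 0")
        case True
        have "norm z * (D * (norm z * t) ^ (D - 1)) = D * norm z ^ D * t ^ (D - 1)"
          by (subst (3) DS) (simp add: power_mult_distrib)
        then have 1: "ennreal (norm z) * ennreal (D * (norm z * t) ^ (D - 1)) = ennreal (D * norm z ^ D * t ^ (D - 1))"
          by (subst ennreal_mult'[symmetric]) (simp_all only: norm_ge_zero)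
        have 2: "indicator {0<..<1} (norm z * t) = (indicator {..<1} (t * norm z) :: ennreal)"
          using True z by (auto simp: indicator_def mult.commute)
        have 3: "(norm z * t) *\<^sub>R sgn z = t *\<^sub>R z"
          using nz by (simp add: sgn_div_norm)
        have 4: "indicator {0<..} t = (1::ennreal)" using True by simp
        show ?thesis by (simp only: mult.assoc[symmetric] 1 2 3 4 mult_1_right)
      next
        case False
        then show ?thesis using z by (simp add: indicator_def zero_less_mult_iff)
      qed
    qed
    finally show ?thesis .
  qed
  have scale: "(\<integral>\<^sup>+z. ?g t z \<partial>lborel) =
      (\<integral>\<^sup>+w. ennreal (D * norm w ^ D * t powr (- real D - 1)) * indicator {0<..} t * (if norm w < t then 1 else 0) * F w * ?B w \<partial>lborel)"
    for t :: real
  proof (cases "t > 0")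
    case True
    let ?h = "\<lambda>w. ennreal (D * norm w ^ D * t powr (- real D - 1)) * indicator {0<..} t * (if norm w < t then 1 else 0) * F w * ?B w"
    have "(\<integral>\<^sup>+w. ?h w \<partial>lborel) = ennreal (t ^ D) * (\<integral>\<^sup>+z. ?h (t *\<^sub>R z) \<partial>lborel)"
      using nn_integral_lborel_affine[where c=t and t="0::'a" and F="?h"] True
      by (simp add: D_def)
    also have "\<dots> = (\<integral>\<^sup>+z. ennreal (t ^ D) * ?h (t *\<^sub>R z) \<partial>lborel)"
      by (rule nn_integral_cmult[symmetric]) measurable
    also have "\<dots> = (\<integral>\<^sup>+z. ?g t z \<partial>lborel)"
    proof (rule nn_integral_cong)
      fix z :: 'a
      have "t powr (- real D - 1) * t ^ D * t ^ D = t ^ (D - 1)"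
      proof -
        have "t ^ D = t powr real D" "t ^ (D - 1) = t powr (real D - 1)"
          using True D powr_realpow[of t D] powr_realpow[of t "D - 1"] by (simp_all add: of_nat_diff)
        then show ?thesis by (simp only: powr_add[symmetric]) simp
      qed
      then have "t ^ D * (D * norm (t *\<^sub>R z) ^ D * t powr (- real D - 1)) = D * norm z ^ D * t ^ (D - 1)"
      proof -
        assume *: "t powr (- real D - 1) * t ^ D * t ^ D = t ^ (D - 1)"
        have "t ^ D * (D * norm (t *\<^sub>R z) ^ D * t powr (- real D - 1)) =
            D * norm z ^ D * (t powr (- real D - 1) * t ^ D * t ^ D)"
          using True by (simp only: norm_scaleR abs_of_pos power_mult_distrib mult.assoc mult.commute mult.left_commute)
        then show ?thesis by (simp only: *)
      qed
      then have 1: "ennreal (t ^ D) * ennreal (D * norm (t *\<^sub>R z) ^ D * t powr (- real D - 1)) = ennreal (D * norm z ^ D * t ^ (D - 1))"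
        using True by (subst ennreal_mult'[symmetric]) simp_all
      have 2: "(if norm (t *\<^sub>R z) < t then 1 else 0) = ?B z" "?B (t *\<^sub>R z) = indicator {..<1} (t * norm z)"
        using True by (simp_all add: indicator_def mult_less_cancel_left1 mult_less_cancel_left2 mult_less_cancel_right1)
      show "ennreal (t ^ D) * ?h (t *\<^sub>R z) = ?g t z"
        by (simp only: mult.assoc[symmetric] 1 2) (simp only: mult.assoc mult.commute mult.left_commute)
    qed
    finally show ?thesis by simp
  qed simp
  have tail: "(\<integral>\<^sup>+t. ennreal (D * norm w ^ D * t powr (- real D - 1)) * indicator {0<..} t * (if norm w < t then 1 else 0) * F w * ?B w \<partial>lborel)
      = F w * ?B w" if w: "w \<noteq> 0" for w
  proof -
    let ?a = "norm w"
    have a: "?a > 0" using w by simp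
    have "(\<integral>\<^sup>+t. ennreal (D * ?a ^ D * t powr (- real D - 1)) * indicator {?a..} t \<partial>lborel) =
        ennreal (0 - (- (?a ^ D * ?a powr (- real D))))"
    proof (rule nn_integral_FTC_atLeast[where F="\<lambda>t. - (?a ^ D * t powr (- real D))"])
      show "((\<lambda>t. - (?a ^ D * t powr (- real D))) \<longlongrightarrow> 0) at_top"
        using tendsto_minus[OF tendsto_mult_right_zero[OF tendsto_neg_powr[of "- real D" "\<lambda>t. t" at_top]], of "?a ^ D"] D
        by (simp add: filterlim_ident)
      fix t assume "?a \<le> t"
      with a have t: "t > 0" by linarith
      show "((\<lambda>t. - (?a ^ D * t powr (- real D))) has_real_derivative D * ?a ^ D * t powr (- real D - 1)) (at t)"
        using t by (auto intro!: derivative_eq_intros)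
      show "0 \<le> D * ?a ^ D * t powr (- real D - 1)" by simp
    qed measurable
    also have "0 - (- (?a ^ D * ?a powr (- real D))) = 1"
      using a by (simp add: powr_minus powr_realpow)
    finally have *: "(\<integral>\<^sup>+t. ennreal (D * ?a ^ D * t powr (- real D - 1)) * indicator {?a..} t \<partial>lborel) = 1"
      by (simp only: ennreal_1)
    have "(\<integral>\<^sup>+t. ennreal (D * norm w ^ D * t powr (- real D - 1)) * indicator {0<..} t * (if norm w < t then 1 else 0) * F w * ?B w \<partial>lborel) =
        (\<integral>\<^sup>+t. ennreal (D * ?a ^ D * t powr (- real D - 1)) * indicator {?a..} t * (F w * ?B w) \<partial>lborel)"
      by (rule nn_integral_cong_AE, use AE_lborel_singleton[of "norm w"] in eventually_elim)
         (use a in \<open>auto simp: indicator_def dest: le_less_trans[OF norm_ge_zero]\<close>)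
    also have "\<dots> = F w * ?B w" by (subst nn_integral_multc) (simp_all add: *)
    finally show ?thesis .
  qed
  have "(\<integral>\<^sup>+r. ennreal (D * r ^ (D - 1)) * indicator {0<..<1} r *
       (\<integral>\<^sup>+z. F (r *\<^sub>R sgn z) * ?B z \<partial>lborel) \<partial>lborel) =
      (\<integral>\<^sup>+r. (\<integral>\<^sup>+z. ennreal (D * r ^ (D - 1)) * indicator {0<..<1} r * (F (r *\<^sub>R sgn z) * ?B z) \<partial>lborel) \<partial>lborel)"
    by (simp add: nn_integral_cmult)
  also have "\<dots> = (\<integral>\<^sup>+z. (\<integral>\<^sup>+r. ennreal (D * r ^ (D - 1)) * indicator {0<..<1} r * (F (r *\<^sub>R sgn z) * ?B z) \<partial>lborel) \<partial>lborel)"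
    by (rule lborel_pair.Fubini') measurable
  also have "\<dots> = (\<integral>\<^sup>+z. (\<integral>\<^sup>+t. ?g t z \<partial>lborel) \<partial>lborel)"
    by (rule nn_integral_cong_AE, use AE_lborel_singleton[of "0::'a"] in eventually_elim) (rule radial)
  also have "\<dots> = (\<integral>\<^sup>+t. (\<integral>\<^sup>+z. ?g t z \<partial>lborel) \<partial>lborel)"
    by (rule lborel_pair.Fubini'[symmetric]) measurable
  also have "\<dots> = (\<integral>\<^sup>+t. (\<integral>\<^sup>+w. ennreal (D * norm w ^ D * t powr (- real D - 1)) * indicator {0<..} t * (if norm w < t then 1 else 0) * F w * ?B w \<partial>lborel) \<partial>lborel)"
    by (intro nn_integral_cong scale)
  also have "\<dots> = (\<integral>\<^sup>+w. (\<integral>\<^sup>+t. ennreal (D * norm w ^ D * t powr (- real D - 1)) * indicator {0<..} t * (if norm w < t then 1 else 0) * F w * ?B w \<partial>lborel) \<partial>lborel)"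
    by (rule lborel_pair.Fubini') measurable
  also have "\<dots> = (\<integral>\<^sup>+w. F w * ?B w \<partial>lborel)"
    by (rule nn_integral_cong_AE, use AE_lborel_singleton[of "0::'a"] in eventually_elim) (rule tail)
  finally show ?thesis by simp
qed

definition ball_volume :: "'n::finite itself \<Rightarrow> ennreal" where
  "ball_volume _ = emeasure lborel (unit_ball :: (complex ^ 'n) set)"

lemma ball_volume_pos: "ball_volume TYPE('n::finite) \<noteq> 0"
  and ball_volume_finite: "ball_volume TYPE('n) \<noteq> top"
  using emeasure_unit_ball_pos[where 'a="complex ^ 'n"] emeasure_unit_ball_finite[where 'a="complex ^ 'n"]
  by (auto simp: ball_volume_def)

lemma nn_integral_polar:
  fixes F :: "complex ^ 'n \<Rightarrow> ennreal"
  assumes [measurable]: "F \<in> borel_measurable borel"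
  shows "(\<integral>\<^sup>+z. F z * indicator unit_ball z \<partial>lborel) = ball_volume TYPE('n) *
    (\<integral>\<^sup>+r. ennreal (2 * CARD('n) * r ^ (2 * CARD('n) - 1)) * indicator {0<..<1} r *
       (\<integral>\<^sup>+\<zeta>. F (r *\<^sub>R \<zeta>) \<partial>sphere_measure) \<partial>lborel)"
proof -
  have DIM: "DIM(complex ^ 'n) = 2 * CARD('n)" by simp
  let ?V = "ball_volume TYPE('n)"
  have m[measurable]: "(\<lambda>r. \<integral>\<^sup>+\<zeta>. F (r *\<^sub>R \<zeta>) \<partial>sphere_measure) \<in> borel_measurable lborel"
    by (rule sphere.borel_measurable_nn_integral) measurable
  have sphere: "(\<integral>\<^sup>+z. F (r *\<^sub>R sgn z) * indicator unit_ball z \<partial>lborel) = ?V * (\<integral>\<^sup>+\<zeta>. F (r *\<^sub>R \<zeta>) \<partial>sphere_measure)" for r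
  proof -
    have "?V * (I / ?V) = I" for I
      using mult_divide_eq_ennreal[OF ball_volume_pos ball_volume_finite, of I]
      by (simp add: ennreal_times_divide mult.commute)

    from this[unfolded ball_volume_def] show ?thesis
      unfolding ball_volume_def by (subst nn_integral_sphere_measure) simp_all
  qed
  have "(\<integral>\<^sup>+z. F z * indicator unit_ball z \<partial>lborel) =
      (\<integral>\<^sup>+r. ?V * (ennreal (2 * CARD('n) * r ^ (2 * CARD('n) - 1)) * indicator {0<..<1} r *
       (\<integral>\<^sup>+\<zeta>. F (r *\<^sub>R \<zeta>) \<partial>sphere_measure)) \<partial>lborel)"
    unfolding nn_integral_polar_sgn[OF assms, unfolded DIM] sphere
    by (rule nn_integral_cong) (simp only: mult.left_commute mult.assoc)
  also have "\<dots> = ?V * (\<integral>\<^sup>+r. ennreal (2 * CARD('n) * r ^ (2 * CARD('n) - 1)) * indicator {0<..<1} r *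
       (\<integral>\<^sup>+\<zeta>. F (r *\<^sub>R \<zeta>) \<partial>sphere_measure) \<partial>lborel)"
    by (rule nn_integral_cmult) measurable
  finally show ?thesis .
qed

lemma norm_vector_scalar: "norm (c *s v) = norm c * norm (v :: complex ^ 'n)"
  by (simp add: norm_vec_def L2_set_right_distrib norm_mult vector_scalar_mult_def)

lemma linear_vector_scalar: "linear (\<lambda>v. c *s (v :: complex ^ 'n))"
  by (rule linearI) (simp_all add: vec_eq_iff algebra_simps scaleR_conv_of_real)

lemma of_real_vector_scalar: "of_real r *s v = r *\<^sub>R (v :: complex ^ 'n)"
  unfolding vec_eq_iff by (simp add: scaleR_conv_of_real[where 'a=complex])

text \<open>
  The reflection in the hyperplane orthogonal to the difference of two unit vectors exchanges these
  vectors when their Hermitian product is real. The factor \<open>c\<close> of modulus \<open>1\<close> achieves this: it makes the \<open>k\<close>-th coordinate of \<open>\<xi> = cnj c *s \<zeta>\<close> real.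
\<close>

lemma exists_unitary_axis:
  fixes \<zeta> :: "complex ^ 'n" and k :: 'n
  assumes \<zeta>: "norm \<zeta> = 1"
  obtains U where "linear U" "\<And>c v. U (c *s v) = c *s U v" "\<And>v. norm (U v) = norm v" "U (axis k 1) = \<zeta>"
proof -
  define h where "h u w = (\<Sum>j\<in>UNIV. u $ j * cnj (w $ j))" for u w :: "complex ^ 'n"
  have h_add: "h (u + u') w = h u w + h u' w" for u u' w
    by (simp add: h_def distrib_right sum.distrib)
  have h_scale: "h (c *s u) w = c * h u w" for c u w
    by (simp add: h_def sum_distrib_left mult_ac)
  have Re_h: "Re (h u w) = u \<bullet> w" for u w
    by (simp add: h_def inner_vec_def inner_complex_def)
  have h_scale2: "h u (c *s w) = cnj c * h u w" for c u w
    by (simp add: h_def sum_distrib_left mult_ac)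
  define c where "c = (if \<zeta> $ k = 0 then 1 else sgn (\<zeta> $ k))"
  have c: "norm c = 1" by (simp add: c_def norm_sgn)
  then have cc: "c * cnj c = 1" using complex_norm_square[of c] by simp
  define \<xi> where "\<xi> = cnj c *s \<zeta>"
  have \<xi>: "norm \<xi> = 1" by (simp add: \<xi>_def norm_vector_scalar c \<zeta>)
  have "\<xi> $ k = of_real (norm (\<zeta> $ k))"
  proof (cases "\<zeta> $ k = 0")
    case False
    then have "\<zeta> $ k = of_real (norm (\<zeta> $ k)) * c"
      by (simp add: c_def sgn_div_norm scaleR_conv_of_real)
    then have "\<xi> $ k = of_real (norm (\<zeta> $ k)) * (c * cnj c)"
      by (metis \<xi>_def mult.commute mult.left_commute vector_smult_component)
    then show ?thesis by (simp add: cc)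
  qed (simp add: \<xi>_def)
  then obtain x :: real where x: "\<xi> $ k = of_real x" by blast
  let ?e = "axis k 1 :: complex ^ 'n"
  define w where "w = ?e - \<xi>"
  \<comment> \<open>the reflection in the complex hyperplane orthogonal to \<open>w\<close>\<close>
  define H where "H v = v - (2 * h v w / of_real ((norm w)\<^sup>2)) *s w" for v
  have H_add: "H (u + v) = H u + H v" for u v
    by (simp add: H_def h_add vec_eq_iff field_simps add_divide_distrib distrib_left)
  have H_scale: "H (a *s v) = a *s H v" for a v
    by (simp add: H_def h_scale vec_eq_iff algebra_simps)
  have H_norm: "norm (H v) = norm v" for v
  proof (cases "w = 0")
    case False
    let ?\<mu> = "2 * h v w / of_real ((norm w)\<^sup>2)"
    have w: "(norm w)\<^sup>2 \<noteq> 0" using False by simp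
    have "v \<bullet> (?\<mu> *s w) = Re (cnj ?\<mu> * h v w)" by (simp only: Re_h[symmetric] h_scale2)
    also have "cnj ?\<mu> * h v w = of_real (2 * (norm (h v w))\<^sup>2 / (norm w)\<^sup>2)"
    proof -
      have "h v w * cnj (h v w) = of_real ((norm (h v w))\<^sup>2)" by (simp only: complex_norm_square)
      moreover have "cnj ?\<mu> * h v w = 2 * (h v w * cnj (h v w)) / of_real ((norm w)\<^sup>2)" by simp
      ultimately show ?thesis by simp
    qed
    finally have 1: "v \<bullet> (?\<mu> *s w) = 2 * (norm (h v w))\<^sup>2 / (norm w)\<^sup>2" by simp
    have 2: "(norm (?\<mu> *s w))\<^sup>2 = 4 * (norm (h v w))\<^sup>2 / (norm w)\<^sup>2"
      using w by (simp add: norm_vector_scalar norm_divide norm_mult power_mult_distrib power_divide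
          power2_eq_square)
    have "(norm (H v))\<^sup>2 = (norm v)\<^sup>2 - 2 * (v \<bullet> (?\<mu> *s w)) + (norm (?\<mu> *s w))\<^sup>2"
      by (simp add: H_def power2_norm_eq_inner inner_diff_left inner_diff_right inner_commute)
    also have "\<dots> = (norm v)\<^sup>2" by (simp only: 1 2)
    finally show ?thesis by simp
  qed (simp add: H_def)
  have H_e: "H ?e = \<xi>"
  proof (cases "w = 0")
    case True
    then show ?thesis by (simp add: H_def w_def)
  next
    case False
    have "h ?e w = cnj (w $ k)"
      by (simp add: h_def axis_def if_distrib[of "\<lambda>x. x * _"] cong: if_cong)
    then have he: "h ?e w = of_real (1 - x)" by (simp add: w_def x)
    have "?e \<bullet> \<xi> = x" by (simp add: Re_h[symmetric] h_def axis_def x if_distrib[of "\<lambda>x. x * _"] cong: if_cong)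
    then have "(norm w)\<^sup>2 = 2 * (1 - x)"
      using \<xi> by (simp add: w_def power2_norm_eq_inner inner_diff_left inner_diff_right inner_commute norm_eq_1 inner_axis_axis)
    then have "2 * h ?e w / of_real ((norm w)\<^sup>2) = 1"
      using False he by (metis of_real_mult of_real_numeral divide_self of_real_eq_0_iff zero_eq_power2 norm_eq_zero)
    then show ?thesis by (simp add: H_def w_def)
  qed
  show thesis
  proof
    let ?U = "\<lambda>v. c *s H v"
    have "H (r *\<^sub>R v) = r *\<^sub>R H v" for r v
      using H_scale[of "of_real r" v] by (simp only: of_real_vector_scalar)
    then have "linear H" by (intro linearI H_add)
    then show "linear ?U"
      using linear_compose[OF _ linear_vector_scalar, of H c] by (simp add: o_def)
    show "?U (a *s v) = a *s ?U v" for a v by (simp add: H_scale vec_eq_iff mult_ac)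
    show "norm (?U v) = norm v" for v by (simp add: norm_vector_scalar H_norm c)
    show "?U ?e = \<zeta>" using cc by (simp add: H_e \<xi>_def vec_eq_iff mult.assoc[symmetric])
  qed
qed

section \<open>Circle means of log-convex functions\<close>

abbreviation circ :: "real \<Rightarrow> complex" where "circ t \<equiv> cis (2 * pi * t)"

lemma continuous_on_circ[continuous_intros]:
  "continuous_on S f \<Longrightarrow> continuous_on S (\<lambda>x. circ (f x))"
  by (simp add: cis_conv_exp) (intro continuous_intros)

lemma unimodular_eq_circ:
  assumes "norm z = 1"
  obtains t where "0 \<le> t" "t \<le> 1" "z = circ t"
proof -
  obtain t where t: "0 \<le> t" "t < 2 * pi" "z = Complex (cos t) (sin t)"
    using complex_unimodular_polar[OF assms] by blast
  show thesis
    by (rule that[of "t / (2 * pi)"]) (use t in \<open>simp_all add: complex_eq_iff divide_le_eq\<close>)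
qed

lemma integral_circle_eq_contour:
  assumes h: "continuous_on (sphere z r) h" and r: "r > 0"
  shows "contour_integral (circlepath z r) (\<lambda>w. h w / (w - z) ^ Suc k) =
    2 * of_real pi * \<i> / of_real r ^ k * integral {0..1} (\<lambda>t. h (z + of_real r * circ t) / circ t ^ k)"
proof -
  have e: "exp (2 * of_real pi * \<i> * of_real t) = circ t" for t
    by (simp add: cis_conv_exp mult_ac)
  have "contour_integral (circlepath z r) (\<lambda>w. h w / (w - z) ^ Suc k) =
     integral {0..1} (\<lambda>t. h (circlepath z r t) / (circlepath z r t - z) ^ Suc k *
       (2 * of_real pi * \<i> * of_real r * circ t))"
    unfolding contour_integral_integral
    by (intro integral_cong) (simp add: vector_derivative_circlepath e)
  also have "\<dots> = integral {0..1} (\<lambda>t. (2 * of_real pi * \<i> / of_real r ^ k) * (h (z + of_real r * circ t) / circ t ^ k))"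
    using r by (intro integral_cong) (simp add: circlepath e power_mult_distrib)
  also have "\<dots> = 2 * of_real pi * \<i> / of_real r ^ k * integral {0..1} (\<lambda>t. h (z + of_real r * circ t) / circ t ^ k)"
    by (rule integral_mult_right)
  finally show ?thesis .
qed

lemma holomorphic_circle_mean:
  assumes h: "h holomorphic_on ball z R" and r: "0 < r" "r < R"
  shows "h z = integral {0..1} (\<lambda>t. h (z + of_real r * circ t))"
    and "deriv h z = integral {0..1} (\<lambda>t. h (z + of_real r * circ t) / circ t) / of_real r"
proof -
  have sub: "cball z r \<subseteq> ball z R" "ball z r \<subseteq> ball z R" using r by auto
  then have c: "continuous_on (cball z r) h" and hol: "h holomorphic_on ball z r"
    using holomorphic_on_subset[OF h sub(1)] holomorphic_on_subset[OF h sub(2)]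
    by (simp_all add: holomorphic_on_imp_continuous_on)
  then have cs: "continuous_on (sphere z r) h" by (auto intro: continuous_on_subset)
  have "contour_integral (circlepath z r) (\<lambda>u. h u / (u - z) ^ Suc 0) = 2 * of_real pi * \<i> * h z"
    using Cauchy_contour_integral_circlepath[OF c hol, of z 0] r by simp
  then show "h z = integral {0..1} (\<lambda>t. h (z + of_real r * circ t))"
    using integral_circle_eq_contour[OF cs r(1), of 0] by simp
  have "contour_integral (circlepath z r) (\<lambda>u. h u / (u - z) ^ Suc 1) = 2 * of_real pi * \<i> * deriv h z"
    using Cauchy_contour_integral_circlepath[OF c hol, of z 1] r by simp
  then have "2 * of_real pi * \<i> * deriv h z =
      2 * of_real pi * \<i> * (integral {0..1} (\<lambda>t. h (z + of_real r * circ t) / circ t) / of_real r)"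
    using integral_circle_eq_contour[OF cs r(1), of 1] by simp
  moreover have "2 * of_real pi * \<i> \<noteq> (0::complex)" by simp
  ultimately show "deriv h z = integral {0..1} (\<lambda>t. h (z + of_real r * circ t) / circ t) / of_real r"
    by (metis mult_cancel_left)
qed

lemma holomorphic_circle_mean_complex:
  assumes h: "h holomorphic_on ball z R" and r: "norm \<rho> < R"
  shows "h z = integral {0..1} (\<lambda>t. h (z + \<rho> * circ t))"
proof (cases "\<rho> = 0")
  case False
  have "(\<lambda>w. h (z + sgn \<rho> * w)) holomorphic_on ball 0 R"
    by (rule holomorphic_on_compose_gen[OF _ h, unfolded o_def])
       (use False in \<open>auto intro!: holomorphic_intros simp: dist_norm norm_mult norm_sgn\<close>)
  from holomorphic_circle_mean(1)[OF this, of "norm \<rho>"] False r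
  have "h z = integral {0..1} (\<lambda>t. h (z + (of_real (norm \<rho>) * sgn \<rho>) * circ t))"
    by (simp add: mult_ac)
  also have "of_real (norm \<rho>) * sgn \<rho> = \<rho>"
    using False by (simp add: sgn_div_norm scaleR_conv_of_real)
  finally show ?thesis .
qed auto

text \<open>
  Convexity of \<open>t \<mapsto> v (exp t)\<close>, expressed by supporting lines. In this form it yields subharmonicity
  of \<open>v |\<phi>|\<close> at once: near a point \<open>x\<close> with \<open>\<phi> x \<noteq> 0\<close> the supporting line at \<open>ln |\<phi> x|\<close> bounds \<open>v |\<phi>|\<close>
  from below by an affine function of the harmonic function \<open>ln |\<phi>|\<close>, with equality at \<open>x\<close>.
\<close>

definition log_convex :: "(real \<Rightarrow> real) \<Rightarrow> bool" where
  "log_convex v \<longleftrightarrow> continuous_on {0..} v \<and> v 0 = 0 \<and> (\<forall>x\<ge>0. 0 \<le> v x) \<and>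
     (\<forall>x>0. \<exists>c. \<forall>y>0. v x + c * (ln y - ln x) \<le> v y)"

lemma log_convex_powr:
  assumes "p > 0"
  shows "log_convex (\<lambda>y. y powr p)"
  unfolding log_convex_def
proof (intro conjI allI impI)
  show "continuous_on {0..} (\<lambda>y::real. y powr p)"
    using assms by (intro continuous_on_powr' continuous_intros) auto
  fix x :: real assume x: "x > 0"
  show "\<exists>c. \<forall>y>0. x powr p + c * (ln y - ln x) \<le> y powr p"
  proof (intro exI allI impI)
    fix y :: real assume y: "y > 0"
    have "1 + p * (ln y - ln x) \<le> exp (p * (ln y - ln x))" by (rule exp_ge_add_one_self)
    also have "\<dots> = y powr p / x powr p"
      using x y by (simp add: powr_def exp_diff right_diff_distrib)
    finally show "x powr p + (x powr p * p) * (ln y - ln x) \<le> y powr p"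
      using x by (simp add: field_simps)
  qed
qed (use assms in auto)

text \<open>
  The slope at \<open>x\<close> is \<open>q \<theta>\<close> with \<open>\<theta> = w / (1 + w)\<close> and \<open>w = k x\<^sup>q\<close>, and the inequality is then the weighted
  inequality of arithmetic and geometric means for \<open>(y / x)\<^sup>q\<close> and \<open>1\<close>.
\<close>

lemma log_convex_ln:
  assumes q: "q > 0" and k: "k \<ge> 0"
  shows "log_convex (\<lambda>y. ln (1 + k * y powr q))"
  unfolding log_convex_def
proof (intro conjI allI impI)
  have pos: "1 + k * y powr q > 0" for y :: real using k by (simp add: add_pos_nonneg)
  then have nz: "1 + k * y powr q \<noteq> 0" for y :: real by (metis less_irrefl)
  have "continuous_on {0..} (\<lambda>y::real. y powr q)"
    using q by (intro continuous_on_powr' continuous_intros) auto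
  then show "continuous_on {0..} (\<lambda>y. ln (1 + k * y powr q))"
    using nz by (intro continuous_on_ln continuous_on_add continuous_on_mult continuous_on_const) auto
  fix x :: real
  show "0 \<le> ln (1 + k * x powr q)" using k by simp
  assume x: "x > 0"
  let ?w = "k * x powr q"
  have w: "?w \<ge> 0" using k by simp
  show "\<exists>c. \<forall>y>0. ln (1 + k * x powr q) + c * (ln y - ln x) \<le> ln (1 + k * y powr q)"
  proof (intro exI allI impI)
    fix y :: real assume y: "y > 0"
    define \<theta> where "\<theta> = ?w / (1 + ?w)"
    have \<theta>: "0 \<le> \<theta>" "\<theta> \<le> 1" using w by (auto simp: \<theta>_def field_simps)
    define u where "u = (y / x) powr q"
    have u: "u > 0" "ln u = q * (ln y - ln x)" using x y by (auto simp: u_def ln_powr ln_div)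
    have "\<theta> * ln u = ln (u powr \<theta> * 1 powr (1 - \<theta>))" using u by (simp add: ln_powr)
    also have "\<dots> \<le> ln (\<theta> * u + (1 - \<theta>) * 1)"
      using Youngs_inequality_0[of \<theta> "1 - \<theta>" u 1] \<theta> u by (subst ln_le_cancel_iff) (auto intro: add_nonneg_pos add_pos_nonneg simp: less_le)
    also have "\<theta> * u + (1 - \<theta>) * 1 = (1 + ?w * u) / (1 + ?w)"
      using w by (simp add: \<theta>_def field_simps add_nonneg_eq_0_iff)
    also have "?w * u = k * y powr q" using x y by (simp add: u_def powr_divide)
    also have "ln ((1 + k * y powr q) / (1 + ?w)) = ln (1 + k * y powr q) - ln (1 + ?w)"
      by (simp add: ln_div nz)
    finally show "ln (1 + k * x powr q) + (\<theta> * q) * (ln y - ln x) \<le> ln (1 + k * y powr q)"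
      using u by (simp add: mult.assoc)
  qed
qed auto

lemma integral_periodic:
  fixes f :: "real \<Rightarrow> real"
  assumes c: "continuous_on UNIV f" and per: "\<And>t. f (t + 1) = f t" and s: "0 \<le> s" "s \<le> 1"
  shows "integral {0..1} (\<lambda>t. f (t + s)) = integral {0..1} f"
proof -
  have i: "f integrable_on {a..b}" for a b
    by (rule integrable_continuous_real) (rule continuous_on_subset[OF c], simp)
  have "integral {0..1} (\<lambda>t. f (t + s)) = integral {s..1 + s} f"
    using integral_shift_real_ivl[of s s "1 + s" f] by simp
  also have "\<dots> = integral {s..1} f + integral {1..1 + s} f"
    using s by (intro Henstock_Kurzweil_Integration.integral_combine[symmetric] i) auto
  also have "integral {1..1 + s} f = integral {0..s} (\<lambda>t. f (t + 1))"
    using integral_shift_real_ivl[of 1 1 "1 + s" f] by simp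
  also have "\<dots> = integral {0..s} f" by (simp add: per)
  also have "integral {s..1} f + integral {0..s} f = integral {0..1} f"
    using Henstock_Kurzweil_Integration.integral_combine[OF s i] by simp
  finally show ?thesis .
qed

text \<open>
  Choose a maximum point \<open>a\<close> on the closed disc of greatest modulus. If it were an interior point, \<open>V\<close>
  would be constant on a small circle around \<open>a\<close>, which contains points of greater modulus.
\<close>

lemma maximum_principle:
  fixes V :: "complex \<Rightarrow> real"
  assumes cont: "continuous_on (ball 0 R') V" and R: "0 \<le> R" "R < R'"
    and sub: "\<And>x. norm x < R \<Longrightarrow> \<exists>\<rho>>0. \<forall>r. 0 < r \<longrightarrow> r < \<rho> \<longrightarrow> V x \<le> integral {0..1} (\<lambda>s. V (x + of_real r * circ s))"
    and x: "norm x \<le> R"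
  obtains y where "norm y = R" "V x \<le> V y"
proof -
  have contR: "continuous_on (cball 0 R) V"
    using R by (intro continuous_on_subset[OF cont]) auto
  obtain m where m: "m \<in> cball 0 R" "\<And>y. y \<in> cball 0 R \<Longrightarrow> V y \<le> V m"
    using continuous_attains_sup[OF _ _ contR] R by (metis cball_eq_empty compact_cball not_less)
  define A where "A = {y \<in> cball 0 R. V y = V m}"
  have "closed A" unfolding A_def
    by (intro continuous_closed_preimage_constant contR closed_cball)
  moreover have "bounded A" unfolding A_def by (rule bounded_subset[of "cball 0 R"]) auto
  ultimately have "compact A" by (simp add: compact_eq_bounded_closed)
  moreover have "A \<noteq> {}" using m by (auto simp: A_def)
  ultimately obtain a where a: "a \<in> A" "\<And>y. y \<in> A \<Longrightarrow> norm y \<le> norm a"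
    using continuous_attains_sup[of A norm] by (auto intro: continuous_intros)
  have "norm a = R"
  proof (rule ccontr)
    assume "norm a \<noteq> R"
    with a have aR: "norm a < R" by (auto simp: A_def)
    from sub[OF this] obtain \<rho> where \<rho>: "\<rho> > 0" "\<And>r. 0 < r \<Longrightarrow> r < \<rho> \<Longrightarrow> V a \<le> integral {0..1} (\<lambda>s. V (a + of_real r * circ s))"
      by blast
    define r where "r = min \<rho> (R - norm a) / 2"
    have r: "0 < r" "r < \<rho>" "r < R - norm a" using \<rho> aR by (auto simp: r_def min_def)
    have inR: "norm (a + of_real r * circ s) \<le> R" for s
      using norm_triangle_ineq[of a "of_real r * circ s"] r by (simp add: norm_mult)
    have c: "continuous_on {0..1} (\<lambda>s. V (a + of_real r * circ s))"
      by (rule continuous_on_compose2[OF contR]) (use inR in \<open>auto intro!: continuous_intros\<close>)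
    have Va: "V a = V m" using a by (simp add: A_def)
    have "integral {0..1} (\<lambda>s. V m - V (a + of_real r * circ s)) =
        V m - integral {0..1} (\<lambda>s. V (a + of_real r * circ s))"
      using integrable_continuous_real[OF c] by (subst integral_diff) auto
    also have "\<dots> \<le> 0" using \<rho>(2)[OF r(1,2)] Va by simp
    finally have "integral {0..1} (\<lambda>s. V m - V (a + of_real r * circ s)) \<le> 0" .
    moreover have "integral {0..1} (\<lambda>s. V m - V (a + of_real r * circ s)) \<ge> 0"
      using inR m(2) by (intro integral_nonneg integrable_continuous_real continuous_intros c) auto
    ultimately have "integral {0..1} (\<lambda>s. V m - V (a + of_real r * circ s)) = 0" by linarith
    then have all: "\<forall>s\<in>{0..1}. V m - V (a + of_real r * circ s) = 0"
      using inR m(2) by (subst (asm) integral_eq_0_iff) (auto intro!: continuous_intros c)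
    \<comment> \<open>the point of the circle that lies farthest from the origin\<close>
    define u where "u = (if a = 0 then 1 else sgn a)"
    have u: "norm u = 1" by (simp add: u_def norm_sgn)
    obtain \<theta> where \<theta>: "0 \<le> \<theta>" "\<theta> \<le> 1" "u = circ \<theta>" using unimodular_eq_circ[OF u] .
    have "V (a + of_real r * circ \<theta>) = V m"
      using bspec[OF all, of \<theta>] \<theta> by simp
    then have "a + of_real r * u \<in> A" using \<theta> inR[of \<theta>] by (auto simp: A_def)
    from a(2)[OF this] have "norm (a + of_real r * u) \<le> norm a" .
    moreover have "a = of_real (norm a) * u" by (auto simp: u_def sgn_div_norm scaleR_conv_of_real)
    then have "a + of_real r * u = of_real (norm a + r) * u" by (simp add: algebra_simps)
    then have "norm (a + of_real r * u) = norm a + r" using r u by (simp add: norm_mult del: of_real_add)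
    ultimately show False using r by simp
  qed
  moreover have "V x \<le> V a" using m(2)[of x] a x by (auto simp: A_def)
  ultimately show thesis using that by blast
qed

text \<open>
  Near a zero of \<open>\<phi>\<close> the radius on which \<open>v |\<phi>|\<close> is below its circle means is not under control.
  The truncation from below by \<open>\<epsilon>\<close> removes this: where \<open>v |\<phi>| \<le> \<epsilon>\<close> every radius will do,
  and elsewhere \<open>|\<phi>|\<close> is bounded away from \<open>0\<close>.
\<close>

lemma uniform_submean:
  assumes v: "log_convex v" and \<phi>: "\<phi> holomorphic_on ball 0 1" and R: "R < 1" and e: "\<epsilon> > 0"
  obtains \<delta> where "\<delta> > 0" "\<And>x \<rho>. norm x \<le> R \<Longrightarrow> norm \<rho> < \<delta> \<Longrightarrow> norm x + norm \<rho> < 1 \<and>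
     max (v (norm (\<phi> x))) \<epsilon> \<le> integral {0..1} (\<lambda>s. max (v (norm (\<phi> (x + \<rho> * circ s)))) \<epsilon>)"
proof -
  let ?h = "\<lambda>x. v (norm (\<phi> x))"
  have vc: "continuous_on {0..} v" and v0: "v 0 = 0"
    and tang: "\<And>x. x > 0 \<Longrightarrow> \<exists>c. \<forall>y>0. v x + c * (ln y - ln x) \<le> v y"
    using v by (auto simp: log_convex_def)
  have \<phi>c: "continuous_on (ball 0 1) \<phi>" using \<phi> by (rule holomorphic_on_imp_continuous_on)
  then have hc: "continuous_on (ball 0 1) ?h"
    by (intro continuous_on_compose2[OF vc] continuous_intros) auto
  obtain c where c: "c > 0" "\<And>y. 0 \<le> y \<Longrightarrow> y < c \<Longrightarrow> v y < \<epsilon>"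
  proof -
    from vc e obtain d where "d > 0" "\<And>y. y \<in> {0..} \<Longrightarrow> dist y 0 < d \<Longrightarrow> dist (v y) (v 0) < \<epsilon>"
      unfolding continuous_on_iff by (meson atLeast_iff order_refl)
    then show thesis using that[of d] v0 by (force simp: dist_real_def)
  qed
  define R' where "R' = (1 + R) / 2"
  have R': "R < R'" "R' < 1" using R by (auto simp: R'_def)
  have "uniformly_continuous_on (cball 0 R') \<phi>"
    by (rule compact_uniformly_continuous) (use R' in \<open>auto intro: continuous_on_subset[OF \<phi>c]\<close>)
  then obtain d where d: "d > 0" "\<And>x y. x \<in> cball 0 R' \<Longrightarrow> y \<in> cball 0 R' \<Longrightarrow> dist y x < d \<Longrightarrow> dist (\<phi> y) (\<phi> x) < c"
    unfolding uniformly_continuous_on_def using c(1) by metis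
  define \<delta> where "\<delta> = min d (R' - R)"
  have \<delta>: "\<delta> > 0" "\<delta> \<le> d" "\<delta> \<le> R' - R" using d R' by (auto simp: \<delta>_def)
  show thesis
  proof (rule that[OF \<delta>(1)])
    fix x \<rho> :: complex assume x: "norm x \<le> R" and \<rho>: "norm \<rho> < \<delta>"
    have "norm x + norm \<rho> < 1" using x \<rho> \<delta> R' by simp
    moreover have near: "y \<in> cball 0 R'" "y \<in> ball 0 1" "dist (\<phi> y) (\<phi> x) < c" if "y \<in> ball x \<delta>" for y
    proof -
      have "norm y \<le> norm x + norm (y - x)" by (metis add.commute diff_add_cancel norm_triangle_ineq)
      then show *: "y \<in> cball 0 R'" using that x \<delta> by (simp add: dist_norm norm_minus_commute)
      then show "y \<in> ball 0 1" using R' by simp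
      show "dist (\<phi> y) (\<phi> x) < c" using d(2)[of x y] * that x \<delta> R' by (simp add: dist_commute)
    qed
    have on_circle: "x + \<rho> * circ s \<in> ball x \<delta>" for s
      using \<rho> by (simp add: dist_norm norm_mult)
    have cont: "continuous_on {0..1} (\<lambda>s. ?h (x + \<rho> * circ s))"
      by (rule continuous_on_compose2[OF hc]) (use near(2) on_circle in \<open>auto intro!: continuous_intros\<close>)
    then have int: "(\<lambda>s. ?h (x + \<rho> * circ s)) integrable_on {0..1}"
      and int_max: "(\<lambda>s. max (?h (x + \<rho> * circ s)) \<epsilon>) integrable_on {0..1}"
      by (auto intro!: integrable_continuous_real continuous_intros)
    have "max (?h x) \<epsilon> \<le> integral {0..1} (\<lambda>s. max (?h (x + \<rho> * circ s)) \<epsilon>)"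
    proof (cases "?h x \<le> \<epsilon>")
      case True
      have "integral {0..1} (\<lambda>s::real. \<epsilon>) \<le> integral {0..1} (\<lambda>s. max (?h (x + \<rho> * circ s)) \<epsilon>)"
        by (intro integral_le int_max) auto
      then show ?thesis using True by simp
    next
      case False
      then have big: "norm (\<phi> x) \<ge> c" using c(2)[of "norm (\<phi> x)"] by force
      then have \<phi>x: "norm (\<phi> x) > 0" "\<phi> x \<noteq> 0" using c(1) by auto
      from tang[OF \<phi>x(1)] obtain b where b: "\<And>y. y > 0 \<Longrightarrow> v (norm (\<phi> x)) + b * (ln y - ln (norm (\<phi> x))) \<le> v y"
        by blast
      have Re_pos: "Re (\<phi> y / \<phi> x) > 0" if "y \<in> ball x \<delta>" for y
      proof -
        have "\<phi> y / \<phi> x - 1 = (\<phi> y - \<phi> x) / \<phi> x" using \<phi>x by (simp add: field_simps)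
        then have "norm (\<phi> y / \<phi> x - 1) < 1"
          using near(3)[OF that] big \<phi>x by (simp add: norm_divide dist_norm divide_less_eq)
        then show ?thesis using abs_Re_le_cmod[of "\<phi> y / \<phi> x - 1"] by simp
      qed
      then have nz: "\<phi> y \<noteq> 0" if "y \<in> ball x \<delta>" for y using that by fastforce
      define g where "g y = Ln (\<phi> y / \<phi> x)" for y
      have "\<phi> holomorphic_on ball x \<delta>"
        using near(2) by (intro holomorphic_on_subset[OF \<phi>]) auto
      then have ghol: "g holomorphic_on ball x \<delta>"
        unfolding g_def using Re_pos \<phi>x(2)
        by (intro holomorphic_intros) (auto simp: complex_nonpos_Reals_iff dest!: less_le_trans[of 0])
      have Re_g: "Re (g y) = ln (norm (\<phi> y)) - ln (norm (\<phi> x))" if "y \<in> ball x \<delta>" for y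
        using nz[OF that] \<phi>x by (simp add: g_def norm_divide ln_div)
      have gc: "continuous_on {0..1} (\<lambda>s. g (x + \<rho> * circ s))"
        by (rule continuous_on_compose2[OF holomorphic_on_imp_continuous_on[OF ghol]])
           (use on_circle in \<open>auto intro!: continuous_intros\<close>)
      have "0 = Re (g x)" by (simp add: g_def \<phi>x)
      also have "g x = integral {0..1} (\<lambda>s. g (x + \<rho> * circ s))"
        by (rule holomorphic_circle_mean_complex[OF ghol \<rho>])
      also have "Re \<dots> = integral {0..1} (\<lambda>s. Re (g (x + \<rho> * circ s)))"
        using integral_linear[OF integrable_continuous_real[OF gc] bounded_linear_Re] by (simp add: o_def)
      finally have zero: "integral {0..1} (\<lambda>s. Re (g (x + \<rho> * circ s))) = 0" by simp
      have Rint: "(\<lambda>s. Re (g (x + \<rho> * circ s))) integrable_on {0..1}"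
        by (intro integrable_continuous_real continuous_intros gc)
      have "?h x = integral {0..1} (\<lambda>s. ?h x + b * Re (g (x + \<rho> * circ s)))"
        using zero by (subst integral_add) (auto intro!: integrable_continuous_real continuous_intros gc)
      also have "\<dots> \<le> integral {0..1} (\<lambda>s. max (?h (x + \<rho> * circ s)) \<epsilon>)"
      proof (rule integral_le)
        show "(\<lambda>s. ?h x + b * Re (g (x + \<rho> * circ s))) integrable_on {0..1}"
          by (intro integrable_continuous_real continuous_intros gc)
        fix s :: real
        show "?h x + b * Re (g (x + \<rho> * circ s)) \<le> max (?h (x + \<rho> * circ s)) \<epsilon>"
          using b[of "norm (\<phi> (x + \<rho> * circ s))"] nz[OF on_circle, of s] Re_g[OF on_circle, of s] by simp
      qed (rule int_max)
      finally show ?thesis using False by simp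
    qed
    ultimately show "norm x + norm \<rho> < 1 \<and>
     max (v (norm (\<phi> x))) \<epsilon> \<le> integral {0..1} (\<lambda>s. max (v (norm (\<phi> (x + \<rho> * circ s)))) \<epsilon>)" by blast
  qed
qed

text \<open>
  The function \<open>V\<close> below, the mean over rotations of \<open>v |\<phi>|\<close> truncated by \<open>\<epsilon>\<close>, is radial and inherits the submean
  value property, so the maximum principle compares its values at the radii \<open>r\<close> and \<open>R\<close>. Averaging the
  submean inequality over rotations needs a radius \<open>\<delta>\<close> that is the same for all centres, whence the
  truncation.
\<close>

lemma circle_mean_mono:
  assumes v: "log_convex v" and \<phi>: "\<phi> holomorphic_on ball 0 1" and r: "0 \<le> r" "r \<le> R" "R < 1"
  shows "integral {0..1} (\<lambda>t. v (norm (\<phi> (of_real r * circ t)))) \<le> integral {0..1} (\<lambda>t. v (norm (\<phi> (of_real R * circ t))))"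
proof (rule field_le_epsilon)
  fix \<epsilon> :: real assume e: "\<epsilon> > 0"
  let ?h = "\<lambda>x. v (norm (\<phi> x))"
  let ?H = "\<lambda>x. max (?h x) \<epsilon>"
  define V where "V x = integral {0..1} (\<lambda>t. ?H (x * circ t))" for x
  have vc: "continuous_on {0..} v" and v0: "\<And>x. x \<ge> 0 \<Longrightarrow> v x \<ge> 0" using v by (auto simp: log_convex_def)
  have hc: "continuous_on (ball 0 1) ?h"
    by (intro continuous_on_compose2[OF vc] continuous_intros holomorphic_on_imp_continuous_on[OF \<phi>]) auto
  then have Hc: "continuous_on (ball 0 1) ?H" by (intro continuous_intros)
  have comp: "continuous_on S (\<lambda>x. ?H (f x))" if "continuous_on S f" "f ` S \<subseteq> ball 0 1"
    for S and f :: "'a::topological_space \<Rightarrow> complex"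
    using that by (intro continuous_on_compose2[OF Hc]) auto
  have comph: "continuous_on S (\<lambda>x. ?h (f x))" if "continuous_on S f" "f ` S \<subseteq> ball 0 1"
    for S and f :: "real \<Rightarrow> complex"
    using that by (intro continuous_on_compose2[OF hc]) auto
  have Vc: "continuous_on (ball 0 1) V"
  proof -
    have "continuous_on (ball 0 1 \<times> cbox 0 1) (\<lambda>(x, t). ?H (x * circ t))"
      unfolding case_prod_unfold
      by (rule comp) (auto intro!: continuous_intros simp: norm_mult)
    from integral_continuous_on_param[OF this] show ?thesis unfolding V_def by simp
  qed
  obtain \<delta> where \<delta>: "\<delta> > 0" "\<And>x \<rho>. norm x \<le> R \<Longrightarrow> norm \<rho> < \<delta> \<Longrightarrow> norm x + norm \<rho> < 1 \<and>
     ?H x \<le> integral {0..1} (\<lambda>s. ?H (x + \<rho> * circ s))"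
    using uniform_submean[OF v \<phi> r(3) e] by blast
  obtain y where y: "norm y = R" "V (of_real r) \<le> V y"
  proof (rule maximum_principle[OF Vc, of R "of_real r"])
    fix x :: complex assume x: "norm x < R"
    show "\<exists>\<rho>>0. \<forall>r. 0 < r \<longrightarrow> r < \<rho> \<longrightarrow> V x \<le> integral {0..1} (\<lambda>s. V (x + of_real r * circ s))"
    proof (intro exI[of _ \<delta>] conjI \<delta>(1) allI impI)
      fix \<rho> :: real assume \<rho>: "0 < \<rho>" "\<rho> < \<delta>"
      have lt: "norm (x + of_real \<rho> * circ s) < 1" for s
        using \<delta>(2)[of x "of_real \<rho>"] norm_triangle_ineq[of x "of_real \<rho> * circ s"] x \<rho> by (simp add: norm_mult)
      have c2: "continuous_on (cbox (0, 0) (1, 1)) (\<lambda>(t::real, s). ?H (x * circ t + of_real \<rho> * circ t * circ s))"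
        unfolding case_prod_unfold
      proof (rule comp)
        show "(\<lambda>p::real \<times> real. x * circ (fst p) + of_real \<rho> * circ (fst p) * circ (snd p)) ` cbox (0, 0) (1, 1) \<subseteq> ball 0 1"
        proof clarsimp
          fix t s :: real
          have "x * circ t + of_real \<rho> * circ t * circ s = (x + of_real \<rho> * circ s) * circ t" by (simp add: algebra_simps)
          then show "norm (x * circ t + of_real \<rho> * circ t * circ s) < 1" using lt by (simp add: norm_mult)
        qed
      qed (intro continuous_intros)
      have "V x \<le> integral {0..1} (\<lambda>t. integral {0..1} (\<lambda>s. ?H (x * circ t + of_real \<rho> * circ t * circ s)))"
        unfolding V_def
      proof (rule integral_le)
        show "(\<lambda>t. ?H (x * circ t)) integrable_on {0..1}"
          by (intro integrable_continuous_real comp) (use x r in \<open>auto intro!: continuous_intros simp: norm_mult\<close>)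
        have "continuous_on (cbox 0 1 \<times> cbox 0 1) (\<lambda>(t::real, s). ?H (x * circ t + of_real \<rho> * circ t * circ s))"
          using c2 by (simp add: cbox_Pair_eq)
        from integral_continuous_on_param[OF this]
        show "(\<lambda>t. integral {0..1} (\<lambda>s. ?H (x * circ t + of_real \<rho> * circ t * circ s))) integrable_on {0..1}"
          by (intro integrable_continuous_real) simp
        fix t :: real
        show "?H (x * circ t) \<le> integral {0..1} (\<lambda>s. ?H (x * circ t + of_real \<rho> * circ t * circ s))"
          using \<delta>(2)[of "x * circ t" "of_real \<rho> * circ t"] x \<rho> by (simp add: norm_mult)
      qed
      also have "\<dots> = integral {0..1} (\<lambda>s. integral {0..1} (\<lambda>t. ?H (x * circ t + of_real \<rho> * circ t * circ s)))"
        using integral_swap_continuous[OF c2] by simp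
      also have "\<dots> = integral {0..1} (\<lambda>s. V (x + of_real \<rho> * circ s))"
        by (simp add: V_def algebra_simps)
      finally show "V x \<le> integral {0..1} (\<lambda>s. V (x + of_real \<rho> * circ s))" .
    qed
  qed (use r in auto)
  obtain \<theta> where \<theta>: "0 \<le> \<theta>" "\<theta> \<le> 1" "y = of_real R * circ \<theta>"
  proof (cases "R = 0")
    case True
    then show ?thesis using that[of 0] y by simp
  next
    case False
    then have "norm (y / of_real R) = 1" using y r by (simp add: norm_divide)
    from unimodular_eq_circ[OF this] obtain t where t: "0 \<le> t" "t \<le> 1" "y / of_real R = circ t" .
    have "y = of_real R * (y / of_real R)" using False by simp
    with t show ?thesis by (intro that[of t]) simp_all
  qed
  have Rc: "continuous_on UNIV (\<lambda>t. ?H (of_real R * circ t))"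
    by (rule comp) (use r in \<open>auto intro!: continuous_intros simp: norm_mult\<close>)
  have hint: "(\<lambda>t. ?h (of_real R * circ t)) integrable_on {0..1}"
    by (intro integrable_continuous_real comph) (use r in \<open>auto intro!: continuous_intros simp: norm_mult\<close>)
  have "integral {0..1} (\<lambda>t. ?h (of_real r * circ t)) \<le> V (of_real r)"
    unfolding V_def
    by (rule integral_le; (intro integrable_continuous_real comp comph)?)
       (use r in \<open>auto intro!: continuous_intros simp: norm_mult\<close>)
  also have "\<dots> \<le> V y" by (rule y)
  also have "V y = integral {0..1} (\<lambda>t. ?H (of_real R * circ (t + \<theta>)))"
    by (simp add: V_def \<theta>(3) cis_mult algebra_simps)
  also have "\<dots> = integral {0..1} (\<lambda>t. ?H (of_real R * circ t))"
    using \<theta> by (intro integral_periodic Rc) (simp_all add: distrib_left cis_mult[symmetric])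
  also have "\<dots> \<le> integral {0..1} (\<lambda>t. ?h (of_real R * circ t) + \<epsilon>)"
  proof (rule integral_le)
    show "(\<lambda>t. ?H (of_real R * circ t)) integrable_on {0..1}"
      by (intro integrable_continuous_real continuous_on_subset[OF Rc]) simp
    show "(\<lambda>t. ?h (of_real R * circ t) + \<epsilon>) integrable_on {0..1}"
      by (intro integrable_add hint integrable_const_ivl)
    fix t :: real
    have "0 \<le> ?h (of_real R * circ t)" by (rule v0) simp
    then show "?H (of_real R * circ t) \<le> ?h (of_real R * circ t) + \<epsilon>" using e by simp
  qed
  also have "\<dots> = integral {0..1} (\<lambda>t. ?h (of_real R * circ t)) + \<epsilon>"
    by (subst integral_add[OF hint]) auto
  finally show "integral {0..1} (\<lambda>t. ?h (of_real r * circ t)) \<le> integral {0..1} (\<lambda>t. ?h (of_real R * circ t)) + \<epsilon>" .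
qed

lemma nn_integral_Icc_continuous:
  fixes f :: "real \<Rightarrow> real"
  assumes c: "continuous_on {a..b} f" and f: "\<And>t. t \<in> {a..b} \<Longrightarrow> 0 \<le> f t"
  shows "(\<integral>\<^sup>+t. ennreal (f t) * indicator {a..b} t \<partial>lborel) = ennreal (integral {a..b} f)"
proof -
  let ?g = "\<lambda>t. indicator {a..b} t *\<^sub>R f t"
  have "?g \<in> borel_measurable borel"
    by (rule borel_measurable_continuous_on_indicator[OF _ c]) simp
  moreover have *: "(f has_integral integral {a..b} f) {a..b}"
    using integrable_integral[OF integrable_continuous_real[OF c]] .
  have "(?g has_integral integral {a..b} f) UNIV"
  proof -
    have "?g = (\<lambda>t. if t \<in> {a..b} then f t else 0)" by (auto simp: indicator_def)
    then show ?thesis using * by (simp only: has_integral_restrict_UNIV)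
  qed
  ultimately have "(\<integral>\<^sup>+t. ennreal (?g t) \<partial>lborel) = ennreal (integral {a..b} f)"
    using f by (intro nn_integral_has_integral_lborel) (auto simp: indicator_def)
  moreover have "(\<integral>\<^sup>+t. ennreal (f t) * indicator {a..b} t \<partial>lborel) = (\<integral>\<^sup>+t. ennreal (?g t) \<partial>lborel)"
    by (intro nn_integral_cong) (auto simp: indicator_def)
  ultimately show ?thesis by simp
qed

lemma nn_circle_mean_mono:
  assumes v: "log_convex v" and \<phi>: "\<phi> holomorphic_on ball 0 1" and r: "0 \<le> r" "r \<le> R" "R < 1"
  shows "(\<integral>\<^sup>+t. ennreal (v (norm (\<phi> (of_real r * circ t)))) * indicator {0..1} t \<partial>lborel) \<le>
    (\<integral>\<^sup>+t. ennreal (v (norm (\<phi> (of_real R * circ t)))) * indicator {0..1} t \<partial>lborel)"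
proof -
  have vc: "continuous_on {0..} v" and v0: "\<And>x. x \<ge> 0 \<Longrightarrow> v x \<ge> 0" using v by (auto simp: log_convex_def)
  have c: "continuous_on {0..1} (\<lambda>t. v (norm (\<phi> (of_real x * circ t))))" if "0 \<le> x" "x < 1" for x
    by (intro continuous_on_compose2[OF vc] continuous_on_norm
         continuous_on_compose2[OF holomorphic_on_imp_continuous_on[OF \<phi>]])
       (use that in \<open>auto intro!: continuous_intros simp: norm_mult\<close>)
  show ?thesis
    using circle_mean_mono[OF v \<phi> r] r
    by (subst (1 2) nn_integral_Icc_continuous) (auto intro!: c v0 ennreal_leI)
qed

section \<open>Holomorphic functions on the ball\<close>

definition cderiv :: "(complex ^ 'n \<Rightarrow> complex) \<Rightarrow> complex ^ 'n \<Rightarrow> complex ^ 'n \<Rightarrow> complex" where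
  "cderiv f z = frechet_derivative f (at z)"

lemma holomorphic_vec_cderiv:
  assumes "holomorphic_vec_on f S" "z \<in> S"
  shows "(f has_derivative cderiv f z) (at z)" and "cderiv f z (c *s v) = c * cderiv f z v"
proof -
  obtain D where D: "(f has_derivative D) (at z)" "\<And>c v. D (c *s v) = c * D v"
    using assms unfolding holomorphic_vec_on_def by blast
  have "cderiv f z = D" unfolding cderiv_def using frechet_derivative_at[OF D(1)] by simp
  then show "(f has_derivative cderiv f z) (at z)" "cderiv f z (c *s v) = c * cderiv f z v"
    using D by simp_all
qed

lemma holomorphic_vec_on_continuous: "holomorphic_vec_on f S \<Longrightarrow> continuous_on S f"
  by (meson continuous_at_imp_continuous_on has_derivative_continuous holomorphic_vec_cderiv(1))

lemma bounded_linear_vector_scalar_left: "bounded_linear (\<lambda>w. w *s (v :: complex ^ 'n))"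
  by (rule linear_conv_bounded_linear[THEN iffD1], rule linearI)
     (simp_all add: vec_eq_iff algebra_simps)

lemma has_derivative_vector_scalar_left:
  "((\<lambda>w. w *s (v :: complex ^ 'n)) has_derivative (\<lambda>w. w *s v)) F"
  by (rule bounded_linear_imp_has_derivative[OF bounded_linear_vector_scalar_left])

lemma continuous_on_vector_scalar[continuous_intros]:
  fixes g :: "'a::topological_space \<Rightarrow> complex ^ 'n"
  assumes "continuous_on S f" "continuous_on S g"
  shows "continuous_on S (\<lambda>x. f x *s g x)"
  unfolding vector_scalar_mult_def using assms
  by (intro continuous_on_vec_lambda continuous_intros)

lemma holomorphic_vec_slice:
  assumes "holomorphic_vec_on f S" "z + w *s v \<in> S"
  shows "((\<lambda>w. f (z + w *s v)) has_field_derivative cderiv f (z + w *s v) v) (at w)"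
proof -
  have "((\<lambda>w. z + w *s v) has_derivative (\<lambda>w. w *s v)) (at w)"
    using has_derivative_add[OF has_derivative_const has_derivative_vector_scalar_left] by simp
  from has_derivative_compose[OF this holomorphic_vec_cderiv(1)[OF assms]]
  show ?thesis
    by (simp add: has_field_derivative_def holomorphic_vec_cderiv(2)[OF assms] mult.commute[of _ "cderiv f _ v"])
qed

lemma holomorphic_on_vec_slice:
  assumes f: "holomorphic_vec_on f S" and sub: "\<And>w. norm w < R \<Longrightarrow> z + w *s v \<in> S"
  shows "(\<lambda>w. f (z + w *s v)) holomorphic_on ball 0 R"
  unfolding holomorphic_on_def field_differentiable_def
proof
  fix w :: complex assume "w \<in> ball 0 R"
  then have "z + w *s v \<in> S" by (intro sub) simp
  from has_field_derivative_at_within[OF holomorphic_vec_slice[OF f this]]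
  show "\<exists>f'. ((\<lambda>w. f (z + w *s v)) has_field_derivative f') (at w within ball 0 R)" by blast
qed

lemma radial_deriv_eq:
  assumes D: "(f has_derivative D) (at z)" and lin: "\<And>c v. D (c *s v) = c * D v"
  shows "radial_deriv f z = D z"
proof -
  have pd: "partial_deriv k f z = D (axis k 1)" for k
  proof -
    have "((\<lambda>w. z + w *s axis k 1) has_derivative (\<lambda>w. w *s axis k 1)) (at 0)"
      using has_derivative_add[OF has_derivative_const has_derivative_vector_scalar_left] by simp
    moreover have "z + 0 *s axis k 1 = z" by simp
    ultimately have "((\<lambda>w. f (z + w *s axis k 1)) has_derivative (\<lambda>w. D (w *s axis k 1))) (at 0)"
      using has_derivative_compose[of "\<lambda>w. z + w *s axis k 1" _ 0 UNIV f D] D by simp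
    then have "((\<lambda>w. f (z + w *s axis k 1)) has_field_derivative D (axis k 1)) (at 0)"
      by (simp add: has_field_derivative_def lin mult.commute[of _ "D _"])
    then show ?thesis unfolding partial_deriv_def by (rule DERIV_imp_deriv)
  qed
  interpret linear D using D has_derivative_linear by blast
  have "radial_deriv f z = (\<Sum>k\<in>UNIV. D (z $ k *s axis k 1))"
    by (simp add: radial_deriv_def pd lin)
  also have "\<dots> = D (\<Sum>k\<in>UNIV. z $ k *s axis k 1)" by (simp add: sum)
  also have "(\<Sum>k\<in>UNIV. z $ k *s axis k 1) = z" by (rule basis_expansion)
  finally show ?thesis .
qed

lemma radial_deriv_cderiv:
  "holomorphic_vec_on f S \<Longrightarrow> z \<in> S \<Longrightarrow> radial_deriv f z = cderiv f z z"
  by (rule radial_deriv_eq) (auto intro: holomorphic_vec_cderiv)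

lemma cderiv_circle:
  assumes f: "holomorphic_vec_on f S" and sub: "\<And>w. norm w < R \<Longrightarrow> z + w *s v \<in> S" and r: "0 < r" "r < R"
  shows "cderiv f z v = integral {0..1} (\<lambda>t. f (z + (of_real r * circ t) *s v) / circ t) / of_real r"
proof -
  let ?g = "\<lambda>w. f (z + w *s v)"
  have "?g holomorphic_on ball 0 R"
    using f sub by (rule holomorphic_on_vec_slice)
  from holomorphic_circle_mean(2)[OF this r]
  have "deriv ?g 0 = integral {0..1} (\<lambda>t. f (z + (of_real r * circ t) *s v) / circ t) / of_real r" by simp
  moreover have "deriv ?g 0 = cderiv f z v"
    using holomorphic_vec_slice[OF f sub[of 0]] r by (intro DERIV_imp_deriv) simp
  ultimately show ?thesis by simp
qed

text \<open>
  The derivative of a holomorphic function is not continuous by definition; it is because Cauchy's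
  formula on complex lines expresses it by the values of \<open>f\<close>.
\<close>

lemma continuous_on_cderiv:
  fixes f :: "complex ^ 'n \<Rightarrow> complex"
  assumes f: "holomorphic_vec_on f unit_ball"
  shows "continuous_on unit_ball (\<lambda>z. cderiv f z v)"
proof (rule continuous_at_imp_continuous_on, rule ballI)
  fix z0 :: "complex ^ 'n" assume "z0 \<in> unit_ball"
  define \<delta> where "\<delta> = (1 - norm z0) / 2"
  have \<delta>: "\<delta> > 0" "norm z0 + 2 * \<delta> = 1" using \<open>z0 \<in> unit_ball\<close> by (auto simp: \<delta>_def field_simps)
  define R where "R = \<delta> / (norm v + 1)"
  have nv: "norm v + 1 > 0" by (simp add: add_nonneg_pos)
  then have R: "R > 0" using \<delta> by (simp add: R_def)
  have "R * norm v \<le> R * (norm v + 1)" using R by simp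
  also have "\<dots> = \<delta>" using nv by (simp add: R_def)
  finally have R: "R > 0" "R * norm v \<le> \<delta>" using R by simp_all
  define r where "r = R / 2"
  have r: "0 < r" "r < R" using R by (auto simp: r_def)
  have inS: "z + w *s v \<in> unit_ball" if "z \<in> ball z0 \<delta>" "norm w < R" for z w
  proof -
    have "norm (z + w *s v) \<le> norm z0 + norm (z - z0) + norm (w *s v)"
      using norm_triangle_ineq[of z "w *s v"] norm_triangle_ineq[of z0 "z - z0"] by simp
    also have "norm (w *s v) \<le> R * norm v"
      using that by (simp add: norm_vector_scalar mult_right_mono)
    finally have "norm (z + w *s v) \<le> norm z0 + norm (z - z0) + R * norm v" by simp
    moreover have "norm (z - z0) < \<delta>" using that by (simp add: dist_norm norm_minus_commute)
    ultimately have "norm (z + w *s v) < 1" using \<delta> R by linarith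
    then show ?thesis by simp
  qed
  have "continuous_on (ball z0 \<delta> \<times> cbox 0 1) (\<lambda>(z, t). f (z + (of_real r * circ t) *s v) / circ t)"
    unfolding case_prod_unfold
    by (intro continuous_on_divide continuous_on_compose2[OF holomorphic_vec_on_continuous[OF f]] continuous_intros)
       (use inS r in \<open>auto simp: norm_mult\<close>)
  from integral_continuous_on_param[OF this]
  have "continuous_on (ball z0 \<delta>) (\<lambda>z. integral {0..1} (\<lambda>t. f (z + (of_real r * circ t) *s v) / circ t) / of_real r)"
    using r by (intro continuous_intros) auto
  moreover have "integral {0..1} (\<lambda>t. f (z + (of_real r * circ t) *s v) / circ t) / of_real r = cderiv f z v"
    if "z \<in> ball z0 \<delta>" for z
    using cderiv_circle[OF f inS[OF that] r] by simp
  ultimately have "continuous_on (ball z0 \<delta>) (\<lambda>z. cderiv f z v)"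
    by (rule continuous_on_eq)
  then show "isCont (\<lambda>z. cderiv f z v) z0"
    using \<delta> by (simp add: continuous_on_eq_continuous_at)
qed

text \<open>
  Cauchy's formula on the complex line through \<open>0\<close> and \<open>z\<close>.
\<close>

lemma radial_circle:
  fixes f :: "complex ^ 'n \<Rightarrow> complex"
  assumes f: "holomorphic_vec_on f unit_ball" and r: "0 < r" "norm z + r < 1"
  shows "radial_deriv f z = integral {0..1} (\<lambda>t. f ((1 + of_real r * circ t) *s z) / circ t) / of_real r"
proof -
  define R where "R = 1 - norm z"
  have in_ball: "z + w *s z \<in> unit_ball" if "norm w < R" for w
  proof -
    have "norm (z + w *s z) \<le> norm z + norm w * norm z"
      using norm_triangle_ineq[of z "w *s z"] by (simp add: norm_vector_scalar)
    also have "norm w * norm z \<le> norm w" using r by (simp add: mult_left_le)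
    finally show ?thesis using that by (simp add: R_def)
  qed
  have "radial_deriv f z = cderiv f z z" using r by (intro radial_deriv_cderiv[OF f]) auto
  also have "\<dots> = integral {0..1} (\<lambda>t. f (z + (of_real r * circ t) *s z) / circ t) / of_real r"
    by (rule cderiv_circle[OF f in_ball]) (use r in \<open>auto simp: R_def\<close>)
  also have "(\<lambda>t. z + (of_real r * circ t) *s z) = (\<lambda>t. (1 + of_real r * circ t) *s z)"
    by (simp add: fun_eq_iff vec_eq_iff algebra_simps)
  finally show ?thesis by (metis (no_types, lifting))
qed

text \<open>
  Cauchy's estimate. The circle of radius \<open>r\<close> in the parameter of the line moves \<open>z\<close> by at most \<open>r\<close>, since
  \<open>|z| \<le> 1\<close>.
\<close>

lemma norm_radial_deriv_le:
  fixes f :: "complex ^ 'n \<Rightarrow> complex"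
  assumes f: "holomorphic_vec_on f unit_ball" and r: "0 < r" "norm z + r < 1"
    and B: "\<And>w. norm w \<le> norm z + r \<Longrightarrow> norm (f w) \<le> B"
  shows "norm (radial_deriv f z) \<le> B / r"
proof -
  have le: "norm ((1 + of_real r * circ t) *s z) \<le> norm z + r" for t
  proof -
    have "norm (1 + of_real r * circ t) \<le> 1 + r"
      using norm_triangle_ineq[of 1 "of_real r * circ t"] r by (simp add: norm_mult)
    then have "norm ((1 + of_real r * circ t) *s z) \<le> (1 + r) * norm z"
      by (simp only: norm_vector_scalar mult_right_mono norm_ge_zero)
    also have "\<dots> \<le> norm z + r" using r by (simp add: distrib_right mult_left_le)
    finally show ?thesis .
  qed
  have lt: "norm ((1 + of_real r * circ t) *s z) < 1" for t by (rule le_less_trans[OF le r(2)])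
  have c: "continuous_on {0..1} (\<lambda>t. f ((1 + of_real r * circ t) *s z) / circ t)"
    by (intro continuous_on_divide continuous_on_compose2[OF holomorphic_vec_on_continuous[OF f]] continuous_intros)
       (use lt in auto)
  have "norm (integral {0..1} (\<lambda>t. f ((1 + of_real r * circ t) *s z) / circ t)) \<le> integral {0..1} (\<lambda>t::real. B)"
    by (intro integral_norm_bound_integral integrable_continuous_real c) (use B le in \<open>auto simp: norm_divide\<close>)
  then show ?thesis
    using r by (simp add: radial_circle[OF f r] norm_divide divide_right_mono)
qed

text \<open>
  Differentiation under the integral sign in \<open>radial_circle\<close>.
\<close>

lemma holomorphic_vec_on_radial_deriv:
  fixes f :: "complex ^ 'n \<Rightarrow> complex"
  assumes f: "holomorphic_vec_on f unit_ball"
  shows "holomorphic_vec_on (radial_deriv f) unit_ball"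
  unfolding holomorphic_vec_on_def
proof
  fix z0 :: "complex ^ 'n" assume z0: "z0 \<in> unit_ball"
  define r where "r = (1 - norm z0) / 4"
  have r: "0 < r" "norm z0 + 4 * r = 1" using z0 by (auto simp: r_def field_simps)
  let ?U = "ball z0 r"
  have U: "norm z + r < 1" if "z \<in> ?U" for z
    using that r norm_triangle_ineq[of z0 "z - z0"] by (simp add: dist_norm norm_minus_commute)
  define a where "a t = 1 + of_real r * circ t" for t
  define c where "c t = a t / (of_real r * circ t)" for t
  have a_in: "a t *s z \<in> unit_ball" if "z \<in> ?U" for z t
  proof -
    have "norm (a t) \<le> 1 + r"
      unfolding a_def using norm_triangle_ineq[of 1 "of_real r * circ t"] r by (simp add: norm_mult)
    then have "norm (a t *s z) \<le> (1 + r) * norm z"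
      by (simp add: norm_vector_scalar mult_right_mono)
    also have "\<dots> \<le> norm z + r" using r U[OF that] by (simp add: distrib_right mult_left_le)
    finally show ?thesis using U[OF that] by simp
  qed
  have ac: "continuous_on S (\<lambda>x. a (h x))" if "continuous_on S h" for S and h :: "'b::topological_space \<Rightarrow> real"
    unfolding a_def by (intro continuous_intros that)
  have cc: "continuous_on S (\<lambda>x. c (h x))" if "continuous_on S h" for S and h :: "'b::topological_space \<Rightarrow> real"
    unfolding c_def using r by (intro continuous_intros ac that) auto
  define g where "g z t = f (a t *s z) / circ t / of_real r" for z t
  define g' where "g' z t = Blinfun (\<lambda>v. c t * cderiv f (a t *s z) v)" for z t
  have g': "blinfun_apply (g' z t) = (\<lambda>v. c t * cderiv f (a t *s z) v)" if "z \<in> ?U" for z t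
    unfolding g'_def
    using holomorphic_vec_cderiv(1)[OF f a_in[OF that]]
    by (intro bounded_linear_Blinfun_apply bounded_linear_const_mult has_derivative_bounded_linear)
  have "((\<lambda>z. integral (cbox 0 1) (g z)) has_derivative blinfun_apply (integral (cbox 0 1) (g' z0))) (at z0 within ?U)"
  proof (rule leibniz_rule)
    fix z t assume z: "z \<in> ?U"
    have "((\<lambda>z. a t *s z) has_derivative (\<lambda>v. a t *s v)) (at z)"
      by (rule bounded_linear_imp_has_derivative) (use linear_vector_scalar in \<open>simp add: linear_conv_bounded_linear\<close>)
    from has_derivative_compose[OF this holomorphic_vec_cderiv(1)[OF f a_in[OF z]]]
    have "((\<lambda>z. f (a t *s z)) has_derivative (\<lambda>v. a t * cderiv f (a t *s z) v)) (at z)"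
      by (simp add: holomorphic_vec_cderiv(2)[OF f a_in[OF z]])
    from has_derivative_mult_left[OF this, of "1 / (circ t * of_real r)"]
    have "((\<lambda>z. g z t) has_derivative (\<lambda>v. c t * cderiv f (a t *s z) v)) (at z)"
      by (simp add: g_def c_def mult_ac)
    then show "((\<lambda>z. g z t) has_derivative blinfun_apply (g' z t)) (at z within ?U)"
      using g'[OF z] by (simp add: has_derivative_at_withinI)
  next
    fix z assume z: "z \<in> ?U"
    show "g z integrable_on cbox 0 1"
      unfolding g_def using a_in[OF z] r
      by (intro integrable_continuous continuous_on_divide continuous_on_compose2[OF holomorphic_vec_on_continuous[OF f]] continuous_intros ac) auto
  next
    show "continuous_on (?U \<times> cbox 0 1) (\<lambda>(z, t). g' z t)"
    proof (rule continuous_on_blinfun_componentwise)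
      fix b :: "complex ^ 'n"
      have "continuous_on (?U \<times> cbox (0::real) 1) (\<lambda>p. c (snd p) * cderiv f (a (snd p) *s fst p) b)"
        using a_in
        by (intro continuous_on_mult continuous_on_compose2[OF continuous_on_cderiv[OF f]] continuous_intros ac cc) auto
      then show "continuous_on (?U \<times> cbox 0 1) (\<lambda>x. blinfun_apply (case x of (z, t) \<Rightarrow> g' z t) b)"
        by (rule continuous_on_eq) (auto simp: g')
    qed
  qed (use r in auto)
  then have d: "((\<lambda>z. integral (cbox 0 1) (g z)) has_derivative blinfun_apply (integral (cbox 0 1) (g' z0))) (at z0)"
    using r by (simp add: at_within_open[of z0 ?U])
  have "((\<lambda>z. radial_deriv f z) has_derivative blinfun_apply (integral (cbox 0 1) (g' z0))) (at z0)"
  proof (rule has_derivative_transform_within_open[OF d])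
    fix z assume z: "z \<in> ?U"
    show "integral (cbox 0 1) (g z) = radial_deriv f z"
      using radial_circle[OF f r(1) U[OF z]] by (simp add: g_def[abs_def] a_def del: divide_divide_eq_left)
  qed (use r in auto)
  moreover have "blinfun_apply (integral (cbox 0 1) (g' z0)) (b *s v) = b * blinfun_apply (integral (cbox 0 1) (g' z0)) v" for b v
  proof -
    have z: "z0 \<in> ?U" using r by simp
    have cont: "continuous_on (cbox 0 1) (g' z0)"
    proof (rule continuous_on_blinfun_componentwise)
      fix b :: "complex ^ 'n"
      have "continuous_on (cbox (0::real) 1) (\<lambda>t. c t * cderiv f (a t *s z0) b)"
        using a_in[OF z]
        by (intro continuous_on_mult continuous_on_compose2[OF continuous_on_cderiv[OF f]] continuous_intros ac cc) auto
      then show "continuous_on (cbox 0 1) (\<lambda>t. blinfun_apply (g' z0 t) b)"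
        by (simp add: g'[OF z])
    qed
    show ?thesis
      unfolding blinfun_apply_integral[OF integrable_continuous[OF cont]] g'[OF z] holomorphic_vec_cderiv(2)[OF f a_in[OF z]]
      by (simp add: mult.left_commute[of _ b])
  qed
  ultimately show "\<exists>D. (radial_deriv f has_derivative D) (at z0) \<and> (\<forall>c v. D (c *s v) = c * D v)" by blast
qed

lemma holomorphic_vec_on_radial_funpow:
  "holomorphic_vec_on f unit_ball \<Longrightarrow> holomorphic_vec_on ((radial_deriv ^^ N) f) (unit_ball :: (complex ^ 'n) set)"
  by (induction N) (auto intro: holomorphic_vec_on_radial_deriv)

lemma holomorphic_vec_on_compose_affine:
  fixes L :: "complex ^ 'm \<Rightarrow> complex ^ 'n"
  assumes f: "holomorphic_vec_on f S" and L: "linear L" "\<And>c v. L (c *s v) = c *s L v"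
    and sub: "\<And>u. u \<in> T \<Longrightarrow> a + L u \<in> S"
  shows "holomorphic_vec_on (\<lambda>u. f (a + L u)) T"
  unfolding holomorphic_vec_on_def
proof
  fix u assume u: "u \<in> T"
  have "bounded_linear L" using L(1) by (simp add: linear_conv_bounded_linear)
  then have "((\<lambda>u. a + L u) has_derivative L) (at u)"
    using has_derivative_add[OF has_derivative_const bounded_linear_imp_has_derivative] by fastforce
  from has_derivative_compose[OF this holomorphic_vec_cderiv(1)[OF f sub[OF u]]]
  show "\<exists>D. ((\<lambda>u. f (a + L u)) has_derivative D) (at u) \<and> (\<forall>c v. D (c *s v) = c * D v)"
    using holomorphic_vec_cderiv(2)[OF f sub[OF u]] L(2) by (metis (no_types, lifting))
qed

lemma holomorphic_on_slice:
  assumes f: "holomorphic_vec_on f unit_ball" and z: "norm z \<le> 1"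
  shows "(\<lambda>w. f (w *s z)) holomorphic_on ball 0 1"
proof -
  have "0 + w *s z \<in> unit_ball" if "norm w < 1" for w
    using that z mult_left_le[of "norm z" "norm w"] by (auto simp: norm_vector_scalar)
  from holomorphic_on_vec_slice[OF f this] show ?thesis by simp
qed

text \<open>
  Along rays the radial derivative is \<open>t d/dt\<close>; this recovers \<open>f\<close> from its radial derivative.
\<close>

lemma radial_deriv_ray:
  fixes f :: "complex ^ 'n \<Rightarrow> complex"
  assumes f: "holomorphic_vec_on f unit_ball" and t: "0 < t" "norm (t *\<^sub>R z) < 1"
  shows "((\<lambda>t. f (t *\<^sub>R z)) has_vector_derivative radial_deriv f (t *\<^sub>R z) / of_real t) (at t)"
proof -
  have in_ball: "t *\<^sub>R z \<in> unit_ball" using t by simp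
  have d: "((\<lambda>t. t *\<^sub>R z) has_derivative (\<lambda>h. h *\<^sub>R z)) (at t)"
    by (auto intro!: derivative_eq_intros)
  have "cderiv f (t *\<^sub>R z) (t *\<^sub>R z) = of_real t * cderiv f (t *\<^sub>R z) z"
    using holomorphic_vec_cderiv(2)[OF f in_ball, of "of_real t" z] by (simp only: of_real_vector_scalar)
  then have 1: "radial_deriv f (t *\<^sub>R z) / of_real t = cderiv f (t *\<^sub>R z) z"
    using t radial_deriv_cderiv[OF f in_ball] by simp
  have 2: "cderiv f (t *\<^sub>R z) (h *\<^sub>R z) = h *\<^sub>R cderiv f (t *\<^sub>R z) z" for h
    using has_derivative_linear[OF holomorphic_vec_cderiv(1)[OF f in_ball]] by (rule linear_cmul)
  show ?thesis
    using has_derivative_compose[OF d holomorphic_vec_cderiv(1)[OF f in_ball]]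
    unfolding has_vector_derivative_def 1 2 .
qed

section \<open>Integral means and pointwise estimates\<close>

text \<open>
  A holomorphic function on the ball is arbitrary, possibly not measurable, outside the ball. Facts on
  its integrals are stated for the functions in \<open>ball_fun\<close> and used for extensions by zero.
\<close>

definition zero_ext :: "(complex ^ 'n \<Rightarrow> complex) \<Rightarrow> complex ^ 'n \<Rightarrow> complex" where
  "zero_ext f z = (if norm z < 1 then f z else 0)"

definition ball_fun :: "(complex ^ 'n \<Rightarrow> complex) \<Rightarrow> bool" where
  "ball_fun f \<longleftrightarrow> holomorphic_vec_on f unit_ball \<and> f \<in> borel_measurable borel"

lemma ball_fun_measurable[measurable_dest]: "ball_fun f \<Longrightarrow> f \<in> borel_measurable borel"
  by (simp add: ball_fun_def)

lemma holomorphic_vec_on_cong: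
  fixes f g :: "complex ^ 'n \<Rightarrow> complex"
  assumes f: "holomorphic_vec_on f S" and S: "open S" and eq: "\<And>z. z \<in> S \<Longrightarrow> g z = f z"
  shows "holomorphic_vec_on g S"
  unfolding holomorphic_vec_on_def
proof
  fix z assume z: "z \<in> S"
  have "(g has_derivative cderiv f z) (at z)"
    by (rule has_derivative_transform_within_open[OF holomorphic_vec_cderiv(1)[OF f z] S z]) (simp add: eq)
  then show "\<exists>D. (g has_derivative D) (at z) \<and> (\<forall>c v. D (c *s v) = c * D v)"
    using holomorphic_vec_cderiv(2)[OF f z] by blast
qed

lemma linear_borel_measurable:
  fixes T :: "'a::euclidean_space \<Rightarrow> 'b::euclidean_space"
  shows "linear T \<Longrightarrow> T \<in> borel_measurable borel"
  by (simp add: linear_continuous_on linear_conv_bounded_linear borel_measurable_continuous_onI)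

lemma ennreal_mult_assoc:
  "0 \<le> a \<Longrightarrow> 0 \<le> b \<Longrightarrow> ennreal a * (ennreal b * x) = ennreal (a * b) * x"
  by (simp add: ennreal_mult mult.assoc)

lemma ball_fun_zero_ext:
  assumes f: "holomorphic_vec_on f unit_ball"
  shows "ball_fun (zero_ext f)"
proof -
  have "(\<lambda>z. indicator unit_ball z *\<^sub>R f z) \<in> borel_measurable borel"
    by (rule borel_measurable_continuous_on_indicator[OF _ holomorphic_vec_on_continuous[OF f]]) simp
  also have "(\<lambda>z. indicator unit_ball z *\<^sub>R f z) = zero_ext f"
    by (auto simp: zero_ext_def indicator_def)
  finally have m: "zero_ext f \<in> borel_measurable borel" .
  have "holomorphic_vec_on (zero_ext f) unit_ball"
    by (rule holomorphic_vec_on_cong[OF f open_ball]) (simp add: zero_ext_def)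
  with m show ?thesis by (simp add: ball_fun_def)
qed

lemma ball_fun_slice:
  assumes "ball_fun f" "norm z \<le> 1"
  shows "(\<lambda>w. f (w *s z)) holomorphic_on ball 0 1"
  using assms holomorphic_on_slice unfolding ball_fun_def by blast

interpretation lborel_sphere: pair_sigma_finite "lborel :: real measure" "sphere_measure :: (complex ^ 'n) measure" ..

text \<open>
  The sphere is a union of circles on complex lines through \<open>0\<close>, and rotation invariance makes its
  measure an average over them. In this way estimates in one variable integrate to estimates on spheres.
\<close>

lemma nn_integral_sphere_slice:
  fixes F :: "complex ^ 'n \<Rightarrow> ennreal"
  assumes [measurable]: "F \<in> borel_measurable borel"
  shows "(\<integral>\<^sup>+\<zeta>. F \<zeta> \<partial>sphere_measure) = (\<integral>\<^sup>+\<zeta>. (\<integral>\<^sup>+t. F (circ t *s \<zeta>) * indicator {0..1} t \<partial>lborel) \<partial>sphere_measure)"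
proof -
  have [measurable]: "(\<lambda>(t, \<zeta>). circ t *s \<zeta>) \<in> borel_measurable (borel \<Otimes>\<^sub>M (borel :: (complex ^ 'n) measure))"
    unfolding borel_prod by (intro borel_measurable_continuous_onI) (simp add: case_prod_unfold, intro continuous_intros)
  have [measurable]: "(\<lambda>(t, \<zeta>). F (circ t *s \<zeta>)) \<in> borel_measurable (lborel \<Otimes>\<^sub>M (sphere_measure :: (complex ^ 'n) measure))"
    by measurable
  have "(\<integral>\<^sup>+\<zeta>. (\<integral>\<^sup>+t. F (circ t *s \<zeta>) * indicator {0..1} t \<partial>lborel) \<partial>sphere_measure) =
      (\<integral>\<^sup>+t. (\<integral>\<^sup>+\<zeta>. F (circ t *s \<zeta>) * indicator {0..1} t \<partial>sphere_measure) \<partial>lborel)"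
    by (rule lborel_sphere.Fubini') measurable
  also have "\<dots> = (\<integral>\<^sup>+t. (\<integral>\<^sup>+\<zeta>. F \<zeta> \<partial>sphere_measure) * indicator {0..1} (t::real) \<partial>lborel)"
  proof (rule nn_integral_cong)
    fix t :: real
    have [measurable]: "(\<lambda>\<zeta>. circ t *s \<zeta>) \<in> borel_measurable (borel :: (complex ^ 'n) measure)"
      by (intro borel_measurable_continuous_onI continuous_intros)
    show "(\<integral>\<^sup>+\<zeta>. F (circ t *s \<zeta>) * indicator {0..1} t \<partial>sphere_measure) = (\<integral>\<^sup>+\<zeta>. F \<zeta> \<partial>sphere_measure) * indicator {0..1} t"
      using nn_integral_sphere_rotation[OF linear_vector_scalar[of "circ t"] _ assms]
      by (simp add: nn_integral_multc norm_vector_scalar)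
  qed
  also have "\<dots> = (\<integral>\<^sup>+\<zeta>. F \<zeta> \<partial>sphere_measure)"
    by (subst nn_integral_cmult) simp_all
  finally show ?thesis by simp
qed

lemma sphere_mean_mono:
  fixes f :: "complex ^ 'n \<Rightarrow> complex"
  assumes v: "log_convex v" and [measurable]: "v \<in> borel_measurable borel" and f: "ball_fun f" and r: "0 \<le> r" "r \<le> R" "R < 1"
  shows "(\<integral>\<^sup>+\<zeta>. ennreal (v (norm (f (r *\<^sub>R \<zeta>)))) \<partial>sphere_measure) \<le>
    (\<integral>\<^sup>+\<zeta>. ennreal (v (norm (f (R *\<^sub>R \<zeta>)))) \<partial>sphere_measure)"
proof -
  note [measurable] = ball_fun_measurable[OF f]
  have eq: "x *\<^sub>R (circ t *s \<zeta>) = (of_real x * circ t) *s \<zeta>" for x t and \<zeta> :: "complex ^ 'n"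
    by (simp only: of_real_vector_scalar[symmetric] vector_smult_assoc)
  have slice: "(\<integral>\<^sup>+\<zeta>. ennreal (v (norm (f (x *\<^sub>R \<zeta>)))) \<partial>sphere_measure) =
      (\<integral>\<^sup>+\<zeta>. (\<integral>\<^sup>+t. ennreal (v (norm (f (x *\<^sub>R (circ t *s \<zeta>))))) * indicator {0..1} t \<partial>lborel) \<partial>sphere_measure)" for x
    by (rule nn_integral_sphere_slice) measurable
  show ?thesis
    unfolding slice
  proof (rule nn_integral_mono)
    fix \<zeta> :: "complex ^ 'n" assume "\<zeta> \<in> space sphere_measure"
    then have "norm \<zeta> \<le> 1" by simp
    from nn_circle_mean_mono[OF v ball_fun_slice[OF f this] r]
    show "(\<integral>\<^sup>+t. ennreal (v (norm (f (r *\<^sub>R (circ t *s \<zeta>))))) * indicator {0..1} t \<partial>lborel) \<le>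
        (\<integral>\<^sup>+t. ennreal (v (norm (f (R *\<^sub>R (circ t *s \<zeta>))))) * indicator {0..1} t \<partial>lborel)"
      by (simp only: eq)
  qed
qed

text \<open>
  The \<open>p\<close>-th power of the classical integral mean \<open>M\<^sub>p(r, f)\<close>.
\<close>

definition integral_mean :: "real \<Rightarrow> (complex ^ 'n \<Rightarrow> complex) \<Rightarrow> real \<Rightarrow> ennreal" where
  "integral_mean p f r = (\<integral>\<^sup>+\<zeta>. ennreal (norm (f (r *\<^sub>R \<zeta>)) powr p) \<partial>sphere_measure)"

lemma integral_mean_mono:
  assumes "ball_fun f" "p > 0" "0 \<le> r" "r \<le> R" "R < 1"
  shows "integral_mean p f r \<le> integral_mean p f R"
  unfolding integral_mean_def using assms by (intro sphere_mean_mono log_convex_powr) auto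

lemma integral_mean_0: "integral_mean p (f :: complex ^ 'n \<Rightarrow> complex) 0 = ennreal (norm (f 0) powr p)"
  by (simp add: integral_mean_def emeasure_sphere_measure)

definition weighted_integral :: "real \<Rightarrow> real \<Rightarrow> (complex ^ 'n \<Rightarrow> complex) \<Rightarrow> ennreal" where
  "weighted_integral p \<gamma> f = (\<integral>\<^sup>+z. ennreal (norm (f z) powr p * (1 - (norm z)\<^sup>2) powr \<gamma>) * indicator unit_ball z \<partial>lborel)"

lemma weighted_integral_polar:
  fixes f :: "complex ^ 'n \<Rightarrow> complex"
  assumes f: "ball_fun f"
  shows "weighted_integral p \<gamma> f = ball_volume TYPE('n) *
    (\<integral>\<^sup>+r. ennreal (2 * CARD('n) * r ^ (2 * CARD('n) - 1)) * indicator {0<..<1} r * (ennreal ((1 - r\<^sup>2) powr \<gamma>) * integral_mean p f r) \<partial>lborel)"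
proof -
  note [measurable] = ball_fun_measurable[OF f]
  have "(\<integral>\<^sup>+\<zeta>. ennreal (norm (f (r *\<^sub>R \<zeta>)) powr p * (1 - (norm (r *\<^sub>R \<zeta>))\<^sup>2) powr \<gamma>) \<partial>sphere_measure) =
      ennreal ((1 - r\<^sup>2) powr \<gamma>) * integral_mean p f r" for r
  proof -
    have "(\<integral>\<^sup>+\<zeta>. ennreal (norm (f (r *\<^sub>R \<zeta>)) powr p * (1 - (norm (r *\<^sub>R \<zeta>))\<^sup>2) powr \<gamma>) \<partial>sphere_measure) =
        (\<integral>\<^sup>+\<zeta>. ennreal ((1 - r\<^sup>2) powr \<gamma>) * ennreal (norm (f (r *\<^sub>R \<zeta>)) powr p) \<partial>sphere_measure)"
      by (intro nn_integral_cong) (simp add: ennreal_mult'[symmetric] mult.commute power_mult_distrib)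
    then show ?thesis by (simp add: integral_mean_def nn_integral_cmult)
  qed
  then show ?thesis
    unfolding weighted_integral_def by (subst nn_integral_polar) simp_all
qed

lemma integral_mean_measurable[measurable]:
  assumes f: "ball_fun f"
  shows "integral_mean p f \<in> borel_measurable borel"
proof -
  note [measurable] = ball_fun_measurable[OF f]
  have "(\<lambda>r. \<integral>\<^sup>+\<zeta>. ennreal (norm (f (r *\<^sub>R \<zeta>)) powr p) \<partial>sphere_measure) \<in> borel_measurable borel"
    by (rule sphere.borel_measurable_nn_integral) measurable
  then show ?thesis by (simp add: integral_mean_def[abs_def])
qed

lemma ball_submean:
  fixes h :: "complex ^ 'n \<Rightarrow> complex"
  assumes h: "ball_fun h" and p: "p > 0"
  shows "ball_volume TYPE('n) * ennreal (norm (h 0) powr p) \<le>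
    (\<integral>\<^sup>+u. ennreal (norm (h u) powr p) * indicator unit_ball u \<partial>lborel)"
proof -
  note [measurable] = ball_fun_measurable[OF h]
  let ?w = "\<lambda>r::real. ennreal (2 * CARD('n) * r ^ (2 * CARD('n) - 1)) * indicator {0<..<1} r"
  have "ball_volume TYPE('n) * ennreal (norm (h 0) powr p) =
      (\<integral>\<^sup>+u. ennreal (norm (h 0) powr p) * indicator unit_ball (u :: complex ^ 'n) \<partial>lborel)"
    by (subst nn_integral_cmult_indicator) (simp_all add: ball_volume_def mult.commute)
  also have "\<dots> = ball_volume TYPE('n) * (\<integral>\<^sup>+r. ?w r * ennreal (norm (h 0) powr p) \<partial>lborel)"
    by (subst nn_integral_polar) (simp_all add: emeasure_sphere_measure)
  also have "\<dots> \<le> ball_volume TYPE('n) * (\<integral>\<^sup>+r. ?w r * integral_mean p h r \<partial>lborel)"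
  proof (rule mult_left_mono, rule nn_integral_mono)
    fix r :: real
    show "?w r * ennreal (norm (h 0) powr p) \<le> ?w r * integral_mean p h r"
      using integral_mean_mono[OF h p, of 0 r] by (auto simp: indicator_def integral_mean_0 intro!: mult_left_mono)
  qed simp
  also have "\<dots> = (\<integral>\<^sup>+u. ennreal (norm (h u) powr p) * indicator unit_ball u \<partial>lborel)"
    unfolding integral_mean_def by (rule nn_integral_polar[symmetric]) measurable
  finally show ?thesis .
qed

lemma power2_norm_vec: "(norm (z :: complex ^ 'n))\<^sup>2 = (\<Sum>j\<in>UNIV. (norm (z $ j))\<^sup>2)"
  by (simp add: norm_vec_def L2_set_def sum_nonneg)

text \<open>
  A point at complex tangential distance \<open>sqrt d\<close> is only of the order of \<open>d\<close> farther from the origin.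
  With \<open>d = (1 - t) / 4\<close> the whole ellipsoid keeps a distance from the sphere that is comparable to
  \<open>1 - t\<close>.
\<close>

lemma dilation_shell:
  fixes u :: "complex ^ 'n" and k :: 'n
  assumes t: "0 \<le> t" "t < 1" and u: "norm u < 1"
  defines "w \<equiv> t *\<^sub>R axis k 1 + dilation k ((1 - t) / 4) u"
  shows "1 - 5 / 4 * (1 - t) < norm w" and "norm w < 1 - (1 - t) / 4"
proof -
  define d where "d = (1 - t) / 4"
  have d4: "4 * d = 1 - t" by (simp add: d_def)
  with t have d: "d > 0" "t = 1 - 4 * d" "d \<le> 1 / 4" by linarith+
  have shell_eq: "1 - 5 / 4 * (1 - t) = t - d" "1 - (1 - t) / 4 = 1 - d" by (simp_all add: d(2))
  have wk: "w $ k = of_real t + of_real d * u $ k"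
    by (simp add: w_def dilation_def d_def axis_def scaleR_conv_of_real[where 'a=complex])
  have wj: "w $ j = of_real (sqrt d) * u $ j" if "j \<noteq> k" for j
    using that by (simp add: w_def dilation_def d_def axis_def scaleR_conv_of_real[where 'a=complex])
  have uk: "norm (u $ k) < 1" using Finite_Cartesian_Product.norm_nth_le[of u k] u by simp
  have "t - d < norm (w $ k)"
  proof -
    have "norm (of_real t :: complex) - norm (of_real d * u $ k) \<le> norm (w $ k)"
      unfolding wk by (rule norm_diff_ineq)
    moreover have "norm (of_real d * u $ k) < d" using uk d by (simp add: norm_mult)
    ultimately show ?thesis using t by simp
  qed
  also have "norm (w $ k) \<le> norm w" by (rule Finite_Cartesian_Product.norm_nth_le)
  finally show "1 - 5 / 4 * (1 - t) < norm w" by (simp only: shell_eq)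
  have "(norm w)\<^sup>2 = (norm (w $ k))\<^sup>2 + (\<Sum>j\<in>UNIV - {k}. (norm (w $ j))\<^sup>2)"
    using sum.remove[of UNIV k "\<lambda>j. (norm (w $ j))\<^sup>2"] by (simp add: power2_norm_vec[of w])
  also have "(\<Sum>j\<in>UNIV - {k}. (norm (w $ j))\<^sup>2) = d * (\<Sum>j\<in>UNIV - {k}. (norm (u $ j))\<^sup>2)"
    unfolding sum_distrib_left using d by (intro sum.cong) (auto simp: wj norm_mult power_mult_distrib)
  also have "(\<Sum>j\<in>UNIV - {k}. (norm (u $ j))\<^sup>2) \<le> (norm u)\<^sup>2"
    unfolding power2_norm_vec by (rule sum_mono2) auto
  also have "(norm u)\<^sup>2 \<le> 1" using u by (simp add: power_le_one)
  also have "(norm (w $ k))\<^sup>2 \<le> (t + d)\<^sup>2"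
  proof (rule power_mono)
    have "norm (w $ k) \<le> t + d * norm (u $ k)"
      unfolding wk using norm_triangle_ineq[of "of_real t" "of_real d * u $ k"] t(1) d(1) by (simp add: norm_mult)
    also have "d * norm (u $ k) \<le> d" using uk d by simp
    finally show "norm (w $ k) \<le> t + d" by simp
  qed simp
  finally have "(norm w)\<^sup>2 \<le> (t + d)\<^sup>2 + d * 1" using d by simp
  also have "\<dots> < (1 - d)\<^sup>2"
  proof -
    have "(1 - d)\<^sup>2 - ((t + d)\<^sup>2 + d) = d * (3 - 8 * d)"
      unfolding d(2) by (simp add: power2_eq_square algebra_simps)
    also have "\<dots> > 0" using d by simp
    finally show ?thesis by simp
  qed
  finally have "norm w < 1 - d"
    by (rule power2_less_imp_less) (use d in simp)
  then show "norm w < 1 - (1 - t) / 4" by (simp only: shell_eq)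
qed

lemma linear_dilation: "linear (dilation k d)"
  by (rule linearI) (simp_all add: dilation_def vec_eq_iff algebra_simps)

lemma dilation_vector_scalar: "dilation k d (c *s v) = c *s dilation k d v"
  by (simp add: dilation_def vec_eq_iff)

text \<open>
  The submean value property on the ellipsoid of \<open>dilation_shell\<close>, moved to \<open>z\<close> by a unitary map. Its volume is
  of the order \<open>s\<^bsup>n+1\<^esup>\<close>, and in polar coordinates the shell that contains it contributes its thickness \<open>s\<close>
  times the mean over the largest sphere; the quotient leaves \<open>s\<^bsup>-n\<^esup>\<close>.
\<close>

lemma pointwise_integral_mean:
  fixes f :: "complex ^ 'n \<Rightarrow> complex"
  assumes f: "ball_fun f" and p: "p > 0" and z: "norm z < 1"
  shows "ennreal (norm (f z) powr p) \<le>
    ennreal (2 * CARD('n) * 4 ^ (CARD('n) + 1) * (1 - norm z) powr (- real CARD('n))) * integral_mean p f (1 - (1 - norm z) / 4)"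
proof -
  note [measurable] = ball_fun_measurable[OF f]
  define k :: 'n where "k = undefined"
  define t where "t = norm z"
  define s where "s = 1 - t"
  define d where "d = s / 4"
  have t: "0 \<le> t" "t < 1" "0 < s" "s \<le> 1" "0 < d" using z by (auto simp: t_def s_def d_def)
  define \<zeta> where "\<zeta> = (if z = 0 then axis k 1 else sgn z)"
  have \<zeta>: "norm \<zeta> = 1" "z = t *\<^sub>R \<zeta>"
    by (auto simp: \<zeta>_def t_def norm_sgn sgn_div_norm norm_axis_1)
  obtain U where U: "linear U" "\<And>c v. U (c *s v) = c *s U v" "\<And>v. norm (U v) = norm v" "U (axis k 1) = \<zeta>"
    using exists_unitary_axis[OF \<zeta>(1)] by blast
  have Uc: "U \<in> borel_measurable borel"
    using U(1) by (rule linear_borel_measurable)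
  note [measurable] = Uc
  have Dc: "dilation k d \<in> borel_measurable borel"
    by (rule linear_borel_measurable[OF linear_dilation])
  note [measurable] = Dc
  let ?a = "t *\<^sub>R axis k 1 :: complex ^ 'n"
  define A where "A = {w :: complex ^ 'n. 1 - 5 / 4 * s < norm w \<and> norm w < 1 - s / 4}"
  have [measurable]: "A \<in> sets borel" unfolding A_def by measurable
  have shell: "?a + dilation k d u \<in> A" if "norm u < 1" for u
    using dilation_shell[OF t(1,2) that, of k] by (simp add: A_def s_def d_def)
  have A_ball: "A \<subseteq> unit_ball" using t by (auto simp: A_def)
  define L where "L u = U (dilation k d u)" for u
  have L: "linear L" "\<And>c v. L (c *s v) = c *s L v"
    using linear_compose[OF linear_dilation U(1)] by (simp_all add: L_def[abs_def] o_def dilation_vector_scalar U(2))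
  have UL: "U (?a + dilation k d u) = z + L u" for u
    using U(1) by (simp add: linear_add linear_cmul U(4) \<zeta> L_def)
  define h where "h u = f (z + L u)" for u
  have "z + L u \<in> unit_ball" if "u \<in> unit_ball" for u
    using shell[of u] that A_ball U(3)[of "?a + dilation k d u"] unfolding UL by auto
  then have "holomorphic_vec_on (\<lambda>u. f (z + L u)) unit_ball"
    by (intro holomorphic_vec_on_compose_affine[OF _ L, of f unit_ball]) (use f in \<open>auto simp: ball_fun_def\<close>)
  then have "holomorphic_vec_on h unit_ball" by (simp add: h_def[abs_def])
  moreover have "h \<in> borel_measurable borel" unfolding h_def L_def by measurable
  ultimately have h: "ball_fun h" by (simp add: ball_fun_def)
  have L0: "L 0 = 0" using L(1) by (rule linear_0)
  let ?V = "ball_volume TYPE('n)"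
  let ?Q = "\<lambda>w. ennreal (norm (f w) powr p) * indicator A w"
  have "?V * ennreal (norm (f z) powr p) \<le> (\<integral>\<^sup>+u. ennreal (norm (h u) powr p) * indicator unit_ball u \<partial>lborel)"
    using ball_submean[OF h p] by (simp add: h_def L0)
  also have "\<dots> \<le> (\<integral>\<^sup>+u. ?Q (U (?a + dilation k d u)) \<partial>lborel)"
  proof (rule nn_integral_mono)
    fix u :: "complex ^ 'n"
    show "ennreal (norm (h u) powr p) * indicator unit_ball u \<le> ?Q (U (?a + dilation k d u))"
      using shell[of u] by (auto simp: indicator_def h_def UL[symmetric] A_def U(3))
  qed
  finally have "ennreal (d ^ (CARD('n) + 1)) * (?V * ennreal (norm (f z) powr p)) \<le>
      ennreal (d ^ (CARD('n) + 1)) * (\<integral>\<^sup>+u. ?Q (U (?a + dilation k d u)) \<partial>lborel)"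
    by (rule mult_left_mono) simp
  also have "\<dots> = (\<integral>\<^sup>+w. ?Q (U w) \<partial>lborel)"
    by (rule nn_integral_dilation) (use t in \<open>auto intro!: measurable_compose[OF Uc]\<close>)
  also have "\<dots> = (\<integral>\<^sup>+w. ?Q w \<partial>lborel)"
    by (rule nn_integral_lborel_isometry[OF U(1,3)]) measurable
  also have "\<dots> = (\<integral>\<^sup>+w. ?Q w * indicator unit_ball w \<partial>lborel)"
    using A_ball by (intro nn_integral_cong) (auto simp: indicator_def)
  also have "\<dots> = ?V * (\<integral>\<^sup>+r. ennreal (2 * CARD('n) * r ^ (2 * CARD('n) - 1)) * indicator {0<..<1} r *
       (\<integral>\<^sup>+\<zeta>. ?Q (r *\<^sub>R \<zeta>) \<partial>sphere_measure) \<partial>lborel)"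
    by (rule nn_integral_polar) measurable
  also have "\<dots> \<le> ?V * (\<integral>\<^sup>+r. ennreal (2 * CARD('n)) * integral_mean p f (1 - s / 4) * indicator {1 - 5 / 4 * s..1 - s / 4} r \<partial>lborel)"
  proof (rule mult_left_mono, rule nn_integral_mono)
    fix r :: real
    show "ennreal (2 * CARD('n) * r ^ (2 * CARD('n) - 1)) * indicator {0<..<1} r *
       (\<integral>\<^sup>+\<zeta>. ?Q (r *\<^sub>R \<zeta>) \<partial>sphere_measure) \<le> ennreal (2 * CARD('n)) * integral_mean p f (1 - s / 4) * indicator {1 - 5 / 4 * s..1 - s / 4} r"
    proof (cases "0 < r \<and> r < 1 \<and> 1 - 5 / 4 * s < r \<and> r < 1 - s / 4")
      case True
      have "(\<integral>\<^sup>+\<zeta>. ?Q (r *\<^sub>R \<zeta>) \<partial>sphere_measure) \<le> integral_mean p f r"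
        unfolding integral_mean_def by (intro nn_integral_mono) (auto simp: indicator_def)
      also have "\<dots> \<le> integral_mean p f (1 - s / 4)" using True t by (intro integral_mean_mono[OF f p]) auto
      finally have 1: "(\<integral>\<^sup>+\<zeta>. ?Q (r *\<^sub>R \<zeta>) \<partial>sphere_measure) \<le> integral_mean p f (1 - s / 4)" .
      have 2: "ennreal (2 * CARD('n) * r ^ (2 * CARD('n) - 1)) \<le> ennreal (2 * CARD('n))"
        using True by (intro ennreal_leI) (simp add: mult_left_le power_le_one)
      show ?thesis using mult_mono[OF 2 1] True by (simp add: indicator_def)
    next
      case False
      have "(\<integral>\<^sup>+\<zeta>. ?Q (r *\<^sub>R \<zeta>) \<partial>(sphere_measure :: (complex ^ 'n) measure)) = 0" if "0 < r"
      proof -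
        have "(\<integral>\<^sup>+\<zeta>. ?Q (r *\<^sub>R \<zeta>) \<partial>(sphere_measure :: (complex ^ 'n) measure)) = (\<integral>\<^sup>+\<zeta>. 0 \<partial>(sphere_measure :: (complex ^ 'n) measure))"
          using that False t by (intro nn_integral_cong) (auto simp: indicator_def A_def)
        then show ?thesis by simp
      qed
      then show ?thesis by (cases "0 < r") (simp_all add: indicator_def)
    qed
  qed simp
  also have "\<dots> = ?V * (ennreal (2 * CARD('n)) * integral_mean p f (1 - s / 4) * ennreal s)"
    using t by (simp add: nn_integral_cmult)
  finally have "?V * (ennreal (d ^ (CARD('n) + 1)) * ennreal (norm (f z) powr p)) \<le>
      ?V * (ennreal (2 * CARD('n) * s) * integral_mean p f (1 - s / 4))"
    using t by (simp add: ennreal_mult mult_ac)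
  then have *: "ennreal (d ^ (CARD('n) + 1)) * ennreal (norm (f z) powr p) \<le> ennreal (2 * CARD('n) * s) * integral_mean p f (1 - s / 4)"
    using ball_volume_pos ball_volume_finite by (subst (asm) ennreal_mult_le_mult_iff) auto
  have "ennreal (norm (f z) powr p) = ennreal (1 / d ^ (CARD('n) + 1)) * (ennreal (d ^ (CARD('n) + 1)) * ennreal (norm (f z) powr p))"
    using t by (simp add: ennreal_mult[symmetric] mult.assoc[symmetric])
  also have "\<dots> \<le> ennreal (1 / d ^ (CARD('n) + 1)) * (ennreal (2 * CARD('n) * s) * integral_mean p f (1 - s / 4))"
    by (intro mult_left_mono *) simp
  also have "\<dots> = ennreal (1 / d ^ (CARD('n) + 1) * (2 * CARD('n) * s)) * integral_mean p f (1 - s / 4)"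
    using t by (subst ennreal_mult_assoc) simp_all
  also have "1 / d ^ (CARD('n) + 1) * (2 * CARD('n) * s) = 2 * CARD('n) * 4 ^ (CARD('n) + 1) * s powr (- real CARD('n))"
    using t by (simp add: d_def power_divide powr_minus powr_realpow field_simps)
  finally show ?thesis by (simp add: s_def t_def)
qed

lemma one_minus_square_bounds:
  fixes r :: real
  assumes "0 \<le> r" "r \<le> 1"
  shows "1 - r \<le> 1 - r\<^sup>2" and "1 - r\<^sup>2 \<le> 2 * (1 - r)"
proof -
  have eq: "1 - r\<^sup>2 = (1 - r) * (1 + r)" by (simp add: power2_eq_square algebra_simps)
  show "1 - r \<le> 1 - r\<^sup>2" unfolding eq using assms mult_left_mono[of 1 "1 + r" "1 - r"] by simp
  show "1 - r\<^sup>2 \<le> 2 * (1 - r)"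
    unfolding eq using assms mult_left_mono[of "1 + r" 2 "1 - r"] by (simp add: mult.commute)
qed

lemma powr_comparable:
  fixes \<gamma> :: real
  assumes "0 < x" "x \<le> b * y" "y \<le> b * x" "1 \<le> b" "0 < y"
  shows "x powr \<gamma> \<le> b powr \<bar>\<gamma>\<bar> * y powr \<gamma>"
proof (cases "\<gamma> \<ge> 0")
  case True
  then have "x powr \<gamma> \<le> (b * y) powr \<gamma>" using assms by (intro powr_mono2) auto
  then show ?thesis using assms True by (simp add: powr_mult)
next
  case False
  then have "x powr \<gamma> \<le> (y / b) powr \<gamma>"
    using assms by (intro powr_mono2') (auto simp: field_simps)
  also have "\<dots> = b powr \<bar>\<gamma>\<bar> * y powr \<gamma>"
    using assms False by (simp add: powr_divide powr_minus field_simps)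
  finally show ?thesis .
qed

text \<open>
  Since integral means increase with the radius, the one at \<open>1 - \<tau>\<close> is below the average over radii in
  \<open>[1 - \<tau>, 1 - \<tau>/2]\<close>.
\<close>

lemma integral_mean_le_weighted_integral:
  fixes p \<gamma> :: real
  assumes p: "p > 0"
  obtains C where "C > 0" "\<And>f :: complex ^ 'n \<Rightarrow> complex. \<And>\<tau>. ball_fun f \<Longrightarrow> 0 < \<tau> \<Longrightarrow> \<tau> \<le> 1 / 4 \<Longrightarrow>
    integral_mean p f (1 - \<tau>) \<le> ennreal (C * \<tau> powr (- \<gamma> - 1)) * weighted_integral p \<gamma> f"
proof -
  let ?V = "ball_volume TYPE('n)"
  obtain V where V: "V > 0" "?V = ennreal V"
    using ball_volume_pos[where 'n='n] ball_volume_finite[where 'n='n]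
    by (cases ?V) (auto simp: less_le)
  define c where "c = V * (2 * CARD('n) * (3 / 4) ^ (2 * CARD('n) - 1)) * 2 powr (- \<bar>\<gamma>\<bar>) / 2"
  have c: "c > 0" using V by (simp add: c_def)
  show thesis
  proof (rule that[of "1 / c"])
    show "1 / c > 0" using c by simp
    fix f :: "complex ^ 'n \<Rightarrow> complex" and \<tau> :: real
    assume f: "ball_fun f" and \<tau>: "0 < \<tau>" "\<tau> \<le> 1 / 4"
    note [measurable] = integral_mean_measurable[OF f]
    let ?M = "integral_mean p f (1 - \<tau>)"
    let ?b = "2 * CARD('n) * (3 / 4) ^ (2 * CARD('n) - 1) * (2 powr (- \<bar>\<gamma>\<bar>) * \<tau> powr \<gamma>)"
    have "ennreal (c * \<tau> powr (\<gamma> + 1)) * ?M = ?V * (ennreal ?b * ?M * ennreal (\<tau> / 2))"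
    proof -
      have "c * \<tau> powr (\<gamma> + 1) = V * (?b * (\<tau> / 2))"
        using \<tau> by (simp add: c_def powr_add)
      moreover have "ennreal ?b * ?M * ennreal (\<tau> / 2) = ennreal (?b * (\<tau> / 2)) * ?M"
        using \<tau> by (subst ennreal_mult[of ?b]) (simp_all add: mult_ac)
      moreover have "?V * (ennreal (?b * (\<tau> / 2)) * ?M) = ennreal (V * (?b * (\<tau> / 2))) * ?M"
        unfolding V(2) using V \<tau> by (intro ennreal_mult_assoc) auto
      ultimately show ?thesis by simp
    qed
    also have "\<dots> = ?V * (\<integral>\<^sup>+r. ennreal ?b * ?M * indicator {1 - \<tau>..1 - \<tau> / 2} (r::real) \<partial>lborel)"
      using \<tau> by (subst nn_integral_cmult_indicator) simp_all
    also have "\<dots> \<le> ?V * (\<integral>\<^sup>+r. ennreal (2 * CARD('n) * r ^ (2 * CARD('n) - 1)) * indicator {0<..<1} r * (ennreal ((1 - r\<^sup>2) powr \<gamma>) * integral_mean p f r) \<partial>lborel)"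
    proof (rule mult_left_mono, rule nn_integral_mono)
      fix r :: real
      show "ennreal ?b * ?M * indicator {1 - \<tau>..1 - \<tau> / 2} r \<le>
          ennreal (2 * CARD('n) * r ^ (2 * CARD('n) - 1)) * indicator {0<..<1} r * (ennreal ((1 - r\<^sup>2) powr \<gamma>) * integral_mean p f r)"
      proof (cases "r \<in> {1 - \<tau>..1 - \<tau> / 2}")
        case True
        then have r: "1 - \<tau> \<le> r" "r \<le> 1 - \<tau> / 2" "3 / 4 \<le> r" "r < 1" using \<tau> by auto
        have eq: "1 - r\<^sup>2 = (1 - r) * (1 + r)" by (simp add: power2_eq_square algebra_simps)
        have lo: "\<tau> / 2 \<le> 1 - r\<^sup>2"
          unfolding eq using mult_mono[of "\<tau> / 2" "1 - r" 1 "1 + r"] r \<tau> by simp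
        have hi: "1 - r\<^sup>2 \<le> 2 * \<tau>"
          unfolding eq using mult_mono[of "1 - r" \<tau> "1 + r" 2] r \<tau> by simp
        have "\<tau> powr \<gamma> \<le> 2 powr \<bar>\<gamma>\<bar> * (1 - r\<^sup>2) powr \<gamma>"
          using lo hi \<tau> by (intro powr_comparable) auto
        then have "2 powr (- \<bar>\<gamma>\<bar>) * \<tau> powr \<gamma> \<le> (1 - r\<^sup>2) powr \<gamma>"
          by (simp add: powr_minus field_simps)
        moreover have "(3 / 4) ^ (2 * CARD('n) - 1) \<le> r ^ (2 * CARD('n) - 1)"
          using r by (intro power_mono) auto
        ultimately have "?b \<le> 2 * CARD('n) * r ^ (2 * CARD('n) - 1) * (1 - r\<^sup>2) powr \<gamma>"
          using r by (intro mult_mono) auto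
        then have 1: "ennreal ?b \<le> ennreal (2 * CARD('n) * r ^ (2 * CARD('n) - 1) * (1 - r\<^sup>2) powr \<gamma>)"
          by (rule ennreal_leI)
        have 2: "?M \<le> integral_mean p f r" using r \<tau> by (intro integral_mean_mono[OF f p]) auto
        have "ennreal ?b * ?M \<le> ennreal (2 * CARD('n) * r ^ (2 * CARD('n) - 1) * (1 - r\<^sup>2) powr \<gamma>) * integral_mean p f r"
          by (rule mult_mono[OF 1 2]) simp_all
        also have "\<dots> = ennreal (2 * CARD('n) * r ^ (2 * CARD('n) - 1)) * (ennreal ((1 - r\<^sup>2) powr \<gamma>) * integral_mean p f r)"
          using r by (intro ennreal_mult_assoc[symmetric]) auto
        finally show ?thesis using True r by simp
      qed simp
    qed simp
    also have "\<dots> = weighted_integral p \<gamma> f" by (rule weighted_integral_polar[OF f, symmetric])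
    finally have *: "ennreal (c * \<tau> powr (\<gamma> + 1)) * ?M \<le> weighted_integral p \<gamma> f" .
    have "?M = ennreal (1 / c * \<tau> powr (- \<gamma> - 1)) * (ennreal (c * \<tau> powr (\<gamma> + 1)) * ?M)"
    proof -
      have "1 / c * \<tau> powr (- \<gamma> - 1) * (c * \<tau> powr (\<gamma> + 1)) = \<tau> powr (- \<gamma> - 1 + (\<gamma> + 1))"
        using c unfolding powr_add[of \<tau> "- \<gamma> - 1"] by simp
      also have "\<dots> = 1" using \<tau> by simp
      finally show ?thesis
        using c by (subst ennreal_mult_assoc) (simp_all only: ennreal_1, simp_all)
    qed
    also have "\<dots> \<le> ennreal (1 / c * \<tau> powr (- \<gamma> - 1)) * weighted_integral p \<gamma> f"
      by (rule mult_left_mono[OF *]) simp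
    finally show "?M \<le> ennreal (1 / c * \<tau> powr (- \<gamma> - 1)) * weighted_integral p \<gamma> f" .
  qed
qed

lemma pointwise_weighted_integral:
  fixes p \<gamma> :: real
  assumes p: "p > 0"
  obtains C where "C > 0" "\<And>f :: complex ^ 'n \<Rightarrow> complex. \<And>z. ball_fun f \<Longrightarrow> norm z < 1 \<Longrightarrow>
    ennreal (norm (f z) powr p) \<le> ennreal (C * (1 - norm z) powr (- (CARD('n) + 1 + \<gamma>))) * weighted_integral p \<gamma> f"
proof -
  obtain C where C: "C > 0" "\<And>f :: complex ^ 'n \<Rightarrow> complex. \<And>\<tau>. ball_fun f \<Longrightarrow> 0 < \<tau> \<Longrightarrow> \<tau> \<le> 1 / 4 \<Longrightarrow>
    integral_mean p f (1 - \<tau>) \<le> ennreal (C * \<tau> powr (- \<gamma> - 1)) * weighted_integral p \<gamma> f"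
    using integral_mean_le_weighted_integral[OF p] by metis
  let ?c = "2 * CARD('n) * 4 ^ (CARD('n) + 1) :: real"
  let ?C = "?c * C * 4 powr (\<gamma> + 1)"
  show thesis
  proof (rule that)
    show "?C > 0" using C by simp
    fix f :: "complex ^ 'n \<Rightarrow> complex" and z :: "complex ^ 'n"
    assume f: "ball_fun f" and z: "norm z < 1"
    define s where "s = 1 - norm z"
    have s: "0 < s" "s \<le> 1" using z by (auto simp: s_def)
    have "ennreal (norm (f z) powr p) \<le> ennreal (?c * s powr (- real CARD('n))) * integral_mean p f (1 - s / 4)"
      using pointwise_integral_mean[OF f p z] by (simp add: s_def)
    also have "\<dots> \<le> ennreal (?c * s powr (- real CARD('n))) * (ennreal (C * (s / 4) powr (- \<gamma> - 1)) * weighted_integral p \<gamma> f)"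
      using s by (intro mult_left_mono C(2)[OF f]) auto
    also have "\<dots> = ennreal (?c * s powr (- real CARD('n)) * (C * (s / 4) powr (- \<gamma> - 1))) * weighted_integral p \<gamma> f"
      using C(1) by (intro ennreal_mult_assoc) auto
    also have "?c * s powr (- real CARD('n)) * (C * (s / 4) powr (- \<gamma> - 1)) = ?C * s powr (- (CARD('n) + 1 + \<gamma>))"
    proof -
      have "(4::real) powr (\<gamma> + 1) = 1 / 4 powr (- \<gamma> - 1)"
        using powr_minus_divide[of 4 "- \<gamma> - 1"] by (simp add: add.commute)
      then have 1: "(s / 4) powr (- \<gamma> - 1) = s powr (- \<gamma> - 1) * 4 powr (\<gamma> + 1)"
        using s by (simp add: powr_divide)
      have "- real CARD('n) + (- \<gamma> - 1) = - (CARD('n) + 1 + \<gamma>)" by simp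
      then have 2: "s powr (- (CARD('n) + 1 + \<gamma>)) = s powr (- real CARD('n)) * s powr (- \<gamma> - 1)"
        by (metis powr_add)
      show ?thesis unfolding 1 2 by (simp only: mult.assoc mult.commute mult.left_commute)
    qed
    finally show "ennreal (norm (f z) powr p) \<le> ennreal (?C * (1 - norm z) powr (- (CARD('n) + 1 + \<gamma>))) * weighted_integral p \<gamma> f"
      by (simp only: s_def)
  qed
qed

section \<open>Integrals of powers\<close>

lemma nn_integral_powr_Icc:
  assumes "a > -1" "c \<ge> 0"
  shows "(\<integral>\<^sup>+s. ennreal (s powr a) * indicator {0..c} s \<partial>lborel) = ennreal (c powr (a + 1) / (a + 1))"
proof -
  have "((\<lambda>s. if s \<in> {0..c} then s powr a else 0) has_integral (c powr (a + 1) / (a + 1))) UNIV"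
    unfolding has_integral_restrict_UNIV using has_integral_powr_from_0[OF assms] .
  then have "(\<integral>\<^sup>+s. ennreal (if s \<in> {0..c} then s powr a else 0) \<partial>lborel) = ennreal (c powr (a + 1) / (a + 1))"
    by (intro nn_integral_has_integral_lborel) auto
  moreover have "(\<integral>\<^sup>+s. ennreal (s powr a) * indicator {0..c} s \<partial>lborel) = (\<integral>\<^sup>+s. ennreal (if s \<in> {0..c} then s powr a else 0) \<partial>lborel)"
    by (intro nn_integral_cong) (auto simp: indicator_def)
  ultimately show ?thesis by simp
qed

lemma nn_integral_powr_atLeast:
  assumes "a < -1" "c > 0"
  shows "(\<integral>\<^sup>+s. ennreal (s powr a) * indicator {c..} s \<partial>lborel) = ennreal (c powr (a + 1) / (- (a + 1)))"
proof -
  have "(\<integral>\<^sup>+s. ennreal (s powr a) * indicator {c..} s \<partial>lborel) = ennreal (0 - c powr (a + 1) / (a + 1))"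
  proof (rule nn_integral_FTC_atLeast[where F="\<lambda>s. s powr (a + 1) / (a + 1)"])
    have "((\<lambda>s. s powr (a + 1)) \<longlongrightarrow> 0) at_top"
      using assms by (intro tendsto_neg_powr filterlim_ident) auto
    then show "((\<lambda>s. s powr (a + 1) / (a + 1)) \<longlongrightarrow> 0) at_top"
      by (rule tendsto_divide_zero)
  next
    fix x assume "c \<le> x"
    with assms have "x > 0" by simp
    then show "((\<lambda>s. s powr (a + 1) / (a + 1)) has_real_derivative x powr a) (at x)"
      using assms by (auto intro!: derivative_eq_intros)
  qed auto
  also have "0 - c powr (a + 1) / (a + 1) = c powr (a + 1) / (- (a + 1))"
    by (simp only: minus_divide_right diff_0)
  finally show ?thesis .
qed

text \<open>
  The two bounds agree at \<open>s = c\<close>; each is integrated on the side where it is the smaller one. The result is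
  a weighted geometric mean of \<open>A\<close> and \<open>B\<close>, which is how this integral interpolates between a uniform and
  an integrated bound.
\<close>

lemma nn_integral_min_powr:
  assumes x: "x > 0" and y: "y > 0" and A: "A > 0" and B: "B > 0"
  shows "(\<integral>\<^sup>+s. ennreal (min (A * s powr (- 1 - x)) (B * s powr (- 1 + y))) * indicator {0<..} s \<partial>lborel) \<le>
    ennreal ((1 / x + 1 / y) * (A powr (y / (x + y)) * B powr (x / (x + y))))"
proof -
  define c where "c = (A / B) powr (1 / (x + y))"
  have c: "c > 0" using A B by (simp add: c_def)
  have xy: "x + y > 0" using x y by simp
  let ?P = "A powr (y / (x + y)) * B powr (x / (x + y))"
  have "A * c powr (- x) = A powr (1 - x / (x + y)) * B powr (x / (x + y))"
    using A B by (simp add: c_def powr_powr powr_divide powr_diff powr_minus field_simps)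
  also have "1 - x / (x + y) = y / (x + y)" using xy by (simp add: field_simps)
  finally have PA: "A * c powr (- x) = ?P" .
  have "B * c powr y = A powr (y / (x + y)) * B powr (1 - y / (x + y))"
    using A B by (simp add: c_def powr_powr powr_divide powr_diff powr_minus field_simps)
  also have "1 - y / (x + y) = x / (x + y)" using xy by (simp add: field_simps)
  finally have PB: "B * c powr y = ?P" .
  have "(\<integral>\<^sup>+s. ennreal (min (A * s powr (- 1 - x)) (B * s powr (- 1 + y))) * indicator {0<..} s \<partial>lborel) \<le>
      (\<integral>\<^sup>+s. ennreal A * (ennreal (s powr (- 1 - x)) * indicator {c..} s) + ennreal B * (ennreal (s powr (- 1 + y)) * indicator {0..c} s) \<partial>lborel)"
  proof (rule nn_integral_mono)
    fix s :: real
    show "ennreal (min (A * s powr (- 1 - x)) (B * s powr (- 1 + y))) * indicator {0<..} s \<le>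
       ennreal A * (ennreal (s powr (- 1 - x)) * indicator {c..} s) + ennreal B * (ennreal (s powr (- 1 + y)) * indicator {0..c} s)"
    proof (cases "s \<ge> c")
      case True
      have "ennreal (min (A * s powr (- 1 - x)) (B * s powr (- 1 + y))) \<le> ennreal A * ennreal (s powr (- 1 - x))"
        using A by (subst ennreal_mult[symmetric]) (auto intro!: ennreal_leI)
      then show ?thesis using True c by (simp add: add_increasing2)
    next
      case False
      have "ennreal (min (A * s powr (- 1 - x)) (B * s powr (- 1 + y))) \<le> ennreal B * ennreal (s powr (- 1 + y))"
        using B by (subst ennreal_mult[symmetric]) (auto intro!: ennreal_leI)
      then show ?thesis using False by (simp add: indicator_def)
    qed
  qed
  also have "\<dots> = ennreal A * (\<integral>\<^sup>+s. ennreal (s powr (- 1 - x)) * indicator {c..} s \<partial>lborel) +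
      ennreal B * (\<integral>\<^sup>+s. ennreal (s powr (- 1 + y)) * indicator {0..c} s \<partial>lborel)"
    by (subst nn_integral_add) (simp_all add: nn_integral_cmult)
  also have "\<dots> = ennreal A * ennreal (c powr (- x) / x) + ennreal B * ennreal (c powr y / y)"
    using x y c by (simp add: nn_integral_powr_Icc nn_integral_powr_atLeast)
  also have "\<dots> = ennreal (A * c powr (- x) / x + B * c powr y / y)"
    using A B x y by (simp add: ennreal_mult[symmetric] ennreal_plus[symmetric] del: ennreal_plus)
  also have "A * c powr (- x) / x + B * c powr y / y = (1 / x + 1 / y) * ?P"
    unfolding PA PB by (simp add: field_simps)
  finally show ?thesis .
qed

lemma nn_integral_reflect:
  fixes F :: "real \<Rightarrow> ennreal"
  assumes "F \<in> borel_measurable borel"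
  shows "(\<integral>\<^sup>+r. F (1 - r) \<partial>lborel) = (\<integral>\<^sup>+s. F s \<partial>lborel)"
  using nn_integral_lborel_affine[OF assms, of "-1" 1] by simp

section \<open>A maximal function on slices\<close>

text \<open>
  The plane is \<open>real \<times> real\<close> here because integrals over boxes are computed as iterated integrals below.
\<close>

definition plane_rot :: "real \<Rightarrow> real \<times> real \<Rightarrow> real \<times> real" where
  "plane_rot t w = (Re (circ t * Complex (fst w) (snd w)), Im (circ t * Complex (fst w) (snd w)))"

lemma linear_plane_rot: "linear (plane_rot t)"
  by (rule linearI) (simp_all add: plane_rot_def algebra_simps)

lemma Complex_plane_rot: "Complex (fst (plane_rot t w)) (snd (plane_rot t w)) = circ t * Complex (fst w) (snd w)"
  by (simp add: plane_rot_def complex_eq_iff)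

lemma norm_Complex_pair: "norm (Complex (fst w) (snd w)) = norm w"
  by (cases w) (simp add: cmod_def norm_Pair)

lemma norm_Complex: "norm (Complex x y) = norm (x, y)"
  using norm_Complex_pair[of "(x, y)"] by simp

lemma norm_plane_rot: "norm (plane_rot t w) = norm w"
  using norm_Complex_pair[of "plane_rot t w"] norm_Complex_pair[of w]
  by (simp add: Complex_plane_rot norm_mult)

lemma disc_submean:
  fixes \<phi> :: "complex \<Rightarrow> complex"
  assumes \<phi>: "\<phi> holomorphic_on ball 0 1" and p: "p > 0"
  shows "emeasure lborel (ball (0 :: real \<times> real) 1) * ennreal (norm (\<phi> 0) powr p) \<le>
    (\<integral>\<^sup>+w. ennreal (norm (\<phi> (Complex (fst w) (snd w))) powr p) * indicator (ball 0 1) w \<partial>(lborel :: (real \<times> real) measure))"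
proof -
  let ?c = "\<lambda>w :: real \<times> real. Complex (fst w) (snd w)"
  let ?B = "ball (0 :: real \<times> real) 1"
  define G where "G w = ennreal (norm (if norm w < 1 then \<phi> (?c w) else 0) powr p)" for w
  have c: "continuous_on UNIV ?c"
    by (simp add: Complex_eq) (intro continuous_intros)
  have \<phi>c: "continuous_on ?B (\<lambda>w. \<phi> (?c w))"
    by (rule continuous_on_compose2[OF holomorphic_on_imp_continuous_on[OF \<phi>] continuous_on_subset[OF c]])
       (auto simp: norm_Complex)
  have "(\<lambda>w. indicator ?B w *\<^sub>R \<phi> (?c w)) \<in> borel_measurable borel"
    by (rule borel_measurable_continuous_on_indicator[OF _ \<phi>c]) simp
  also have "(\<lambda>w. indicator ?B w *\<^sub>R \<phi> (?c w)) = (\<lambda>w. if norm w < 1 then \<phi> (?c w) else 0)"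
    by (auto simp: indicator_def)
  finally have [measurable]: "G \<in> borel_measurable borel"
    unfolding G_def by measurable
  have rot: "(\<lambda>(t, w). plane_rot t w) \<in> borel_measurable (borel \<Otimes>\<^sub>M borel)"
    unfolding borel_prod plane_rot_def case_prod_unfold
    by (intro borel_measurable_continuous_onI) (simp add: Complex_eq, intro continuous_intros)
  note [measurable] = rot
  have "emeasure lborel ?B * ennreal (norm (\<phi> 0) powr p) = (\<integral>\<^sup>+w. ennreal (norm (\<phi> 0) powr p) * indicator ?B w \<partial>lborel)"
    by (subst nn_integral_cmult_indicator) (simp_all add: mult.commute)
  also have "\<dots> \<le> (\<integral>\<^sup>+w. (\<integral>\<^sup>+t. G (plane_rot t w) * indicator {0..1} t \<partial>lborel) \<partial>lborel)"
  proof (rule nn_integral_mono)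
    fix w :: "real \<times> real"
    show "ennreal (norm (\<phi> 0) powr p) * indicator ?B w \<le> (\<integral>\<^sup>+t. G (plane_rot t w) * indicator {0..1} t \<partial>lborel)"
    proof (cases "norm w < 1")
      case True
      define u where "u = (if w = 0 then 1 else sgn (?c w))"
      have nz: "?c w = 0 \<longleftrightarrow> w = 0" using norm_Complex_pair[of w] by (metis norm_eq_zero)
      have u: "norm u = 1" by (simp add: u_def norm_sgn nz)
      have cu: "?c w = of_real (norm w) * u"
        using norm_Complex_pair[of w] by (auto simp: u_def sgn_div_norm scaleR_conv_of_real nz)
      have hol: "(\<lambda>x. \<phi> (x * u)) holomorphic_on ball 0 1"
        by (rule holomorphic_on_compose_gen[OF _ \<phi>, unfolded o_def])
           (auto intro!: holomorphic_intros simp: norm_mult u)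
      have "ennreal (norm (\<phi> 0) powr p) = (\<integral>\<^sup>+t. ennreal (norm (\<phi> ((of_real 0 * circ t) * u)) powr p) * indicator {0..1} (t::real) \<partial>lborel)"
        by (simp add: nn_integral_cmult_indicator)
      also have "\<dots> \<le> (\<integral>\<^sup>+t. ennreal (norm (\<phi> ((of_real (norm w) * circ t) * u)) powr p) * indicator {0..1} t \<partial>lborel)"
        by (rule nn_circle_mean_mono[OF log_convex_powr[OF p] hol, of 0 "norm w"]) (use True in auto)
      also have "\<dots> = (\<integral>\<^sup>+t. G (plane_rot t w) * indicator {0..1} t \<partial>lborel)"
        using True by (intro nn_integral_cong) (simp add: G_def norm_plane_rot Complex_plane_rot cu mult_ac)
      finally show ?thesis using True by simp
    qed (simp add: G_def)
  qed
  also have "\<dots> = (\<integral>\<^sup>+t. (\<integral>\<^sup>+w. G (plane_rot t w) * indicator {0..1} t \<partial>lborel) \<partial>lborel)"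
    by (rule lborel_pair.Fubini'[symmetric]) measurable
  also have "\<dots> = (\<integral>\<^sup>+t. (\<integral>\<^sup>+w. G w \<partial>lborel) * indicator {0..1} (t::real) \<partial>lborel)"
  proof (rule nn_integral_cong)
    fix t :: real
    have [measurable]: "plane_rot t \<in> borel_measurable borel" by (rule linear_borel_measurable[OF linear_plane_rot])
    show "(\<integral>\<^sup>+w. G (plane_rot t w) * indicator {0..1} t \<partial>lborel) = (\<integral>\<^sup>+w. G w \<partial>lborel) * indicator {0..1} t"
      using nn_integral_lborel_isometry[OF linear_plane_rot[of t] norm_plane_rot[of t], of G]
      by (simp add: nn_integral_multc)
  qed
  also have "\<dots> = (\<integral>\<^sup>+w. G w \<partial>lborel)"
    by (subst nn_integral_cmult) simp_all
  also have "\<dots> = (\<integral>\<^sup>+w. ennreal (norm (\<phi> (?c w)) powr p) * indicator ?B w \<partial>lborel)"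
    by (intro nn_integral_cong) (auto simp: G_def indicator_def)
  finally show ?thesis .
qed

text \<open>
  Near \<open>ln u\<close> the function \<open>\<phi> \<circ> exp\<close> has the submean value property on a disc of radius \<open>d = (1 - u) / 2\<close>. The
  exponential map carries this disc, and the square around it, into the box of points \<open>r cis \<theta>\<close> with
  \<open>1 - r\<close> comparable to \<open>1 - u\<close> and \<open>|\<theta>| \<le> 1 - u\<close>. A box in polar coordinates is needed because
  rotations of the sphere act on \<open>\<theta>\<close>.
\<close>

lemma box_submean:
  fixes p :: real
  assumes p: "p > 0"
  obtains C where "C > 0" "\<And>\<phi> u. \<phi> holomorphic_on ball 0 1 \<Longrightarrow> \<phi> \<in> borel_measurable borel \<Longrightarrow> 1 / 2 \<le> u \<Longrightarrow> u < 1 \<Longrightarrow>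
    ennreal (norm (\<phi> (of_real u)) powr p) \<le> ennreal (C / (1 - u)\<^sup>2) *
     (\<integral>\<^sup>+r. indicator {1 - 2 * (1 - u)..1 - (1 - u) / 8} r * indicator {1/4<..<1} r * (\<integral>\<^sup>+\<theta>. ennreal (norm (\<phi> (of_real r * cis \<theta>)) powr p) *
        indicator {- (1 - u)..1 - u} \<theta> \<partial>lborel) \<partial>lborel)"
proof -
  obtain V where V: "V > 0" "emeasure lborel (ball (0 :: real \<times> real) 1) = ennreal V"
    using emeasure_unit_ball_pos[where 'a="real \<times> real"] emeasure_unit_ball_finite[where 'a="real \<times> real"]
    by (cases "emeasure lborel (ball (0 :: real \<times> real) 1)") auto
  show thesis
  proof (rule that[of "16 / V"])
    show "16 / V > 0" using V by simp
    fix \<phi> :: "complex \<Rightarrow> complex" and u :: real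
    assume \<phi>: "\<phi> holomorphic_on ball 0 1" and [measurable]: "\<phi> \<in> borel_measurable borel" and u: "1 / 2 \<le> u" "u < 1"
    define s where "s = 1 - u"
    have s: "0 < s" "s \<le> 1 / 2" "u = 1 - s" using u by (auto simp: s_def)
    define a where "a = ln u"
    have ea: "exp a = u" using u by (simp add: a_def)
    have a: "a \<le> - s" using ln_le_minus_one[of u] u by (simp add: a_def s_def)
    define d where "d = s / 2"
    have d: "d > 0" "d \<le> 1 / 4" "s = 2 * d" using s by (auto simp: d_def)
    define \<psi> where "\<psi> w = \<phi> (exp (of_real a + of_real d * w))" for w
    have in_disc: "norm (exp (of_real a + of_real d * w)) < 1" if "norm w < 1" for w :: complex
    proof -
      have "d * Re w < s" using abs_Re_le_cmod[of w] that d mult_left_mono[of "Re w" 1 d] by simp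
      then show ?thesis using a by simp
    qed
    have \<psi>: "\<psi> holomorphic_on ball 0 1"
      unfolding \<psi>_def
      by (rule holomorphic_on_compose_gen[OF _ \<phi>, unfolded o_def])
         (use in_disc in \<open>auto intro!: holomorphic_intros\<close>)
    have \<psi>0: "\<psi> 0 = \<phi> (of_real u)" by (simp add: \<psi>_def ea[symmetric] exp_of_real)
    let ?c = "\<lambda>w :: real \<times> real. Complex (fst w) (snd w)"
    have \<psi>c: "\<psi> (Complex x y) = \<phi> (of_real (exp (a + d * x)) * cis (d * y))" for x y
    proof -
      have "of_real a + of_real d * Complex x y = of_real (a + d * x) + \<i> * of_real (d * y)"
        by (simp add: Complex_eq algebra_simps)
      then have "exp (of_real a + of_real d * Complex x y) = of_real (exp (a + d * x)) * cis (d * y)"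
        by (simp only: exp_add exp_of_real cis_conv_exp)
      then show ?thesis by (simp add: \<psi>_def)
    qed
    define g where "g x \<theta> = ennreal (norm (\<phi> (of_real x * cis \<theta>)) powr p)" for x \<theta>
    have [measurable]: "(\<lambda>z. cis (f z)) \<in> borel_measurable M" if "f \<in> borel_measurable M" for f :: "'z \<Rightarrow> real" and M
      using measurable_compose[OF that borel_measurable_continuous_onI[of cis]]
      by (simp add: cis_conv_exp continuous_intros)
    have [measurable]: "(\<lambda>w. g (x w) (y w)) \<in> borel_measurable M" if "x \<in> borel_measurable M" "y \<in> borel_measurable M"
      for x y :: "'z \<Rightarrow> real" and M
      unfolding g_def using that by measurable
    have "ennreal V * ennreal (norm (\<phi> (of_real u)) powr p) \<le>
        (\<integral>\<^sup>+w. ennreal (norm (\<psi> (?c w)) powr p) * indicator (ball 0 1) w \<partial>(lborel :: (real \<times> real) measure))"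
      using disc_submean[OF \<psi> p] by (simp add: \<psi>0 V)
    also have "\<dots> \<le> (\<integral>\<^sup>+w. g (exp (a + d * fst w)) (d * snd w) * indicator {-1..1} (fst w) * indicator {-1..1} (snd w) \<partial>(lborel :: (real \<times> real) measure))"
    proof (rule nn_integral_mono)
      fix w :: "real \<times> real"
      show "ennreal (norm (\<psi> (?c w)) powr p) * indicator (ball 0 1) w \<le> g (exp (a + d * fst w)) (d * snd w) * indicator {-1..1} (fst w) * indicator {-1..1} (snd w)"
        using norm_fst_le[of "fst w" "snd w"] norm_snd_le[of "snd w" "fst w"]
        by (cases w) (auto simp: \<psi>c g_def indicator_def)
    qed
    also have "\<dots> = (\<integral>\<^sup>+x. (\<integral>\<^sup>+y. g (exp (a + d * x)) (d * y) * indicator {-1..1} x * indicator {-1..1} y \<partial>lborel) \<partial>lborel)"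
      unfolding lborel_prod[symmetric]
      by (subst lborel.nn_integral_fst[symmetric]) simp_all
    also have "\<dots> = (\<integral>\<^sup>+x. (\<integral>\<^sup>+\<theta>. g (exp (a + d * x)) \<theta> * indicator {-d..d} \<theta> \<partial>lborel) * ennreal (1 / d) * indicator {-1..1} x \<partial>lborel)"
    proof (rule nn_integral_cong)
      fix x :: real
      have "(\<integral>\<^sup>+\<theta>. g (exp (a + d * x)) \<theta> * indicator {-d..d} \<theta> \<partial>lborel) =
          ennreal d * (\<integral>\<^sup>+y. g (exp (a + d * x)) (d * y) * indicator {-d..d} (d * y) \<partial>lborel)"
        using nn_integral_lborel_affine[of "\<lambda>\<theta>. g (exp (a + d * x)) \<theta> * indicator {-d..d} \<theta>" d 0] d by simp
      also have "(\<lambda>y. indicator {-d..d} (d * y) :: ennreal) = indicator {-1..1}"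
      proof
        fix y
        have "- d \<le> d * y \<longleftrightarrow> - 1 \<le> y" "d * y \<le> d \<longleftrightarrow> y \<le> 1"
          using d mult_le_cancel_left_pos[of d "- 1" y] mult_le_cancel_left_pos[of d y 1] by simp_all
        then show "indicator {-d..d} (d * y) = (indicator {-1..1} y :: ennreal)" by (simp add: indicator_def)
      qed
      finally have *: "(\<integral>\<^sup>+\<theta>. g (exp (a + d * x)) \<theta> * indicator {-d..d} \<theta> \<partial>lborel) =
          ennreal d * (\<integral>\<^sup>+y. g (exp (a + d * x)) (d * y) * indicator {-1..1} y \<partial>lborel)" by (metis (no_types, lifting))
      show "(\<integral>\<^sup>+y. g (exp (a + d * x)) (d * y) * indicator {-1..1} x * indicator {-1..1} y \<partial>lborel) =
          (\<integral>\<^sup>+\<theta>. g (exp (a + d * x)) \<theta> * indicator {-d..d} \<theta> \<partial>lborel) * ennreal (1 / d) * indicator {-1..1} x"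
      proof (cases "x \<in> {-1..1}")
        case True
        have "ennreal (1 / d) * (ennreal d * I) = I" for I
          using d by (subst ennreal_mult_assoc) simp_all
        then have "ennreal d * I * ennreal (1 / d) = I" for I by (subst mult.commute)
        then show ?thesis unfolding * using True by simp
      qed simp
    qed
    also have "\<dots> = ennreal (1 / d) * (\<integral>\<^sup>+x. (\<integral>\<^sup>+\<theta>. g (exp (a + d * x)) \<theta> * indicator {-d..d} \<theta> \<partial>lborel) * indicator {-1..1} x \<partial>lborel)"
      by (subst nn_integral_cmult[symmetric]) (simp_all add: mult_ac)
    \<comment> \<open>the derivative \<open>d exp (a + d x)\<close> of the substitution \<open>r = exp (a + d x)\<close> is at least \<open>d / 4\<close>\<close>
    also have "\<dots> \<le> ennreal (1 / d) * (ennreal (4 / d) * (\<integral>\<^sup>+x. (\<integral>\<^sup>+\<theta>. g (exp (a + d * x)) \<theta> * indicator {-d..d} \<theta> \<partial>lborel) * ennreal (d * exp (a + d * x)) * indicator {-1..1} x \<partial>lborel))"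
    proof (rule mult_left_mono)
      have "(\<integral>\<^sup>+x. (\<integral>\<^sup>+\<theta>. g (exp (a + d * x)) \<theta> * indicator {-d..d} \<theta> \<partial>lborel) * indicator {-1..1} x \<partial>lborel) \<le>
         (\<integral>\<^sup>+x. ennreal (4 / d) * ((\<integral>\<^sup>+\<theta>. g (exp (a + d * x)) \<theta> * indicator {-d..d} \<theta> \<partial>lborel) * ennreal (d * exp (a + d * x)) * indicator {-1..1} x) \<partial>lborel)"
      proof (rule nn_integral_mono)
        fix x :: real
        let ?I = "\<integral>\<^sup>+\<theta>. g (exp (a + d * x)) \<theta> * indicator {-d..d} \<theta> \<partial>lborel"
        show "?I * indicator {-1..1} x \<le> ennreal (4 / d) * (?I * ennreal (d * exp (a + d * x)) * indicator {-1..1} x)"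
        proof (cases "x \<in> {-1..1}")
          case True
          have "1 / 4 \<le> exp (a + d * x)"
          proof -
            have "1 - d \<le> exp (- d)" using exp_ge_add_one_self[of "-d"] by simp
            moreover have "- d \<le> d * x" using True d mult_left_mono[of "- 1" x d] by simp
            then have "exp (- d) \<le> exp (d * x)" by simp
            ultimately have "3 / 4 \<le> exp (d * x)" using d(2) by linarith
            then have "1 / 2 * (3 / 4) \<le> u * exp (d * x)" using u by (intro mult_mono) auto
            then show ?thesis by (simp add: exp_add ea)
          qed
          then have "1 \<le> 4 / d * (d * exp (a + d * x))" using d by simp
          then have "1 \<le> ennreal (4 / d) * ennreal (d * exp (a + d * x))"
            using d by (subst ennreal_mult[symmetric]) (auto simp del: ennreal_1 simp: ennreal_1[symmetric] intro!: ennreal_leI)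
          from mult_right_mono[OF this, of ?I] show ?thesis
            using True by (simp add: mult_ac)
        qed simp
      qed
      also have "\<dots> = ennreal (4 / d) * (\<integral>\<^sup>+x. (\<integral>\<^sup>+\<theta>. g (exp (a + d * x)) \<theta> * indicator {-d..d} \<theta> \<partial>lborel) * ennreal (d * exp (a + d * x)) * indicator {-1..1} x \<partial>lborel)"
        by (rule nn_integral_cmult) measurable
      finally show "(\<integral>\<^sup>+x. (\<integral>\<^sup>+\<theta>. g (exp (a + d * x)) \<theta> * indicator {-d..d} \<theta> \<partial>lborel) * indicator {-1..1} x \<partial>lborel) \<le>
         ennreal (4 / d) * (\<integral>\<^sup>+x. (\<integral>\<^sup>+\<theta>. g (exp (a + d * x)) \<theta> * indicator {-d..d} \<theta> \<partial>lborel) * ennreal (d * exp (a + d * x)) * indicator {-1..1} x \<partial>lborel)" .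
    qed simp
    also have "(\<integral>\<^sup>+x. (\<integral>\<^sup>+\<theta>. g (exp (a + d * x)) \<theta> * indicator {-d..d} \<theta> \<partial>lborel) * ennreal (d * exp (a + d * x)) * indicator {-1..1} x \<partial>lborel) =
        (\<integral>\<^sup>+r. (\<integral>\<^sup>+\<theta>. g r \<theta> * indicator {-d..d} \<theta> \<partial>lborel) * indicator {exp (a + d * (-1))..exp (a + d * 1)} r \<partial>lborel)"
      by (rule nn_integral_substitution_aux[symmetric])
         (use d in \<open>auto intro!: derivative_eq_intros continuous_intros\<close>)
    also have "\<dots> \<le> (\<integral>\<^sup>+r. indicator {1 - 2 * s..1 - s / 8} r * indicator {1/4<..<1} r * (\<integral>\<^sup>+\<theta>. g r \<theta> * indicator {-s..s} \<theta> \<partial>lborel) \<partial>lborel)"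
    proof (rule nn_integral_mono)
      fix r :: real
      show "(\<integral>\<^sup>+\<theta>. g r \<theta> * indicator {-d..d} \<theta> \<partial>lborel) * indicator {exp (a + d * (-1))..exp (a + d * 1)} r \<le>
         indicator {1 - 2 * s..1 - s / 8} r * indicator {1/4<..<1} r * (\<integral>\<^sup>+\<theta>. g r \<theta> * indicator {-s..s} \<theta> \<partial>lborel)"
      proof (cases "r \<in> {exp (a + d * (-1))..exp (a + d * 1)}")
        case True
        have "1 - d \<le> exp (- d)" using exp_ge_add_one_self[of "-d"] by simp
        then have "u * (1 - d) \<le> u * exp (- d)" using u by (intro mult_left_mono) auto
        also have "u * exp (- d) = exp (a + d * (-1))" by (simp add: ea[symmetric] exp_add[symmetric])
        also have "\<dots> \<le> r" using True by simp
        finally have "u * (1 - d) \<le> r" .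
        moreover have "u * (1 - d) = 1 - 3 * d + 2 * (d * d)"
          unfolding s(3) d(3) by (simp add: algebra_simps)
        moreover have "0 < d * d" using d by simp
        ultimately have lo: "1 - 3 * d < r" by linarith
        have "r \<le> exp (- d)" using True a d by (auto intro: order_trans)
        also have "\<dots> \<le> 1 - d / 4"
        proof -
          have "1 + d \<le> exp d" by (rule exp_ge_add_one_self)
          then have "exp (- d) \<le> 1 / (1 + d)" using d by (simp add: exp_minus field_simps)
          also have "\<dots> \<le> 1 - d / 4" using d by (simp add: field_simps)
          finally show ?thesis .
        qed
        finally have hi: "r \<le> 1 - d / 4" .
        have "(\<integral>\<^sup>+\<theta>. g r \<theta> * indicator {-d..d} \<theta> \<partial>lborel) \<le> (\<integral>\<^sup>+\<theta>. g r \<theta> * indicator {-s..s} \<theta> \<partial>lborel)"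
          using d by (intro nn_integral_mono) (auto simp: indicator_def)
        moreover have "r \<in> {1 - 2 * s..1 - s / 8}" "r \<in> {1/4<..<1}" using lo hi d by auto
        ultimately show ?thesis using True by simp
      qed simp
    qed
    finally have "ennreal V * ennreal (norm (\<phi> (of_real u)) powr p) \<le> ennreal (1 / d) * (ennreal (4 / d) *
        (\<integral>\<^sup>+r. indicator {1 - 2 * s..1 - s / 8} r * indicator {1/4<..<1} r * (\<integral>\<^sup>+\<theta>. g r \<theta> * indicator {-s..s} \<theta> \<partial>lborel) \<partial>lborel))"
      (is "_ \<le> _ * (_ * ?I)") by (simp add: mult_left_mono)
    then have "ennreal (1 / V) * (ennreal V * ennreal (norm (\<phi> (of_real u)) powr p)) \<le> ennreal (1 / V) * (ennreal (1 / d) * (ennreal (4 / d) * ?I))"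
      by (rule mult_left_mono) simp
    also have "ennreal (1 / V) * (ennreal V * ennreal (norm (\<phi> (of_real u)) powr p)) = ennreal (norm (\<phi> (of_real u)) powr p)"
      using V by (subst ennreal_mult_assoc) simp_all
    also have "ennreal (1 / V) * (ennreal (1 / d) * (ennreal (4 / d) * ?I)) = ennreal (16 / V / s\<^sup>2) * ?I"
      using V d by (simp add: ennreal_mult_assoc power2_eq_square)
    finally show "ennreal (norm (\<phi> (of_real u)) powr p) \<le> ennreal (16 / V / (1 - u)\<^sup>2) *
     (\<integral>\<^sup>+r. indicator {1 - 2 * (1 - u)..1 - (1 - u) / 8} r * indicator {1/4<..<1} r * (\<integral>\<^sup>+\<theta>. ennreal (norm (\<phi> (of_real r * cis \<theta>)) powr p) *
        indicator {- (1 - u)..1 - u} \<theta> \<partial>lborel) \<partial>lborel)"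
      by (simp only: s_def g_def)
  qed
qed

lemma borel_measurable_vector_scalar[measurable (raw)]:
  fixes v :: "'a \<Rightarrow> complex ^ 'n"
  assumes "x \<in> borel_measurable M" "v \<in> borel_measurable M"
  shows "(\<lambda>z. x z *s v z) \<in> borel_measurable M"
  by (rule borel_measurable_continuous_Pair[OF assms, of "\<lambda>c v. c *s v"]) (intro continuous_intros)

lemma borel_measurable_cis[measurable (raw)]:
  assumes "f \<in> borel_measurable M"
  shows "(\<lambda>z. cis (f z)) \<in> borel_measurable M"
proof -
  have "cis \<in> borel_measurable borel"
    by (intro borel_measurable_continuous_onI) (simp add: cis_conv_exp, intro continuous_intros)
  from measurable_compose[OF assms this] show ?thesis .
qed

text \<open>
  The factor \<open>H \<zeta>\<close> collects, over the radii \<open>r > 1/4\<close>, the integral of \<open>|f|\<^sup>p\<close> over the arc of angle \<open>16 (1 - r)\<close> around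
  \<open>r \<zeta>\<close> on the circle through that point, with weight \<open>(1 - r)\<^bsup>\<gamma>-1\<^esup>\<close>. By \<open>box_submean\<close> the radii with
  \<open>1 - r\<close> comparable to \<open>1 - u\<close> suffice to bound \<open>|f (u \<zeta>)|\<^sup>p\<close>. In the integral over the sphere the
  rotations drop out, each arc contributes the factor \<open>16 (1 - r)\<close>, and the weight becomes \<open>(1 - r)\<^sup>\<gamma>\<close>.
\<close>

lemma slice_maximal:
  fixes p \<gamma> :: real
  assumes p: "p > 0"
  obtains C where "C > 0" "\<And>f :: complex ^ 'n \<Rightarrow> complex. ball_fun f \<Longrightarrow> \<exists>H. H \<in> borel_measurable borel \<and>
    (\<forall>\<zeta> u. norm \<zeta> = 1 \<longrightarrow> 1 / 2 \<le> u \<longrightarrow> u < 1 \<longrightarrow> ennreal (norm (f (u *\<^sub>R \<zeta>)) powr p) \<le> ennreal ((1 - u) powr (- (\<gamma> + 1))) * H \<zeta>) \<and>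
    (\<integral>\<^sup>+\<zeta>. H \<zeta> \<partial>sphere_measure) \<le> ennreal C * weighted_integral p \<gamma> f"
proof -
  obtain C0 where C0: "C0 > 0" "\<And>\<phi> u. \<phi> holomorphic_on ball 0 1 \<Longrightarrow> \<phi> \<in> borel_measurable borel \<Longrightarrow> 1 / 2 \<le> u \<Longrightarrow> u < 1 \<Longrightarrow>
    ennreal (norm (\<phi> (of_real u)) powr p) \<le> ennreal (C0 / (1 - u)\<^sup>2) *
     (\<integral>\<^sup>+r. indicator {1 - 2 * (1 - u)..1 - (1 - u) / 8} r * indicator {1/4<..<1} r * (\<integral>\<^sup>+\<theta>. ennreal (norm (\<phi> (of_real r * cis \<theta>)) powr p) *
        indicator {- (1 - u)..1 - u} \<theta> \<partial>lborel) \<partial>lborel)"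
    by (rule box_submean[OF p], rule that)
  let ?V = "ball_volume TYPE('n)"
  obtain V where V: "V > 0" "?V = ennreal V"
    using ball_volume_pos[where 'n='n] ball_volume_finite[where 'n='n]
    by (cases ?V) (auto simp: less_le)
  define c1 where "c1 = C0 * 8 powr \<bar>\<gamma> - 1\<bar>"
  have c1: "c1 > 0" using C0 by (simp add: c1_def)
  define c2 where "c2 = 16 * 2 powr \<bar>\<gamma>\<bar> * 4 ^ (2 * CARD('n) - 1)"
  have c2: "c2 > 0" by (simp add: c2_def)
  show thesis
  proof (rule that[of "c1 * c2 / V"])
    show "c1 * c2 / V > 0" using c1 c2 V by simp
    fix f :: "complex ^ 'n \<Rightarrow> complex" assume f: "ball_fun f"
    note [measurable] = ball_fun_measurable[OF f] integral_mean_measurable[OF f]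
    define J where "J r \<zeta> = (\<integral>\<^sup>+\<theta>. ennreal (norm (f (r *\<^sub>R (cis \<theta> *s \<zeta>))) powr p) * (if - 8 * (1 - r) \<le> \<theta> \<and> \<theta> \<le> 8 * (1 - r) then 1 else 0) \<partial>lborel)"
      for r and \<zeta> :: "complex ^ 'n"
    define H where "H \<zeta> = ennreal c1 * (\<integral>\<^sup>+r. indicator {1/4<..<1} r * (ennreal ((1 - r) powr (\<gamma> - 1)) * J r \<zeta>) \<partial>lborel)" for \<zeta>
    have J_meas: "(\<lambda>w. J (x w) (y w)) \<in> borel_measurable M" if [measurable]: "x \<in> borel_measurable M" "y \<in> borel_measurable M"
      for x y and M :: "'z measure"
      unfolding J_def by measurable
    note [measurable (raw)] = J_meas
    have H_meas: "H \<in> borel_measurable borel" unfolding H_def[abs_def] by measurable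
    have pointwise: "ennreal (norm (f (u *\<^sub>R \<zeta>)) powr p) \<le> ennreal ((1 - u) powr (- (\<gamma> + 1))) * H \<zeta>"
      if \<zeta>: "norm \<zeta> = 1" and u: "1 / 2 \<le> u" "u < 1" for \<zeta> u
    proof -
      define s where "s = 1 - u"
      have s: "s > 0" using u by (simp add: s_def)
      have hol: "(\<lambda>w. f (w *s \<zeta>)) holomorphic_on ball 0 1" using \<zeta> by (intro ball_fun_slice[OF f]) simp
      have "ennreal (norm (f (of_real u *s \<zeta>)) powr p) \<le> ennreal (C0 / s\<^sup>2) *
         (\<integral>\<^sup>+r. indicator {1 - 2 * s..1 - s / 8} r * indicator {1/4<..<1} r * (\<integral>\<^sup>+\<theta>. ennreal (norm (f ((of_real r * cis \<theta>) *s \<zeta>)) powr p) *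
            indicator {- s..s} \<theta> \<partial>lborel) \<partial>lborel)"
        unfolding s_def by (rule C0(2)[OF hol _ u]) measurable
      also have "\<dots> = ennreal (C0 * s powr (- (\<gamma> + 1))) *
         (\<integral>\<^sup>+r. ennreal (s powr (\<gamma> - 1)) * (indicator {1 - 2 * s..1 - s / 8} r * indicator {1/4<..<1} r * (\<integral>\<^sup>+\<theta>. ennreal (norm (f ((of_real r * cis \<theta>) *s \<zeta>)) powr p) *
            indicator {- s..s} \<theta> \<partial>lborel)) \<partial>lborel)"
      proof -
        have "s powr (- (\<gamma> + 1)) * s powr (\<gamma> - 1) = s powr (- 2)" by (simp add: powr_add[symmetric])
        also have "\<dots> = 1 / s\<^sup>2" using s by (simp add: powr_minus_divide powr_numeral)
        finally have "C0 / s\<^sup>2 = C0 * s powr (- (\<gamma> + 1)) * s powr (\<gamma> - 1)" by (simp add: mult.assoc)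
        then have "ennreal (C0 / s\<^sup>2) = ennreal (C0 * s powr (- (\<gamma> + 1))) * ennreal (s powr (\<gamma> - 1))"
          using C0(1) by (simp add: ennreal_mult)
        then show ?thesis by (subst nn_integral_cmult) (simp_all add: mult.assoc)
      qed
      also have "\<dots> \<le> ennreal (C0 * s powr (- (\<gamma> + 1))) *
         (\<integral>\<^sup>+r. ennreal (8 powr \<bar>\<gamma> - 1\<bar>) * (indicator {1/4<..<1} r * (ennreal ((1 - r) powr (\<gamma> - 1)) * J r \<zeta>)) \<partial>lborel)"
      proof (rule mult_left_mono, rule nn_integral_mono)
        fix r :: real
        let ?I = "\<integral>\<^sup>+\<theta>. ennreal (norm (f ((of_real r * cis \<theta>) *s \<zeta>)) powr p) * indicator {- s..s} \<theta> \<partial>lborel"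
        show "ennreal (s powr (\<gamma> - 1)) * (indicator {1 - 2 * s..1 - s / 8} r * indicator {1/4<..<1} r * ?I) \<le>
            ennreal (8 powr \<bar>\<gamma> - 1\<bar>) * (indicator {1/4<..<1} r * (ennreal ((1 - r) powr (\<gamma> - 1)) * J r \<zeta>))"
        proof (cases "r \<in> {1 - 2 * s..1 - s / 8} \<and> r \<in> {1/4<..<1}")
          case True
          then have r: "1 - r \<le> 8 * s" "s \<le> 8 * (1 - r)" "1 - r > 0" using s by auto
          have "s powr (\<gamma> - 1) \<le> 8 powr \<bar>\<gamma> - 1\<bar> * (1 - r) powr (\<gamma> - 1)"
            using r s by (intro powr_comparable) auto
          then have 1: "ennreal (s powr (\<gamma> - 1)) \<le> ennreal (8 powr \<bar>\<gamma> - 1\<bar>) * ennreal ((1 - r) powr (\<gamma> - 1))"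
            by (subst ennreal_mult[symmetric]) (auto intro: ennreal_leI)
          have eq: "(of_real r * cis \<theta>) *s \<zeta> = r *\<^sub>R (cis \<theta> *s \<zeta>)" for \<theta>
            by (simp only: of_real_vector_scalar[symmetric] vector_smult_assoc)
          have 2: "?I \<le> J r \<zeta>"
            unfolding J_def eq using r by (intro nn_integral_mono) (auto simp: indicator_def)
          show ?thesis using True mult_mono[OF 1 2] by (simp add: mult.assoc)
        qed auto
      qed simp
      also have "\<dots> = ennreal (C0 * s powr (- (\<gamma> + 1))) * (ennreal (8 powr \<bar>\<gamma> - 1\<bar>) * (\<integral>\<^sup>+r. indicator {1/4<..<1} r * (ennreal ((1 - r) powr (\<gamma> - 1)) * J r \<zeta>) \<partial>lborel))"
        by (subst nn_integral_cmult) simp_all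
      also have "\<dots> = ennreal (s powr (- (\<gamma> + 1))) * H \<zeta>"
        unfolding H_def c1_def using C0(1) by (simp add: ennreal_mult_assoc mult_ac)
      finally show ?thesis by (simp only: s_def of_real_vector_scalar)
    qed
    have J_int: "(\<integral>\<^sup>+\<zeta>. J r \<zeta> \<partial>sphere_measure) = ennreal (16 * (1 - r)) * integral_mean p f r" if r: "r < 1" for r
    proof -
      have "(\<integral>\<^sup>+\<zeta>. J r \<zeta> \<partial>sphere_measure) =
          (\<integral>\<^sup>+\<theta>. (\<integral>\<^sup>+\<zeta>. ennreal (norm (f (r *\<^sub>R (cis \<theta> *s \<zeta>))) powr p) * (if - 8 * (1 - r) \<le> \<theta> \<and> \<theta> \<le> 8 * (1 - r) then 1 else 0) \<partial>sphere_measure) \<partial>lborel)"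
        unfolding J_def by (rule lborel_sphere.Fubini') measurable
      also have "\<dots> = (\<integral>\<^sup>+\<theta>. integral_mean p f r * indicator {- 8 * (1 - r)..8 * (1 - r)} (\<theta>::real) \<partial>lborel)"
      proof (rule nn_integral_cong)
        fix \<theta> :: real
        have "(\<integral>\<^sup>+\<zeta>. ennreal (norm (f (r *\<^sub>R (cis \<theta> *s \<zeta>))) powr p) \<partial>sphere_measure) = integral_mean p f r"
          unfolding integral_mean_def by (rule nn_integral_sphere_rotation[OF linear_vector_scalar]) (simp add: norm_vector_scalar, measurable)
        then show "(\<integral>\<^sup>+\<zeta>. ennreal (norm (f (r *\<^sub>R (cis \<theta> *s \<zeta>))) powr p) * (if - 8 * (1 - r) \<le> \<theta> \<and> \<theta> \<le> 8 * (1 - r) then 1 else 0) \<partial>sphere_measure) =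
            integral_mean p f r * indicator {- 8 * (1 - r)..8 * (1 - r)} \<theta>"
          by (subst nn_integral_multc) (simp_all add: indicator_def)
      qed
      also have "\<dots> = integral_mean p f r * ennreal (16 * (1 - r))"
        using r by (subst nn_integral_cmult_indicator) (simp_all add: algebra_simps)
      finally show ?thesis by (simp add: mult.commute)
    qed
    define K where "K = (\<integral>\<^sup>+r. ennreal (2 * CARD('n) * r ^ (2 * CARD('n) - 1)) * indicator {0<..<1} r * (ennreal ((1 - r\<^sup>2) powr \<gamma>) * integral_mean p f r) \<partial>lborel)"
    have H_sphere: "(\<integral>\<^sup>+\<zeta>. H \<zeta> \<partial>sphere_measure) =
        ennreal c1 * (\<integral>\<^sup>+\<zeta>. (\<integral>\<^sup>+r. indicator {1/4<..<1} r * (ennreal ((1 - r) powr (\<gamma> - 1)) * J r \<zeta>) \<partial>lborel) \<partial>sphere_measure)"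
      unfolding H_def by (rule nn_integral_cmult) measurable
    have "(\<integral>\<^sup>+\<zeta>. (\<integral>\<^sup>+r. indicator {1/4<..<1} r * (ennreal ((1 - r) powr (\<gamma> - 1)) * J r \<zeta>) \<partial>lborel) \<partial>sphere_measure) =
        (\<integral>\<^sup>+r. (\<integral>\<^sup>+\<zeta>. indicator {1/4<..<1} r * (ennreal ((1 - r) powr (\<gamma> - 1)) * J r \<zeta>) \<partial>sphere_measure) \<partial>lborel)"
      by (rule lborel_sphere.Fubini') measurable
    also have "\<dots> \<le> (\<integral>\<^sup>+r. ennreal c2 * (ennreal (r ^ (2 * CARD('n) - 1)) * indicator {0<..<1} r * (ennreal ((1 - r\<^sup>2) powr \<gamma>) * integral_mean p f r)) \<partial>lborel)"
    proof (rule nn_integral_mono)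
      fix r :: real
      have "(\<integral>\<^sup>+\<zeta>. indicator {1/4<..<1} r * (ennreal ((1 - r) powr (\<gamma> - 1)) * J r \<zeta>) \<partial>sphere_measure) =
          indicator {1/4<..<1} r * (ennreal ((1 - r) powr (\<gamma> - 1)) * (\<integral>\<^sup>+\<zeta>. J r \<zeta> \<partial>sphere_measure))"
        by (subst nn_integral_cmult, measurable, subst nn_integral_cmult) simp_all
      also have "\<dots> \<le> ennreal c2 * (ennreal (r ^ (2 * CARD('n) - 1)) * indicator {0<..<1} r * (ennreal ((1 - r\<^sup>2) powr \<gamma>) * integral_mean p f r))"
      proof (cases "r \<in> {1/4<..<1}")
        case True
        then have r: "1/4 < r" "r < 1" by auto
        have 1: "(1 - r) powr \<gamma> \<le> 2 powr \<bar>\<gamma>\<bar> * (1 - r\<^sup>2) powr \<gamma>"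
          using one_minus_square_bounds[of r] r by (intro powr_comparable) auto
        have 2: "1 \<le> 4 ^ (2 * CARD('n) - 1) * r ^ (2 * CARD('n) - 1)"
          unfolding power_mult_distrib[symmetric] using r by (intro one_le_power) simp
        have "1 * (1 - r) powr \<gamma> \<le> (4 ^ (2 * CARD('n) - 1) * r ^ (2 * CARD('n) - 1)) * (2 powr \<bar>\<gamma>\<bar> * (1 - r\<^sup>2) powr \<gamma>)"
          by (rule mult_mono[OF 2 1]) (use r in simp_all)
        moreover have "(1 - r) powr (\<gamma> - 1) * (1 - r) = (1 - r) powr \<gamma>"
          using r powr_add[of "1 - r" "\<gamma> - 1" 1] by simp
        ultimately have "(1 - r) powr (\<gamma> - 1) * (16 * (1 - r)) \<le> c2 * (r ^ (2 * CARD('n) - 1) * (1 - r\<^sup>2) powr \<gamma>)"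
          unfolding c2_def by (simp only: mult.assoc mult.commute mult.left_commute mult_1 mult_le_cancel_left_pos[of 16])
        then have "ennreal ((1 - r) powr (\<gamma> - 1) * (16 * (1 - r))) * integral_mean p f r \<le> ennreal (c2 * (r ^ (2 * CARD('n) - 1) * (1 - r\<^sup>2) powr \<gamma>)) * integral_mean p f r"
          by (intro mult_right_mono ennreal_leI) auto
        then show ?thesis
          using r c2 by (simp add: J_int ennreal_mult mult.assoc)
      qed simp
      finally show "(\<integral>\<^sup>+\<zeta>. indicator {1/4<..<1} r * (ennreal ((1 - r) powr (\<gamma> - 1)) * J r \<zeta>) \<partial>sphere_measure) \<le>
        ennreal c2 * (ennreal (r ^ (2 * CARD('n) - 1)) * indicator {0<..<1} r * (ennreal ((1 - r\<^sup>2) powr \<gamma>) * integral_mean p f r))" .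
    qed
    also have "\<dots> = ennreal c2 * (\<integral>\<^sup>+r. ennreal (r ^ (2 * CARD('n) - 1)) * indicator {0<..<1} r * (ennreal ((1 - r\<^sup>2) powr \<gamma>) * integral_mean p f r) \<partial>lborel)"
      by (rule nn_integral_cmult) measurable
    also have "\<dots> \<le> ennreal c2 * (\<integral>\<^sup>+r. ennreal (2 * CARD('n) * r ^ (2 * CARD('n) - 1)) * indicator {0<..<1} r * (ennreal ((1 - r\<^sup>2) powr \<gamma>) * integral_mean p f r) \<partial>lborel)"
    proof (rule mult_left_mono, rule nn_integral_mono)
      fix r :: real
      have "1 \<le> real CARD('n)" by simp
      then have "1 \<le> 2 * real CARD('n)" by linarith
      then have "0 < r \<Longrightarrow> r ^ (2 * CARD('n) - 1) \<le> 2 * CARD('n) * r ^ (2 * CARD('n) - 1)"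
        using mult_right_mono[of 1 "2 * real CARD('n)" "r ^ (2 * CARD('n) - 1)"] by simp
      then have "ennreal (r ^ (2 * CARD('n) - 1)) * indicator {0<..<1} r \<le> ennreal (2 * CARD('n) * r ^ (2 * CARD('n) - 1)) * indicator {0<..<1} r"
        by (cases "0 < r") (auto simp: indicator_def intro!: ennreal_leI)
      then show "ennreal (r ^ (2 * CARD('n) - 1)) * indicator {0<..<1} r * (ennreal ((1 - r\<^sup>2) powr \<gamma>) * integral_mean p f r) \<le>
          ennreal (2 * CARD('n) * r ^ (2 * CARD('n) - 1)) * indicator {0<..<1} r * (ennreal ((1 - r\<^sup>2) powr \<gamma>) * integral_mean p f r)"
        by (rule mult_right_mono) simp
    qed simp
    also have "\<dots> = ennreal c2 * K" by (simp only: K_def)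
    finally have "ennreal c1 * (\<integral>\<^sup>+\<zeta>. (\<integral>\<^sup>+r. indicator {1/4<..<1} r * (ennreal ((1 - r) powr (\<gamma> - 1)) * J r \<zeta>) \<partial>lborel) \<partial>sphere_measure) \<le> ennreal c1 * (ennreal c2 * K)"
      by (rule mult_left_mono) simp
    also have "\<dots> = ennreal (c1 * c2 / V) * weighted_integral p \<gamma> f"
    proof -
      have "K = ennreal (1 / V) * (ennreal V * K)"
        using V by (subst ennreal_mult_assoc) simp_all
      also have "ennreal V * K = weighted_integral p \<gamma> f" by (simp only: K_def weighted_integral_polar[OF f] V(2))
      finally have K: "K = ennreal (1 / V) * weighted_integral p \<gamma> f" .
      show ?thesis unfolding K using c1 c2 V by (simp add: ennreal_mult_assoc)
    qed
    finally have H_int: "(\<integral>\<^sup>+\<zeta>. H \<zeta> \<partial>sphere_measure) \<le> ennreal (c1 * c2 / V) * weighted_integral p \<gamma> f"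
      unfolding H_sphere .
    show "\<exists>H. H \<in> borel_measurable borel \<and>
      (\<forall>\<zeta> u. norm \<zeta> = 1 \<longrightarrow> 1 / 2 \<le> u \<longrightarrow> u < 1 \<longrightarrow> ennreal (norm (f (u *\<^sub>R \<zeta>)) powr p) \<le> ennreal ((1 - u) powr (- (\<gamma> + 1))) * H \<zeta>) \<and>
      (\<integral>\<^sup>+\<zeta>. H \<zeta> \<partial>sphere_measure) \<le> ennreal (c1 * c2 / V) * weighted_integral p \<gamma> f"
      using H_meas pointwise H_int by (intro exI[of _ H] conjI allI impI) simp_all
  qed
qed

section \<open>From Hardy to Bergman spaces\<close>

lemma ln_one_plus_ge_half: "0 \<le> y \<Longrightarrow> y \<le> 1 \<Longrightarrow> y \<le> 2 * ln (1 + (y::real))"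
proof -
  assume y: "0 \<le> y" "y \<le> 1"
  have "1 - 1 / (1 + y) \<le> ln (1 + y)"
    using ln_le_minus_one[of "1 / (1 + y)"] y by (simp add: ln_div)
  moreover have "y / 2 \<le> 1 - 1 / (1 + y)" using y mult_left_le[of y y] by (simp add: field_simps)
  ultimately show ?thesis by linarith
qed

lemma ln_one_plus_le_powr:
  assumes e: "0 < \<epsilon>" "\<epsilon> \<le> 1" and y: "(y::real) > 0"
  shows "ln (1 + y) \<le> 2 * y powr \<epsilon> / \<epsilon>"
proof (cases "y \<le> 1")
  case True
  have "ln (1 + y) \<le> y" using y by (intro ln_add_one_self_le_self) simp
  also have "y \<le> y powr \<epsilon>" using powr_mono'[of \<epsilon> 1 y] True y e by simp
  also have "\<dots> \<le> 2 * y powr \<epsilon> / \<epsilon>" using e mult_right_mono[of \<epsilon> 2 "y powr \<epsilon>"] by (simp add: le_divide_eq mult.commute)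
  finally show ?thesis .
next
  case False
  have "ln (1 + y) \<le> ln (2 * y)" using False by (subst ln_le_cancel_iff) auto
  also have "\<dots> = ln 2 + ln y" using y by (simp add: ln_mult)
  also have "\<dots> \<le> 1 + y powr \<epsilon> / \<epsilon>"
    using False e ln_2_less_1 by (intro add_mono ln_powr_bound) auto
  also have "1 \<le> y powr \<epsilon> / \<epsilon>" using False e ge_one_powr_ge_zero[of y \<epsilon>] by (simp add: le_divide_eq)
  finally show ?thesis by simp
qed

text \<open>
  The inequalities \<open>ln (1 + x) \<le> x\<close> and \<open>ln (1 + x) \<le> C x\<^bsup>p/(2q)\<^esup>\<close> bound the integrand by the minimum of two
  powers of \<open>s\<close>, one integrable at \<open>0\<close> and the other at infinity. The geometric mean that
  \<open>nn_integral_min_powr\<close> produces is homogeneous in \<open>u\<close> of degree \<open>p\<close>.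
\<close>

lemma log_power_integral:
  assumes p: "0 < p" and pq: "p < q" and n: "n > 0" and L: "L > 0" and u: "u \<ge> 0"
  defines "y \<equiv> n * (q / p - 1)"
  shows "(\<integral>\<^sup>+s. ennreal (2 * L powr q * s powr (- n - 1) * ln (1 + (u / L) powr q * s powr (n * q / p))) * indicator {0<..} s \<partial>lborel) \<le>
    ennreal ((2 / n + 1 / y) * (2 * L powr q * (4 * q / p) powr (y / (n / 2 + y))) * (u / L) powr p)"
proof (cases "u = 0")
  case True
  then show ?thesis by simp
next
  case False
  then have u: "u > 0" using u by simp
  have q: "q > 0" using p pq by simp
  have y: "y > 0" using p pq n by (simp add: y_def)
  define v where "v = u / L"
  have v: "v > 0" using u L by (simp add: v_def)
  define A where "A = 2 * L powr q * (4 * q / p) * v powr (p / 2)"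
  define B where "B = 2 * L powr q * v powr q"
  have AB: "A > 0" "B > 0" using L p q v by (auto simp: A_def B_def intro!: mult_pos_pos divide_pos_pos)
  have "(\<integral>\<^sup>+s. ennreal (2 * L powr q * s powr (- n - 1) * ln (1 + v powr q * s powr (n * q / p))) * indicator {0<..} s \<partial>lborel) \<le>
      (\<integral>\<^sup>+s. ennreal (min (A * s powr (- 1 - n / 2)) (B * s powr (- 1 + y))) * indicator {0<..} s \<partial>lborel)"
  proof (rule nn_integral_mono)
    fix s :: real
    show "ennreal (2 * L powr q * s powr (- n - 1) * ln (1 + v powr q * s powr (n * q / p))) * indicator {0<..} s \<le>
        ennreal (min (A * s powr (- 1 - n / 2)) (B * s powr (- 1 + y))) * indicator {0<..} s"
    proof (cases "s > 0")
      case True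
      let ?y = "v powr q * s powr (n * q / p)"
      have yp: "?y > 0" using v True by simp
      have "ln (1 + ?y) \<le> ?y" using yp by (intro ln_add_one_self_le_self) simp
      then have "2 * L powr q * s powr (- n - 1) * ln (1 + ?y) \<le> 2 * L powr q * s powr (- n - 1) * ?y"
        by (intro mult_left_mono) auto
      also have "\<dots> = 2 * L powr q * v powr q * (s powr (- n - 1) * s powr (n * q / p))" by (simp only: mult_ac)
      also have "s powr (- n - 1) * s powr (n * q / p) = s powr (- 1 + y)"
        unfolding powr_add[symmetric] y_def by (simp add: algebra_simps)
      finally have 1: "2 * L powr q * s powr (- n - 1) * ln (1 + ?y) \<le> B * s powr (- 1 + y)" by (simp only: B_def)
      have "ln (1 + ?y) \<le> 2 * ?y powr (p / (2 * q)) / (p / (2 * q))"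
        using p pq yp by (intro ln_one_plus_le_powr) auto
      also have "?y powr (p / (2 * q)) = v powr (p / 2) * s powr (n / 2)"
        using v True p q by (simp add: powr_mult powr_powr)
      finally have "2 * L powr q * s powr (- n - 1) * ln (1 + ?y) \<le> 2 * L powr q * s powr (- n - 1) * (2 * (v powr (p / 2) * s powr (n / 2)) / (p / (2 * q)))"
        by (intro mult_left_mono) auto
      also have "\<dots> = 2 * L powr q * (4 * q / p) * v powr (p / 2) * (s powr (- n - 1) * s powr (n / 2))"
        using p q by (simp add: field_simps)
      also have "s powr (- n - 1) * s powr (n / 2) = s powr (- 1 - n / 2)"
        unfolding powr_add[symmetric] by (rule arg_cong[where f="\<lambda>x. s powr x"]) (simp add: field_simps)
      finally have 2: "2 * L powr q * s powr (- n - 1) * ln (1 + ?y) \<le> A * s powr (- 1 - n / 2)" by (simp only: A_def)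
      show ?thesis using 1 2 by (intro mult_right_mono ennreal_leI) auto
    qed simp
  qed
  also have "\<dots> \<le> ennreal ((1 / (n / 2) + 1 / y) * (A powr (y / (n / 2 + y)) * B powr ((n / 2) / (n / 2 + y))))"
    by (rule nn_integral_min_powr) (use n y AB in auto)
  also have "(1 / (n / 2) + 1 / y) * (A powr (y / (n / 2 + y)) * B powr ((n / 2) / (n / 2 + y))) =
     (2 / n + 1 / y) * (2 * L powr q * (4 * q / p) powr (y / (n / 2 + y))) * v powr p"
  proof -
    define \<theta> where "\<theta> = y / (n / 2 + y)"
    have ny: "n / 2 + y > 0" using n y by simp
    have \<theta>': "(n / 2) / (n / 2 + y) = 1 - \<theta>" using ny by (simp add: \<theta>_def field_simps)
    have "p / 2 * \<theta> + q * (1 - \<theta>) = p"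
    proof -
      have \<theta>1: "\<theta> * (n / 2 + y) = y" unfolding \<theta>_def using ny by simp
      moreover have "(1 - \<theta>) * (n / 2 + y) = n / 2" by (simp only: left_diff_distrib \<theta>1) simp
      ultimately have "(p / 2 * \<theta> + q * (1 - \<theta>)) * (n / 2 + y) = p / 2 * y + q * (n / 2)"
        by (simp only: distrib_right mult.assoc)
      also have "\<dots> = p * (n / 2 + y)" using p by (simp add: y_def field_simps)
      finally show ?thesis using ny by simp
    qed
    then have ex: "v powr p = v powr (p / 2 * \<theta>) * v powr (q * (1 - \<theta>))"
      by (simp add: powr_add[symmetric])
    have "2 * L powr q = (2 * L powr q) powr (\<theta> + (1 - \<theta>))" using L by simp
    then have ex2: "2 * L powr q = (2 * L powr q) powr \<theta> * (2 * L powr q) powr (1 - \<theta>)" by (simp only: powr_add)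
    have "A powr \<theta> = (2 * L powr q) powr \<theta> * (4 * q / p) powr \<theta> * v powr (p / 2 * \<theta>)"
      unfolding A_def using L p q v by (simp only: powr_mult powr_powr)
    moreover have "B powr (1 - \<theta>) = (2 * L powr q) powr (1 - \<theta>) * v powr (q * (1 - \<theta>))"
      unfolding B_def using L q v by (simp only: powr_mult powr_powr)
    ultimately have "A powr \<theta> * B powr (1 - \<theta>) = ((2 * L powr q) powr \<theta> * (2 * L powr q) powr (1 - \<theta>)) * (4 * q / p) powr \<theta> * (v powr (p / 2 * \<theta>) * v powr (q * (1 - \<theta>)))"
      by (simp only: mult_ac)
    also have "\<dots> = 2 * L powr q * (4 * q / p) powr \<theta> * v powr p" by (simp only: ex ex2[symmetric])
    finally show ?thesis unfolding \<theta>' \<theta>_def[symmetric] by simp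
  qed
  finally show ?thesis by (simp only: v_def)
qed

lemma powr_le_imp_le: "a powr p \<le> b powr p \<Longrightarrow> 0 < p \<Longrightarrow> 0 \<le> b \<Longrightarrow> a \<le> (b::real)"
  by (metis not_less powr_less_mono2)

text \<open>
  With \<open>L\<close> from the pointwise bound, \<open>W r u\<close> below dominates \<open>(1 - r)\<^sup>\<beta> u\<^sup>q\<close> at \<open>u = |f (r \<zeta>)|\<close>, and it is
  log-convex in \<open>u\<close>, so that the sphere of radius \<open>r\<close> may be replaced by the one of radius \<open>R > r\<close>. Then
  \<open>u = |f (R \<zeta>)|\<close> is independent of \<open>r\<close>, and the integral of \<open>W r u\<close> over \<open>r\<close> is a multiple of \<open>u\<^sup>p\<close>.
\<close>

lemma hardy_bergman_bound:
  fixes p q K :: real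
  assumes p: "0 < p" and pq: "p < q" and K: "K > 0"
  defines "\<beta> \<equiv> CARD('n) * q / p - CARD('n) - 1"
  obtains C where "C > 0" "\<And>f :: complex ^ 'n \<Rightarrow> complex. ball_fun f \<Longrightarrow> (\<And>r. 0 < r \<Longrightarrow> r < 1 \<Longrightarrow> integral_mean p f r \<le> ennreal K) \<Longrightarrow>
    (\<integral>\<^sup>+r. indicator {0<..<1} r * (ennreal ((1 - r) powr \<beta>) * integral_mean q f r) \<partial>lborel) \<le> ennreal C"
proof -
  let ?n = "real CARD('n)"
  have n: "?n > 0" by simp
  have q: "q > 0" using p pq by simp
  define c0 where "c0 = 2 * CARD('n) * 4 ^ (CARD('n) + 1) * K"
  have c0: "c0 > 0" using K by (simp add: c0_def)
  define L where "L = c0 powr (1 / p)"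
  have L: "L > 0" "L powr p = c0" using c0 p by (simp_all add: L_def powr_powr)
  define y where "y = ?n * (q / p - 1)"
  define D where "D = (2 / ?n + 1 / y) * (2 * L powr q * (4 * q / p) powr (y / (?n / 2 + y)))"
  have D: "D > 0" using L p pq q by (simp add: D_def y_def add_pos_pos)
  show thesis
  proof (rule that[of "D / L powr p * K"])
    show "D / L powr p * K > 0" using D L K c0 by simp
    fix f :: "complex ^ 'n \<Rightarrow> complex" assume f: "ball_fun f" and bound: "\<And>r. 0 < r \<Longrightarrow> r < 1 \<Longrightarrow> integral_mean p f r \<le> ennreal K"
    note [measurable] = ball_fun_measurable[OF f] integral_mean_measurable[OF f]
    have pw: "norm (f z) \<le> L * (1 - norm z) powr (- ?n / p)" if z: "norm z < 1" for z
    proof -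
      define s where "s = 1 - norm z"
      have s: "0 < s" "s \<le> 1" using z by (auto simp: s_def)
      have "ennreal (norm (f z) powr p) \<le> ennreal (2 * CARD('n) * 4 ^ (CARD('n) + 1) * s powr (- ?n)) * integral_mean p f (1 - s / 4)"
        using pointwise_integral_mean[OF f p z] by (simp add: s_def)
      also have "\<dots> \<le> ennreal (2 * CARD('n) * 4 ^ (CARD('n) + 1) * s powr (- ?n)) * ennreal K"
        using s by (intro mult_left_mono bound) auto
      also have "\<dots> = ennreal (c0 * s powr (- ?n))"
        using K by (simp add: c0_def ennreal_mult[symmetric] mult_ac)
      finally have "norm (f z) powr p \<le> c0 * s powr (- ?n)" using c0 by simp
      also have "c0 * s powr (- ?n) = (L * s powr (- ?n / p)) powr p"
        using L p s by (simp add: powr_mult powr_powr)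
      finally show ?thesis
        unfolding s_def[symmetric] by (rule powr_le_imp_le) (use p L in auto)
    qed
    define W where "W r u = 2 * L powr q * (1 - r) powr (- ?n - 1) * ln (1 + (u / L) powr q * (1 - r) powr (?n * q / p))" for r u :: real
    have W_dom: "(1 - r) powr \<beta> * norm (f (r *\<^sub>R \<zeta>)) powr q \<le> W r (norm (f (r *\<^sub>R \<zeta>)))"
      if r: "0 < r" "r < 1" and \<zeta>: "norm \<zeta> = 1" for r \<zeta>
    proof -
      let ?u = "norm (f (r *\<^sub>R \<zeta>))" and ?s = "1 - r"
      let ?y = "(?u / L) powr q * ?s powr (?n * q / p)"
      have "?u \<le> L * ?s powr (- ?n / p)" using pw[of "r *\<^sub>R \<zeta>"] r \<zeta> by simp
      then have "?u / L \<le> ?s powr (- ?n / p)" using L by (simp add: field_simps)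
      then have "(?u / L) powr q \<le> (?s powr (- ?n / p)) powr q" using q L by (intro powr_mono2) auto
      then have "?y \<le> (?s powr (- ?n / p)) powr q * ?s powr (?n * q / p)" by (intro mult_right_mono) auto
      also have "\<dots> = 1" using r by (simp add: powr_powr powr_add[symmetric])
      finally have y1: "?y \<le> 1" .
      have "?s powr \<beta> * ?u powr q = L powr q * ?s powr (- ?n - 1) * ?y"
      proof -
        have "?s powr \<beta> = ?s powr (- ?n - 1) * ?s powr (?n * q / p)"
          unfolding powr_add[symmetric] \<beta>_def by (simp add: algebra_simps)
        moreover have "?u powr q = L powr q * (?u / L) powr q" using L by (simp add: powr_divide)
        ultimately show ?thesis by (simp only: mult_ac)
      qed
      also have "\<dots> \<le> L powr q * ?s powr (- ?n - 1) * (2 * ln (1 + ?y))"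
        using y1 by (intro mult_left_mono ln_one_plus_ge_half) auto
      also have "\<dots> = W r ?u" by (simp add: W_def)
      finally show ?thesis .
    qed
    have below: "(\<integral>\<^sup>+r. indicator {0<..<R} r * (ennreal ((1 - r) powr \<beta>) * integral_mean q f r) \<partial>lborel) \<le> ennreal (D / L powr p * K)"
      if R: "0 < R" "R < 1" for R
    proof -
      have "(\<integral>\<^sup>+r. indicator {0<..<R} r * (ennreal ((1 - r) powr \<beta>) * integral_mean q f r) \<partial>lborel) \<le>
          (\<integral>\<^sup>+r. (\<integral>\<^sup>+\<zeta>. indicator {0<..<1} r * ennreal (W r (norm (f (R *\<^sub>R \<zeta>)))) \<partial>sphere_measure) \<partial>lborel)"
      proof (rule nn_integral_mono)
        fix r :: real
        show "indicator {0<..<R} r * (ennreal ((1 - r) powr \<beta>) * integral_mean q f r) \<le>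
            (\<integral>\<^sup>+\<zeta>. indicator {0<..<1} r * ennreal (W r (norm (f (R *\<^sub>R \<zeta>)))) \<partial>sphere_measure)"
        proof (cases "r \<in> {0<..<R}")
          case True
          then have r: "0 < r" "r < R" "r < 1" using R by auto
          let ?v = "\<lambda>u. ln (1 + ((1 - r) powr (?n * q / p) / L powr q) * u powr q)"
          let ?c = "2 * L powr q * (1 - r) powr (- ?n - 1)"
          have Wv: "W r u = ?c * ?v u" if "u \<ge> 0" for u
            using that L by (simp add: W_def powr_divide mult_ac)
          have v0: "0 \<le> ?v u" for u using L by simp
          have c_nonneg: "0 \<le> ?c" by simp
          have "ennreal ((1 - r) powr \<beta>) * integral_mean q f r = (\<integral>\<^sup>+\<zeta>. ennreal ((1 - r) powr \<beta> * norm (f (r *\<^sub>R \<zeta>)) powr q) \<partial>sphere_measure)"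
            unfolding integral_mean_def by (subst nn_integral_cmult[symmetric]) (simp_all add: ennreal_mult)
          also have "\<dots> \<le> (\<integral>\<^sup>+\<zeta>. ennreal ?c * ennreal (?v (norm (f (r *\<^sub>R \<zeta>)))) \<partial>sphere_measure)"
          proof (rule nn_integral_mono)
            fix \<zeta> :: "complex ^ 'n" assume "\<zeta> \<in> space sphere_measure"
            then have "norm \<zeta> = 1" by simp
            from W_dom[OF r(1,3) this]
            show "ennreal ((1 - r) powr \<beta> * norm (f (r *\<^sub>R \<zeta>)) powr q) \<le> ennreal ?c * ennreal (?v (norm (f (r *\<^sub>R \<zeta>))))"
              unfolding ennreal_mult[OF c_nonneg v0, symmetric] by (intro ennreal_leI) (simp only: Wv norm_ge_zero)
          qed
          also have "\<dots> = ennreal ?c * (\<integral>\<^sup>+\<zeta>. ennreal (?v (norm (f (r *\<^sub>R \<zeta>)))) \<partial>sphere_measure)"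
            by (rule nn_integral_cmult) measurable
          also have "\<dots> \<le> ennreal ?c * (\<integral>\<^sup>+\<zeta>. ennreal (?v (norm (f (R *\<^sub>R \<zeta>)))) \<partial>sphere_measure)"
          proof (rule mult_left_mono)
            show "(\<integral>\<^sup>+\<zeta>. ennreal (?v (norm (f (r *\<^sub>R \<zeta>)))) \<partial>sphere_measure) \<le> (\<integral>\<^sup>+\<zeta>. ennreal (?v (norm (f (R *\<^sub>R \<zeta>)))) \<partial>sphere_measure)"
              by (rule sphere_mean_mono[OF log_convex_ln[OF q] _ f]) (use r R L in auto)
          qed simp
          also have "\<dots> = (\<integral>\<^sup>+\<zeta>. ennreal ?c * ennreal (?v (norm (f (R *\<^sub>R \<zeta>)))) \<partial>sphere_measure)"
            by (rule nn_integral_cmult[symmetric]) measurable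
          also have "\<dots> = (\<integral>\<^sup>+\<zeta>. ennreal (W r (norm (f (R *\<^sub>R \<zeta>)))) \<partial>sphere_measure)"
            using v0 by (intro nn_integral_cong, subst ennreal_mult[symmetric]) (simp_all only: Wv norm_ge_zero, simp_all)
          finally show ?thesis using True r by simp
        qed simp
      qed
      also have "\<dots> = (\<integral>\<^sup>+\<zeta>. (\<integral>\<^sup>+r. indicator {0<..<1} r * ennreal (W r (norm (f (R *\<^sub>R \<zeta>)))) \<partial>lborel) \<partial>sphere_measure)"
        unfolding W_def by (rule lborel_sphere.Fubini'[symmetric]) measurable
      also have "\<dots> \<le> (\<integral>\<^sup>+\<zeta>. ennreal (D / L powr p) * ennreal (norm (f (R *\<^sub>R \<zeta>)) powr p) \<partial>sphere_measure)"
      proof (rule nn_integral_mono)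
        fix \<zeta> :: "complex ^ 'n"
        let ?u = "norm (f (R *\<^sub>R \<zeta>))"
        let ?F = "\<lambda>s. ennreal (2 * L powr q * s powr (- ?n - 1) * ln (1 + (?u / L) powr q * s powr (?n * q / p))) * indicator {0<..} s"
        have "(\<integral>\<^sup>+r. indicator {0<..<1} r * ennreal (W r ?u) \<partial>lborel) \<le> (\<integral>\<^sup>+r. ?F (1 - r) \<partial>lborel)"
          by (intro nn_integral_mono) (auto simp: W_def indicator_def)
        also have "\<dots> = (\<integral>\<^sup>+s. ?F s \<partial>lborel)" by (rule nn_integral_reflect) measurable
        also have "\<dots> \<le> ennreal (D * (?u / L) powr p)"
          using log_power_integral[OF p pq n L(1), of ?u] by (simp add: D_def y_def)
        also have "\<dots> = ennreal (D / L powr p) * ennreal (?u powr p)"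
          using D L c0 by (simp add: ennreal_mult[symmetric] powr_divide)
        finally show "(\<integral>\<^sup>+r. indicator {0<..<1} r * ennreal (W r ?u) \<partial>lborel) \<le> ennreal (D / L powr p) * ennreal (?u powr p)" .
      qed
      also have "\<dots> = ennreal (D / L powr p) * integral_mean p f R"
        unfolding integral_mean_def by (rule nn_integral_cmult) measurable
      also have "\<dots> \<le> ennreal (D / L powr p) * ennreal K"
        using R by (intro mult_left_mono bound) auto
      also have "\<dots> = ennreal (D / L powr p * K)" using D L K c0 by (simp add: ennreal_mult[symmetric])
      finally show ?thesis .
    qed
    \<comment> \<open>the bound in \<open>below\<close> does not depend on \<open>R\<close>, so \<open>R\<close> may tend to \<open>1\<close>\<close>
    define R where "R i = 1 - 1 / (real i + 2)" for i
    have R: "0 < R i" "R i < 1" for i by (auto simp: R_def field_simps)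
    have Rmono: "R i \<le> R j" if "i \<le> j" for i j using that by (auto simp: R_def field_simps)
    let ?G = "\<lambda>i r. indicator {0<..<R i} r * (ennreal ((1 - r) powr \<beta>) * integral_mean q f r)"
    have sup: "indicator {0<..<1} r = (SUP i. indicator {0<..<R i} r :: ennreal)" for r
    proof (rule antisym)
      show "indicator {0<..<1} r \<le> (SUP i. indicator {0<..<R i} r :: ennreal)"
      proof (cases "r \<in> {0<..<1}")
        case True
        obtain i where "1 / (1 - r) < real i" using reals_Archimedean2 by blast
        then have "1 / (1 - r) < real i + 2" by simp
        then have "1 / (real i + 2) < 1 - r" using True by (simp add: field_simps)
        then have "r \<in> {0<..<R i}" using True by (simp add: R_def)
        then have "indicator {0<..<1} r = (indicator {0<..<R i} r :: ennreal)" using True by simp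
        then show ?thesis using SUP_upper[of i UNIV "\<lambda>i. indicator {0<..<R i} r :: ennreal"] by simp
      qed simp
      show "(SUP i. indicator {0<..<R i} r :: ennreal) \<le> indicator {0<..<1} r"
        by (rule SUP_least) (use R less_trans in \<open>fastforce simp: indicator_def\<close>)
    qed
    have "(\<integral>\<^sup>+r. indicator {0<..<1} r * (ennreal ((1 - r) powr \<beta>) * integral_mean q f r) \<partial>lborel) = (\<integral>\<^sup>+r. (SUP i. ?G i r) \<partial>lborel)"
      unfolding sup by (simp add: SUP_mult_right_ennreal)
    also have "\<dots> = (SUP i. \<integral>\<^sup>+r. ?G i r \<partial>lborel)"
    proof (rule nn_integral_monotone_convergence_SUP)
      show "incseq ?G"
        unfolding incseq_def le_fun_def
      proof (intro allI impI mult_right_mono)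
        fix i j :: nat and r :: real assume "i \<le> j"
        then show "indicator {0<..<R i} r \<le> (indicator {0<..<R j} r :: ennreal)"
          using Rmono[of i j] by (auto simp: indicator_def)
      qed simp
    qed measurable
    also have "\<dots> \<le> ennreal (D / L powr p * K)"
      by (rule SUP_least) (rule below[OF R])
    finally show "(\<integral>\<^sup>+r. indicator {0<..<1} r * (ennreal ((1 - r) powr \<beta>) * integral_mean q f r) \<partial>lborel) \<le> ennreal (D / L powr p * K)" .
  qed
qed

section \<open>From Bergman to Hardy spaces\<close>

lemma radial_step:
  fixes f :: "complex ^ 'n \<Rightarrow> complex"
  assumes f: "holomorphic_vec_on f unit_ball" and \<zeta>: "norm \<zeta> = 1" and t: "1 / 2 \<le> t" "t \<le> r" "r < 1"
  shows "ennreal (norm (f (r *\<^sub>R \<zeta>))) \<le> ennreal (norm (f (t *\<^sub>R \<zeta>))) +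
    2 * (\<integral>\<^sup>+u. ennreal (norm (radial_deriv f (u *\<^sub>R \<zeta>))) * indicator {t..r} u \<partial>lborel)"
proof -
  let ?R = "\<lambda>u. radial_deriv f (u *\<^sub>R \<zeta>)"
  have inb: "norm (u *\<^sub>R \<zeta>) < 1" if "u \<in> {t..r}" for u using that t \<zeta> by simp
  have Rc: "continuous_on {t..r} ?R"
    by (rule continuous_on_compose2[OF holomorphic_vec_on_continuous[OF holomorphic_vec_on_radial_deriv[OF f]]])
       (use inb in \<open>auto intro!: continuous_intros\<close>)
  have "((\<lambda>u. ?R u / of_real u) has_integral f (r *\<^sub>R \<zeta>) - f (t *\<^sub>R \<zeta>)) {t..r}"
  proof (rule fundamental_theorem_of_calculus[OF t(2)])
    fix u assume u: "u \<in> {t..r}"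
    show "((\<lambda>u. f (u *\<^sub>R \<zeta>)) has_vector_derivative ?R u / of_real u) (at u within {t..r})"
    proof -
      have "0 < u" using u t by simp
      from radial_deriv_ray[OF f this inb[OF u]] show ?thesis by (rule has_vector_derivative_at_within)
    qed
  qed
  then have "norm (f (r *\<^sub>R \<zeta>) - f (t *\<^sub>R \<zeta>)) = norm (integral {t..r} (\<lambda>u. ?R u / of_real u))"
    and int: "(\<lambda>u. ?R u / of_real u) integrable_on {t..r}"
    by (auto simp: integral_unique)
  note this(1)
  also have "norm (integral {t..r} (\<lambda>u. ?R u / of_real u)) \<le> integral {t..r} (\<lambda>u. 2 * norm (?R u))"
  proof (rule integral_norm_bound_integral[OF int])
    show "(\<lambda>u. 2 * norm (?R u)) integrable_on {t..r}"
      by (intro integrable_continuous_real continuous_intros Rc)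
    fix u assume "u \<in> {t..r}"
    then have u: "1 / 2 \<le> u" using t by auto
    then have "norm (?R u) / u \<le> norm (?R u) / (1 / 2)" by (intro divide_left_mono) auto
    then show "norm (?R u / of_real u) \<le> 2 * norm (?R u)" using u by (simp add: norm_divide)
  qed
  also have "\<dots> = 2 * integral {t..r} (\<lambda>u. norm (?R u))" by simp
  finally have "norm (f (r *\<^sub>R \<zeta>)) \<le> norm (f (t *\<^sub>R \<zeta>)) + 2 * integral {t..r} (\<lambda>u. norm (?R u))"
    using norm_triangle_sub[of "f (r *\<^sub>R \<zeta>)" "f (t *\<^sub>R \<zeta>)"] by linarith
  then have "ennreal (norm (f (r *\<^sub>R \<zeta>))) \<le> ennreal (norm (f (t *\<^sub>R \<zeta>)) + 2 * integral {t..r} (\<lambda>u. norm (?R u)))"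
    by (rule ennreal_leI)
  also have "\<dots> = ennreal (norm (f (t *\<^sub>R \<zeta>))) + 2 * ennreal (integral {t..r} (\<lambda>u. norm (?R u)))"
  proof -
    have "0 \<le> integral {t..r} (\<lambda>u. norm (?R u))"
      by (intro Henstock_Kurzweil_Integration.integral_nonneg integrable_continuous_real continuous_intros Rc) simp
    then show ?thesis by (simp add: ennreal_mult)
  qed
  also have "ennreal (integral {t..r} (\<lambda>u. norm (?R u))) = (\<integral>\<^sup>+u. ennreal (norm (?R u)) * indicator {t..r} u \<partial>lborel)"
    by (rule nn_integral_Icc_continuous[symmetric]) (auto intro!: continuous_intros Rc)
  finally show ?thesis .
qed

text \<open>
  Repeated use of \<open>radial_step\<close>; exchanging the order of the integrals gives one power of \<open>1 - u\<close> in each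
  step. Every step costs a factor \<open>2\<close>, from \<open>1 / u \<le> 2\<close>.
\<close>

lemma radial_taylor:
  fixes f :: "complex ^ 'n \<Rightarrow> complex"
  assumes \<zeta>: "norm \<zeta> = 1" and t: "1 / 2 \<le> t" and f: "holomorphic_vec_on f unit_ball" and r: "t \<le> r" "r < 1"
    and B: "\<And>k. k \<le> M \<Longrightarrow> norm ((radial_deriv ^^ k) f (t *\<^sub>R \<zeta>)) \<le> B"
  shows "ennreal (norm (f (r *\<^sub>R \<zeta>))) \<le> ennreal (2 ^ Suc M * B) +
    ennreal (2 ^ Suc M) * (\<integral>\<^sup>+u. ennreal ((1 - u) ^ M * norm (zero_ext ((radial_deriv ^^ Suc M) f) (u *\<^sub>R \<zeta>))) * indicator {t..r} u \<partial>lborel)"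
  using f r B
proof (induction M arbitrary: f r)
  case 0
  have "norm (f (t *\<^sub>R \<zeta>)) \<le> B" using 0(4)[of 0] by simp
  also have "B \<le> 2 * B" using norm_ge_zero[of "f (t *\<^sub>R \<zeta>)"] calculation by linarith
  finally have "ennreal (norm (f (t *\<^sub>R \<zeta>))) \<le> ennreal (2 * B)" by (rule ennreal_leI)
  moreover have "(\<integral>\<^sup>+u. ennreal (norm (radial_deriv f (u *\<^sub>R \<zeta>))) * indicator {t..r} u \<partial>lborel) =
      (\<integral>\<^sup>+u. ennreal (norm (zero_ext (radial_deriv f) (u *\<^sub>R \<zeta>))) * indicator {t..r} u \<partial>lborel)"
    using 0 t \<zeta> by (intro nn_integral_cong) (auto simp: zero_ext_def indicator_def)
  ultimately show ?case
    using radial_step[OF 0(1) \<zeta> t 0(2,3)] by (simp add: add_mono order_trans[OF _ add_right_mono])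
next
  case (Suc M)
  have B0: "0 \<le> B" using order_trans[OF norm_ge_zero Suc(5)[of 0]] by simp
  have swap: "(radial_deriv ^^ k) (radial_deriv f) = (radial_deriv ^^ Suc k) f" for k
    by (simp add: funpow_swap1)
  let ?c = "2 ^ Suc M :: real"
  define g where "g = zero_ext ((radial_deriv ^^ Suc (Suc M)) f)"
  have "ball_fun g" unfolding g_def by (intro ball_fun_zero_ext holomorphic_vec_on_radial_funpow Suc)
  note [measurable] = ball_fun_measurable[OF this]
  define G where "G w = ennreal ((1 - w) ^ M * norm (g (w *\<^sub>R \<zeta>)))" for w
  have [measurable]: "G \<in> borel_measurable borel" unfolding G_def by measurable
  have inner: "ennreal (norm (radial_deriv f (u *\<^sub>R \<zeta>))) \<le> ennreal (?c * B) + ennreal ?c * (\<integral>\<^sup>+w. G w * indicator {t..u} w \<partial>lborel)"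
    if u: "t \<le> u" "u \<le> r" for u
  proof -
    have "norm ((radial_deriv ^^ k) (radial_deriv f) (t *\<^sub>R \<zeta>)) \<le> B" if "k \<le> M" for k
      unfolding swap using that by (intro Suc(5)) simp
    from Suc.IH[OF holomorphic_vec_on_radial_deriv[OF Suc(2)] u(1) _ this] u Suc(4)
    show ?thesis unfolding swap G_def g_def by simp
  qed
  have "(\<integral>\<^sup>+u. ennreal (norm (radial_deriv f (u *\<^sub>R \<zeta>))) * indicator {t..r} u \<partial>lborel) \<le>
      (\<integral>\<^sup>+u. ennreal (?c * B) * indicator {t..r} u + ennreal ?c * (\<integral>\<^sup>+w. G w * (if t \<le> w \<and> w \<le> u \<and> u \<le> r then 1 else 0) \<partial>lborel) \<partial>lborel)"
  proof (rule nn_integral_mono)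
    fix u :: real
    show "ennreal (norm (radial_deriv f (u *\<^sub>R \<zeta>))) * indicator {t..r} u \<le>
        ennreal (?c * B) * indicator {t..r} u + ennreal ?c * (\<integral>\<^sup>+w. G w * (if t \<le> w \<and> w \<le> u \<and> u \<le> r then 1 else 0) \<partial>lborel)"
    proof (cases "u \<in> {t..r}")
      case True
      then have "(\<integral>\<^sup>+w. G w * indicator {t..u} w \<partial>lborel) = (\<integral>\<^sup>+w. G w * (if t \<le> w \<and> w \<le> u \<and> u \<le> r then 1 else 0) \<partial>lborel)"
        by (intro nn_integral_cong) (auto simp: indicator_def)
      then show ?thesis using inner[of u] True by simp
    qed simp
  qed
  also have "\<dots> = ennreal (?c * B) * ennreal (r - t) + ennreal ?c * (\<integral>\<^sup>+u. (\<integral>\<^sup>+w. G w * (if t \<le> w \<and> w \<le> u \<and> u \<le> r then 1 else 0) \<partial>lborel) \<partial>lborel)"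
    using Suc(3) by (subst nn_integral_add, measurable) (simp add: nn_integral_cmult nn_integral_cmult_indicator)
  also have "(\<integral>\<^sup>+u. (\<integral>\<^sup>+w. G w * (if t \<le> w \<and> w \<le> u \<and> u \<le> r then 1 else 0) \<partial>lborel) \<partial>lborel) =
      (\<integral>\<^sup>+w. (\<integral>\<^sup>+u. G w * (if t \<le> w \<and> w \<le> u \<and> u \<le> r then 1 else 0) \<partial>lborel) \<partial>lborel)"
    by (rule lborel_pair.Fubini') measurable
  also have "\<dots> \<le> (\<integral>\<^sup>+w. ennreal ((1 - w) ^ Suc M * norm (g (w *\<^sub>R \<zeta>))) * indicator {t..r} w \<partial>lborel)"
  proof (rule nn_integral_mono)
    fix w :: real
    show "(\<integral>\<^sup>+u. G w * (if t \<le> w \<and> w \<le> u \<and> u \<le> r then 1 else 0) \<partial>lborel) \<le> ennreal ((1 - w) ^ Suc M * norm (g (w *\<^sub>R \<zeta>))) * indicator {t..r} w"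
    proof (cases "w \<in> {t..r}")
      case True
      then have "(\<integral>\<^sup>+u. G w * (if t \<le> w \<and> w \<le> u \<and> u \<le> r then 1 else 0) \<partial>lborel) = (\<integral>\<^sup>+u. G w * indicator {w..r} u \<partial>lborel)"
        by (intro nn_integral_cong) (auto simp: indicator_def)
      also have "\<dots> = G w * ennreal (r - w)" using True by (subst nn_integral_cmult_indicator) auto
      also have "\<dots> \<le> G w * ennreal (1 - w)" using Suc(4) by (intro mult_left_mono ennreal_leI) auto
      also have "\<dots> = ennreal ((1 - w) ^ Suc M * norm (g (w *\<^sub>R \<zeta>)))"
        using True Suc(4) unfolding G_def by (subst ennreal_mult[symmetric]) (auto simp: mult_ac)
      finally show ?thesis using True by simp
    next
      case False
      then have "(\<integral>\<^sup>+u. G w * (if t \<le> w \<and> w \<le> u \<and> u \<le> r then 1 else 0) \<partial>lborel) = (\<integral>\<^sup>+u. 0 \<partial>(lborel :: real measure))"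
        by (intro nn_integral_cong) auto
      then show ?thesis by simp
    qed
  qed
  finally have main: "(\<integral>\<^sup>+u. ennreal (norm (radial_deriv f (u *\<^sub>R \<zeta>))) * indicator {t..r} u \<partial>lborel) \<le>
      ennreal (?c * B) * ennreal (r - t) + ennreal ?c * (\<integral>\<^sup>+w. ennreal ((1 - w) ^ Suc M * norm (g (w *\<^sub>R \<zeta>))) * indicator {t..r} w \<partial>lborel)"
    (is "_ \<le> _ + _ * ?I") by (simp add: mult_left_mono add_left_mono)
  have "ennreal (norm (f (r *\<^sub>R \<zeta>))) \<le> ennreal (norm (f (t *\<^sub>R \<zeta>))) + 2 * (ennreal (?c * B) * ennreal (r - t) + ennreal ?c * ?I)"
    using radial_step[OF Suc(2) \<zeta> t Suc(3,4)] mult_left_mono[OF main, of 2] by (meson add_left_mono order_trans zero_le)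
  also have "\<dots> \<le> ennreal B + 2 * (ennreal (?c * B) * ennreal (1 / 2) + ennreal ?c * ?I)"
    using Suc(5)[of 0] Suc(4) t by (intro add_mono mult_left_mono ennreal_leI) auto
  also have "\<dots> = ennreal (B + ?c * B) + ennreal (2 * ?c) * ?I"
  proof -
    have "2 * (ennreal (?c * B) * ennreal (1 / 2)) = ennreal 2 * (ennreal (1 / 2) * ennreal (?c * B))" by (simp add: mult.commute)
    also have "\<dots> = ennreal (?c * B)" by (subst ennreal_mult_assoc) simp_all
    finally have 1: "2 * (ennreal (?c * B) * ennreal (1 / 2)) = ennreal (?c * B)" .
    have 2: "2 * (ennreal ?c * ?I) = ennreal (2 * ?c) * ?I" by (simp add: ennreal_mult mult.assoc)
    show ?thesis unfolding distrib_left 1 2 using B0 by (simp add: add.assoc[symmetric])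
  qed
  also have "\<dots> \<le> ennreal (2 ^ Suc (Suc M) * B) + ennreal (2 ^ Suc (Suc M)) * ?I"
  proof (rule add_mono)
    have "1 \<le> ?c" by (rule one_le_power) simp
    from mult_right_mono[OF this B0] have "B \<le> ?c * B" by simp
    moreover have "2 ^ Suc (Suc M) * B = ?c * B + ?c * B" by simp
    ultimately show "ennreal (B + ?c * B) \<le> ennreal (2 ^ Suc (Suc M) * B)" by (intro ennreal_leI) linarith
  qed simp
  finally show ?case by (simp only: g_def)
qed

lemma powr_add_le: "0 \<le> a \<Longrightarrow> 0 \<le> b \<Longrightarrow> 0 < q \<Longrightarrow> (a + b) powr q \<le> 2 powr q * (a powr q + b powr (q::real))"
proof -
  assume ab: "0 \<le> a" "0 \<le> b" and q: "0 < q"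
  have "(a + b) powr q \<le> (2 * max a b) powr q" using ab q by (intro powr_mono2) auto
  also have "\<dots> = 2 powr q * (max a b) powr q" using ab by (simp add: powr_mult)
  also have "(max a b) powr q \<le> a powr q + b powr q" by (auto simp: max_def)
  finally show ?thesis by simp
qed

lemma sum_prod_le: "0 \<le> a \<Longrightarrow> 0 \<le> b \<Longrightarrow> 0 \<le> x \<Longrightarrow> 0 \<le> y \<Longrightarrow> x * a + y * b \<le> (x + y) * (a + (b::real))"
  by (simp add: distrib_left distrib_right)

text \<open>
  With \<open>s = 1 - u\<close>, the pointwise bound and the bound by \<open>H\<close> of the integrand \<open>s\<^sup>M |g (u \<zeta>)|\<close> in Taylor's
  formula have the exponents \<open>\<delta> - 1 - n/q\<close> and \<open>\<delta> - 1 + \<kappa>\<close> of \<open>s\<close>, where \<open>\<kappa> = n/p - n/q > 0\<close>. After the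
  factor \<open>s\<^sup>\<delta> \<le> (1 - t)\<^sup>\<delta>\<close> is split off, \<open>nn_integral_min_powr\<close> applies and gives \<open>H\<close> to the power
  \<open>(1/p) (n/q) / (n/q + \<kappa>) = 1/q\<close>.
\<close>

lemma bergman_hardy_bound:
  fixes p q \<alpha> K :: real and M :: nat
  assumes p: "0 < p" and pq: "p < q" and K: "K > 0"
    and le: "(CARD('n) + 1 + \<alpha>) / p \<le> CARD('n) / q"
  defines "\<gamma> \<equiv> Suc M * p + \<alpha>" and "\<delta> \<equiv> CARD('n) / q - (CARD('n) + 1 + \<alpha>) / p"
  obtains C where "C > 0" "\<And>(f :: complex ^ 'n \<Rightarrow> complex) t r B. holomorphic_vec_on f unit_ball \<Longrightarrow>
     weighted_integral p \<gamma> (zero_ext ((radial_deriv ^^ Suc M) f)) \<le> ennreal K \<Longrightarrow> 1 / 2 \<le> t \<Longrightarrow> t \<le> r \<Longrightarrow> r < 1 \<Longrightarrow> 0 \<le> B \<Longrightarrow>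
     (\<And>k z. k \<le> M \<Longrightarrow> norm z = t \<Longrightarrow> norm ((radial_deriv ^^ k) f z) \<le> B) \<Longrightarrow>
     integral_mean q f r \<le> ennreal (C * (B powr q + (1 - t) powr (\<delta> * q)))"
proof -
  let ?n = "real CARD('n)"
  have n: "?n > 0" by simp
  have q: "q > 0" using p pq by simp
  have \<delta>: "\<delta> \<ge> 0" using le by (simp add: \<delta>_def)
  obtain C1 where C1: "C1 > 0" "\<And>f :: complex ^ 'n \<Rightarrow> complex. \<And>z. ball_fun f \<Longrightarrow> norm z < 1 \<Longrightarrow>
    ennreal (norm (f z) powr p) \<le> ennreal (C1 * (1 - norm z) powr (- (CARD('n) + 1 + \<gamma>))) * weighted_integral p \<gamma> f"
    by (rule pointwise_weighted_integral[OF p, of \<gamma>], rule that)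
  obtain C2 where C2: "C2 > 0" "\<And>f :: complex ^ 'n \<Rightarrow> complex. ball_fun f \<Longrightarrow> \<exists>H. H \<in> borel_measurable borel \<and>
    (\<forall>\<zeta> u. norm \<zeta> = 1 \<longrightarrow> 1 / 2 \<le> u \<longrightarrow> u < 1 \<longrightarrow> ennreal (norm (f (u *\<^sub>R \<zeta>)) powr p) \<le> ennreal ((1 - u) powr (- (\<gamma> + 1))) * H \<zeta>) \<and>
    (\<integral>\<^sup>+\<zeta>. H \<zeta> \<partial>sphere_measure) \<le> ennreal C2 * weighted_integral p \<gamma> f"
    by (rule slice_maximal[OF p, of \<gamma>], rule that)
  define A where "A = (C1 * K) powr (1 / p)"
  have A: "A > 0" "A powr p = C1 * K" using C1 K p by (auto simp: A_def powr_powr)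
  define \<kappa> where "\<kappa> = ?n / p - ?n / q"
  have \<kappa>: "\<kappa> > 0" using p pq n by (simp add: \<kappa>_def divide_strict_left_mono)
  have nq\<kappa>: "?n / q + \<kappa> = ?n / p" by (simp add: \<kappa>_def)
  define c3 where "c3 = (1 / (?n / q) + 1 / \<kappa>) * A powr (\<kappa> / (?n / p))"
  have c3: "c3 > 0" using A \<kappa> n q by (simp add: c3_def add_pos_pos)
  define c4 where "c4 = 2 powr q * (2 ^ Suc M) powr q"
  define c5 where "c5 = 2 powr q * (2 ^ Suc M * c3) powr q"
  have c45: "c4 > 0" "c5 > 0" using c3 by (simp_all add: c4_def c5_def)
  have e1: "(?n + 1 + \<gamma>) / p = Suc M + ?n / q - \<delta>"
    using p by (simp add: \<gamma>_def \<delta>_def field_simps)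
  have e2: "(\<gamma> + 1) / p = Suc M - \<kappa> - \<delta>"
    using p by (simp add: \<gamma>_def \<delta>_def \<kappa>_def field_simps)
  show thesis
  proof (rule that[of "c4 + c5 * (C2 * K + 1)"])
    show "c4 + c5 * (C2 * K + 1) > 0" using c45 C2 K by (simp add: add_pos_pos)
    fix f :: "complex ^ 'n \<Rightarrow> complex" and t r B :: real
    assume f: "holomorphic_vec_on f unit_ball" and wK: "weighted_integral p \<gamma> (zero_ext ((radial_deriv ^^ Suc M) f)) \<le> ennreal K"
      and t: "1 / 2 \<le> t" "t \<le> r" "r < 1" and B0: "0 \<le> B"
      and B: "\<And>k z. k \<le> M \<Longrightarrow> norm z = t \<Longrightarrow> norm ((radial_deriv ^^ k) f z) \<le> B"
    define g where "g = zero_ext ((radial_deriv ^^ Suc M) f)"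
    have g: "ball_fun g" unfolding g_def by (intro ball_fun_zero_ext holomorphic_vec_on_radial_funpow f)
    have wg: "weighted_integral p \<gamma> g \<le> ennreal K" using wK by (simp add: g_def)
    obtain H where [measurable]: "H \<in> borel_measurable borel"
      and H: "\<And>\<zeta> u. norm \<zeta> = 1 \<Longrightarrow> 1 / 2 \<le> u \<Longrightarrow> u < 1 \<Longrightarrow> ennreal (norm (g (u *\<^sub>R \<zeta>)) powr p) \<le> ennreal ((1 - u) powr (- (\<gamma> + 1))) * H \<zeta>"
      and Hint: "(\<integral>\<^sup>+\<zeta>. H \<zeta> \<partial>sphere_measure) \<le> ennreal C2 * weighted_integral p \<gamma> g"
      using C2(2)[OF g] by blast
    have pw: "norm (g z) \<le> A * (1 - norm z) powr (- ((?n + 1 + \<gamma>) / p))" if z: "norm z < 1" for z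
    proof -
      have "ennreal (norm (g z) powr p) \<le> ennreal (C1 * (1 - norm z) powr (- (?n + 1 + \<gamma>))) * ennreal K"
        using C1(2)[OF g z, unfolded of_nat_add of_nat_1] mult_left_mono[OF wg, of "ennreal (C1 * (1 - norm z) powr (- (?n + 1 + \<gamma>)))"] by (meson order_trans zero_le)
      also have "\<dots> = ennreal (C1 * K * (1 - norm z) powr (- (?n + 1 + \<gamma>)))"
        using C1 K by (simp add: ennreal_mult[symmetric] mult_ac)
      finally have "norm (g z) powr p \<le> C1 * K * (1 - norm z) powr (- (?n + 1 + \<gamma>))" using C1 K by simp
      also have "\<dots> = (A * (1 - norm z) powr (- ((?n + 1 + \<gamma>) / p))) powr p"
        using A p by (simp add: powr_mult powr_powr)
      finally show ?thesis by (rule powr_le_imp_le) (use p A in auto)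
    qed
    have point: "ennreal (norm (f (r *\<^sub>R \<zeta>)) powr q) \<le> ennreal (c4 * B powr q) + ennreal (c5 * (1 - t) powr (\<delta> * q)) * (H \<zeta> + 1)"
      if \<zeta>: "norm \<zeta> = 1" for \<zeta>
    proof (cases "H \<zeta> = top")
      case True
      define c where "c = c5 * (1 - t) powr (\<delta> * q)"
      have "c > 0" using c45 t by (simp add: c_def)
      then show ?thesis unfolding c_def[symmetric] using True by (simp add: ennreal_mult_top)
    next
      case False
      \<comment> \<open>the summand \<open>1\<close> makes \<open>X\<close> positive, as \<open>nn_integral_min_powr\<close> demands\<close>
      define X where "X = enn2real (H \<zeta>) + 1"
      have X: "X > 0" "ennreal X = H \<zeta> + 1" "H \<zeta> \<le> ennreal X"
        using False by (auto simp: X_def add_nonneg_pos less_top)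
      have g2: "norm (g (u *\<^sub>R \<zeta>)) \<le> X powr (1 / p) * (1 - u) powr (- ((\<gamma> + 1) / p))" if u: "1 / 2 \<le> u" "u < 1" for u
      proof -
        have "ennreal (norm (g (u *\<^sub>R \<zeta>)) powr p) \<le> ennreal ((1 - u) powr (- (\<gamma> + 1))) * ennreal X"
          using H[OF \<zeta> u] mult_left_mono[OF X(3), of "ennreal ((1 - u) powr (- (\<gamma> + 1)))"] by (meson order_trans zero_le)
        then have "norm (g (u *\<^sub>R \<zeta>)) powr p \<le> (1 - u) powr (- (\<gamma> + 1)) * X"
          using X(1) by (simp add: ennreal_mult[symmetric])
        also have "\<dots> = (X powr (1 / p) * (1 - u) powr (- ((\<gamma> + 1) / p))) powr p"
          using X p by (simp add: powr_mult powr_powr)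
        finally show ?thesis by (rule powr_le_imp_le) (use p in auto)
      qed
      let ?min = "\<lambda>s. min (A * s powr (- 1 - ?n / q)) (X powr (1 / p) * s powr (- 1 + \<kappa>))"
      have dom: "(1 - u) ^ M * norm (g (u *\<^sub>R \<zeta>)) \<le> (1 - t) powr \<delta> * ?min (1 - u)" if u: "t \<le> u" "u < 1" for u
      proof -
        let ?s = "1 - u"
        have s: "?s > 0" "?s \<le> 1 - t" using u by auto
        have sM: "?s ^ M = ?s powr real M" using s by (simp add: powr_realpow)
        have sd: "?s powr \<delta> \<le> (1 - t) powr \<delta>" using s \<delta> by (intro powr_mono2) auto
        have "?s ^ M * norm (g (u *\<^sub>R \<zeta>)) \<le> ?s powr real M * (A * ?s powr (- ((?n + 1 + \<gamma>) / p)))"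
          unfolding sM using pw[of "u *\<^sub>R \<zeta>"] u t \<zeta> by (intro mult_left_mono) auto
        also have "\<dots> = A * (?s powr real M * ?s powr (- ((?n + 1 + \<gamma>) / p)))" by (simp only: mult_ac)
        also have "?s powr real M * ?s powr (- ((?n + 1 + \<gamma>) / p)) = ?s powr \<delta> * ?s powr (- 1 - ?n / q)"
          unfolding powr_add[symmetric] e1 by simp
        also have "A * (?s powr \<delta> * ?s powr (- 1 - ?n / q)) \<le> A * ((1 - t) powr \<delta> * ?s powr (- 1 - ?n / q))"
          using A sd by (intro mult_left_mono mult_right_mono) auto
        finally have 1: "?s ^ M * norm (g (u *\<^sub>R \<zeta>)) \<le> (1 - t) powr \<delta> * (A * ?s powr (- 1 - ?n / q))" by (simp only: mult_ac)
        have "?s ^ M * norm (g (u *\<^sub>R \<zeta>)) \<le> ?s powr real M * (X powr (1 / p) * ?s powr (- ((\<gamma> + 1) / p)))"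
          unfolding sM using g2[of u] u t by (intro mult_left_mono) auto
        also have "\<dots> = X powr (1 / p) * (?s powr real M * ?s powr (- ((\<gamma> + 1) / p)))" by (simp only: mult_ac)
        also have "?s powr real M * ?s powr (- ((\<gamma> + 1) / p)) = ?s powr \<delta> * ?s powr (- 1 + \<kappa>)"
          unfolding powr_add[symmetric] e2 by simp
        also have "X powr (1 / p) * (?s powr \<delta> * ?s powr (- 1 + \<kappa>)) \<le> X powr (1 / p) * ((1 - t) powr \<delta> * ?s powr (- 1 + \<kappa>))"
          using sd by (intro mult_left_mono mult_right_mono) auto
        finally have 2: "?s ^ M * norm (g (u *\<^sub>R \<zeta>)) \<le> (1 - t) powr \<delta> * (X powr (1 / p) * ?s powr (- 1 + \<kappa>))" by (simp only: mult_ac)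
        show ?thesis using 1 2 by (simp add: min_def)
      qed
      have "(\<integral>\<^sup>+u. ennreal ((1 - u) ^ M * norm (g (u *\<^sub>R \<zeta>))) * indicator {t..r} u \<partial>lborel) \<le>
          (\<integral>\<^sup>+u. ennreal ((1 - t) powr \<delta>) * (ennreal (?min (1 - u)) * indicator {0<..} (1 - u)) \<partial>lborel)"
      proof (rule nn_integral_mono)
        fix u :: real
        show "ennreal ((1 - u) ^ M * norm (g (u *\<^sub>R \<zeta>))) * indicator {t..r} u \<le> ennreal ((1 - t) powr \<delta>) * (ennreal (?min (1 - u)) * indicator {0<..} (1 - u))"
        proof (cases "u \<in> {t..r}")
          case True
          then have u: "t \<le> u" "u < 1" using t by auto
          have "ennreal ((1 - u) ^ M * norm (g (u *\<^sub>R \<zeta>))) \<le> ennreal ((1 - t) powr \<delta>) * ennreal (?min (1 - u))"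
            using dom[OF u] A by (subst ennreal_mult[symmetric]) (auto intro!: ennreal_leI)
          then show ?thesis using True u by simp
        qed simp
      qed
      also have "\<dots> = ennreal ((1 - t) powr \<delta>) * (\<integral>\<^sup>+u. ennreal (?min (1 - u)) * indicator {0<..} (1 - u) \<partial>lborel)"
        by (rule nn_integral_cmult) measurable
      also have "(\<integral>\<^sup>+u. ennreal (?min (1 - u)) * indicator {0<..} (1 - u) \<partial>lborel) = (\<integral>\<^sup>+s. ennreal (?min s) * indicator {0<..} s \<partial>lborel)"
        by (rule nn_integral_reflect) measurable
      finally have I1: "(\<integral>\<^sup>+u. ennreal ((1 - u) ^ M * norm (g (u *\<^sub>R \<zeta>))) * indicator {t..r} u \<partial>lborel) \<le>
        ennreal ((1 - t) powr \<delta>) * (\<integral>\<^sup>+s. ennreal (?min s) * indicator {0<..} s \<partial>lborel)" .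
      have "(\<integral>\<^sup>+s. ennreal (?min s) * indicator {0<..} s \<partial>lborel) \<le>
         ennreal ((1 / (?n / q) + 1 / \<kappa>) * (A powr (\<kappa> / (?n / q + \<kappa>)) * (X powr (1 / p)) powr ((?n / q) / (?n / q + \<kappa>))))"
        by (rule nn_integral_min_powr) (use n q \<kappa> A X in auto)
      also have "(X powr (1 / p)) powr ((?n / q) / (?n / q + \<kappa>)) = X powr (1 / q)"
        unfolding nq\<kappa> using p q n by (simp add: powr_powr)
      also have "(1 / (?n / q) + 1 / \<kappa>) * (A powr (\<kappa> / (?n / q + \<kappa>)) * X powr (1 / q)) = c3 * X powr (1 / q)"
        unfolding nq\<kappa> c3_def by (simp only: mult.assoc)
      finally have I2: "(\<integral>\<^sup>+s. ennreal (?min s) * indicator {0<..} s \<partial>lborel) \<le> ennreal (c3 * X powr (1 / q))" .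
      let ?T = "(1 - t) powr \<delta> * (c3 * X powr (1 / q))"
      have I: "(\<integral>\<^sup>+u. ennreal ((1 - u) ^ M * norm (g (u *\<^sub>R \<zeta>))) * indicator {t..r} u \<partial>lborel) \<le> ennreal ?T"
        using I1 mult_left_mono[OF I2, of "ennreal ((1 - t) powr \<delta>)"] c3 by (simp add: ennreal_mult)
      have "ennreal (norm (f (r *\<^sub>R \<zeta>))) \<le> ennreal (2 ^ Suc M * B) + ennreal (2 ^ Suc M) * ennreal ?T"
        using radial_taylor[OF \<zeta> t(1) f t(2,3), of M B] B \<zeta> t mult_left_mono[OF I, of "ennreal (2 ^ Suc M)"]
        by (fold g_def) (auto intro: order_trans add_left_mono)
      also have "\<dots> = ennreal (2 ^ Suc M * B + 2 ^ Suc M * ?T)"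
        using B0 c3 by (simp add: ennreal_mult[symmetric] ennreal_plus[symmetric] del: ennreal_plus power_Suc)
      finally have "norm (f (r *\<^sub>R \<zeta>)) \<le> 2 ^ Suc M * B + 2 ^ Suc M * ?T"
        using B0 c3 by (subst (asm) ennreal_le_iff) auto
      then have "norm (f (r *\<^sub>R \<zeta>)) powr q \<le> (2 ^ Suc M * B + 2 ^ Suc M * ?T) powr q"
        using q by (intro powr_mono2) auto
      also have "\<dots> \<le> 2 powr q * ((2 ^ Suc M * B) powr q + (2 ^ Suc M * ?T) powr q)"
        using B0 c3 q by (intro powr_add_le) auto
      also have "(2 ^ Suc M * B) powr q = (2 ^ Suc M) powr q * B powr q" by (rule powr_mult)
      also have "2 ^ Suc M * ?T = (2 ^ Suc M * c3) * ((1 - t) powr \<delta> * X powr (1 / q))" by (simp only: mult_ac)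
      also have "((2 ^ Suc M * c3) * ((1 - t) powr \<delta> * X powr (1 / q))) powr q = (2 ^ Suc M * c3) powr q * ((1 - t) powr (\<delta> * q) * X)"
        using c3 X q by (simp add: powr_mult powr_powr)
      also have "2 powr q * ((2 ^ Suc M) powr q * B powr q + (2 ^ Suc M * c3) powr q * ((1 - t) powr (\<delta> * q) * X)) =
          c4 * B powr q + c5 * (1 - t) powr (\<delta> * q) * X"
        unfolding c4_def c5_def by (simp only: distrib_left mult_ac)
      finally have "ennreal (norm (f (r *\<^sub>R \<zeta>)) powr q) \<le> ennreal (c4 * B powr q + c5 * (1 - t) powr (\<delta> * q) * X)" by (rule ennreal_leI)
      also have "\<dots> = ennreal (c4 * B powr q) + ennreal (c5 * (1 - t) powr (\<delta> * q)) * (H \<zeta> + 1)"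
        unfolding X(2)[symmetric] using c45 X(1) by (simp add: ennreal_mult[symmetric] ennreal_plus[symmetric] del: ennreal_plus)
      finally show ?thesis .
    qed
    have "integral_mean q f r \<le> (\<integral>\<^sup>+\<zeta>. ennreal (c4 * B powr q) + ennreal (c5 * (1 - t) powr (\<delta> * q)) * (H \<zeta> + 1) \<partial>sphere_measure)"
      unfolding integral_mean_def by (intro nn_integral_mono point) simp
    also have "\<dots> = ennreal (c4 * B powr q) + ennreal (c5 * (1 - t) powr (\<delta> * q)) * ((\<integral>\<^sup>+\<zeta>. H \<zeta> \<partial>sphere_measure) + 1)"
      by (simp add: nn_integral_add nn_integral_cmult emeasure_sphere_measure)
    also have "\<dots> \<le> ennreal (c4 * B powr q) + ennreal (c5 * (1 - t) powr (\<delta> * q)) * ennreal (C2 * K + 1)"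
    proof (intro add_left_mono mult_left_mono)
      have "(\<integral>\<^sup>+\<zeta>. H \<zeta> \<partial>sphere_measure) \<le> ennreal C2 * ennreal K"
        using Hint mult_left_mono[OF wg, of "ennreal C2"] by (meson order_trans zero_le)
      then show "(\<integral>\<^sup>+\<zeta>. H \<zeta> \<partial>sphere_measure) + 1 \<le> ennreal (C2 * K + 1)"
        using C2 K by (simp add: ennreal_mult add_right_mono)
    qed simp
    also have "\<dots> = ennreal (c4 * B powr q + c5 * (1 - t) powr (\<delta> * q) * (C2 * K + 1))"
      using c45 C2 K by (simp add: ennreal_mult[symmetric] ennreal_plus[symmetric] del: ennreal_plus)
    also have "\<dots> \<le> ennreal ((c4 + c5 * (C2 * K + 1)) * (B powr q + (1 - t) powr (\<delta> * q)))"
    proof (rule ennreal_leI)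
      let ?a = "B powr q" and ?b = "(1 - t) powr (\<delta> * q)" and ?c = "c5 * (C2 * K + 1)"
      have "c5 * ?b * (C2 * K + 1) = ?c * ?b" by (simp only: mult_ac)
      moreover have "0 \<le> ?c" using c45 C2 K by simp
      ultimately show "c4 * ?a + c5 * ?b * (C2 * K + 1) \<le> (c4 + ?c) * (?a + ?b)"
        using c45 by (simp only: sum_prod_le less_imp_le powr_ge_zero)
    qed
    finally show "integral_mean q f r \<le> ennreal ((c4 + c5 * (C2 * K + 1)) * (B powr q + (1 - t) powr (\<delta> * q)))" .
  qed
qed

section \<open>Caps and kernel integrals on the sphere\<close>

definition cap :: "'n \<Rightarrow> real \<Rightarrow> (complex ^ 'n) set" where
  "cap k d = {z. norm (1 - z $ k) < d}"

lemma cap_borel[measurable]: "cap k d \<in> sets (borel :: (complex ^ 'n) measure)"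
proof -
  have "open (cap k d :: (complex ^ 'n) set)"
    unfolding cap_def by (intro open_Collect_less continuous_intros)
  then show ?thesis by simp
qed

text \<open>
  The non-isotropic dilation of factor \<open>d\<close> maps a fixed ball onto a set that contains this part of the unit
  ball: \<open>|w\<^sub>k - 1| < d\<close> and \<open>|w| < 1\<close> force the other coordinates to be of the order of \<open>sqrt d\<close>.
\<close>

lemma ball_cap_volume:
  fixes d :: real and k :: "'n::finite"
  assumes d: "0 < d" "d \<le> 1"
  shows "(\<integral>\<^sup>+z. indicator (cap k d) z * indicator unit_ball z \<partial>lborel) \<le>
    ennreal (d ^ (CARD('n) + 1)) * emeasure lborel (ball (0 :: complex ^ 'n) 2)"
proof -
  let ?F = "\<lambda>z :: complex ^ 'n. indicator (cap k d) z * indicator unit_ball z :: ennreal"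
  have "(\<integral>\<^sup>+z. ?F z \<partial>lborel) = ennreal (d ^ (CARD('n) + 1)) * (\<integral>\<^sup>+u. ?F (axis k 1 + dilation k d u) \<partial>lborel)"
  proof (rule nn_integral_dilation[symmetric, OF _ d(1)])
    have "unit_ball \<in> sets (borel :: (complex ^ 'n) measure)" by simp
    then show "?F \<in> borel_measurable borel" by (intro borel_measurable_times_ennreal borel_measurable_indicator cap_borel)
  qed
  also have "(\<integral>\<^sup>+u. ?F (axis k 1 + dilation k d u) \<partial>lborel) \<le> (\<integral>\<^sup>+u. indicator (ball (0 :: complex ^ 'n) 2) u \<partial>lborel)"
  proof (rule nn_integral_mono)
    fix u :: "complex ^ 'n"
    let ?w = "axis k 1 + dilation k d u"
    show "?F ?w \<le> indicator (ball 0 2) u"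
    proof (cases "?w \<in> cap k d \<and> ?w \<in> unit_ball")
      case True
      have wk: "?w $ k = 1 + of_real d * u $ k"
        by (simp add: dilation_def axis_def scaleR_conv_of_real[where 'a=complex])
      have wj: "?w $ j = of_real (sqrt d) * u $ j" if "j \<noteq> k" for j
        using that by (simp add: dilation_def axis_def scaleR_conv_of_real[where 'a=complex])
      have "norm (1 - ?w $ k) < d" using True by (simp add: cap_def)
      then have "d * norm (u $ k) < d * 1" unfolding wk using d by (simp add: norm_mult)
      then have uk: "norm (u $ k) < 1" using d by (simp only: mult_less_cancel_left_pos)
      have dk: "d * norm (u $ k) \<le> d" using uk d by simp
      then have dk1: "d * norm (u $ k) \<le> 1" using d by linarith
      have "1 - d * norm (u $ k) \<le> norm (?w $ k)"
        unfolding wk using norm_diff_ineq[of 1 "of_real d * u $ k"] d by (simp add: norm_mult)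
      then have "(1 - d * norm (u $ k))\<^sup>2 \<le> (norm (?w $ k))\<^sup>2" using dk1 by (intro power_mono) auto
      moreover have "1 - 2 * d \<le> (1 - d * norm (u $ k))\<^sup>2"
      proof -
        have "(1 - d * norm (u $ k))\<^sup>2 = 1 - 2 * (d * norm (u $ k)) + (d * norm (u $ k))\<^sup>2"
          by (simp add: power2_eq_square algebra_simps)
        then show ?thesis using dk zero_le_power2[of "d * norm (u $ k)"] by linarith
      qed
      moreover have "(norm ?w)\<^sup>2 = (norm (?w $ k))\<^sup>2 + (\<Sum>j\<in>UNIV - {k}. (norm (?w $ j))\<^sup>2)"
        using sum.remove[of UNIV k "\<lambda>j. (norm (?w $ j))\<^sup>2"] by (simp add: power2_norm_vec[of ?w])
      moreover have "(norm ?w)\<^sup>2 < 1" using True by (simp add: power_less_one_iff abs_square_less_1)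
      moreover have "(\<Sum>j\<in>UNIV - {k}. (norm (?w $ j))\<^sup>2) = d * (\<Sum>j\<in>UNIV - {k}. (norm (u $ j))\<^sup>2)"
        unfolding sum_distrib_left
      proof (rule sum.cong)
        fix j assume "j \<in> UNIV - {k}"
        then have "j \<noteq> k" by simp
        then show "(norm (?w $ j))\<^sup>2 = d * (norm (u $ j))\<^sup>2"
          unfolding wj[OF \<open>j \<noteq> k\<close>] using d by (simp add: norm_mult power_mult_distrib)
      qed simp
      ultimately have "d * (\<Sum>j\<in>UNIV - {k}. (norm (u $ j))\<^sup>2) < d * 2" by linarith
      then have "(\<Sum>j\<in>UNIV - {k}. (norm (u $ j))\<^sup>2) < 2" using d by (simp only: mult_less_cancel_left_pos)
      moreover have "(norm u)\<^sup>2 = (norm (u $ k))\<^sup>2 + (\<Sum>j\<in>UNIV - {k}. (norm (u $ j))\<^sup>2)"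
        using sum.remove[of UNIV k "\<lambda>j. (norm (u $ j))\<^sup>2"] by (simp add: power2_norm_vec[of u])
      moreover have "(norm (u $ k))\<^sup>2 \<le> 1" using uk by (simp add: power_le_one)
      ultimately have "(norm u)\<^sup>2 < 2\<^sup>2" by simp
      then have "norm u < 2" by (rule power2_less_imp_less) simp
      then show ?thesis using True by simp
    qed (auto simp: indicator_def)
  qed
  also have "(\<integral>\<^sup>+u. indicator (ball (0 :: complex ^ 'n) 2) u \<partial>lborel) = emeasure lborel (ball (0 :: complex ^ 'n) 2)" by simp
  finally show ?thesis by (simp add: mult_left_mono)
qed

text \<open>
  Over the cap of size \<open>d\<close> on the sphere, the shell of thickness \<open>d\<close> lies in the cap of size \<open>2 d\<close> of the ball.
  Comparison of volumes gives the measure up to a factor \<open>d\<close>; for \<open>d > 1/2\<close> a large constant suffices.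
\<close>

lemma sphere_cap:
  fixes k :: "'n::finite"
  obtains C where "C > 0" "\<And>d. 0 < d \<Longrightarrow> (\<integral>\<^sup>+\<zeta>. indicator (cap k d) \<zeta> \<partial>(sphere_measure :: (complex ^ 'n) measure)) \<le> ennreal (C * d ^ CARD('n))"
proof -
  let ?S = "sphere_measure :: (complex ^ 'n) measure"
  let ?V = "ball_volume TYPE('n)"
  obtain V where V: "V > 0" "?V = ennreal V"
    using ball_volume_pos[where 'n='n] ball_volume_finite[where 'n='n]
    by (cases ?V) (auto simp: less_le)
  obtain V2 where V2: "V2 \<ge> 0" "emeasure lborel (ball (0 :: complex ^ 'n) 2) = ennreal V2"
    using emeasure_lborel_ball_finite[of "0 :: complex ^ 'n" 2]
    by (cases "emeasure lborel (ball (0 :: complex ^ 'n) 2)") auto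
  define c where "c = V * (2 * CARD('n) * (1 / 2) ^ (2 * CARD('n) - 1))"
  have c: "c > 0" using V by (simp add: c_def)
  define C where "C = 2 ^ (CARD('n) + 1) * V2 / c + 2 ^ CARD('n)"
  show thesis
  proof (rule that[of C])
    show "C > 0" using c V2 by (simp add: C_def add_nonneg_pos)
    fix d :: real assume d: "0 < d"
    let ?s = "\<integral>\<^sup>+\<zeta>. indicator (cap k d) \<zeta> \<partial>?S"
    show "?s \<le> ennreal (C * d ^ CARD('n))"
    proof (cases "d \<le> 1 / 2")
      case False
      have "?s \<le> (\<integral>\<^sup>+\<zeta>. 1 \<partial>?S)" by (intro nn_integral_mono) (simp add: indicator_def)
      also have "\<dots> = 1" by (simp add: emeasure_sphere_measure)
      also have "1 \<le> ennreal (C * d ^ CARD('n))"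
      proof -
        have "1 \<le> (2 * d) ^ CARD('n)" using False by (intro one_le_power) simp
        also have "\<dots> = 2 ^ CARD('n) * d ^ CARD('n)" by (simp add: power_mult_distrib)
        also have "\<dots> \<le> C * d ^ CARD('n)" using d c V2 by (intro mult_right_mono) (auto simp: C_def)
        finally show ?thesis using ennreal_leI by fastforce
      qed
      finally show ?thesis .
    next
      case True
      have "ennreal (c * d) * ?s = ?V * (ennreal (2 * CARD('n) * (1 / 2) ^ (2 * CARD('n) - 1)) * ?s * ennreal d)"
      proof -
        have "ennreal (2 * CARD('n) * (1 / 2) ^ (2 * CARD('n) - 1)) * ?s * ennreal d = ennreal (2 * CARD('n) * (1 / 2) ^ (2 * CARD('n) - 1) * d) * ?s"
          using d by (subst ennreal_mult) (simp_all add: mult_ac)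
        moreover have "?V * (ennreal (2 * CARD('n) * (1 / 2) ^ (2 * CARD('n) - 1) * d) * ?s) = ennreal (c * d) * ?s"
          unfolding V(2) c_def using V d by (subst ennreal_mult_assoc) (simp_all add: mult.assoc)
        ultimately show ?thesis by simp
      qed
      also have "\<dots> = ?V * (\<integral>\<^sup>+r. ennreal (2 * CARD('n) * (1 / 2) ^ (2 * CARD('n) - 1)) * ?s * indicator {1 - d<..<1} (r::real) \<partial>lborel)"
        using d by (subst nn_integral_cmult_indicator) simp_all
      also have "\<dots> \<le> ?V * (\<integral>\<^sup>+r. ennreal (2 * CARD('n) * r ^ (2 * CARD('n) - 1)) * indicator {0<..<1} r *
       (\<integral>\<^sup>+\<zeta>. indicator (cap k (2 * d)) (r *\<^sub>R \<zeta>) \<partial>?S) \<partial>lborel)"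
      proof (rule mult_left_mono, rule nn_integral_mono)
        fix r :: real
        show "ennreal (2 * CARD('n) * (1 / 2) ^ (2 * CARD('n) - 1)) * ?s * indicator {1 - d<..<1} r \<le>
            ennreal (2 * CARD('n) * r ^ (2 * CARD('n) - 1)) * indicator {0<..<1} r * (\<integral>\<^sup>+\<zeta>. indicator (cap k (2 * d)) (r *\<^sub>R \<zeta>) \<partial>?S)"
        proof (cases "r \<in> {1 - d<..<1}")
          case r: True
          have 1: "?s \<le> (\<integral>\<^sup>+\<zeta>. indicator (cap k (2 * d)) (r *\<^sub>R \<zeta>) \<partial>?S)"
          proof (rule nn_integral_mono)
            fix \<zeta> :: "complex ^ 'n" assume "\<zeta> \<in> space ?S"
            then have \<zeta>: "norm (\<zeta> $ k) \<le> 1" using Finite_Cartesian_Product.norm_nth_le[of \<zeta> k] by simp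
            have "norm (1 - (r *\<^sub>R \<zeta>) $ k) \<le> norm (1 - \<zeta> $ k) + norm ((1 - r) *\<^sub>R \<zeta> $ k)"
              using norm_triangle_ineq[of "1 - \<zeta> $ k" "(1 - r) *\<^sub>R \<zeta> $ k"] by (simp add: scaleR_left_diff_distrib)
            also have "norm ((1 - r) *\<^sub>R \<zeta> $ k) \<le> (1 - r) * 1"
              unfolding norm_scaleR using r \<zeta> by (intro mult_mono) auto
            finally have "norm (1 - (r *\<^sub>R \<zeta>) $ k) \<le> norm (1 - \<zeta> $ k) + (1 - r)" by simp
            then show "indicator (cap k d) \<zeta> \<le> (indicator (cap k (2 * d)) (r *\<^sub>R \<zeta>) :: ennreal)"
              using r by (auto simp: indicator_def cap_def)
          qed
          have 2: "ennreal (2 * CARD('n) * (1 / 2) ^ (2 * CARD('n) - 1)) \<le> ennreal (2 * CARD('n) * r ^ (2 * CARD('n) - 1))"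
            using r True by (intro ennreal_leI mult_left_mono power_mono) auto
          show ?thesis using mult_mono[OF 2 1] r True by simp
        qed simp
      qed simp
      also have "\<dots> = (\<integral>\<^sup>+z. indicator (cap k (2 * d)) z * indicator unit_ball z \<partial>(lborel :: (complex ^ 'n) measure))"
        by (rule nn_integral_polar[symmetric]) measurable
      also have "\<dots> \<le> ennreal ((2 * d) ^ (CARD('n) + 1)) * ennreal V2"
        unfolding V2(2)[symmetric] using d True by (intro ball_cap_volume) auto
      finally have *: "ennreal (c * d) * ?s \<le> ennreal ((2 * d) ^ (CARD('n) + 1)) * ennreal V2" .
      have "?s = ennreal (1 / (c * d)) * (ennreal (c * d) * ?s)"
        using c d by (subst ennreal_mult_assoc) simp_all
      also have "\<dots> \<le> ennreal (1 / (c * d)) * (ennreal ((2 * d) ^ (CARD('n) + 1)) * ennreal V2)"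
        by (rule mult_left_mono[OF *]) simp
      also have "\<dots> = ennreal (2 ^ (CARD('n) + 1) * V2 / c * d ^ CARD('n))"
        using c d V2 by (simp add: ennreal_mult[symmetric] power_mult_distrib)
      also have "\<dots> \<le> ennreal (C * d ^ CARD('n))"
        using d by (intro ennreal_leI mult_right_mono) (auto simp: C_def)
      finally show ?thesis .
    qed
  qed
qed

text \<open>
  Dyadic decomposition into the sets where \<open>|1 - r \<zeta>\<^sub>k|\<close> is comparable to \<open>2\<^sup>j (1 - r)\<close>. Each is contained in a
  cap of size \<open>2\<^bsup>j+2\<^esup> (1 - r)\<close>, and the estimates form a geometric series of ratio \<open>2\<^bsup>n-m\<^esup> < 1\<close>.
\<close>

lemma sphere_kernel_integral:
  fixes m :: real and k :: "'n::finite"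
  assumes m: "m > CARD('n)"
  obtains C where "C > 0" "\<And>r. 0 \<le> r \<Longrightarrow> r < 1 \<Longrightarrow>
    (\<integral>\<^sup>+\<zeta>. ennreal (norm (1 - of_real r * \<zeta> $ k) powr (- m)) \<partial>(sphere_measure :: (complex ^ 'n) measure)) \<le> ennreal (C * (1 - r) powr (CARD('n) - m))"
proof -
  let ?S = "sphere_measure :: (complex ^ 'n) measure"
  let ?n = "real CARD('n)"
  obtain C0 where C0: "C0 > 0" "\<And>d. 0 < d \<Longrightarrow> (\<integral>\<^sup>+\<zeta>. indicator (cap k d) \<zeta> \<partial>?S) \<le> ennreal (C0 * d ^ CARD('n))"
    by (rule sphere_cap[of k], rule that)
  define \<theta> where "\<theta> = 2 powr (?n - m)"
  have \<theta>: "0 < \<theta>" "\<theta> < 1" using m by (auto simp: \<theta>_def powr_less_one)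
  show thesis
  proof (rule that[of "C0 * 4 ^ CARD('n) / (1 - \<theta>)"])
    show "C0 * 4 ^ CARD('n) / (1 - \<theta>) > 0" using C0 \<theta> by simp
    fix r :: real assume r: "0 \<le> r" "r < 1"
    define d where "d = 1 - r"
    have d: "d > 0" using r by (simp add: d_def)
    have term_le: "f j \<le> (\<Sum>j. f j)" for f :: "nat \<Rightarrow> ennreal" and j
      using sum_le_suminf[of f "{j}"] by simp
    let ?a = "\<lambda>j. ennreal ((2 ^ j * d) powr (- m))"
    have "(\<integral>\<^sup>+\<zeta>. ennreal (norm (1 - of_real r * \<zeta> $ k) powr (- m)) \<partial>?S) \<le>
        (\<integral>\<^sup>+\<zeta>. (\<Sum>j. ?a j * indicator (cap k (2 ^ (j + 2) * d)) \<zeta>) \<partial>?S)"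
    proof (rule nn_integral_mono)
      fix \<zeta> :: "complex ^ 'n" assume "\<zeta> \<in> space ?S"
      then have \<zeta>: "norm (\<zeta> $ k) \<le> 1" using Finite_Cartesian_Product.norm_nth_le[of \<zeta> k] by simp
      define x where "x = norm (1 - of_real r * \<zeta> $ k)"
      have "norm (of_real r * \<zeta> $ k) \<le> r * 1" unfolding norm_mult using r \<zeta> by (intro mult_mono) auto
      then have x: "d \<le> x" unfolding x_def d_def using norm_triangle_ineq2[of 1 "of_real r * \<zeta> $ k"] by simp
      have near: "norm (1 - \<zeta> $ k) \<le> 2 * x"
      proof -
        have "norm (1 - \<zeta> $ k) \<le> x + norm ((1 - r) *\<^sub>R \<zeta> $ k)"
          unfolding x_def using norm_triangle_ineq4[of "1 - of_real r * \<zeta> $ k" "(1 - r) *\<^sub>R \<zeta> $ k"]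
          by (simp add: scaleR_conv_of_real algebra_simps)
        also have "norm ((1 - r) *\<^sub>R \<zeta> $ k) \<le> (1 - r) * 1"
          unfolding norm_scaleR using r \<zeta> by (intro mult_mono) auto
        finally show ?thesis using x by (simp add: d_def)
      qed
      define j where "j = nat \<lfloor>log 2 (x / d)\<rfloor>"
      have l: "0 \<le> log 2 (x / d)" using x d by (intro zero_le_log_cancel_iff[THEN iffD2]) auto
      have j: "real j \<le> log 2 (x / d)" "log 2 (x / d) < real j + 1" using l by (simp_all add: j_def of_nat_nat)
      have "2 powr real j \<le> x / d" using j(1) x d by (subst (asm) le_log_iff) auto
      then have j1: "2 ^ j * d \<le> x" using d by (simp add: powr_realpow field_simps)
      have "x / d < 2 powr (real j + 1)" using j(2) x d by (subst (asm) log_less_iff) auto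
      then have j2: "x < 2 ^ (j + 1) * d" using d by (simp add: powr_add powr_realpow field_simps)
      have "ennreal (x powr (- m)) \<le> ?a j * indicator (cap k (2 ^ (j + 2) * d)) \<zeta>"
      proof -
        have "x powr (- m) \<le> (2 ^ j * d) powr (- m)" using j1 d m by (intro powr_mono2') auto
        moreover have "\<zeta> \<in> cap k (2 ^ (j + 2) * d)" using near j2 by (simp add: cap_def)
        ultimately show ?thesis by (simp add: ennreal_leI)
      qed
      also have "\<dots> \<le> (\<Sum>j. ?a j * indicator (cap k (2 ^ (j + 2) * d)) \<zeta>)"
        by (rule term_le)
      finally show "ennreal (norm (1 - of_real r * \<zeta> $ k) powr (- m)) \<le> (\<Sum>j. ?a j * indicator (cap k (2 ^ (j + 2) * d)) \<zeta>)"
        by (simp only: x_def)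
    qed
    also have "\<dots> = (\<Sum>j. \<integral>\<^sup>+\<zeta>. ?a j * indicator (cap k (2 ^ (j + 2) * d)) \<zeta> \<partial>?S)"
      by (rule nn_integral_suminf) measurable
    also have "\<dots> \<le> (\<Sum>j. ennreal (C0 * 4 ^ CARD('n) * d powr (?n - m) * \<theta> ^ j))"
    proof (rule suminf_le)
      fix j
      have "(\<integral>\<^sup>+\<zeta>. ?a j * indicator (cap k (2 ^ (j + 2) * d)) \<zeta> \<partial>?S) = ?a j * (\<integral>\<^sup>+\<zeta>. indicator (cap k (2 ^ (j + 2) * d)) \<zeta> \<partial>?S)"
        by (rule nn_integral_cmult) measurable
      also have "\<dots> \<le> ?a j * ennreal (C0 * (2 ^ (j + 2) * d) ^ CARD('n))"
        using d by (intro mult_left_mono C0(2)) auto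
      also have "\<dots> = ennreal ((2 ^ j * d) powr (- m) * (C0 * (2 ^ (j + 2) * d) ^ CARD('n)))"
        using C0 d by (subst ennreal_mult) auto
      also have "(2 ^ j * d) powr (- m) * (C0 * (2 ^ (j + 2) * d) ^ CARD('n)) = C0 * 4 ^ CARD('n) * d powr (?n - m) * \<theta> ^ j"
      proof -
        have e1: "(2 ^ (j + 2) * d) ^ CARD('n) = 4 ^ CARD('n) * (2 ^ j * d) powr ?n"
          using d by (simp add: powr_realpow power_add power_mult_distrib)
        have e2: "(2 ^ j * d) powr (- m) * (2 ^ j * d) powr ?n = (2 ^ j * d) powr (?n - m)"
          by (simp add: powr_add[symmetric])
        have e3: "(2 ^ j * d) powr (?n - m) = \<theta> ^ j * d powr (?n - m)"
        proof -
          have "(2 ^ j :: real) powr (?n - m) = \<theta> ^ j"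
            unfolding \<theta>_def by (simp add: powr_realpow[symmetric] powr_powr powr_power mult.commute)
          then show ?thesis using d by (simp add: powr_mult)
        qed
        have "(2 ^ j * d) powr (- m) * (C0 * (2 ^ (j + 2) * d) ^ CARD('n)) =
            C0 * 4 ^ CARD('n) * ((2 ^ j * d) powr (- m) * (2 ^ j * d) powr ?n)"
          unfolding e1 by (simp only: mult_ac)
        then show ?thesis unfolding e2 e3 by (simp only: mult_ac)
      qed
      finally show "(\<integral>\<^sup>+\<zeta>. ?a j * indicator (cap k (2 ^ (j + 2) * d)) \<zeta> \<partial>?S) \<le> ennreal (C0 * 4 ^ CARD('n) * d powr (?n - m) * \<theta> ^ j)" .
    qed auto
    also have "\<dots> = ennreal (C0 * 4 ^ CARD('n) * d powr (?n - m) * (1 / (1 - \<theta>)))"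
    proof (rule suminf_ennreal_eq)
      show "(\<lambda>j. C0 * 4 ^ CARD('n) * d powr (?n - m) * \<theta> ^ j) sums (C0 * 4 ^ CARD('n) * d powr (?n - m) * (1 / (1 - \<theta>)))"
        using \<theta> by (intro sums_mult geometric_sums) auto
    qed (use C0 \<theta> in auto)
    also have "C0 * 4 ^ CARD('n) * d powr (?n - m) * (1 / (1 - \<theta>)) = C0 * 4 ^ CARD('n) / (1 - \<theta>) * (1 - r) powr (?n - m)"
      by (simp add: d_def)
    finally show "(\<integral>\<^sup>+\<zeta>. ennreal (norm (1 - of_real r * \<zeta> $ k) powr (- m)) \<partial>?S) \<le> ennreal (C0 * 4 ^ CARD('n) / (1 - \<theta>) * (1 - r) powr (CARD('n) - m))" .
  qed
qed

section \<open>Powers of the Cauchy kernel\<close>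

definition pow_fun :: "'n \<Rightarrow> real \<Rightarrow> real \<Rightarrow> complex ^ 'n \<Rightarrow> complex" where
  "pow_fun k b \<rho> z = (1 - of_real \<rho> * z $ k) powr (- of_real b)"

lemma norm_powr_of_real:
  fixes z :: complex
  shows "z \<noteq> 0 \<Longrightarrow> norm (z powr of_real x) = norm z powr x"
  using norm_powr_real_powr'[of "of_real x" z] by simp

lemma norm_coord_less:
  fixes z :: "complex ^ 'n"
  assumes \<rho>: "0 \<le> \<rho>" "\<rho> \<le> 1" and z: "norm z < 1"
  shows "norm (of_real \<rho> * z $ k) < 1"
proof -
  have "norm (of_real \<rho> * z $ k) \<le> 1 * norm (z $ k)"
    unfolding norm_mult using \<rho> by (intro mult_right_mono) auto
  then show ?thesis using Finite_Cartesian_Product.norm_nth_le[of z k] z by simp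
qed

lemma one_minus_pos:
  fixes w :: complex
  assumes "norm w < 1"
  shows "1 - w \<notin> \<real>\<^sub>\<le>\<^sub>0" "1 - w \<noteq> 0"
proof -
  have "Re w < 1" using assms abs_Re_le_cmod[of w] by linarith
  then show "1 - w \<notin> \<real>\<^sub>\<le>\<^sub>0" "1 - w \<noteq> 0" by (auto simp: complex_nonpos_Reals_iff)
qed

lemma has_derivative_coord:
  fixes z :: "complex ^ 'n"
  assumes "(\<psi> has_field_derivative D) (at (of_real \<rho> * z $ k))"
  shows "((\<lambda>z :: complex ^ 'n. \<psi> (of_real \<rho> * z $ k)) has_derivative (\<lambda>v. D * (of_real \<rho> * v $ k))) (at z)"
proof -
  have "((\<lambda>z :: complex ^ 'n. of_real \<rho> * z $ k) has_derivative (\<lambda>v. of_real \<rho> * v $ k)) (at z)"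
    by (intro has_derivative_mult_right bounded_linear_imp_has_derivative bounded_linear_vec_nth)
  from has_derivative_compose[OF this assms[unfolded has_field_derivative_def]] show ?thesis .
qed

text \<open>
  Multiplied by \<open>w\<close>, this derivative is a combination of two functions of the same form, with exponents
  \<open>j\<close> and \<open>j + 1\<close>. The recursion for \<open>radial_coeff\<close> records the coefficients.
\<close>

lemma pow_term_deriv:
  fixes w :: complex and b :: real and j :: nat
  assumes w: "norm w < 1"
  shows "((\<lambda>w. w ^ j * (1 - w) powr (- of_real (b + j))) has_field_derivative
    (of_nat j * w ^ (j - 1) * (1 - w) powr (- of_real (b + j)) + w ^ j * (of_real (b + j) * (1 - w) powr (- of_real (b + Suc j))))) (at w)"
proof -
  have d0: "((\<lambda>w. (1 - w) powr (- e)) has_field_derivative (- e * (1 - w) powr (- e - 1)) * (0 - 1)) (at w)" for e :: complex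
    by (rule DERIV_chain2[where f="\<lambda>u. u powr (- e)" and g="\<lambda>w. 1 - w", OF has_field_derivative_powr[OF one_minus_pos(1)[OF w]]])
      (intro derivative_intros)
  have e: "- complex_of_real (b + j) - 1 = - of_real (b + Suc j)" by simp
  have d: "((\<lambda>w. (1 - w) powr (- of_real (b + j))) has_field_derivative
      of_real (b + j) * (1 - w) powr (- of_real (b + Suc j))) (at w)"
    using d0[of "of_real (b + j)"] unfolding e
    by (simp only: diff_0 mult_minus_left mult_minus_right minus_minus mult_1_right)
  show ?thesis
    by (rule derivative_eq_intros d refl)+ simp
qed

fun radial_coeff :: "real \<Rightarrow> nat \<Rightarrow> nat \<Rightarrow> real" where
  "radial_coeff b 0 j = (if j = 0 then 1 else 0)"
| "radial_coeff b (Suc N) j = real j * radial_coeff b N j + (if j = 0 then 0 else (b + real j - 1) * radial_coeff b N (j - 1))"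

lemma radial_coeff_nonneg: "b > 0 \<Longrightarrow> 0 \<le> radial_coeff b N j"
  by (induction N arbitrary: j) (auto intro!: add_nonneg_nonneg mult_nonneg_nonneg)

lemma radial_coeff_zero: "N < j \<Longrightarrow> radial_coeff b N j = 0"
  by (induction N arbitrary: j) auto

lemma radial_coeff_top: "b > 0 \<Longrightarrow> 0 < radial_coeff b N N"
  by (induction N) (auto simp: radial_coeff_zero intro!: mult_pos_pos)

lemma radial_pow_fun:
  fixes z :: "complex ^ 'n"
  assumes \<rho>: "0 \<le> \<rho>" "\<rho> \<le> 1" and z: "norm z < 1"
  shows "(radial_deriv ^^ N) (pow_fun k b \<rho>) z =
      (\<Sum>j\<le>N. of_real (radial_coeff b N j) * ((of_real \<rho> * z $ k) ^ j * (1 - of_real \<rho> * z $ k) powr (- of_real (b + j))))"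
  using z
proof (induction N arbitrary: z)
  case 0
  then show ?case by (simp add: pow_fun_def)
next
  case (Suc N)
  define T where "T j w = w ^ j * (1 - w) powr (- of_real (b + real j))" for j and w :: complex
  define T' where "T' j w = of_nat j * w ^ (j - 1) * (1 - w) powr (- of_real (b + j)) + w ^ j * (of_real (b + j) * (1 - w) powr (- of_real (b + Suc j)))" for j and w :: complex
  let ?a = "radial_coeff b N"
  let ?w = "of_real \<rho> * z $ k"
  have w: "norm ?w < 1" by (rule norm_coord_less[OF \<rho> Suc(2)])
  have "((\<lambda>z :: complex ^ 'n. \<Sum>j\<le>N. of_real (?a j) * T j (of_real \<rho> * z $ k)) has_derivative
      (\<lambda>v. \<Sum>j\<le>N. of_real (?a j) * (T' j ?w * (of_real \<rho> * v $ k)))) (at z)"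
  proof (intro has_derivative_sum has_derivative_mult_right has_derivative_coord)
    fix j
    show "(T j has_field_derivative T' j ?w) (at ?w)"
      using pow_term_deriv[OF w, of j b] by (simp add: T_def[abs_def] T'_def)
  qed
  then have d: "((radial_deriv ^^ N) (pow_fun k b \<rho>) has_derivative
      (\<lambda>v. \<Sum>j\<le>N. of_real (?a j) * (T' j ?w * (of_real \<rho> * v $ k)))) (at z)"
    by (rule has_derivative_transform_within_open[OF _ open_ball[of 0 1]]) (use Suc in \<open>auto simp: T_def\<close>)
  have "(radial_deriv ^^ Suc N) (pow_fun k b \<rho>) z = (\<Sum>j\<le>N. of_real (?a j) * (T' j ?w * ?w))"
    using radial_deriv_eq[OF d] by (simp add: sum_distrib_left mult_ac)
  also have "\<dots> = (\<Sum>j\<le>N. of_real (real j * ?a j) * T j ?w) + (\<Sum>j\<le>N. of_real ((b + j) * ?a j) * T (Suc j) ?w)"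
    unfolding sum.distrib[symmetric]
  proof (rule sum.cong)
    fix j
    have "T' j ?w * ?w = of_nat j * T j ?w + of_real (b + j) * T (Suc j) ?w"
      unfolding T_def T'_def by (cases j) (simp_all add: algebra_simps)
    then show "of_real (?a j) * (T' j ?w * ?w) = of_real (real j * ?a j) * T j ?w + of_real ((b + j) * ?a j) * T (Suc j) ?w"
      by (simp add: algebra_simps)
  qed simp
  also have "(\<Sum>j\<le>N. of_real (real j * ?a j) * T j ?w) = (\<Sum>j\<le>Suc N. of_real (real j * ?a j) * T j ?w)"
    by (simp add: radial_coeff_zero)
  also have "(\<Sum>j\<le>N. of_real ((b + j) * ?a j) * T (Suc j) ?w) =
      (\<Sum>j\<le>Suc N. of_real (if j = 0 then 0 else (b + real j - 1) * ?a (j - 1)) * T j ?w)"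
    by (subst sum.atMost_Suc_shift) simp
  also have "(\<Sum>j\<le>Suc N. of_real (real j * ?a j) * T j ?w) + \<dots> = (\<Sum>j\<le>Suc N. of_real (radial_coeff b (Suc N) j) * T j ?w)"
    unfolding sum.distrib[symmetric] by (intro sum.cong) (simp_all add: distrib_right)
  finally show ?case by (simp only: T_def)
qed

lemma holomorphic_pow_fun:
  assumes \<rho>: "0 \<le> \<rho>" "\<rho> \<le> 1"
  shows "holomorphic_vec_on (pow_fun k b \<rho> :: complex ^ 'n \<Rightarrow> complex) unit_ball"
  unfolding holomorphic_vec_on_def
proof
  fix z :: "complex ^ 'n" assume "z \<in> unit_ball"
  then have "norm (of_real \<rho> * z $ k) < 1" by (intro norm_coord_less[OF \<rho>]) simp
  from has_derivative_coord[OF pow_term_deriv[OF this, of 0 b]]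
  show "\<exists>D. (pow_fun k b \<rho> has_derivative D) (at z) \<and> (\<forall>c v. D (c *s v) = c * D v)"
    by (intro exI[of _ "\<lambda>v. (of_nat 0 * (of_real \<rho> * z $ k) ^ (0 - 1) * (1 - of_real \<rho> * z $ k) powr - of_real (b + real 0) +
        (of_real \<rho> * z $ k) ^ 0 * (of_real (b + real 0) * (1 - of_real \<rho> * z $ k) powr - of_real (b + real (Suc 0)))) * (of_real \<rho> * v $ k)"] conjI)
      (simp_all add: pow_fun_def[abs_def])
qed

text \<open>
  In \<open>radial_pow_fun\<close> the term \<open>j = N\<close> dominates, because \<open>|1 - w| \<le> 2\<close>.
\<close>

lemma norm_radial_pow_fun_le:
  fixes b :: real and k :: "'n::finite"
  assumes b: "b > 0"
  obtains C where "C > 0" "\<And>\<rho> z. 0 \<le> \<rho> \<Longrightarrow> \<rho> \<le> 1 \<Longrightarrow> norm z < 1 \<Longrightarrow>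
    norm ((radial_deriv ^^ N) (pow_fun k b \<rho>) (z :: complex ^ 'n)) \<le> C * norm (1 - of_real \<rho> * z $ k) powr (- (b + N))"
proof (rule that)
  let ?a = "radial_coeff b N"
  show "(\<Sum>j\<le>N. ?a j) * 2 ^ N > 0"
  proof (rule mult_pos_pos)
    show "(\<Sum>j\<le>N. ?a j) > 0"
      using radial_coeff_top[OF b, of N] radial_coeff_nonneg[OF b] by (intro sum_pos2[of _ N]) auto
  qed simp
  fix \<rho> :: real and z :: "complex ^ 'n"
  assume \<rho>: "0 \<le> \<rho>" "\<rho> \<le> 1" and z: "norm z < 1"
  define w where "w = of_real \<rho> * z $ k"
  have w: "norm w < 1" unfolding w_def by (rule norm_coord_less[OF \<rho> z])
  have nz: "1 - w \<noteq> 0" by (rule one_minus_pos(2)[OF w])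
  define x where "x = norm (1 - w)"
  have x: "0 < x" "x \<le> 2" using nz w norm_triangle_ineq4[of 1 w] by (auto simp: x_def)
  have "norm ((radial_deriv ^^ N) (pow_fun k b \<rho>) z) \<le> (\<Sum>j\<le>N. ?a j * (2 ^ N * x powr (- (b + N))))"
    unfolding radial_pow_fun[OF \<rho> z] w_def[symmetric]
  proof (rule sum_norm_le)
    fix j assume j: "j \<in> {..N}"
    have p: "norm ((1 - w) powr (- of_real (b + real j))) = x powr (- (b + j))"
      using norm_powr_of_real[OF nz, of "- (b + j)"] by (simp add: x_def)
    have "x powr (- (b + j)) = x powr (real N - real j) * x powr (- (b + N))"
      unfolding powr_add[symmetric] by (rule arg_cong[where f="\<lambda>t. x powr t"]) simp
    also have "x powr (real N - real j) = x ^ (N - j)"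
      using x j by (simp add: powr_realpow[symmetric] of_nat_diff)
    also have "\<dots> \<le> 2 ^ (N - j)" using x by (intro power_mono) auto
    also have "\<dots> \<le> 2 ^ N" by (intro power_increasing) auto
    finally have "x powr (- (b + j)) \<le> 2 ^ N * x powr (- (b + N))" by (simp add: mult_right_mono)
    moreover have "norm w ^ j \<le> 1" using w by (intro power_le_one) auto
    ultimately have "norm w ^ j * x powr (- (b + j)) \<le> 1 * (2 ^ N * x powr (- (b + N)))"
      by (intro mult_mono) auto
    then have "?a j * (norm w ^ j * x powr (- (b + j))) \<le> ?a j * (2 ^ N * x powr (- (b + N)))"
      using radial_coeff_nonneg[OF b] by (intro mult_left_mono) auto
    then show "norm (of_real (?a j) * (w ^ j * (1 - w) powr (- of_real (b + real j)))) \<le> ?a j * (2 ^ N * x powr (- (b + N)))"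
      using radial_coeff_nonneg[OF b, of N j] by (simp only: norm_mult norm_power p norm_of_real abs_of_nonneg)
  qed
  also have "\<dots> = (\<Sum>j\<le>N. ?a j) * 2 ^ N * x powr (- (b + N))" by (simp add: sum_distrib_right mult.assoc)
  finally show "norm ((radial_deriv ^^ N) (pow_fun k b \<rho>) z) \<le> (\<Sum>j\<le>N. ?a j) * 2 ^ N * norm (1 - of_real \<rho> * z $ k) powr (- (b + N))"
    by (simp only: x_def w_def)
qed

text \<open>
  On the ray in the direction of the \<open>k\<close>-th coordinate vector all terms of \<open>radial_pow_fun\<close> are nonnegative, so
  that there is no cancellation.
\<close>

lemma norm_radial_pow_fun_ge:
  fixes b \<rho> x :: real and k :: "'n::finite"
  assumes b: "b > 0" and \<rho>: "0 \<le> \<rho>" "\<rho> \<le> 1" and x: "0 \<le> x" "x < 1"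
  shows "radial_coeff b N N * (\<rho> * x) ^ N * (1 - \<rho> * x) powr (- (b + N)) \<le>
    norm ((radial_deriv ^^ N) (pow_fun k b \<rho>) (x *\<^sub>R axis k 1 :: complex ^ 'n))"
proof -
  let ?a = "radial_coeff b N"
  let ?z = "x *\<^sub>R axis k 1 :: complex ^ 'n"
  have z: "norm ?z < 1" using x by (simp add: norm_axis_1)
  have zk: "of_real \<rho> * ?z $ k = of_real (\<rho> * x)" by (simp add: axis_def scaleR_conv_of_real[where 'a=complex])
  have le: "\<rho> * x \<le> 1" using \<rho> x by (simp add: mult_le_one)
  have pw: "(1 - of_real (\<rho> * x)) powr (- of_real c) = (of_real ((1 - \<rho> * x) powr (- c)) :: complex)" for c
    using powr_of_real[of "1 - \<rho> * x" "- c"] le by simp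
  have "(radial_deriv ^^ N) (pow_fun k b \<rho>) ?z = of_real (\<Sum>j\<le>N. ?a j * ((\<rho> * x) ^ j * (1 - \<rho> * x) powr (- (b + j))))"
    unfolding radial_pow_fun[OF \<rho> z] zk pw by simp
  moreover have "?a N * ((\<rho> * x) ^ N * (1 - \<rho> * x) powr (- (b + N))) \<le> (\<Sum>j\<le>N. ?a j * ((\<rho> * x) ^ j * (1 - \<rho> * x) powr (- (b + j))))"
    using radial_coeff_nonneg[OF b] \<rho> x by (intro member_le_sum) auto
  ultimately show ?thesis
    unfolding norm_of_real using abs_ge_self order_trans by (metis (no_types, lifting) mult.assoc norm_of_real)
qed

section \<open>Norms of powers of the Cauchy kernel\<close>

lemma integral_mean_pow_le:
  fixes p D c \<rho> r :: real and k :: "'n::finite" and g :: "complex ^ 'n \<Rightarrow> complex"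
  assumes p: "p > 0" and D: "D \<ge> 0" and r: "0 \<le> r" "r < 1"
    and g: "\<And>z. norm z < 1 \<Longrightarrow> norm (g z) \<le> D * norm (1 - of_real \<rho> * z $ k) powr (- c)"
  shows "integral_mean p g r \<le> ennreal (D powr p) * (\<integral>\<^sup>+\<zeta>. ennreal (norm (1 - of_real (\<rho> * r) * \<zeta> $ k) powr (- (c * p))) \<partial>(sphere_measure :: (complex ^ 'n) measure))"
proof -
  have [measurable]: "(\<lambda>\<zeta>. \<zeta> $ k) \<in> borel_measurable (borel :: (complex ^ 'n) measure)"
    by (intro borel_measurable_continuous_onI continuous_intros)
  have "integral_mean p g r \<le> (\<integral>\<^sup>+\<zeta>. ennreal (D powr p) * ennreal (norm (1 - of_real (\<rho> * r) * \<zeta> $ k) powr (- (c * p))) \<partial>(sphere_measure :: (complex ^ 'n) measure))"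
    unfolding integral_mean_def
  proof (rule nn_integral_mono)
    fix \<zeta> :: "complex ^ 'n" assume "\<zeta> \<in> space sphere_measure"
    then have "norm (r *\<^sub>R \<zeta>) < 1" using r by simp
    from g[OF this] have "norm (g (r *\<^sub>R \<zeta>)) powr p \<le> (D * norm (1 - of_real (\<rho> * r) * \<zeta> $ k) powr (- c)) powr p"
      using p by (intro powr_mono2) (auto simp: scaleR_conv_of_real[where 'a=complex] mult.assoc)
    also have "\<dots> = D powr p * norm (1 - of_real (\<rho> * r) * \<zeta> $ k) powr (- (c * p))"
      using D by (simp add: powr_mult powr_powr)
    finally show "ennreal (norm (g (r *\<^sub>R \<zeta>)) powr p) \<le> ennreal (D powr p) * ennreal (norm (1 - of_real (\<rho> * r) * \<zeta> $ k) powr (- (c * p)))"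
      by (subst ennreal_mult[symmetric]) (auto intro: ennreal_leI)
  qed
  also have "\<dots> = ennreal (D powr p) * (\<integral>\<^sup>+\<zeta>. ennreal (norm (1 - of_real (\<rho> * r) * \<zeta> $ k) powr (- (c * p))) \<partial>(sphere_measure :: (complex ^ 'n) measure))"
    by (rule nn_integral_cmult) measurable
  finally show ?thesis .
qed

lemma integral_mean_pow_bound:
  fixes p D c :: real and k :: "'n::finite"
  assumes p: "p > 0" and D: "D \<ge> 0" and c: "c * p > CARD('n)"
  obtains C where "C > 0" "\<And>g :: complex ^ 'n \<Rightarrow> complex. \<And>\<rho> r. (\<forall>z. norm z < 1 \<longrightarrow> norm (g z) \<le> D * norm (1 - of_real \<rho> * z $ k) powr (- c)) \<Longrightarrow>
    0 \<le> \<rho> \<Longrightarrow> \<rho> \<le> 1 \<Longrightarrow> 0 \<le> r \<Longrightarrow> r < 1 \<Longrightarrow> integral_mean p g r \<le> ennreal (C * (1 - \<rho> * r) powr (CARD('n) - c * p))"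
proof -
  obtain C where C: "C > 0" "\<And>r. 0 \<le> r \<Longrightarrow> r < 1 \<Longrightarrow>
    (\<integral>\<^sup>+\<zeta>. ennreal (norm (1 - of_real r * \<zeta> $ k) powr (- (c * p))) \<partial>(sphere_measure :: (complex ^ 'n) measure)) \<le> ennreal (C * (1 - r) powr (CARD('n) - c * p))"
    by (rule sphere_kernel_integral[OF c, of k], rule that)
  show thesis
  proof (rule that[of "(D powr p + 1) * C"])
    show "(D powr p + 1) * C > 0" using C by (simp add: add_nonneg_pos)
    fix g :: "complex ^ 'n \<Rightarrow> complex" and \<rho> r :: real
    assume g: "\<forall>z. norm z < 1 \<longrightarrow> norm (g z) \<le> D * norm (1 - of_real \<rho> * z $ k) powr (- c)" and \<rho>: "0 \<le> \<rho>" "\<rho> \<le> 1" and r: "0 \<le> r" "r < 1"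
    have \<rho>r: "0 \<le> \<rho> * r" "\<rho> * r < 1" using \<rho> r mult_left_le_one_le[of r \<rho>] by auto
    have "integral_mean p g r \<le> ennreal (D powr p) * (\<integral>\<^sup>+\<zeta>. ennreal (norm (1 - of_real (\<rho> * r) * \<zeta> $ k) powr (- (c * p))) \<partial>(sphere_measure :: (complex ^ 'n) measure))"
      by (rule integral_mean_pow_le[OF p D r]) (use g in auto)
    also have "\<dots> \<le> ennreal (D powr p) * ennreal (C * (1 - \<rho> * r) powr (CARD('n) - c * p))"
      by (intro mult_left_mono C(2)[OF \<rho>r]) simp
    also have "\<dots> \<le> ennreal ((D powr p + 1) * C * (1 - \<rho> * r) powr (CARD('n) - c * p))"
      using C(1) by (subst ennreal_mult[symmetric]) (auto intro!: ennreal_leI mult_right_mono simp: mult.assoc)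
    finally show "integral_mean p g r \<le> ennreal ((D powr p + 1) * C * (1 - \<rho> * r) powr (CARD('n) - c * p))" .
  qed
qed

lemma weighted_integral_le_radial:
  fixes g :: "complex ^ 'n \<Rightarrow> complex"
  assumes g: "ball_fun g" and h: "\<And>r. 0 < r \<Longrightarrow> r < 1 \<Longrightarrow> integral_mean p g r \<le> ennreal (h r)" and h0: "\<And>r. 0 \<le> h r"
    and [measurable]: "h \<in> borel_measurable borel"
  shows "weighted_integral p \<gamma> g \<le> ball_volume TYPE('n) * (ennreal (2 * CARD('n) * 2 powr \<bar>\<gamma>\<bar>) * (\<integral>\<^sup>+r. ennreal ((1 - r) powr \<gamma> * h r) * indicator {0<..<1} r \<partial>lborel))"
  unfolding weighted_integral_polar[OF g]
proof (rule mult_left_mono)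
  let ?c = "2 * CARD('n) * 2 powr \<bar>\<gamma>\<bar>"
  have "(\<integral>\<^sup>+r. ennreal (2 * CARD('n) * r ^ (2 * CARD('n) - 1)) * indicator {0<..<1} r * (ennreal ((1 - r\<^sup>2) powr \<gamma>) * integral_mean p g r) \<partial>lborel) \<le>
      (\<integral>\<^sup>+r. ennreal ?c * (ennreal ((1 - r) powr \<gamma> * h r) * indicator {0<..<1} r) \<partial>lborel)"
  proof (rule nn_integral_mono)
    fix r :: real
    show "ennreal (2 * CARD('n) * r ^ (2 * CARD('n) - 1)) * indicator {0<..<1} r * (ennreal ((1 - r\<^sup>2) powr \<gamma>) * integral_mean p g r) \<le>
        ennreal ?c * (ennreal ((1 - r) powr \<gamma> * h r) * indicator {0<..<1} r)"
    proof (cases "r \<in> {0<..<1}")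
      case True
      then have r: "0 < r" "r < 1" by auto
      note sq = one_minus_square_bounds[OF less_imp_le[OF r(1)] less_imp_le[OF r(2)]]
      have 1: "(1 - r\<^sup>2) powr \<gamma> \<le> 2 powr \<bar>\<gamma>\<bar> * (1 - r) powr \<gamma>"
        by (intro powr_comparable) (use sq r in \<open>simp_all\<close>)
      have 2: "2 * CARD('n) * r ^ (2 * CARD('n) - 1) \<le> 2 * CARD('n)"
        using r by (simp add: mult_left_le power_le_one)
      have "ennreal (2 * CARD('n) * r ^ (2 * CARD('n) - 1)) * (ennreal ((1 - r\<^sup>2) powr \<gamma>) * integral_mean p g r) \<le>
          ennreal (2 * CARD('n)) * (ennreal (2 powr \<bar>\<gamma>\<bar> * (1 - r) powr \<gamma>) * ennreal (h r))"
        by (intro mult_mono ennreal_leI 1 2 h[OF r]) simp_all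
      also have "\<dots> = ennreal ?c * ennreal ((1 - r) powr \<gamma> * h r)"
        using h0[of r] by (simp add: ennreal_mult[symmetric] mult_ac)
      finally show ?thesis using True by simp
    qed simp
  qed
  also have "\<dots> = ennreal ?c * (\<integral>\<^sup>+r. ennreal ((1 - r) powr \<gamma> * h r) * indicator {0<..<1} r \<partial>lborel)"
    by (rule nn_integral_cmult) measurable
  finally show "(\<integral>\<^sup>+r. ennreal (2 * CARD('n) * r ^ (2 * CARD('n) - 1)) * indicator {0<..<1} r * (ennreal ((1 - r\<^sup>2) powr \<gamma>) * integral_mean p g r) \<partial>lborel) \<le>
      ennreal ?c * (\<integral>\<^sup>+r. ennreal ((1 - r) powr \<gamma> * h r) * indicator {0<..<1} r \<partial>lborel)" .
qed simp

text \<open>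
  The integrand of the radial integral, \<open>(1 - r)\<^sup>\<gamma> (1 - \<rho> r)\<^bsup>n-cp\<^esup>\<close>, is estimated by replacing
  \<open>1 - \<rho> r\<close> by \<open>1 - r\<close> or by \<open>1 - \<rho>\<close>, both of which are smaller. The minimum of the two is integrated
  by \<open>nn_integral_min_powr\<close>.
\<close>

lemma weighted_integral_pow_bound:
  fixes p D c \<gamma> :: real and k :: "'n::finite"
  assumes p: "p > 0" and D: "D \<ge> 0" and \<gamma>: "\<gamma> > -1" and c: "c * p > CARD('n) + 1 + \<gamma>"
  obtains C where "C > 0" "\<And>g :: complex ^ 'n \<Rightarrow> complex. \<And>\<rho>. ball_fun g \<Longrightarrow> (\<forall>z. norm z < 1 \<longrightarrow> norm (g z) \<le> D * norm (1 - of_real \<rho> * z $ k) powr (- c)) \<Longrightarrow>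
    0 \<le> \<rho> \<Longrightarrow> \<rho> < 1 \<Longrightarrow> weighted_integral p \<gamma> g \<le> ennreal (C * (1 - \<rho>) powr (CARD('n) + 1 + \<gamma> - c * p))"
proof -
  let ?n = "real CARD('n)"
  have cn: "c * p > ?n" using c \<gamma> by simp
  obtain C0 where C0: "C0 > 0" "\<And>g :: complex ^ 'n \<Rightarrow> complex. \<And>\<rho> r. (\<forall>z. norm z < 1 \<longrightarrow> norm (g z) \<le> D * norm (1 - of_real \<rho> * z $ k) powr (- c)) \<Longrightarrow>
    0 \<le> \<rho> \<Longrightarrow> \<rho> \<le> 1 \<Longrightarrow> 0 \<le> r \<Longrightarrow> r < 1 \<Longrightarrow> integral_mean p g r \<le> ennreal (C0 * (1 - \<rho> * r) powr (?n - c * p))"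
    by (rule integral_mean_pow_bound[OF p D cn, of k], rule that)
  obtain V where V: "V \<ge> 0" "ball_volume TYPE('n) = ennreal V"
    using ball_volume_finite[where 'n='n] by (cases "ball_volume TYPE('n)") auto
  define x where "x = c * p - ?n - \<gamma> - 1"
  define y where "y = \<gamma> + 1"
  have x: "x > 0" using c by (simp add: x_def)
  have y: "y > 0" using \<gamma> by (simp add: y_def)
  have xy: "x + y = c * p - ?n" by (simp add: x_def y_def)
  define e where "e = 1 / x + 1 / y"
  have e: "e > 0" using x y by (simp add: e_def add_pos_pos)
  define b where "b = 2 * ?n * 2 powr \<bar>\<gamma>\<bar>"
  have b: "b \<ge> 0" by (simp add: b_def)
  show thesis
  proof (rule that[of "V * (b * (C0 * e)) + 1"])
    have "V * (b * (C0 * e)) \<ge> 0" using V b C0 e by simp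
    then show "V * (b * (C0 * e)) + 1 > 0" by linarith
    fix g :: "complex ^ 'n \<Rightarrow> complex" and \<rho> :: real
    assume g: "ball_fun g" and gb: "\<forall>z. norm z < 1 \<longrightarrow> norm (g z) \<le> D * norm (1 - of_real \<rho> * z $ k) powr (- c)" and \<rho>: "0 \<le> \<rho>" "\<rho> < 1"
    let ?d = "1 - \<rho>"
    let ?min = "\<lambda>s. min (1 * s powr (- 1 - x)) (?d powr (?n - c * p) * s powr (- 1 + y))"
    have "(\<integral>\<^sup>+r. ennreal ((1 - r) powr \<gamma> * (C0 * (1 - \<rho> * r) powr (?n - c * p))) * indicator {0<..<1} r \<partial>lborel) \<le>
        (\<integral>\<^sup>+r. ennreal C0 * (ennreal (?min (1 - r)) * indicator {0<..} (1 - r)) \<partial>lborel)"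
    proof (rule nn_integral_mono)
      fix r :: real
      show "ennreal ((1 - r) powr \<gamma> * (C0 * (1 - \<rho> * r) powr (?n - c * p))) * indicator {0<..<1} r \<le> ennreal C0 * (ennreal (?min (1 - r)) * indicator {0<..} (1 - r))"
      proof (cases "r \<in> {0<..<1}")
        case True
        then have r: "0 < r" "r < 1" by auto
        have "1 - r \<le> 1 - \<rho> * r" "?d \<le> 1 - \<rho> * r" using r \<rho> by (simp_all add: mult_left_le mult_right_le_one_le)
        then have 1: "(1 - \<rho> * r) powr (?n - c * p) \<le> (1 - r) powr (?n - c * p)" "(1 - \<rho> * r) powr (?n - c * p) \<le> ?d powr (?n - c * p)"
          using r \<rho> cn by (auto intro!: powr_mono2')
        have "(1 - r) powr \<gamma> * (1 - r) powr (?n - c * p) = (1 - r) powr (- 1 - x)"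
          by (simp add: powr_add[symmetric] x_def algebra_simps)
        then have 2: "(1 - r) powr \<gamma> * (1 - \<rho> * r) powr (?n - c * p) \<le> 1 * (1 - r) powr (- 1 - x)"
          using mult_left_mono[OF 1(1), of "(1 - r) powr \<gamma>"] by simp
        have 3: "(1 - r) powr \<gamma> * (1 - \<rho> * r) powr (?n - c * p) \<le> ?d powr (?n - c * p) * (1 - r) powr (- 1 + y)"
          using mult_left_mono[OF 1(2), of "(1 - r) powr \<gamma>"] by (simp add: y_def mult.commute)
        have "(1 - r) powr \<gamma> * (1 - \<rho> * r) powr (?n - c * p) \<le> ?min (1 - r)" using 2 3 by simp
        then have "C0 * ((1 - r) powr \<gamma> * (1 - \<rho> * r) powr (?n - c * p)) \<le> C0 * ?min (1 - r)"
          using C0(1) by (intro mult_left_mono) auto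
        then have "ennreal ((1 - r) powr \<gamma> * (C0 * (1 - \<rho> * r) powr (?n - c * p))) \<le> ennreal (C0 * ?min (1 - r))"
          by (intro ennreal_leI) (simp only: mult.left_commute)
        also have "\<dots> = ennreal C0 * ennreal (?min (1 - r))" using C0(1) by (intro ennreal_mult) auto
        finally show ?thesis using True by simp
      qed simp
    qed
    also have "\<dots> = ennreal C0 * (\<integral>\<^sup>+r. ennreal (?min (1 - r)) * indicator {0<..} (1 - r) \<partial>lborel)"
      by (rule nn_integral_cmult) measurable
    also have "(\<integral>\<^sup>+r. ennreal (?min (1 - r)) * indicator {0<..} (1 - r) \<partial>lborel) = (\<integral>\<^sup>+s. ennreal (?min s) * indicator {0<..} s \<partial>lborel)"
      by (rule nn_integral_reflect) measurable
    finally have I1: "(\<integral>\<^sup>+r. ennreal ((1 - r) powr \<gamma> * (C0 * (1 - \<rho> * r) powr (?n - c * p))) * indicator {0<..<1} r \<partial>lborel) \<le>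
        ennreal C0 * (\<integral>\<^sup>+s. ennreal (?min s) * indicator {0<..} s \<partial>lborel)" .
    have "(\<integral>\<^sup>+s. ennreal (?min s) * indicator {0<..} s \<partial>lborel) \<le>
        ennreal ((1 / x + 1 / y) * (1 powr (y / (x + y)) * (?d powr (?n - c * p)) powr (x / (x + y))))"
      by (rule nn_integral_min_powr) (use x y \<rho> in auto)
    also have "(?d powr (?n - c * p)) powr (x / (x + y)) = ?d powr (- x)"
    proof -
      have "(?n - c * p) * (x / (x + y)) = - x"
        unfolding xy using cn by (simp add: field_simps)
      then show ?thesis by (simp add: powr_powr)
    qed
    finally have I2: "(\<integral>\<^sup>+s. ennreal (?min s) * indicator {0<..} s \<partial>lborel) \<le> ennreal (e * ?d powr (- x))"
      by (simp add: e_def)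
    have "weighted_integral p \<gamma> g \<le> ball_volume TYPE('n) * (ennreal (2 * CARD('n) * 2 powr \<bar>\<gamma>\<bar>) *
        (\<integral>\<^sup>+r. ennreal ((1 - r) powr \<gamma> * (C0 * (1 - \<rho> * r) powr (?n - c * p))) * indicator {0<..<1} r \<partial>lborel))"
      by (rule weighted_integral_le_radial[OF g]) (use C0(1) C0(2)[OF gb \<rho>(1)] \<rho>(2) in auto)
    also have "\<dots> \<le> ennreal V * (ennreal b * (ennreal C0 * ennreal (e * ?d powr (- x))))"
      unfolding V(2) b_def of_nat_mult of_nat_numeral
      by (intro mult_left_mono order_trans[OF I1] I2) simp_all
    also have "\<dots> = ennreal (V * (b * (C0 * e)) * ?d powr (- x))"
      using V b C0 e by (simp add: ennreal_mult[symmetric] mult_ac)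
    also have "\<dots> \<le> ennreal ((V * (b * (C0 * e)) + 1) * ?d powr (- x))"
      by (intro ennreal_leI mult_right_mono) auto
    also have "- x = ?n + 1 + \<gamma> - c * p" by (simp add: x_def)
    finally show "weighted_integral p \<gamma> g \<le> ennreal ((V * (b * (C0 * e)) + 1) * (1 - \<rho>) powr (CARD('n) + 1 + \<gamma> - c * p))" by (simp add: add.commute)
  qed
qed

lemma weighted_integral_pow_finite:
  fixes p D c \<gamma> :: real and k :: "'n::finite" and g :: "complex ^ 'n \<Rightarrow> complex"
  assumes p: "p > 0" and D: "D \<ge> 0" and \<gamma>: "\<gamma> > -1" and c: "c * p < CARD('n) + 1 + \<gamma>"
    and g: "ball_fun g" and gb: "\<And>z. norm z < 1 \<Longrightarrow> norm (g z) \<le> D * norm (1 - z $ k) powr (- c)"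
  shows "weighted_integral p \<gamma> g < top"
proof -
  let ?n = "real CARD('n)"
  \<comment> \<open>the kernel estimate needs an exponent above \<open>n\<close>\<close>
  define m where "m = (max (c * p) ?n + (?n + 1 + \<gamma>)) / 2"
  have m: "c * p \<le> m" "?n < m" "m < ?n + 1 + \<gamma>" using c \<gamma> by (auto simp: m_def max_def field_simps)
  define c' where "c' = m / p"
  have c': "c' * p = m" "c \<le> c'" using p m by (auto simp: c'_def field_simps)
  define D' where "D' = D * 2 powr (c' - c)"
  have D': "D' \<ge> 0" using D by (simp add: D'_def)
  have gb': "norm (g z) \<le> D' * norm (1 - of_real 1 * z $ k) powr (- c')" if z: "norm z < 1" for z
  proof -
    define x where "x = norm (1 - z $ k)"
    have zk: "norm (z $ k) < 1" using Finite_Cartesian_Product.norm_nth_le[of z k] z by simp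
    then have x: "0 < x" "x \<le> 2" using one_minus_pos(2)[OF zk] norm_triangle_ineq4[of 1 "z $ k"] by (auto simp: x_def)
    have "x powr (- c) = x powr (c' - c) * x powr (- c')" by (simp add: powr_add[symmetric])
    also have "\<dots> \<le> 2 powr (c' - c) * x powr (- c')" using x c' by (intro mult_right_mono powr_mono2) auto
    finally have "D * x powr (- c) \<le> D * (2 powr (c' - c) * x powr (- c'))" using D by (intro mult_left_mono)
    then show ?thesis using gb[OF z] by (simp add: x_def D'_def mult.assoc)
  qed
  have c'n: "c' * p > ?n" using c' m by simp
  obtain C0 where C0: "C0 > 0" "\<And>g :: complex ^ 'n \<Rightarrow> complex. \<And>\<rho> r. (\<forall>z. norm z < 1 \<longrightarrow> norm (g z) \<le> D' * norm (1 - of_real \<rho> * z $ k) powr (- c')) \<Longrightarrow>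
    0 \<le> \<rho> \<Longrightarrow> \<rho> \<le> 1 \<Longrightarrow> 0 \<le> r \<Longrightarrow> r < 1 \<Longrightarrow> integral_mean p g r \<le> ennreal (C0 * (1 - \<rho> * r) powr (?n - c' * p))"
    by (rule integral_mean_pow_bound[OF p D' c'n, of k], rule that)
  have pm: "integral_mean p g r \<le> ennreal (C0 * (1 - r) powr (?n - m))" if "0 < r" "r < 1" for r
    using C0(2)[of g 1 r] gb' that c' by simp
  have "(\<integral>\<^sup>+r. ennreal ((1 - r) powr \<gamma> * (C0 * (1 - r) powr (?n - m))) * indicator {0<..<1} r \<partial>lborel) \<le>
      (\<integral>\<^sup>+r. ennreal C0 * (ennreal ((1 - r) powr (\<gamma> + (?n - m))) * indicator {0..1} (1 - r)) \<partial>lborel)"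
  proof (rule nn_integral_mono)
    fix r :: real
    have "(1 - r) powr \<gamma> * (C0 * (1 - r) powr (?n - m)) = C0 * (1 - r) powr (\<gamma> + (?n - m))" by (simp only: powr_add mult_ac)
    then have "ennreal ((1 - r) powr \<gamma> * (C0 * (1 - r) powr (?n - m))) = ennreal C0 * ennreal ((1 - r) powr (\<gamma> + (?n - m)))"
      using C0(1) by (simp only: ennreal_mult less_imp_le powr_ge_zero)
    then show "ennreal ((1 - r) powr \<gamma> * (C0 * (1 - r) powr (?n - m))) * indicator {0<..<1} r \<le>
        ennreal C0 * (ennreal ((1 - r) powr (\<gamma> + (?n - m))) * indicator {0..1} (1 - r))"
      by (auto simp: indicator_def)
  qed
  also have "\<dots> = ennreal C0 * (\<integral>\<^sup>+r. ennreal ((1 - r) powr (\<gamma> + (?n - m))) * indicator {0..1} (1 - r) \<partial>lborel)"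
    by (rule nn_integral_cmult) measurable
  also have "(\<integral>\<^sup>+r. ennreal ((1 - r) powr (\<gamma> + (?n - m))) * indicator {0..1} (1 - r) \<partial>lborel) = (\<integral>\<^sup>+s. ennreal (s powr (\<gamma> + (?n - m))) * indicator {0..1} s \<partial>lborel)"
    by (rule nn_integral_reflect) measurable
  also have "\<dots> = ennreal (1 powr (\<gamma> + (?n - m) + 1) / (\<gamma> + (?n - m) + 1))"
    by (rule nn_integral_powr_Icc) (use m in auto)
  finally have fin: "(\<integral>\<^sup>+r. ennreal ((1 - r) powr \<gamma> * (C0 * (1 - r) powr (?n - m))) * indicator {0<..<1} r \<partial>lborel) < top"
    using ennreal_mult_less_top ennreal_less_top le_less_trans by blast
  have "weighted_integral p \<gamma> g \<le> ball_volume TYPE('n) * (ennreal (2 * CARD('n) * 2 powr \<bar>\<gamma>\<bar>) *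
      (\<integral>\<^sup>+r. ennreal ((1 - r) powr \<gamma> * (C0 * (1 - r) powr (?n - m))) * indicator {0<..<1} r \<partial>lborel))"
    by (rule weighted_integral_le_radial[OF g pm]) (use C0(1) in auto)
  also have "\<dots> < top"
    using fin ball_volume_finite[where 'n='n] by (simp add: ennreal_mult_less_top less_top)
  finally show ?thesis .
qed

section \<open>The function spaces in terms of sphere means and weighted volume integrals\<close>

lemma bergman_order_gt: "p > 0 \<Longrightarrow> real (bergman_order p \<alpha>) * p + \<alpha> > -1"
proof -
  assume p: "p > 0"
  obtain N :: nat where "-1 - \<alpha> < real N * p" using reals_Archimedean3[OF p] by blast
  then have "real N * p + \<alpha> > -1" by simp
  then show ?thesis unfolding bergman_order_def by (rule LeastI)
qed

lemma bergman_order_0: "\<alpha> > -1 \<Longrightarrow> bergman_order p \<alpha> = 0"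
  unfolding bergman_order_def by (intro Least_eq_0) simp

lemma weighted_radial_0: "weighted_radial 0 f = f"
  by (simp add: weighted_radial_def fun_eq_iff)

lemma ball_weight_integral:
  fixes F :: "complex ^ 'n \<Rightarrow> ennreal"
  assumes "F \<in> borel_measurable (restrict_space lborel unit_ball)"
  shows "(\<integral>\<^sup>+z. F z \<partial>ball_weight \<alpha>) = (\<integral>\<^sup>+z. ennreal ((1 - (norm z)\<^sup>2) powr \<alpha>) * F z * indicator unit_ball z \<partial>lborel)"
proof -
  have w: "(\<lambda>z :: complex ^ 'n. ennreal ((1 - (norm z)\<^sup>2) powr \<alpha>)) \<in> borel_measurable (restrict_space lborel unit_ball)"
    by (rule measurable_restrict_space1) measurable
  show ?thesis
    unfolding ball_weight_def nn_integral_density[OF w assms]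
    by (subst nn_integral_restrict_space) auto
qed

text \<open>
  The number \<open>\<kappa>\<close> is the normalization of \<open>v\<^sub>\<alpha>\<close>. For \<open>\<alpha> > -1\<close> the mass of the weight is an integral of the
  constant function, the power of exponent \<open>c = 0\<close>, hence finite; it is positive by the pointwise bound.
\<close>

lemma ball_measure_integral:
  fixes \<alpha> :: real
  obtains \<kappa> where "\<kappa> > 0" "\<And>F :: complex ^ 'n \<Rightarrow> ennreal. F \<in> borel_measurable (restrict_space lborel unit_ball) \<Longrightarrow>
    (\<integral>\<^sup>+z. F z \<partial>ball_measure \<alpha>) = ennreal \<kappa> * (\<integral>\<^sup>+z. ennreal ((1 - (norm z)\<^sup>2) powr \<alpha>) * F z * indicator unit_ball z \<partial>lborel)"
proof (cases "\<alpha> > -1")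
  case True
  define m where "m = emeasure (ball_weight \<alpha> :: (complex ^ 'n) measure) unit_ball"
  define one :: "complex ^ 'n \<Rightarrow> complex" where "one = zero_ext (\<lambda>_. 1)"
  have "holomorphic_vec_on (\<lambda>_ :: complex ^ 'n. 1) unit_ball"
    unfolding holomorphic_vec_on_def by (auto intro!: exI[of _ "\<lambda>_. 0"])
  then have one: "ball_fun one" unfolding one_def by (rule ball_fun_zero_ext)
  have "space (ball_weight \<alpha> :: (complex ^ 'n) measure) = unit_ball"
    by (simp add: ball_weight_def space_restrict_space)
  then have "m = (\<integral>\<^sup>+z. 1 \<partial>(ball_weight \<alpha> :: (complex ^ 'n) measure))" by (simp add: m_def)
  also have "\<dots> = weighted_integral 1 \<alpha> one"
    unfolding weighted_integral_def by (subst ball_weight_integral) (auto simp: one_def zero_ext_def indicator_def intro!: nn_integral_cong)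
  finally have m: "m = weighted_integral 1 \<alpha> one" .
  obtain k :: 'n where True by blast
  have "z $ k \<noteq> 1" if "norm z < 1" for z :: "complex ^ 'n"
    using norm_coord_less[of 1 z k] that by auto
  then have "weighted_integral 1 \<alpha> one < top"
    by (intro weighted_integral_pow_finite[where D=1 and c=0 and k=k]) (use True one in \<open>auto simp: one_def zero_ext_def\<close>)
  moreover obtain C where "C > 0" "\<And>f :: complex ^ 'n \<Rightarrow> complex. \<And>z. ball_fun f \<Longrightarrow> norm z < 1 \<Longrightarrow>
      ennreal (norm (f z) powr 1) \<le> ennreal (C * (1 - norm z) powr (- (CARD('n) + 1 + \<alpha>))) * weighted_integral 1 \<alpha> f"
    by (rule pointwise_weighted_integral[where p=1 and \<gamma>=\<alpha> and 'n='n]) (simp, rule that)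
  from this(2)[OF one, of 0] have "weighted_integral 1 \<alpha> one \<noteq> 0" by (auto simp: one_def zero_ext_def)
  ultimately obtain \<mu> where \<mu>: "\<mu> > 0" "m = ennreal \<mu>"
    unfolding m by (cases "weighted_integral 1 \<alpha> one") (auto simp: less_le)
  show thesis
  proof (rule that[of "inverse \<mu>"])
    fix F :: "complex ^ 'n \<Rightarrow> ennreal" assume F: "F \<in> borel_measurable (restrict_space lborel unit_ball)"
    then have "F \<in> borel_measurable (ball_weight \<alpha>)" by (simp add: ball_weight_def)
    then have "(\<integral>\<^sup>+z. F z \<partial>ball_measure \<alpha>) = inverse m * (\<integral>\<^sup>+z. F z \<partial>ball_weight \<alpha>)"
      using True by (simp add: ball_measure_def m_def nn_integral_scale_measure)
    then show "(\<integral>\<^sup>+z. F z \<partial>ball_measure \<alpha>) = ennreal (inverse \<mu>) * (\<integral>\<^sup>+z. ennreal ((1 - (norm z)\<^sup>2) powr \<alpha>) * F z * indicator unit_ball z \<partial>lborel)"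
      using \<mu> by (simp add: ball_weight_integral[OF F] inverse_ennreal)
  qed (use \<mu> in simp)
next
  case False
  show thesis
    by (rule that[of 1]) (use False in \<open>simp_all add: ball_measure_def ball_weight_integral\<close>)
qed

lemma continuous_on_weighted_radial:
  fixes f :: "complex ^ 'n \<Rightarrow> complex"
  assumes f: "holomorphic_vec_on f unit_ball"
  shows "continuous_on unit_ball (weighted_radial N f)"
  unfolding weighted_radial_def[abs_def]
  by (intro continuous_intros holomorphic_vec_on_continuous holomorphic_vec_on_radial_funpow f)

lemma weighted_radial_integral:
  fixes \<alpha> :: real
  obtains \<kappa> where "\<kappa> > 0" "\<And>(f :: complex ^ 'n \<Rightarrow> complex) N p. holomorphic_vec_on f unit_ball \<Longrightarrow> p > 0 \<Longrightarrow>
    Lp_integral p (ball_measure \<alpha>) (weighted_radial N f) = ennreal \<kappa> * weighted_integral p (N * p + \<alpha>) (zero_ext ((radial_deriv ^^ N) f))"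
proof -
  obtain \<kappa> where \<kappa>: "\<kappa> > 0" "\<And>F :: complex ^ 'n \<Rightarrow> ennreal. F \<in> borel_measurable (restrict_space lborel unit_ball) \<Longrightarrow>
    (\<integral>\<^sup>+z. F z \<partial>ball_measure \<alpha>) = ennreal \<kappa> * (\<integral>\<^sup>+z. ennreal ((1 - (norm z)\<^sup>2) powr \<alpha>) * F z * indicator unit_ball z \<partial>lborel)"
    by (rule ball_measure_integral[of \<alpha>], rule that)
  show thesis
  proof (rule that[OF \<kappa>(1)])
    fix f :: "complex ^ 'n \<Rightarrow> complex" and N :: nat and p :: real
    assume f: "holomorphic_vec_on f unit_ball" and p: "p > 0"
    have "weighted_radial N f \<in> borel_measurable (restrict_space borel unit_ball)"
      by (rule borel_measurable_continuous_on_restrict[OF continuous_on_weighted_radial[OF f]])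
    then have [measurable]: "weighted_radial N f \<in> borel_measurable (restrict_space lborel unit_ball)"
      by (simp cong: measurable_cong_sets add: sets_restrict_space)
    have "(\<integral>\<^sup>+z. ennreal ((1 - (norm z)\<^sup>2) powr \<alpha>) * ennreal (norm (weighted_radial N f z) powr p) * indicator unit_ball z \<partial>lborel) =
        weighted_integral p (N * p + \<alpha>) (zero_ext ((radial_deriv ^^ N) f))"
      unfolding weighted_integral_def
    proof (rule nn_integral_cong)
      fix z :: "complex ^ 'n"
      show "ennreal ((1 - (norm z)\<^sup>2) powr \<alpha>) * ennreal (norm (weighted_radial N f z) powr p) * indicator unit_ball z =
          ennreal (norm (zero_ext ((radial_deriv ^^ N) f) z) powr p * (1 - (norm z)\<^sup>2) powr (N * p + \<alpha>)) * indicator unit_ball z"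
      proof (cases "norm z < 1")
        case True
        let ?s = "1 - (norm z)\<^sup>2"
        have s: "?s > 0" using True by (simp add: power_less_one_iff)
        have "norm (weighted_radial N f z) powr p = ?s powr (N * p) * norm ((radial_deriv ^^ N) f z) powr p"
          using s by (simp add: weighted_radial_def norm_mult norm_power powr_mult powr_realpow[symmetric] powr_powr del: of_real_power of_real_diff)
        then have "?s powr \<alpha> * norm (weighted_radial N f z) powr p = norm ((radial_deriv ^^ N) f z) powr p * ?s powr (N * p + \<alpha>)"
          by (simp add: powr_add mult_ac)
        then show ?thesis using True by (simp add: zero_ext_def ennreal_mult[symmetric])
      qed simp
    qed
    then show "Lp_integral p (ball_measure \<alpha>) (weighted_radial N f) = ennreal \<kappa> * weighted_integral p (N * p + \<alpha>) (zero_ext ((radial_deriv ^^ N) f))"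
      unfolding Lp_integral_def by (subst \<kappa>(2)) simp_all
  qed
qed

text \<open>
  The weights of \<open>weighted_radial\<close> and \<open>v\<^sub>\<alpha>\<close> combine: up to a constant, the \<open>p\<close>-th power of the seminorm of
  \<open>A\<^sup>p\<^sub>\<alpha>\<close> is this integral.
\<close>

abbreviation bergman_integral :: "real \<Rightarrow> real \<Rightarrow> (complex ^ 'n \<Rightarrow> complex) \<Rightarrow> ennreal" where
  "bergman_integral p \<alpha> f \<equiv> weighted_integral p (real (bergman_order p \<alpha>) * p + \<alpha>) (zero_ext ((radial_deriv ^^ bergman_order p \<alpha>) f))"

lemma bergman_space_iff:
  fixes f :: "complex ^ 'n \<Rightarrow> complex"
  assumes p: "p > 0"
  shows "f \<in> bergman_space p \<alpha> \<longleftrightarrow> holomorphic_vec_on f unit_ball \<and> bergman_integral p \<alpha> f < top"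
proof -
  obtain \<kappa> where \<kappa>: "\<kappa> > 0" "\<And>(f :: complex ^ 'n \<Rightarrow> complex) N p. holomorphic_vec_on f unit_ball \<Longrightarrow> p > 0 \<Longrightarrow>
    Lp_integral p (ball_measure \<alpha>) (weighted_radial N f) = ennreal \<kappa> * weighted_integral p (N * p + \<alpha>) (zero_ext ((radial_deriv ^^ N) f))"
    by (rule weighted_radial_integral[of \<alpha>], rule that)
  have m: "weighted_radial N f \<in> borel_measurable (ball_measure \<alpha>)" if f: "holomorphic_vec_on f unit_ball" for N
  proof -
    have "sets (ball_measure \<alpha> :: (complex ^ 'n) measure) = sets (restrict_space borel unit_ball)"
      by (simp add: ball_measure_def ball_weight_def sets_restrict_space)
    then show ?thesis
      using borel_measurable_continuous_on_restrict[OF continuous_on_weighted_radial[OF f, of N]] by (simp cong: measurable_cong_sets)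
  qed
  show ?thesis
    using \<kappa>(1) p by (auto simp: bergman_space_def Lp_space_def \<kappa>(2) m ennreal_mult_less_top)
qed

lemma bergman_norm_bounds:
  fixes p \<alpha> :: real
  assumes p: "p > 0"
  obtains \<kappa> where "\<kappa> > 0"
    "\<And>(f :: complex ^ 'n \<Rightarrow> complex). holomorphic_vec_on f unit_ball \<Longrightarrow>
      enn2real (ennreal \<kappa> * bergman_integral p \<alpha> f) powr (1 / p) \<le> bergman_norm p \<alpha> f"
    "\<And>(f :: complex ^ 'n \<Rightarrow> complex). holomorphic_vec_on f unit_ball \<Longrightarrow>
      bergman_norm p \<alpha> f \<le> norm (f 0) + enn2real (ennreal \<kappa> * bergman_integral p \<alpha> f) powr (1 / p)"
    "\<And>(f :: complex ^ 'n \<Rightarrow> complex). holomorphic_vec_on f unit_ball \<Longrightarrow> \<alpha> > -1 \<Longrightarrow>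
      bergman_norm p \<alpha> f = enn2real (ennreal \<kappa> * bergman_integral p \<alpha> f) powr (1 / p)"
proof -
  obtain \<kappa> where \<kappa>: "\<kappa> > 0" "\<And>(f :: complex ^ 'n \<Rightarrow> complex) N p. holomorphic_vec_on f unit_ball \<Longrightarrow> p > 0 \<Longrightarrow>
    Lp_integral p (ball_measure \<alpha>) (weighted_radial N f) = ennreal \<kappa> * weighted_integral p (N * p + \<alpha>) (zero_ext ((radial_deriv ^^ N) f))"
    by (rule weighted_radial_integral[of \<alpha>], rule that)
  have eq: "bergman_norm p \<alpha> f = (if \<alpha> > -1 then 0 else norm (f 0)) + enn2real (ennreal \<kappa> * bergman_integral p \<alpha> f) powr (1 / p)"
    if f: "holomorphic_vec_on f unit_ball" for f :: "complex ^ 'n \<Rightarrow> complex"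
    using \<kappa>(2)[OF f p, of "bergman_order p \<alpha>"]
    by (cases "\<alpha> > -1") (simp_all add: bergman_norm_def Lp_norm_def bergman_order_0 weighted_radial_0)
  show thesis
    by (rule that[OF \<kappa>(1)]) (simp_all add: eq)
qed

lemma bergman_bounded_weighted_integral:
  fixes p \<alpha> C :: real
  assumes p: "p > 0"
  obtains K where "K > 0" "\<And>f :: complex ^ 'n \<Rightarrow> complex. f \<in> bergman_space p \<alpha> \<Longrightarrow> bergman_norm p \<alpha> f \<le> C \<Longrightarrow>
    bergman_integral p \<alpha> f \<le> ennreal K"
proof -
  obtain \<kappa> where \<kappa>: "\<kappa> > 0" "\<And>(f :: complex ^ 'n \<Rightarrow> complex). holomorphic_vec_on f unit_ball \<Longrightarrow>
      enn2real (ennreal \<kappa> * bergman_integral p \<alpha> f) powr (1 / p) \<le> bergman_norm p \<alpha> f"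
    by (rule bergman_norm_bounds[OF p, of \<alpha>], rule that)
  define K where "K = (\<bar>C\<bar> + 1) powr p / \<kappa>"
  show thesis
  proof (rule that[of K])
    show "K > 0" using \<kappa>(1) by (simp add: K_def)
    fix f :: "complex ^ 'n \<Rightarrow> complex" assume f: "f \<in> bergman_space p \<alpha>" and C: "bergman_norm p \<alpha> f \<le> C"
    from f have h: "holomorphic_vec_on f unit_ball" and fin: "bergman_integral p \<alpha> f < top" by (auto simp: bergman_space_iff[OF p])
    obtain w where w: "0 \<le> w" "bergman_integral p \<alpha> f = ennreal w" using fin by (cases "bergman_integral p \<alpha> f") auto
    have "(\<kappa> * w) powr (1 / p) \<le> \<bar>C\<bar> + 1"
      using \<kappa>(2)[OF h] C \<kappa>(1) w by (simp add: ennreal_mult[symmetric])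
    then have "((\<kappa> * w) powr (1 / p)) powr p \<le> (\<bar>C\<bar> + 1) powr p" using p by (intro powr_mono2) auto
    then have "\<kappa> * w \<le> (\<bar>C\<bar> + 1) powr p" using p \<kappa>(1) w by (simp add: powr_powr)
    then show "bergman_integral p \<alpha> f \<le> ennreal K" unfolding w K_def using \<kappa>(1) by (intro ennreal_leI) (simp add: field_simps)
  qed
qed

lemma hardy_sup_integral_mean: "hardy_sup p f = (SUP r\<in>{0<..<1}. integral_mean p f r)"
  by (simp add: hardy_sup_def Lp_integral_def integral_mean_def)

lemma integral_mean_zero_ext: "0 \<le> r \<Longrightarrow> r < 1 \<Longrightarrow> integral_mean p (zero_ext f) r = integral_mean p f r"
  unfolding integral_mean_def by (intro nn_integral_cong) (simp add: zero_ext_def)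

lemma hardy_sup_le_iff: "hardy_sup p f \<le> C \<longleftrightarrow> (\<forall>r. 0 < r \<longrightarrow> r < 1 \<longrightarrow> integral_mean p f r \<le> C)"
  by (auto simp: hardy_sup_integral_mean SUP_le_iff)

lemma hardy_bounded_integral_mean:
  assumes p: "p > 0" and f: "f \<in> hardy_space p" and C: "hardy_norm p f \<le> C"
  shows "hardy_sup p f \<le> ennreal (C powr p)"
proof -
  obtain h where h: "0 \<le> h" "hardy_sup p f = ennreal h"
    using f by (cases "hardy_sup p f") (auto simp: hardy_space_def)
  then have "(h powr (1 / p)) powr p \<le> C powr p" using C p by (intro powr_mono2) (auto simp: hardy_norm_def)
  then show ?thesis using p h by (simp add: powr_powr ennreal_leI)
qed

lemma tendsto_enn2real_powr:
  fixes X :: "nat \<Rightarrow> ennreal" and q :: real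
  assumes q: "q > 0" and X: "\<And>\<epsilon>. \<epsilon> > 0 \<Longrightarrow> eventually (\<lambda>k. X k \<le> ennreal \<epsilon>) sequentially"
  shows "(\<lambda>k. enn2real (X k) powr (1 / q)) \<longlonglongrightarrow> 0"
proof (rule tendstoI)
  fix e :: real assume e: "e > 0"
  have "eventually (\<lambda>k. X k \<le> ennreal ((e / 2) powr q)) sequentially" using e by (intro X) simp
  then show "eventually (\<lambda>k. dist (enn2real (X k) powr (1 / q)) 0 < e) sequentially"
  proof (rule eventually_mono)
    fix k assume "X k \<le> ennreal ((e / 2) powr q)"
    then have "enn2real (X k) \<le> (e / 2) powr q" by (rule enn2real_leI[rotated]) simp
    then have "enn2real (X k) powr (1 / q) \<le> ((e / 2) powr q) powr (1 / q)" using q by (intro powr_mono2) auto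
    then show "dist (enn2real (X k) powr (1 / q)) 0 < e" using q e by (simp add: powr_powr)
  qed
qed

section \<open>The embeddings\<close>

text \<open>
  Iterated Cauchy estimates, with one constant for all orders up to \<open>M\<close>.
\<close>

lemma radial_funpow_bound:
  fixes t t' :: real
  assumes "0 \<le> t" "t < t'" "t' < 1"
  obtains C where "C > 0" "\<And>(f :: complex ^ 'n \<Rightarrow> complex) B k z. holomorphic_vec_on f unit_ball \<Longrightarrow> (\<forall>w. norm w \<le> t' \<longrightarrow> norm (f w) \<le> B) \<Longrightarrow>
    k \<le> M \<Longrightarrow> norm z \<le> t \<Longrightarrow> norm ((radial_deriv ^^ k) f z) \<le> C * B"
proof -
  have "\<exists>C>0. \<forall>f :: complex ^ 'n \<Rightarrow> complex. \<forall>B z. holomorphic_vec_on f unit_ball \<longrightarrow> (\<forall>w. norm w \<le> t' \<longrightarrow> norm (f w) \<le> B) \<longrightarrow>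
      norm z \<le> t \<longrightarrow> norm ((radial_deriv ^^ k) f z) \<le> C * B" for k
    using assms
  proof (induction k arbitrary: t)
    case 0
    then show ?case by (intro exI[of _ 1]) auto
  next
    case (Suc k)
    define t1 where "t1 = (t + t') / 2"
    have t1: "t < t1" "t1 < t'" using Suc by (auto simp: t1_def)
    obtain C where C: "C > 0" "\<And>(f :: complex ^ 'n \<Rightarrow> complex) B z. holomorphic_vec_on f unit_ball \<Longrightarrow> (\<forall>w. norm w \<le> t' \<longrightarrow> norm (f w) \<le> B) \<Longrightarrow>
      norm z \<le> t1 \<Longrightarrow> norm ((radial_deriv ^^ k) f z) \<le> C * B"
      using Suc.IH[of t1] Suc.prems t1 by auto
    show ?case
    proof (intro exI[of _ "C / (t1 - t)"] conjI allI impI)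
      show "C / (t1 - t) > 0" using C t1 by simp
      fix f :: "complex ^ 'n \<Rightarrow> complex" and B :: real and z :: "complex ^ 'n"
      assume f: "holomorphic_vec_on f unit_ball" and B: "\<forall>w. norm w \<le> t' \<longrightarrow> norm (f w) \<le> B" and z: "norm z \<le> t"
      have "norm (radial_deriv ((radial_deriv ^^ k) f) z) \<le> C * B / (t1 - t)"
        by (rule norm_radial_deriv_le[OF holomorphic_vec_on_radial_funpow[OF f]])
          (use t1 z Suc.prems C(2)[OF f B] in auto)
      then show "norm ((radial_deriv ^^ Suc k) f z) \<le> C / (t1 - t) * B" by simp
    qed
  qed
  then obtain C where C: "\<And>k. C k > 0" "\<And>k (f :: complex ^ 'n \<Rightarrow> complex) B z. holomorphic_vec_on f unit_ball \<Longrightarrow> (\<forall>w. norm w \<le> t' \<longrightarrow> norm (f w) \<le> B) \<Longrightarrow>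
      norm z \<le> t \<Longrightarrow> norm ((radial_deriv ^^ k) f z) \<le> C k * B"
    by metis
  show thesis
  proof (rule that[of "\<Sum>k\<le>M. C k"])
    show "(\<Sum>k\<le>M. C k) > 0" using C(1) by (intro sum_pos) auto
    fix f :: "complex ^ 'n \<Rightarrow> complex" and B :: real and k :: nat and z :: "complex ^ 'n"
    assume f: "holomorphic_vec_on f unit_ball" and B: "\<forall>w. norm w \<le> t' \<longrightarrow> norm (f w) \<le> B" and k: "k \<le> M" and z: "norm z \<le> t"
    have "B \<ge> 0" using order_trans[OF norm_ge_zero B[rule_format, of 0]] assms by simp
    moreover have "C k \<le> (\<Sum>k\<le>M. C k)" using k C(1) by (intro member_le_sum) (auto intro: less_imp_le)
    ultimately show "norm ((radial_deriv ^^ k) f z) \<le> (\<Sum>k\<le>M. C k) * B"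
      using C(2)[OF f B z, of k] mult_right_mono by fastforce
  qed
qed

lemma holomorphic_bounded_cball:
  fixes f :: "complex ^ 'n \<Rightarrow> complex"
  assumes "holomorphic_vec_on f unit_ball" "t < 1"
  obtains B where "B \<ge> 0" "\<forall>w. norm w \<le> t \<longrightarrow> norm (f w) \<le> B"
proof -
  have "cball (0 :: complex ^ 'n) t \<subseteq> unit_ball" using assms(2) by auto
  then have "compact (f ` cball 0 t)"
    by (intro compact_continuous_image continuous_on_subset[OF holomorphic_vec_on_continuous[OF assms(1)]]) auto
  then obtain B where "B > 0" "\<forall>w\<in>f ` cball 0 t. norm w \<le> B"
    using compact_imp_bounded bounded_pos by blast
  then show thesis by (intro that[of B]) auto
qed

text \<open>
  The first term is controlled by the size of \<open>f\<close> on a compact ball, the second one tends to \<open>0\<close> as \<open>t \<rightarrow> 1\<close> if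
  \<open>\<delta> > 0\<close>. The constant \<open>C\<close> is chosen before \<open>t\<close>, while \<open>C'\<close> depends on \<open>t\<close>.
\<close>

lemma bergman_hardy_sup_bound:
  fixes p q \<alpha> K :: real
  assumes p: "0 < p" and pq: "p < q" and K: "K > 0"
    and le: "(CARD('n) + 1 + \<alpha>) / p \<le> CARD('n) / q"
  defines "\<delta> \<equiv> CARD('n) / q - (CARD('n) + 1 + \<alpha>) / p"
  obtains C where "C > 0" "\<And>t. 1 / 2 \<le> t \<Longrightarrow> t < 1 \<Longrightarrow> \<exists>C'>0. \<forall>f B. holomorphic_vec_on f (unit_ball :: (complex ^ 'n) set) \<longrightarrow>
     bergman_integral p \<alpha> f \<le> ennreal K \<longrightarrow> (\<forall>w. norm w \<le> (1 + t) / 2 \<longrightarrow> norm (f w) \<le> B) \<longrightarrow>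
     hardy_sup q f \<le> ennreal (C * ((C' * B) powr q + (1 - t) powr (\<delta> * q)))"
proof -
  have q: "q > 0" using p pq by simp
  have "(CARD('n) + 1 + \<alpha>) / p < CARD('n) / p" using le p pq by (smt (verit) divide_strict_left_mono mult_pos_pos of_nat_0_less_iff zero_less_card_finite)
  \<comment> \<open>so the order of the derivatives is positive, of the form \<open>Suc M\<close>\<close>
  then have "\<alpha> < -1" using p by (simp add: divide_less_cancel)
  with bergman_order_gt[OF p, of \<alpha>] obtain M where M: "bergman_order p \<alpha> = Suc M" by (cases "bergman_order p \<alpha>") auto
  obtain C where C: "C > 0" "\<And>(f :: complex ^ 'n \<Rightarrow> complex) t r B. holomorphic_vec_on f unit_ball \<Longrightarrow>
     weighted_integral p (Suc M * p + \<alpha>) (zero_ext ((radial_deriv ^^ Suc M) f)) \<le> ennreal K \<Longrightarrow> 1 / 2 \<le> t \<Longrightarrow> t \<le> r \<Longrightarrow> r < 1 \<Longrightarrow> 0 \<le> B \<Longrightarrow>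
     (\<forall>k\<le>M. \<forall>z. norm z = t \<longrightarrow> norm ((radial_deriv ^^ k) f z) \<le> B) \<Longrightarrow>
     integral_mean q f r \<le> ennreal (C * (B powr q + (1 - t) powr (\<delta> * q)))"
    by (rule bergman_hardy_bound[OF p pq K le, of M, folded \<delta>_def]) (erule that, blast)
  show thesis
  proof (rule that[OF C(1)])
    fix t :: real assume t: "1 / 2 \<le> t" "t < 1"
    have tt: "0 \<le> t" "t < (1 + t) / 2" "(1 + t) / 2 < 1" using t by auto
    obtain C' where C': "C' > 0" "\<And>(f :: complex ^ 'n \<Rightarrow> complex) B k z. holomorphic_vec_on f unit_ball \<Longrightarrow> (\<forall>w. norm w \<le> (1 + t) / 2 \<longrightarrow> norm (f w) \<le> B) \<Longrightarrow>
      k \<le> M \<Longrightarrow> norm z \<le> t \<Longrightarrow> norm ((radial_deriv ^^ k) f z) \<le> C' * B"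
      by (rule radial_funpow_bound[OF tt, of M], rule that)
    show "\<exists>C'>0. \<forall>f B. holomorphic_vec_on f (unit_ball :: (complex ^ 'n) set) \<longrightarrow>
     bergman_integral p \<alpha> f \<le> ennreal K \<longrightarrow> (\<forall>w. norm w \<le> (1 + t) / 2 \<longrightarrow> norm (f w) \<le> B) \<longrightarrow>
     hardy_sup q f \<le> ennreal (C * ((C' * B) powr q + (1 - t) powr (\<delta> * q)))"
    proof (intro exI[of _ C'] conjI C'(1) allI impI)
      fix f :: "complex ^ 'n \<Rightarrow> complex" and B
      assume f: "holomorphic_vec_on f unit_ball" and W: "bergman_integral p \<alpha> f \<le> ennreal K" and B: "\<forall>w. norm w \<le> (1 + t) / 2 \<longrightarrow> norm (f w) \<le> B"
      have "0 \<le> B" using order_trans[OF norm_ge_zero B[rule_format, of 0]] t by simp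
      then have B0: "0 \<le> C' * B" using C'(1) by simp
      have big: "integral_mean q f r \<le> ennreal (C * ((C' * B) powr q + (1 - t) powr (\<delta> * q)))" if "t \<le> r" "r < 1" for r
        by (rule C(2)[OF f _ t(1) that B0]) (use W C'(2)[OF f B] in \<open>auto simp: M\<close>)
      show "hardy_sup q f \<le> ennreal (C * ((C' * B) powr q + (1 - t) powr (\<delta> * q)))"
        unfolding hardy_sup_le_iff
      proof (intro allI impI)
        fix r :: real assume r: "0 < r" "r < 1"
        have "integral_mean q (zero_ext f) r \<le> integral_mean q (zero_ext f) (max r t)"
          using r t by (intro integral_mean_mono ball_fun_zero_ext f q) auto
        then have "integral_mean q f r \<le> integral_mean q f (max r t)" using r t by (simp add: integral_mean_zero_ext)
        also have "\<dots> \<le> ennreal (C * ((C' * B) powr q + (1 - t) powr (\<delta> * q)))" using r t by (intro big) auto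
        finally show "integral_mean q f r \<le> ennreal (C * ((C' * B) powr q + (1 - t) powr (\<delta> * q)))" .
      qed
    qed
  qed
qed

lemma bergman_subset_hardy:
  fixes p q \<alpha> :: real
  assumes p: "0 < p" and pq: "p < q" and le: "(CARD('n) + 1 + \<alpha>) / p \<le> CARD('n) / q"
  shows "(bergman_space p \<alpha> :: (complex ^ 'n \<Rightarrow> complex) set) \<subseteq> hardy_space q"
proof
  fix f :: "complex ^ 'n \<Rightarrow> complex" assume "f \<in> bergman_space p \<alpha>"
  then have f: "holomorphic_vec_on f unit_ball" and W: "bergman_integral p \<alpha> f < top" by (auto simp: bergman_space_iff[OF p])
  define K where "K = enn2real (bergman_integral p \<alpha> f) + 1"
  have K: "K > 0" by (simp add: K_def add_nonneg_pos)
  have WK: "bergman_integral p \<alpha> f \<le> ennreal K"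
    using W unfolding K_def by (cases "bergman_integral p \<alpha> f") (auto intro!: ennreal_leI)
  obtain B where B: "\<forall>w. norm w \<le> (1 + 1 / 2) / 2 \<longrightarrow> norm (f w) \<le> B"
    using holomorphic_bounded_cball[OF f, of "(1 + 1 / 2) / 2"] by auto
  obtain C where C: "C > 0" "\<And>t. 1 / 2 \<le> t \<Longrightarrow> t < 1 \<Longrightarrow> \<exists>C'>0. \<forall>f B. holomorphic_vec_on f (unit_ball :: (complex ^ 'n) set) \<longrightarrow>
     bergman_integral p \<alpha> f \<le> ennreal K \<longrightarrow> (\<forall>w. norm w \<le> (1 + t) / 2 \<longrightarrow> norm (f w) \<le> B) \<longrightarrow>
     hardy_sup q f \<le> ennreal (C * ((C' * B) powr q + (1 - t) powr ((CARD('n) / q - (CARD('n) + 1 + \<alpha>) / p) * q)))"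
    by (rule bergman_hardy_sup_bound[OF p pq K le], rule that)
  obtain C' where "hardy_sup q f \<le> ennreal (C * ((C' * B) powr q + (1 - 1 / 2) powr ((CARD('n) / q - (CARD('n) + 1 + \<alpha>) / p) * q)))"
    using C(2)[of "1 / 2"] f WK B by auto
  then have "hardy_sup q f < top" using ennreal_less_top le_less_trans by blast
  then show "f \<in> hardy_space q" using f by (simp add: hardy_space_def)
qed

lemma uniform_limit_eventually_le:
  fixes F :: "nat \<Rightarrow> complex ^ 'n \<Rightarrow> complex"
  assumes U: "\<forall>K. compact K \<and> K \<subseteq> unit_ball \<longrightarrow> uniform_limit K F (\<lambda>_. 0) sequentially" and t: "t < 1" and B: "B > 0"
  shows "eventually (\<lambda>k. \<forall>w. norm w \<le> t \<longrightarrow> norm (F k w) \<le> B) sequentially"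
proof -
  have "uniform_limit (cball 0 t) F (\<lambda>_. 0) sequentially" using U t by (auto simp: subset_eq)
  from uniform_limitD[OF this B] show ?thesis
    by (rule eventually_mono) (auto simp: less_imp_le)
qed

text \<open>
  Given \<open>\<epsilon>\<close>, the radius \<open>t = 1 - s\<close> makes the second term of \<open>bergman_hardy_sup_bound\<close> small for all functions of the
  sequence; then uniform convergence on a compact ball makes the first one small for almost all of them.
\<close>

lemma bergman_compact_hardy:
  fixes p q \<alpha> :: real
  assumes p: "0 < p" and pq: "p < q" and less: "(CARD('n) + 1 + \<alpha>) / p < CARD('n) / q"
  shows "compact_embedding (bergman_space p \<alpha> :: (complex ^ 'n \<Rightarrow> complex) set) (bergman_norm p \<alpha>) (hardy_space q) (hardy_norm q)"
  unfolding compact_embedding_def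
proof (intro conjI allI impI, goal_cases)
  case 1
  show ?case by (rule bergman_subset_hardy[OF p pq less_imp_le[OF less]])
next
  case (2 F)
  have q: "q > 0" using p pq by simp
  obtain c where c: "\<And>k. bergman_norm p \<alpha> (F k) \<le> c" using 2 by blast
  obtain K where K: "K > 0" "\<And>f :: complex ^ 'n \<Rightarrow> complex. f \<in> bergman_space p \<alpha> \<Longrightarrow> bergman_norm p \<alpha> f \<le> c \<Longrightarrow>
    bergman_integral p \<alpha> f \<le> ennreal K"
    by (rule bergman_bounded_weighted_integral[OF p, of \<alpha> c], rule that)
  have W: "bergman_integral p \<alpha> (F k) \<le> ennreal K" for k using K(2) c 2 by blast
  have hol: "holomorphic_vec_on (F k) unit_ball" for k using 2 bergman_space_iff[OF p] by blast
  define \<delta> where "\<delta> = CARD('n) / q - (CARD('n) + 1 + \<alpha>) / p"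
  have \<delta>: "\<delta> * q > 0" using less q by (simp add: \<delta>_def)
  obtain C where C: "C > 0" "\<And>t. 1 / 2 \<le> t \<Longrightarrow> t < 1 \<Longrightarrow> \<exists>C'>0. \<forall>f B. holomorphic_vec_on f (unit_ball :: (complex ^ 'n) set) \<longrightarrow>
     bergman_integral p \<alpha> f \<le> ennreal K \<longrightarrow> (\<forall>w. norm w \<le> (1 + t) / 2 \<longrightarrow> norm (f w) \<le> B) \<longrightarrow>
     hardy_sup q f \<le> ennreal (C * ((C' * B) powr q + (1 - t) powr (\<delta> * q)))"
    by (rule bergman_hardy_sup_bound[OF p pq K(1) less_imp_le[OF less], folded \<delta>_def], rule that)
  show ?case unfolding hardy_norm_def
  proof (rule tendsto_enn2real_powr[OF q])
    fix \<epsilon> :: real assume \<epsilon>: "\<epsilon> > 0"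
    define e where "e = \<epsilon> / (2 * C)"
    have e: "e > 0" using \<epsilon> C by (simp add: e_def)
    define s where "s = min (1 / 2) (e powr (1 / (\<delta> * q)))"
    have s: "0 < s" "s \<le> 1 / 2" using e by (auto simp: s_def)
    have "s powr (\<delta> * q) \<le> (e powr (1 / (\<delta> * q))) powr (\<delta> * q)" using s \<delta> by (intro powr_mono2) (auto simp: s_def)
    then have se: "s powr (\<delta> * q) \<le> e" using \<delta> e by (auto simp: powr_powr split: if_splits)
    obtain C' where C': "C' > 0" "\<And>f B. holomorphic_vec_on f (unit_ball :: (complex ^ 'n) set) \<Longrightarrow>
     bergman_integral p \<alpha> f \<le> ennreal K \<Longrightarrow> (\<forall>w. norm w \<le> (1 + (1 - s)) / 2 \<longrightarrow> norm (f w) \<le> B) \<Longrightarrow>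
     hardy_sup q f \<le> ennreal (C * ((C' * B) powr q + (1 - (1 - s)) powr (\<delta> * q)))"
      using C(2)[of "1 - s"] s by auto
    define B where "B = e powr (1 / q) / C'"
    have B: "B > 0" "(C' * B) powr q = e" using e C'(1) q by (simp_all add: B_def powr_powr)
    have "C * ((C' * B) powr q + (1 - (1 - s)) powr (\<delta> * q)) \<le> C * (e + e)"
      using se C(1) B by (intro mult_left_mono) auto
    also have "\<dots> = \<epsilon>" using C(1) by (simp add: e_def field_simps)
    finally have le: "C * ((C' * B) powr q + (1 - (1 - s)) powr (\<delta> * q)) \<le> \<epsilon>" .
    have "eventually (\<lambda>k. \<forall>w. norm w \<le> (1 + (1 - s)) / 2 \<longrightarrow> norm (F k w) \<le> B) sequentially"
      using 2 s B by (intro uniform_limit_eventually_le) auto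
    then show "eventually (\<lambda>k. hardy_sup q (F k) \<le> ennreal \<epsilon>) sequentially"
    proof (rule eventually_mono)
      fix k assume "\<forall>w. norm w \<le> (1 + (1 - s)) / 2 \<longrightarrow> norm (F k w) \<le> B"
      from C'(2)[OF hol W this] show "hardy_sup q (F k) \<le> ennreal \<epsilon>"
        by (rule order_trans) (rule ennreal_leI[OF le])
    qed
  qed
qed

lemma integral_mean_bounded:
  fixes f :: "complex ^ 'n \<Rightarrow> complex"
  assumes "q > 0" "0 \<le> r" and B: "\<forall>w. norm w \<le> r \<longrightarrow> norm (f w) \<le> B"
  shows "integral_mean q f r \<le> ennreal (B powr q)"
proof -
  have "integral_mean q f r \<le> (\<integral>\<^sup>+\<zeta>. ennreal (B powr q) \<partial>(sphere_measure :: (complex ^ 'n) measure))"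
    unfolding integral_mean_def using assms by (intro nn_integral_mono ennreal_leI powr_mono2) auto
  then show ?thesis by (simp add: emeasure_sphere_measure)
qed

text \<open>
  Inside the ball of radius \<open>t\<close> the function is bounded by \<open>B\<close>, and the weight is integrable as \<open>\<alpha> > -1\<close>. Outside, the
  weight exceeds the critical one of \<open>hardy_bergman_bound\<close> by the factor \<open>(1 - r)\<^sup>\<delta> \<le> (1 - t)\<^sup>\<delta>\<close> only.
\<close>

lemma hardy_bergman_integral_bound:
  fixes p q \<alpha> K :: real
  assumes p: "0 < p" and pq: "p < q" and K: "K > 0" and le: "CARD('n) / p \<le> (CARD('n) + 1 + \<alpha>) / q"
  defines "\<delta> \<equiv> (CARD('n) + 1 + \<alpha>) - CARD('n) * q / p"
  obtains C where "C > 0" "\<And>(f :: complex ^ 'n \<Rightarrow> complex) t B. holomorphic_vec_on f unit_ball \<Longrightarrow> hardy_sup p f \<le> ennreal K \<Longrightarrow>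
    0 \<le> t \<Longrightarrow> t < 1 \<Longrightarrow> (\<forall>w. norm w \<le> t \<longrightarrow> norm (f w) \<le> B) \<Longrightarrow> weighted_integral q \<alpha> (zero_ext f) \<le> ennreal (C * (B powr q + (1 - t) powr \<delta>))"
proof -
  define \<beta> where "\<beta> = CARD('n) * q / p - CARD('n) - 1"
  have q: "q > 0" using p pq by simp
  have "\<beta> > -1" using p pq by (simp add: \<beta>_def field_simps)
  moreover have \<delta>: "\<delta> = \<alpha> - \<beta>" "\<delta> \<ge> 0" using le p q by (simp_all add: \<delta>_def \<beta>_def field_simps)
  ultimately have \<alpha>: "\<alpha> > -1" by simp
  obtain C0 where C0: "C0 > 0" "\<And>f :: complex ^ 'n \<Rightarrow> complex. ball_fun f \<Longrightarrow> (\<forall>r. 0 < r \<longrightarrow> r < 1 \<longrightarrow> integral_mean p f r \<le> ennreal K) \<Longrightarrow>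
    (\<integral>\<^sup>+r. indicator {0<..<1} r * (ennreal ((1 - r) powr \<beta>) * integral_mean q f r) \<partial>lborel) \<le> ennreal C0"
    by (rule hardy_bergman_bound[OF p pq K, where 'n='n, folded \<beta>_def]) (erule that, blast)
  obtain V where V: "V > 0" "ball_volume TYPE('n) = ennreal V"
    using ball_volume_pos[where 'n='n] ball_volume_finite[where 'n='n]
    by (cases "ball_volume TYPE('n)") (auto simp: less_le)
  define c where "c = 2 * CARD('n) * 2 powr \<bar>\<alpha>\<bar>"
  have c: "c > 0" by (simp add: c_def)
  show thesis
  proof (rule that[of "V * (c * (1 / (\<alpha> + 1) + C0))"])
    have "1 / (\<alpha> + 1) > 0" using \<alpha> by simp
    then show "V * (c * (1 / (\<alpha> + 1) + C0)) > 0" using V c C0(1) by (intro mult_pos_pos add_pos_pos)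
    fix f :: "complex ^ 'n \<Rightarrow> complex" and t B :: real
    assume f: "holomorphic_vec_on f unit_ball" and H: "hardy_sup p f \<le> ennreal K" and t: "0 \<le> t" "t < 1"
      and B: "\<forall>w. norm w \<le> t \<longrightarrow> norm (f w) \<le> B"
    let ?g = "zero_ext f"
    have g: "ball_fun ?g" by (rule ball_fun_zero_ext[OF f])
    note [measurable] = integral_mean_measurable[OF g]
    have Kg: "\<forall>r. 0 < r \<longrightarrow> r < 1 \<longrightarrow> integral_mean p ?g r \<le> ennreal K"
      using H by (simp add: hardy_sup_le_iff integral_mean_zero_ext)
    have "(\<integral>\<^sup>+r. ennreal (2 * CARD('n) * r ^ (2 * CARD('n) - 1)) * indicator {0<..<1} r * (ennreal ((1 - r\<^sup>2) powr \<alpha>) * integral_mean q ?g r) \<partial>lborel) \<le>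
       (\<integral>\<^sup>+r. ennreal c * (ennreal (B powr q) * (ennreal ((1 - r) powr \<alpha>) * indicator {0..1} (1 - r)) +
          ennreal ((1 - t) powr \<delta>) * (indicator {0<..<1} r * (ennreal ((1 - r) powr \<beta>) * integral_mean q ?g r))) \<partial>lborel)"
    proof (rule nn_integral_mono)
      fix r :: real
      show "ennreal (2 * CARD('n) * r ^ (2 * CARD('n) - 1)) * indicator {0<..<1} r * (ennreal ((1 - r\<^sup>2) powr \<alpha>) * integral_mean q ?g r) \<le>
        ennreal c * (ennreal (B powr q) * (ennreal ((1 - r) powr \<alpha>) * indicator {0..1} (1 - r)) +
          ennreal ((1 - t) powr \<delta>) * (indicator {0<..<1} r * (ennreal ((1 - r) powr \<beta>) * integral_mean q ?g r)))"
      proof (cases "r \<in> {0<..<1}")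
        case True
        then have r: "0 < r" "r < 1" by auto
        note sq = one_minus_square_bounds[OF less_imp_le[OF r(1)] less_imp_le[OF r(2)]]
        have 1: "(1 - r\<^sup>2) powr \<alpha> \<le> 2 powr \<bar>\<alpha>\<bar> * (1 - r) powr \<alpha>"
          by (intro powr_comparable) (use sq r in \<open>simp_all\<close>)
        have 2: "2 * CARD('n) * r ^ (2 * CARD('n) - 1) \<le> 2 * CARD('n)"
          using r by (simp add: mult_left_le power_le_one)
        have 3: "ennreal ((1 - r) powr \<alpha>) * integral_mean q ?g r \<le>
          ennreal (B powr q) * ennreal ((1 - r) powr \<alpha>) + ennreal ((1 - t) powr \<delta>) * (ennreal ((1 - r) powr \<beta>) * integral_mean q ?g r)"
        proof (cases "r \<le> t")
          case True
          have "integral_mean q ?g r \<le> ennreal (B powr q)"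
            using r True B q by (simp add: integral_mean_zero_ext integral_mean_bounded)
          then have "ennreal ((1 - r) powr \<alpha>) * integral_mean q ?g r \<le> ennreal ((1 - r) powr \<alpha>) * ennreal (B powr q)"
            by (rule mult_left_mono) simp
          also have "\<dots> \<le> ennreal (B powr q) * ennreal ((1 - r) powr \<alpha>) + ennreal ((1 - t) powr \<delta>) * (ennreal ((1 - r) powr \<beta>) * integral_mean q ?g r)"
            by (simp add: mult.commute)
          finally show ?thesis .
        next
          case False
          have "(1 - r) powr \<alpha> = (1 - r) powr \<delta> * (1 - r) powr \<beta>" by (simp add: powr_add[symmetric] \<delta>)
          also have "\<dots> \<le> (1 - t) powr \<delta> * (1 - r) powr \<beta>" using False r \<delta> by (intro mult_right_mono powr_mono2) auto
          finally have "ennreal ((1 - r) powr \<alpha>) \<le> ennreal ((1 - t) powr \<delta>) * ennreal ((1 - r) powr \<beta>)"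
            by (subst ennreal_mult[symmetric]) (auto intro: ennreal_leI)
          then have "ennreal ((1 - r) powr \<alpha>) * integral_mean q ?g r \<le> ennreal ((1 - t) powr \<delta>) * ennreal ((1 - r) powr \<beta>) * integral_mean q ?g r"
            by (rule mult_right_mono) simp
          also have "\<dots> \<le> ennreal (B powr q) * ennreal ((1 - r) powr \<alpha>) + ennreal ((1 - t) powr \<delta>) * (ennreal ((1 - r) powr \<beta>) * integral_mean q ?g r)"
            by (simp add: mult.assoc)
          finally show ?thesis .
        qed
        have "ennreal (2 * CARD('n) * r ^ (2 * CARD('n) - 1)) * (ennreal ((1 - r\<^sup>2) powr \<alpha>) * integral_mean q ?g r) \<le>
            ennreal (2 * CARD('n)) * (ennreal (2 powr \<bar>\<alpha>\<bar> * (1 - r) powr \<alpha>) * integral_mean q ?g r)"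
          by (intro mult_mono ennreal_leI 1 2 order_refl) simp_all
        also have "\<dots> = ennreal c * (ennreal ((1 - r) powr \<alpha>) * integral_mean q ?g r)"
          by (simp add: c_def ennreal_mult mult_ac)
        also have "\<dots> \<le> ennreal c * (ennreal (B powr q) * ennreal ((1 - r) powr \<alpha>) + ennreal ((1 - t) powr \<delta>) * (ennreal ((1 - r) powr \<beta>) * integral_mean q ?g r))"
          by (rule mult_left_mono[OF 3]) simp
        finally show ?thesis using True by simp
      qed simp
    qed
    also have "\<dots> = ennreal c * (ennreal (B powr q) * (\<integral>\<^sup>+r. ennreal ((1 - r) powr \<alpha>) * indicator {0..1} (1 - r) \<partial>lborel) +
          ennreal ((1 - t) powr \<delta>) * (\<integral>\<^sup>+r. indicator {0<..<1} r * (ennreal ((1 - r) powr \<beta>) * integral_mean q ?g r) \<partial>lborel))"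
      by (subst nn_integral_cmult, measurable, subst nn_integral_add, measurable, simp add: nn_integral_cmult)
    also have "(\<integral>\<^sup>+r. ennreal ((1 - r) powr \<alpha>) * indicator {0..1} (1 - r) \<partial>lborel) = (\<integral>\<^sup>+s. ennreal (s powr \<alpha>) * indicator {0..1} s \<partial>lborel)"
      by (rule nn_integral_reflect) measurable
    also have "\<dots> = ennreal (1 powr (\<alpha> + 1) / (\<alpha> + 1))"
      by (rule nn_integral_powr_Icc) (use \<alpha> in auto)
    also have "ennreal c * (ennreal (B powr q) * ennreal (1 powr (\<alpha> + 1) / (\<alpha> + 1)) +
          ennreal ((1 - t) powr \<delta>) * (\<integral>\<^sup>+r. indicator {0<..<1} r * (ennreal ((1 - r) powr \<beta>) * integral_mean q ?g r) \<partial>lborel)) \<le>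
        ennreal c * (ennreal (B powr q) * ennreal (1 / (\<alpha> + 1)) + ennreal ((1 - t) powr \<delta>) * ennreal C0)"
      by (intro mult_left_mono add_mono C0(2)[OF g Kg]) simp_all
    also have "\<dots> = ennreal (c * (B powr q * (1 / (\<alpha> + 1)) + (1 - t) powr \<delta> * C0))"
      using c C0(1) \<alpha> by (simp add: ennreal_mult[symmetric] ennreal_plus[symmetric] del: ennreal_plus)
    also have "\<dots> \<le> ennreal (c * ((1 / (\<alpha> + 1) + C0) * (B powr q + (1 - t) powr \<delta>)))"
    proof (intro ennreal_leI mult_left_mono)
      have "0 \<le> 1 / (\<alpha> + 1) * (1 - t) powr \<delta>" "0 \<le> C0 * B powr q" using \<alpha> C0(1) by simp_all
      then show "B powr q * (1 / (\<alpha> + 1)) + (1 - t) powr \<delta> * C0 \<le> (1 / (\<alpha> + 1) + C0) * (B powr q + (1 - t) powr \<delta>)"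
        by (simp only: distrib_left distrib_right mult.commute)
    qed (use c in simp)
    finally have I: "(\<integral>\<^sup>+r. ennreal (2 * CARD('n) * r ^ (2 * CARD('n) - 1)) * indicator {0<..<1} r * (ennreal ((1 - r\<^sup>2) powr \<alpha>) * integral_mean q ?g r) \<partial>lborel) \<le>
      ennreal (c * ((1 / (\<alpha> + 1) + C0) * (B powr q + (1 - t) powr \<delta>)))" .
    have "weighted_integral q \<alpha> ?g \<le> ennreal V * ennreal (c * ((1 / (\<alpha> + 1) + C0) * (B powr q + (1 - t) powr \<delta>)))"
      unfolding weighted_integral_polar[OF g] V(2) by (rule mult_left_mono[OF I]) simp
    also have "\<dots> = ennreal (V * (c * (1 / (\<alpha> + 1) + C0)) * (B powr q + (1 - t) powr \<delta>))"
      using V c C0(1) \<alpha> by (simp add: ennreal_mult[symmetric] mult.assoc)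
    finally show "weighted_integral q \<alpha> ?g \<le> ennreal (V * (c * (1 / (\<alpha> + 1) + C0)) * (B powr q + (1 - t) powr \<delta>))" .
  qed
qed

lemma bergman_integral_0: "\<alpha> > -1 \<Longrightarrow> bergman_integral p \<alpha> f = weighted_integral p \<alpha> (zero_ext f)"
  by (simp add: bergman_order_0)

lemma hardy_exponent_gt:
  fixes p q \<alpha> :: real
  assumes p: "0 < p" and pq: "p < q" and le: "CARD('n::finite) / p \<le> (CARD('n) + 1 + \<alpha>) / q"
  shows "\<alpha> > -1"
proof -
  have "CARD('n) / q < CARD('n) / p" using p pq by (intro divide_strict_left_mono) auto
  with le have "CARD('n) / q < (CARD('n) + 1 + \<alpha>) / q" by simp
  then show ?thesis using p pq by (simp add: divide_less_cancel)
qed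

lemma hardy_subset_bergman:
  fixes p q \<alpha> :: real
  assumes p: "0 < p" and pq: "p < q" and le: "CARD('n) / p \<le> (CARD('n) + 1 + \<alpha>) / q"
  shows "(hardy_space p :: (complex ^ 'n \<Rightarrow> complex) set) \<subseteq> bergman_space q \<alpha>"
proof
  fix f :: "complex ^ 'n \<Rightarrow> complex" assume "f \<in> hardy_space p"
  then have f: "holomorphic_vec_on f unit_ball" and H: "hardy_sup p f < top" by (auto simp: hardy_space_def)
  define K where "K = enn2real (hardy_sup p f) + 1"
  have K: "K > 0" by (simp add: K_def add_nonneg_pos)
  have HK: "hardy_sup p f \<le> ennreal K"
    using H unfolding K_def by (cases "hardy_sup p f") (auto intro!: ennreal_leI)
  obtain C where C: "C > 0" "\<And>(f :: complex ^ 'n \<Rightarrow> complex) t B. holomorphic_vec_on f unit_ball \<Longrightarrow> hardy_sup p f \<le> ennreal K \<Longrightarrow>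
    0 \<le> t \<Longrightarrow> t < 1 \<Longrightarrow> (\<forall>w. norm w \<le> t \<longrightarrow> norm (f w) \<le> B) \<Longrightarrow> weighted_integral q \<alpha> (zero_ext f) \<le>
      ennreal (C * (B powr q + (1 - t) powr ((CARD('n) + 1 + \<alpha>) - CARD('n) * q / p)))"
    by (rule hardy_bergman_integral_bound[OF p pq K le], rule that)
  have "weighted_integral q \<alpha> (zero_ext f) < top"
    using C(2)[OF f HK, of 0 "norm (f 0)"] ennreal_less_top le_less_trans by fastforce
  then show "f \<in> bergman_space q \<alpha>"
    using f hardy_exponent_gt[OF p pq le] p pq by (simp add: bergman_space_iff bergman_order_0)
qed

lemma hardy_compact_bergman:
  fixes p q \<alpha> :: real
  assumes p: "0 < p" and pq: "p < q" and less: "CARD('n) / p < (CARD('n) + 1 + \<alpha>) / q"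
  shows "compact_embedding (hardy_space p :: (complex ^ 'n \<Rightarrow> complex) set) (hardy_norm p) (bergman_space q \<alpha>) (bergman_norm q \<alpha>)"
  unfolding compact_embedding_def
proof (intro conjI allI impI, goal_cases)
  case 1
  show ?case by (rule hardy_subset_bergman[OF p pq less_imp_le[OF less]])
next
  case (2 F)
  have q: "q > 0" using p pq by simp
  have \<alpha>: "\<alpha> > -1" by (rule hardy_exponent_gt[OF p pq less_imp_le[OF less]])
  obtain c where c: "\<And>k. hardy_norm p (F k) \<le> c" using 2 by blast
  define K where "K = c powr p + 1"
  have K: "K > 0" by (simp add: K_def add_nonneg_pos)
  have H: "hardy_sup p (F k) \<le> ennreal K" for k
  proof -
    have "hardy_sup p (F k) \<le> ennreal (c powr p)" using 2 by (intro hardy_bounded_integral_mean[OF p _ c]) auto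
    also have "\<dots> \<le> ennreal K" by (simp add: K_def ennreal_leI)
    finally show ?thesis .
  qed
  have hol: "holomorphic_vec_on (F k) unit_ball" for k using 2 by (auto simp: hardy_space_def)
  define \<delta> where "\<delta> = (CARD('n) + 1 + \<alpha>) - CARD('n) * q / p"
  have \<delta>: "\<delta> > 0" using less q p by (simp add: \<delta>_def field_simps)
  obtain C where C: "C > 0" "\<And>(f :: complex ^ 'n \<Rightarrow> complex) t B. holomorphic_vec_on f unit_ball \<Longrightarrow> hardy_sup p f \<le> ennreal K \<Longrightarrow>
    0 \<le> t \<Longrightarrow> t < 1 \<Longrightarrow> (\<forall>w. norm w \<le> t \<longrightarrow> norm (f w) \<le> B) \<Longrightarrow> weighted_integral q \<alpha> (zero_ext f) \<le> ennreal (C * (B powr q + (1 - t) powr \<delta>))"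
    by (rule hardy_bergman_integral_bound[OF p pq K less_imp_le[OF less], folded \<delta>_def], rule that)
  obtain \<kappa> where \<kappa>: "\<kappa> > 0" "\<And>(f :: complex ^ 'n \<Rightarrow> complex). holomorphic_vec_on f unit_ball \<Longrightarrow> \<alpha> > -1 \<Longrightarrow>
      bergman_norm q \<alpha> f = enn2real (ennreal \<kappa> * bergman_integral q \<alpha> f) powr (1 / q)"
    by (rule bergman_norm_bounds[OF q, of \<alpha>], rule that)
  show ?case unfolding \<kappa>(2)[OF hol \<alpha>] bergman_integral_0[OF \<alpha>]
  proof (rule tendsto_enn2real_powr[OF q])
    fix \<epsilon> :: real assume \<epsilon>: "\<epsilon> > 0"
    define e where "e = \<epsilon> / (2 * (\<kappa> * C))"
    have e: "e > 0" using \<epsilon> C \<kappa> by (simp add: e_def)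
    define s where "s = min (1 / 2) (e powr (1 / \<delta>))"
    have s: "0 < s" "s \<le> 1 / 2" using e by (auto simp: s_def)
    have "s powr \<delta> \<le> (e powr (1 / \<delta>)) powr \<delta>" using s \<delta> by (intro powr_mono2) (auto simp: s_def)
    then have se: "s powr \<delta> \<le> e" using \<delta> e by (simp add: powr_powr)
    define B where "B = e powr (1 / q)"
    have B: "B > 0" "B powr q = e" using e q by (simp_all add: B_def powr_powr)
    have "\<kappa> * (C * (B powr q + (1 - (1 - s)) powr \<delta>)) \<le> \<kappa> * (C * (e + e))"
      using se C(1) B \<kappa>(1) by (intro mult_left_mono) auto
    also have "\<dots> = \<epsilon>" using C(1) \<kappa>(1) by (simp add: e_def field_simps)
    finally have le: "\<kappa> * (C * (B powr q + (1 - (1 - s)) powr \<delta>)) \<le> \<epsilon>" .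
    have "eventually (\<lambda>k. \<forall>w. norm w \<le> 1 - s \<longrightarrow> norm (F k w) \<le> B) sequentially"
      using 2 s B by (intro uniform_limit_eventually_le) auto
    then show "eventually (\<lambda>k. ennreal \<kappa> * weighted_integral q \<alpha> (zero_ext (F k)) \<le> ennreal \<epsilon>) sequentially"
    proof (rule eventually_mono)
      fix k assume "\<forall>w. norm w \<le> 1 - s \<longrightarrow> norm (F k w) \<le> B"
      then have "weighted_integral q \<alpha> (zero_ext (F k)) \<le> ennreal (C * (B powr q + (1 - (1 - s)) powr \<delta>))"
        using s by (intro C(2)[OF hol H]) auto
      then have "ennreal \<kappa> * weighted_integral q \<alpha> (zero_ext (F k)) \<le> ennreal \<kappa> * ennreal (C * (B powr q + (1 - (1 - s)) powr \<delta>))"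
        by (rule mult_left_mono) simp
      also have "\<dots> = ennreal (\<kappa> * (C * (B powr q + (1 - (1 - s)) powr \<delta>)))"
        using \<kappa>(1) C(1) by (intro ennreal_mult[symmetric]) auto
      also have "\<dots> \<le> ennreal \<epsilon>" by (rule ennreal_leI[OF le])
      finally show "ennreal \<kappa> * weighted_integral q \<alpha> (zero_ext (F k)) \<le> ennreal \<epsilon>" .
    qed
  qed
qed

section \<open>Necessity of the exponent inequalities\<close>

lemma powr_bounded_imp_nonneg:
  fixes a C :: real
  assumes C: "\<And>s. 0 < s \<Longrightarrow> s \<le> 1 / 2 \<Longrightarrow> s powr a \<le> C"
  shows "a \<ge> 0"
proof (rule ccontr)
  assume "\<not> a \<ge> 0"
  then have a: "a < 0" by simp
  define D where "D = max (C + 1) (2 powr (- a))"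
  have D: "C < D" "2 powr (- a) \<le> D" "0 < D" by (auto simp: D_def less_max_iff_disj)
  define s where "s = D powr (1 / a)"
  have "s \<le> (2 powr (- a)) powr (1 / a)" unfolding s_def using D a by (intro powr_mono2') auto
  also have "\<dots> = 2 powr (- 1)" unfolding powr_powr using a by simp
  also have "\<dots> = 1 / 2" by (simp add: powr_minus_divide)
  finally have "s powr a \<le> C" using D by (intro C) (simp_all add: s_def)
  moreover have "s powr a = D" using a D by (simp add: s_def powr_powr)
  ultimately show False using D by simp
qed

lemma norm_axis_point: "0 \<le> x \<Longrightarrow> norm (x *\<^sub>R axis k 1 :: complex ^ 'n) = x"
  by (simp add: norm_axis_1)

lemma pow_fun_in_bergman:
  fixes p b \<alpha> :: real and k :: "'n::finite"
  assumes p: "p > 0" and b: "b > 0" and less: "b * p < CARD('n) + 1 + \<alpha>"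
  shows "pow_fun k b 1 \<in> bergman_space p \<alpha>"
proof -
  define N where "N = bergman_order p \<alpha>"
  have hol: "holomorphic_vec_on (pow_fun k b 1) unit_ball" by (rule holomorphic_pow_fun) auto
  obtain C where C: "C > 0" "\<And>\<rho> z. 0 \<le> \<rho> \<Longrightarrow> \<rho> \<le> 1 \<Longrightarrow> norm z < 1 \<Longrightarrow>
    norm ((radial_deriv ^^ N) (pow_fun k b \<rho>) (z :: complex ^ 'n)) \<le> C * norm (1 - of_real \<rho> * z $ k) powr (- (b + N))"
    by (rule norm_radial_pow_fun_le[OF b, of N k], rule that)
  have "weighted_integral p (N * p + \<alpha>) (zero_ext ((radial_deriv ^^ N) (pow_fun k b 1))) < top"
  proof (rule weighted_integral_pow_finite[where D=C and c="b + N" and k=k])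
    show "- 1 < N * p + \<alpha>" using bergman_order_gt[OF p, of \<alpha>] by (simp add: N_def)
    show "(b + N) * p < CARD('n) + 1 + (N * p + \<alpha>)" using less by (simp add: algebra_simps)
    show "ball_fun (zero_ext ((radial_deriv ^^ N) (pow_fun k b 1)))"
      by (intro ball_fun_zero_ext holomorphic_vec_on_radial_funpow hol)
    fix z :: "complex ^ 'n" assume "norm z < 1"
    then show "norm (zero_ext ((radial_deriv ^^ N) (pow_fun k b 1)) z) \<le> C * norm (1 - z $ k) powr (- (b + N))"
      using C(2)[of 1 z] by (simp add: zero_ext_def)
  qed (use p C in auto)
  then show ?thesis using hol by (simp add: bergman_space_iff[OF p] N_def)
qed

lemma pow_fun_axis_ge:
  fixes b \<rho> x :: real and k :: "'n::finite"
  assumes "b > 0" "0 \<le> \<rho>" "\<rho> \<le> 1" "0 \<le> x" "x < 1"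
  shows "(1 - \<rho> * x) powr (- b) \<le> norm (pow_fun k b \<rho> (x *\<^sub>R axis k 1))"
  using norm_radial_pow_fun_ge[OF assms, where N=0 and k=k] by simp

lemma pow_fun_in_hardy_imp:
  fixes q b :: real and k :: "'n::finite"
  assumes q: "q > 0" and b: "b > 0" and f: "pow_fun k b 1 \<in> hardy_space q"
  shows "b * q \<le> CARD('n)"
proof -
  define f where "f = pow_fun k b 1"
  have hol: "holomorphic_vec_on f unit_ball" and H: "hardy_sup q f < top" using f by (auto simp: hardy_space_def f_def)
  obtain h where h: "0 \<le> h" "hardy_sup q f = ennreal h" using H by (cases "hardy_sup q f") auto
  define A where "A = 2 * real CARD('n) * 4 ^ (CARD('n) + 1)"
  have A: "A > 0" by (simp add: A_def)
  have "CARD('n) - b * q \<ge> 0"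
  proof (rule powr_bounded_imp_nonneg)
    fix s :: real assume s: "0 < s" "s \<le> 1 / 2"
    let ?z = "(1 - s) *\<^sub>R axis k 1 :: complex ^ 'n"
    have z: "norm ?z = 1 - s" using s by (intro norm_axis_point) simp
    have z1: "norm ?z < 1" unfolding z using s by simp
    have "s powr (- b) \<le> norm (f ?z)" using pow_fun_axis_ge[OF b, of 1 "1 - s" k] s by (simp add: f_def)
    then have "(s powr (- b)) powr q \<le> norm (f ?z) powr q" using q by (intro powr_mono2) auto
    then have "ennreal (s powr (- b * q)) \<le> ennreal (norm (zero_ext f ?z) powr q)"
      using z1 by (simp add: powr_powr zero_ext_def ennreal_leI)
    also have "\<dots> \<le> ennreal (A * (1 - norm ?z) powr (- real CARD('n))) * integral_mean q (zero_ext f) (1 - (1 - norm ?z) / 4)"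
      using pointwise_integral_mean[OF ball_fun_zero_ext[OF hol] q z1] by (simp add: A_def)
    also have "\<dots> = ennreal (A * s powr (- real CARD('n))) * integral_mean q f (1 - s / 4)"
      unfolding z using s by (simp add: integral_mean_zero_ext)
    also have "\<dots> \<le> ennreal (A * s powr (- real CARD('n))) * ennreal h"
      using hardy_sup_le_iff[of q f "ennreal h"] s h by (intro mult_left_mono) auto
    also have "\<dots> = ennreal (A * s powr (- real CARD('n)) * h)" using A h by (simp add: ennreal_mult)
    finally have le: "s powr (- b * q) \<le> A * s powr (- real CARD('n)) * h" using A h by (simp add: ennreal_le_iff)
    have "s powr (CARD('n) - b * q) = s powr real CARD('n) * s powr (- b * q)" by (simp add: powr_add[symmetric])
    also have "\<dots> \<le> s powr real CARD('n) * (A * s powr (- real CARD('n)) * h)" by (rule mult_left_mono[OF le]) simp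
    also have "\<dots> = A * h" using s by (simp add: powr_minus field_simps)
    finally show "s powr (CARD('n) - b * q) \<le> A * h" .
  qed
  then show ?thesis by simp
qed

text \<open>
  By the pointwise estimate for the derivative of order \<open>N\<close>, the growth \<open>(1 - x)\<^bsup>-(b+N)\<^esup>\<close> of that derivative
  along a ray is at most the one that the weight \<open>\<gamma> = N q + \<alpha>\<close> permits; the summands \<open>N q\<close> cancel.
\<close>

lemma pow_fun_in_bergman_imp:
  fixes q b \<alpha> :: real and k :: "'n::finite"
  assumes q: "q > 0" and b: "b > 0" and f: "pow_fun k b 1 \<in> bergman_space q \<alpha>"
  shows "b * q \<le> CARD('n) + 1 + \<alpha>"
proof -
  define N where "N = bergman_order q \<alpha>"
  define g where "g = zero_ext ((radial_deriv ^^ N) (pow_fun k b 1))"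
  define \<gamma> where "\<gamma> = N * q + \<alpha>"
  from f have hol: "holomorphic_vec_on (pow_fun k b 1) unit_ball" and W: "weighted_integral q \<gamma> g < top"
    by (auto simp: bergman_space_iff[OF q] g_def N_def \<gamma>_def)
  have g: "ball_fun g" unfolding g_def by (intro ball_fun_zero_ext holomorphic_vec_on_radial_funpow hol)
  obtain w where w: "0 \<le> w" "weighted_integral q \<gamma> g = ennreal w" using W by (cases "weighted_integral q \<gamma> g") auto
  obtain C where C: "C > 0" "\<And>f :: complex ^ 'n \<Rightarrow> complex. \<And>z. ball_fun f \<Longrightarrow> norm z < 1 \<Longrightarrow>
    ennreal (norm (f z) powr q) \<le> ennreal (C * (1 - norm z) powr (- (CARD('n) + 1 + \<gamma>))) * weighted_integral q \<gamma> f"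
    by (rule pointwise_weighted_integral[OF q, of \<gamma>, where 'n='n], rule that)
  define a where "a = radial_coeff b N N * (1 / 2) ^ N"
  have a: "a > 0" using radial_coeff_top[OF b, of N] by (simp add: a_def)
  have "CARD('n) + 1 + \<gamma> - (b + N) * q \<ge> 0"
  proof (rule powr_bounded_imp_nonneg)
    fix s :: real assume s: "0 < s" "s \<le> 1 / 2"
    let ?z = "(1 - s) *\<^sub>R axis k 1 :: complex ^ 'n"
    have z: "norm ?z = 1 - s" using s by (intro norm_axis_point) simp
    have z1: "norm ?z < 1" unfolding z using s by simp
    have "a * s powr (- (b + N)) \<le> radial_coeff b N N * (1 - s) ^ N * s powr (- (b + N))"
      unfolding a_def using s radial_coeff_nonneg[OF b, of N N] by (intro mult_right_mono mult_left_mono power_mono) auto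
    also have "\<dots> \<le> norm ((radial_deriv ^^ N) (pow_fun k b 1) ?z)"
      using norm_radial_pow_fun_ge[OF b, of 1 "1 - s" N k] s by simp
    finally have "(a * s powr (- (b + N))) powr q \<le> norm (g ?z) powr q" using q a z1 by (intro powr_mono2) (auto simp: g_def zero_ext_def)
    then have "a powr q * s powr (- (b + N) * q) \<le> norm (g ?z) powr q" using a by (simp add: powr_mult powr_powr)
    then have "ennreal (a powr q * s powr (- (b + N) * q)) \<le> ennreal (norm (g ?z) powr q)" by (rule ennreal_leI)
    also have "\<dots> \<le> ennreal (C * (1 - norm ?z) powr (- (CARD('n) + 1 + \<gamma>))) * weighted_integral q \<gamma> g" by (rule C(2)[OF g z1])
    also have "\<dots> = ennreal (C * s powr (- (CARD('n) + 1 + \<gamma>)) * w)" unfolding z w(2) using C(1) w by (simp add: ennreal_mult)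
    finally have le: "a powr q * s powr (- (b + N) * q) \<le> C * s powr (- (CARD('n) + 1 + \<gamma>)) * w"
      using C(1) w by (subst (asm) ennreal_le_iff) auto
    have "s powr (CARD('n) + 1 + \<gamma> - (b + N) * q) = s powr (CARD('n) + 1 + \<gamma>) * (a powr q * s powr (- (b + N) * q)) / a powr q"
      using a by (simp add: powr_add[symmetric] algebra_simps)
    also have "\<dots> \<le> s powr (CARD('n) + 1 + \<gamma>) * (C * s powr (- (CARD('n) + 1 + \<gamma>)) * w) / a powr q"
      by (intro divide_right_mono mult_left_mono le) auto
    also have "\<dots> = (s powr (CARD('n) + 1 + \<gamma>) * s powr (- (CARD('n) + 1 + \<gamma>))) * (C * w / a powr q)" by simp
    also have "s powr (CARD('n) + 1 + \<gamma>) * s powr (- (CARD('n) + 1 + \<gamma>)) = 1" using s by (subst powr_add[symmetric]) simp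
    finally show "s powr (CARD('n) + 1 + \<gamma> - (b + N) * q) \<le> 1 * (C * w / a powr q)" .
  qed
  then show ?thesis by (simp add: \<gamma>_def algebra_simps)
qed

lemma bergman_subset_hardy_imp:
  fixes p q \<alpha> :: real
  assumes p: "p > 0" and q: "q > 0" and sub: "(bergman_space p \<alpha> :: (complex ^ 'n \<Rightarrow> complex) set) \<subseteq> hardy_space q"
  shows "(CARD('n) + 1 + \<alpha>) / p \<le> CARD('n) / q"
proof (rule ccontr)
  assume "\<not> (CARD('n) + 1 + \<alpha>) / p \<le> CARD('n) / q"
  then have "CARD('n) / q < (CARD('n) + 1 + \<alpha>) / p" by simp
  from dense[OF this] obtain b where b: "CARD('n) / q < b" "b < (CARD('n) + 1 + \<alpha>) / p" by blast
  obtain k :: 'n where True by blast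
  have b0: "b > 0" by (rule less_trans[OF _ b(1)]) (use q in simp)
  have "b * p < CARD('n) + 1 + \<alpha>" using b(2) p by (simp add: field_simps)
  then have "pow_fun k b 1 \<in> hardy_space q" using pow_fun_in_bergman[OF p b0] sub by blast
  from pow_fun_in_hardy_imp[OF q b0 this] show False using b(1) q by (simp add: field_simps)
qed

text \<open>
  Membership of the kernel power in \<open>H\<^sup>p\<close> follows from the embedding of a Bergman space: for
  \<open>p' = p/2\<close> and \<open>\<alpha>' = n/2 - n - 1\<close> the critical inequality of \<open>bergman_subset_hardy\<close> is an equality,
  and the condition \<open>b p' < n + 1 + \<alpha>'\<close> says \<open>b < n/p\<close>.
\<close>

lemma hardy_subset_bergman_imp:
  fixes p q \<alpha> :: real
  assumes p: "p > 0" and q: "q > 0" and sub: "(hardy_space p :: (complex ^ 'n \<Rightarrow> complex) set) \<subseteq> bergman_space q \<alpha>"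
  shows "CARD('n) / p \<le> (CARD('n) + 1 + \<alpha>) / q"
proof (rule ccontr)
  assume "\<not> CARD('n) / p \<le> (CARD('n) + 1 + \<alpha>) / q"
  then have less: "(CARD('n) + 1 + \<alpha>) / q < CARD('n) / p" by simp
  obtain k :: 'n where True by blast
  have "max 0 ((CARD('n) + 1 + \<alpha>) / q) < CARD('n) / p" using less p by simp
  then obtain b where "max 0 ((CARD('n) + 1 + \<alpha>) / q) < b" and b2: "b < CARD('n) / p" using dense by blast
  then have b: "0 < b" "(CARD('n) + 1 + \<alpha>) / q < b" by auto
  define \<alpha>' where "\<alpha>' = real CARD('n) / 2 - CARD('n) - 1"
  have "pow_fun k b 1 \<in> bergman_space (p / 2) \<alpha>'"
    by (rule pow_fun_in_bergman) (use p b b2 in \<open>simp_all add: \<alpha>'_def field_simps\<close>)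
  moreover have "(bergman_space (p / 2) \<alpha>' :: (complex ^ 'n \<Rightarrow> complex) set) \<subseteq> hardy_space p"
    by (rule bergman_subset_hardy) (use p in \<open>simp_all add: \<alpha>'_def\<close>)
  ultimately have "pow_fun k b 1 \<in> bergman_space q \<alpha>" using sub by blast
  from pow_fun_in_bergman_imp[OF q b(1) this] show False using b(2) q by (simp add: field_simps)
qed

section \<open>Failure of compactness at the critical exponents\<close>

lemma radial_funpow_scale:
  fixes f :: "complex ^ 'n \<Rightarrow> complex"
  assumes f: "holomorphic_vec_on f unit_ball" and z: "norm z < 1"
  shows "(radial_deriv ^^ N) (\<lambda>z. c * f z) z = c * (radial_deriv ^^ N) f z"
  using z
proof (induction N arbitrary: z)
  case (Suc N)
  let ?g = "(radial_deriv ^^ N) f"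
  have g: "holomorphic_vec_on ?g unit_ball" by (rule holomorphic_vec_on_radial_funpow[OF f])
  have z: "z \<in> unit_ball" using Suc.prems by simp
  have "((\<lambda>z. c * ?g z) has_derivative (\<lambda>v. c * cderiv ?g z v)) (at z)"
    by (intro has_derivative_mult_right holomorphic_vec_cderiv(1)[OF g z])
  then have "((radial_deriv ^^ N) (\<lambda>z. c * f z) has_derivative (\<lambda>v. c * cderiv ?g z v)) (at z)"
    by (rule has_derivative_transform_within_open[OF _ open_ball z]) (simp add: Suc.IH)
  from radial_deriv_eq[OF this] show ?case
    using holomorphic_vec_cderiv(2)[OF g z] radial_deriv_cderiv[OF g z] by simp
qed simp

lemma weighted_integral_scale:
  fixes g :: "complex ^ 'n \<Rightarrow> complex"
  assumes g: "ball_fun g"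
  shows "weighted_integral p \<gamma> (\<lambda>z. c * g z) = ennreal (norm c powr p) * weighted_integral p \<gamma> g"
proof -
  note [measurable] = ball_fun_measurable[OF g]
  have "weighted_integral p \<gamma> (\<lambda>z. c * g z) = (\<integral>\<^sup>+z. ennreal (norm c powr p) * (ennreal (norm (g z) powr p * (1 - (norm z)\<^sup>2) powr \<gamma>) * indicator unit_ball z) \<partial>lborel)"
    unfolding weighted_integral_def by (intro nn_integral_cong) (simp add: norm_mult powr_mult ennreal_mult mult.assoc)
  also have "\<dots> = ennreal (norm c powr p) * weighted_integral p \<gamma> g"
    unfolding weighted_integral_def
  proof (rule nn_integral_cmult)
    have [measurable]: "unit_ball \<in> sets (borel :: (complex ^ 'n) measure)" by simp
    show "(\<lambda>z. ennreal (norm (g z) powr p * (1 - (norm z)\<^sup>2) powr \<gamma>) * indicator unit_ball z) \<in> borel_measurable lborel"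
      by measurable
  qed
  finally show ?thesis .
qed

lemma integral_mean_scale:
  fixes g :: "complex ^ 'n \<Rightarrow> complex"
  assumes g: "ball_fun g"
  shows "integral_mean p (\<lambda>z. c * g z) r = ennreal (norm c powr p) * integral_mean p g r"
proof -
  note [measurable] = ball_fun_measurable[OF g]
  have "integral_mean p (\<lambda>z. c * g z) r = (\<integral>\<^sup>+\<zeta>. ennreal (norm c powr p) * ennreal (norm (g (r *\<^sub>R \<zeta>)) powr p) \<partial>(sphere_measure :: (complex ^ 'n) measure))"
    unfolding integral_mean_def by (intro nn_integral_cong) (simp add: norm_mult powr_mult ennreal_mult)
  then show ?thesis unfolding integral_mean_def by (simp add: nn_integral_cmult)
qed

text \<open>
  For \<open>b\<close> one above the critical exponent, the factor \<open>s\<close> normalizes \<open>(1 - (1 - s) z\<^sub>k)\<^bsup>-b\<^esup>\<close>: its norms in the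
  domain of the embedding remain bounded as \<open>s \<rightarrow> 0\<close>. It tends to \<open>0\<close> locally uniformly and
  concentrates at \<open>(1 - s) e\<^sub>k\<close>.
\<close>

definition peak :: "'n::finite \<Rightarrow> real \<Rightarrow> real \<Rightarrow> complex ^ 'n \<Rightarrow> complex" where
  "peak k b s = (\<lambda>z. of_real s * pow_fun k b (1 - s) z)"

lemma peak_0: "0 < s \<Longrightarrow> norm (peak k b s 0) = s"
  by (simp add: peak_def pow_fun_def)

lemma holomorphic_peak:
  assumes s: "0 < s" "s < 1"
  shows "holomorphic_vec_on (peak k b s :: complex ^ 'n \<Rightarrow> complex) unit_ball"
  unfolding holomorphic_vec_on_def
proof
  fix z :: "complex ^ 'n" assume z: "z \<in> unit_ball"
  have h: "holomorphic_vec_on (pow_fun k b (1 - s)) unit_ball" using s by (intro holomorphic_pow_fun) auto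
  show "\<exists>D. (peak k b s has_derivative D) (at z) \<and> (\<forall>c v. D (c *s v) = c * D v)"
    unfolding peak_def
    by (intro exI[of _ "\<lambda>v. of_real s * cderiv (pow_fun k b (1 - s)) z v"] conjI has_derivative_mult_right holomorphic_vec_cderiv(1)[OF h z])
      (simp add: holomorphic_vec_cderiv(2)[OF h z])
qed

lemma norm_pow_fun:
  fixes z :: "complex ^ 'n"
  assumes "0 \<le> \<rho>" "\<rho> \<le> 1" "norm z < 1"
  shows "norm (pow_fun k b \<rho> z) = norm (1 - of_real \<rho> * z $ k) powr (- b)"
  using norm_powr_of_real[OF one_minus_pos(2)[OF norm_coord_less[OF assms, of k]], of "- b"] by (simp add: pow_fun_def)

lemma peak_uniform_limit:
  fixes K :: "(complex ^ 'n) set"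
  assumes b: "b > 0" and K: "compact K" "K \<subseteq> unit_ball"
  shows "uniform_limit K (\<lambda>m. peak k b (1 / (real m + 2))) (\<lambda>_. 0) sequentially"
proof -
  obtain t where t: "t < 1" "0 \<le> t" "\<And>z. z \<in> K \<Longrightarrow> norm z \<le> t"
  proof (cases "K = {}")
    case True
    then show ?thesis by (intro that[of 0]) auto
  next
    case False
    have "continuous_on K norm" by (intro continuous_intros)
    from continuous_attains_sup[OF K(1) False this] obtain x where "x \<in> K" "\<forall>y\<in>K. norm y \<le> norm x" by blast
    then show ?thesis using K(2) by (intro that[of "norm x"]) auto
  qed
  have bound: "norm (peak k b (1 / (real m + 2)) z) \<le> 1 / (real m + 2) * (1 - t) powr (- b)" if z: "z \<in> K" for m z
  proof -
    define \<rho> where "\<rho> = 1 - 1 / (real m + 2)"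
    have \<rho>: "0 \<le> \<rho>" "\<rho> \<le> 1" by (auto simp: \<rho>_def field_simps)
    have zt: "norm z \<le> t" "norm z < 1" using t z by force+
    have "norm (of_real \<rho> * z $ k) \<le> 1 * norm (z $ k)"
      unfolding norm_mult using \<rho> by (intro mult_right_mono) auto
    also have "\<dots> \<le> t" using Finite_Cartesian_Product.norm_nth_le[of z k] zt by simp
    finally have "1 - t \<le> norm (1 - of_real \<rho> * z $ k)"
      using norm_triangle_ineq2[of 1 "of_real \<rho> * z $ k"] by simp
    then have "norm (1 - of_real \<rho> * z $ k) powr (- b) \<le> (1 - t) powr (- b)" using t b by (intro powr_mono2') auto
    then have "norm (pow_fun k b \<rho> z) \<le> (1 - t) powr (- b)" using norm_pow_fun[OF \<rho> zt(2)] by simp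
    then have "1 / (real m + 2) * norm (pow_fun k b \<rho> z) \<le> 1 / (real m + 2) * (1 - t) powr (- b)"
      by (rule mult_left_mono) simp
    then show ?thesis by (simp add: peak_def norm_mult norm_divide \<rho>_def del: of_real_divide)
  qed
  have lim: "(\<lambda>m. 1 / (real m + 2) * (1 - t) powr (- b)) \<longlonglongrightarrow> 0" by real_asymp
  show ?thesis
  proof (rule uniform_limitI)
    fix e :: real assume "e > 0"
    from order_tendstoD(2)[OF lim this]
    show "eventually (\<lambda>m. \<forall>z\<in>K. dist (peak k b (1 / (real m + 2)) z) 0 < e) sequentially"
      by (rule eventually_mono) (use bound in \<open>auto intro: le_less_trans\<close>)
  qed
qed

lemma peak_ge:
  fixes b s :: real and k :: "'n::finite"
  assumes b: "b > 0" and s: "0 < s" "s < 1" and q: "q > 0"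
  shows "2 powr (- b * q) * s powr (q - b * q) \<le> norm (zero_ext (peak k b s) ((1 - s) *\<^sub>R axis k 1)) powr q"
proof -
  have "(2 * s) powr (- b) \<le> (1 - (1 - s) * (1 - s)) powr (- b)"
  proof (rule powr_mono2')
    have "1 - (1 - s) * (1 - s) = s * (2 - s)" by (simp add: algebra_simps)
    then show "0 < 1 - (1 - s) * (1 - s)" using s by simp
    show "1 - (1 - s) * (1 - s) \<le> 2 * s" by (simp add: algebra_simps)
  qed (use b in simp)
  also have "\<dots> \<le> norm (pow_fun k b (1 - s) ((1 - s) *\<^sub>R axis k 1))"
    using s by (intro pow_fun_axis_ge[OF b]) auto
  finally have "s * (2 * s) powr (- b) \<le> norm (peak k b s ((1 - s) *\<^sub>R axis k 1))"
    unfolding peak_def norm_mult using s by (simp add: mult_left_mono)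
  then have "(s * (2 * s) powr (- b)) powr q \<le> norm (peak k b s ((1 - s) *\<^sub>R axis k 1)) powr q" using s q by (intro powr_mono2) auto
  moreover have "(s * (2 * s) powr (- b)) powr q = 2 powr (- b * q) * s powr (q - b * q)"
  proof -
    have "s * (2 * s) powr (- b) = 2 powr (- b) * (s powr 1 * s powr (- b))" using s by (simp add: powr_mult)
    also have "s powr 1 * s powr (- b) = s powr (1 - b)" unfolding powr_add[symmetric] by simp
    finally have "s * (2 * s) powr (- b) = 2 powr (- b) * s powr (1 - b)" .
    moreover have "(1 - b) * q = q - b * q" by (simp add: algebra_simps)
    ultimately show ?thesis by (simp only: powr_mult powr_powr powr_ge_zero)
  qed
  ultimately show ?thesis using s by (simp add: zero_ext_def norm_axis_1)
qed

lemma peak_bergman_integral_bound: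
  fixes p b \<alpha> :: real and k :: "'n::finite"
  assumes p: "p > 0" and b: "b > 0" and eq: "b * p = CARD('n) + 1 + \<alpha> + p"
  obtains C where "C > 0" "\<And>s. 0 < s \<Longrightarrow> s < 1 \<Longrightarrow> bergman_integral p \<alpha> (peak k b s) \<le> ennreal C"
proof -
  define N where "N = bergman_order p \<alpha>"
  define \<gamma> where "\<gamma> = N * p + \<alpha>"
  have \<gamma>: "\<gamma> > -1" using bergman_order_gt[OF p, of \<alpha>] by (simp add: N_def \<gamma>_def)
  obtain C1 where C1: "C1 > 0" "\<And>\<rho> z. 0 \<le> \<rho> \<Longrightarrow> \<rho> \<le> 1 \<Longrightarrow> norm z < 1 \<Longrightarrow>
    norm ((radial_deriv ^^ N) (pow_fun k b \<rho>) (z :: complex ^ 'n)) \<le> C1 * norm (1 - of_real \<rho> * z $ k) powr (- (b + N))"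
    by (rule norm_radial_pow_fun_le[OF b, of N k], rule that)
  have c: "(b + N) * p > CARD('n) + 1 + \<gamma>" using eq p by (simp add: \<gamma>_def algebra_simps)
  obtain C where C: "C > 0" "\<And>g :: complex ^ 'n \<Rightarrow> complex. \<And>\<rho>. ball_fun g \<Longrightarrow> (\<forall>z. norm z < 1 \<longrightarrow> norm (g z) \<le> C1 * norm (1 - of_real \<rho> * z $ k) powr (- (b + N))) \<Longrightarrow>
    0 \<le> \<rho> \<Longrightarrow> \<rho> < 1 \<Longrightarrow> weighted_integral p \<gamma> g \<le> ennreal (C * (1 - \<rho>) powr (CARD('n) + 1 + \<gamma> - (b + N) * p))"
    by (rule weighted_integral_pow_bound[OF p less_imp_le[OF C1(1)] \<gamma> c, of k], rule that)
  show thesis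
  proof (rule that[OF C(1)])
    fix s :: real assume s: "0 < s" "s < 1"
    let ?g = "zero_ext ((radial_deriv ^^ N) (pow_fun k b (1 - s)))"
    have hol: "holomorphic_vec_on (pow_fun k b (1 - s)) unit_ball" using s by (intro holomorphic_pow_fun) auto
    have g: "ball_fun ?g" by (intro ball_fun_zero_ext holomorphic_vec_on_radial_funpow hol)
    have "zero_ext ((radial_deriv ^^ N) (peak k b s)) = (\<lambda>z. of_real s * ?g z)"
      using radial_funpow_scale[OF hol] by (auto simp: zero_ext_def peak_def fun_eq_iff)
    then have "weighted_integral p \<gamma> (zero_ext ((radial_deriv ^^ N) (peak k b s))) = ennreal (s powr p) * weighted_integral p \<gamma> ?g"
      using weighted_integral_scale[OF g, of p \<gamma> "of_real s"] s by simp
    also have "\<dots> \<le> ennreal (s powr p) * ennreal (C * (1 - (1 - s)) powr (CARD('n) + 1 + \<gamma> - (b + N) * p))"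
      using s C1(2)[of "1 - s"] by (intro mult_left_mono C(2)[OF g]) (auto simp: zero_ext_def)
    also have "\<dots> = ennreal (C * (s powr p * s powr (CARD('n) + 1 + \<gamma> - (b + N) * p)))"
      using C(1) by (simp add: ennreal_mult[symmetric] mult_ac)
    also have "s powr p * s powr (CARD('n) + 1 + \<gamma> - (b + N) * p) = 1"
    proof -
      have "p + (CARD('n) + 1 + \<gamma> - (b + N) * p) = 0" using eq by (simp add: \<gamma>_def algebra_simps)
      then show ?thesis using s by (simp add: powr_add[symmetric])
    qed
    finally show "bergman_integral p \<alpha> (peak k b s) \<le> ennreal C" by (simp add: N_def \<gamma>_def)
  qed
qed

lemma peak_hardy_bound:
  fixes p b :: real and k :: "'n::finite"
  assumes p: "p > 0" and b: "b > 0" and eq: "b * p = CARD('n) + p"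
  obtains C where "C > 0" "\<And>s. 0 < s \<Longrightarrow> s < 1 \<Longrightarrow> hardy_sup p (peak k b s) \<le> ennreal C"
proof -
  have c: "b * p > CARD('n)" using eq p by simp
  obtain C where C: "C > 0" "\<And>g :: complex ^ 'n \<Rightarrow> complex. \<And>\<rho> r. (\<forall>z. norm z < 1 \<longrightarrow> norm (g z) \<le> 1 * norm (1 - of_real \<rho> * z $ k) powr (- b)) \<Longrightarrow>
    0 \<le> \<rho> \<Longrightarrow> \<rho> \<le> 1 \<Longrightarrow> 0 \<le> r \<Longrightarrow> r < 1 \<Longrightarrow> integral_mean p g r \<le> ennreal (C * (1 - \<rho> * r) powr (CARD('n) - b * p))"
    by (rule integral_mean_pow_bound[OF p zero_le_one c, of k], rule that)
  show thesis
  proof (rule that[OF C(1)])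
    fix s :: real assume s: "0 < s" "s < 1"
    let ?g = "zero_ext (pow_fun k b (1 - s))"
    have hol: "holomorphic_vec_on (pow_fun k b (1 - s)) unit_ball" using s by (intro holomorphic_pow_fun) auto
    have g: "ball_fun ?g" by (intro ball_fun_zero_ext hol)
    show "hardy_sup p (peak k b s) \<le> ennreal C"
      unfolding hardy_sup_le_iff
    proof (intro allI impI)
      fix r :: real assume r: "0 < r" "r < 1"
      have "zero_ext (peak k b s) = (\<lambda>z. of_real s * ?g z)" by (auto simp: zero_ext_def peak_def fun_eq_iff)
      then have "integral_mean p (peak k b s) r = ennreal (s powr p) * integral_mean p ?g r"
        using integral_mean_scale[OF g, of p "of_real s" r] integral_mean_zero_ext[of r p "peak k b s"] r s by simp
      also have "\<dots> \<le> ennreal (s powr p) * ennreal (C * (1 - (1 - s) * r) powr (CARD('n) - b * p))"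
        using s r norm_pow_fun[of "1 - s" _ k b] by (intro mult_left_mono C(2)) (auto simp: zero_ext_def)
      also have "\<dots> \<le> ennreal (s powr p) * ennreal (C * s powr (- p))"
      proof (intro mult_left_mono ennreal_leI)
        have "(1 - s) * r \<le> (1 - s) * 1" using s r by (intro mult_left_mono) auto
        then have "s \<le> 1 - (1 - s) * r" by simp
        then have "(1 - (1 - s) * r) powr (- p) \<le> s powr (- p)" using s p by (intro powr_mono2') auto
        then show "(1 - (1 - s) * r) powr (CARD('n) - b * p) \<le> s powr (- p)" by (simp add: eq)
      qed (use C in auto)
      also have "\<dots> = ennreal C" using C(1) s by (simp add: ennreal_mult[symmetric] powr_minus)
      finally show "integral_mean p (peak k b s) r \<le> ennreal C" .
    qed
  qed
qed

lemma compact_embeddingD: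
  assumes "compact_embedding X normX Y normY" "\<And>k. F k \<in> X" "\<And>k. normX (F k) \<le> C"
    "\<And>K. compact K \<Longrightarrow> K \<subseteq> unit_ball \<Longrightarrow> uniform_limit K F (\<lambda>_. 0) sequentially"
  shows "(\<lambda>k. normY (F k)) \<longlonglongrightarrow> 0"
proof -
  have "(\<forall>k. F k \<in> X) \<and> (\<exists>C. \<forall>k. normX (F k) \<le> C) \<and>
      (\<forall>K. compact K \<and> K \<subseteq> unit_ball \<longrightarrow> uniform_limit K F (\<lambda>_. 0) sequentially)"
    using assms(2-4) by blast
  with assms(1)[unfolded compact_embedding_def, THEN conjunct2, THEN spec, of F] show ?thesis by (rule mp)
qed

lemma tendsto_0_ge_imp: "X \<longlonglongrightarrow> (0::real) \<Longrightarrow> (\<And>m. c \<le> X m) \<Longrightarrow> c \<le> 0"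
  by (rule LIMSEQ_le_const) auto

text \<open>
  At the point \<open>(1 - s) e\<^sub>k\<close> the value of the peak is of the order \<open>s\<^bsup>1-b\<^esup> = s\<^bsup>-n/q\<^esup>\<close>, the largest order that a
  bounded sequence in \<open>H\<^sup>q\<close> can have; its norm in \<open>H\<^sup>q\<close> is therefore bounded from below.
\<close>

lemma bergman_hardy_not_compact:
  fixes p q \<alpha> :: real
  assumes p: "0 < p" and q: "0 < q" and eq: "(CARD('n) + 1 + \<alpha>) / p = CARD('n) / q"
  shows "\<not> compact_embedding (bergman_space p \<alpha> :: (complex ^ 'n \<Rightarrow> complex) set) (bergman_norm p \<alpha>) (hardy_space q) (hardy_norm q)"
proof
  assume comp: "compact_embedding (bergman_space p \<alpha> :: (complex ^ 'n \<Rightarrow> complex) set) (bergman_norm p \<alpha>) (hardy_space q) (hardy_norm q)"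
  obtain k :: 'n where True by blast
  define b where "b = CARD('n) / q + 1"
  have b: "b > 0" using q by (simp add: b_def add_pos_pos)
  have bp: "b * p = CARD('n) + 1 + \<alpha> + p" unfolding b_def eq[symmetric] using p by (simp add: field_simps)
  have bq: "q - b * q = - real CARD('n)" using q by (simp add: b_def field_simps)
  define s where "s m = 1 / (real m + 2)" for m
  have s: "0 < s m" "s m < 1" for m by (auto simp: s_def field_simps)
  obtain C where C: "C > 0" "\<And>s. 0 < s \<Longrightarrow> s < 1 \<Longrightarrow> bergman_integral p \<alpha> (peak k b s) \<le> ennreal C"
    by (rule peak_bergman_integral_bound[OF p b bp, of k], rule that)
  obtain \<kappa> where \<kappa>: "\<kappa> > 0" "\<And>(f :: complex ^ 'n \<Rightarrow> complex). holomorphic_vec_on f unit_ball \<Longrightarrow>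
      bergman_norm p \<alpha> f \<le> norm (f 0) + enn2real (ennreal \<kappa> * bergman_integral p \<alpha> f) powr (1 / p)"
    by (rule bergman_norm_bounds[OF p, of \<alpha>], rule that)
  have hol: "holomorphic_vec_on (peak k b (s m)) unit_ball" for m by (rule holomorphic_peak[OF s])
  have mem: "peak k b (s m) \<in> bergman_space p \<alpha>" for m
    using hol le_less_trans[OF C(2)[OF s] ennreal_less_top] by (auto simp: bergman_space_iff[OF p])
  have bd: "bergman_norm p \<alpha> (peak k b (s m)) \<le> 1 + (\<kappa> * C) powr (1 / p)" for m
  proof -
    have "ennreal \<kappa> * bergman_integral p \<alpha> (peak k b (s m)) \<le> ennreal \<kappa> * ennreal C" by (intro mult_left_mono C(2)[OF s]) simp
    also have "\<dots> = ennreal (\<kappa> * C)" using \<kappa>(1) C(1) by (simp add: ennreal_mult)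
    finally have "enn2real (ennreal \<kappa> * bergman_integral p \<alpha> (peak k b (s m))) \<le> \<kappa> * C" using \<kappa>(1) C(1) by (intro enn2real_leI) auto
    then have "enn2real (ennreal \<kappa> * bergman_integral p \<alpha> (peak k b (s m))) powr (1 / p) \<le> (\<kappa> * C) powr (1 / p)" using p by (intro powr_mono2) auto
    then show ?thesis using \<kappa>(2)[OF hol, of m] peak_0[of "s m" k b] s[of m] by linarith
  qed
  have lim: "(\<lambda>m. hardy_norm q (peak k b (s m))) \<longlonglongrightarrow> 0"
    by (rule compact_embeddingD[OF comp mem bd]) (unfold s_def, rule peak_uniform_limit[OF b])
  define A where "A = 2 * real CARD('n) * 4 ^ (CARD('n) + 1)"
  have A: "A > 0" by (simp add: A_def)
  have "(2 powr (- b * q) / A) powr (1 / q) \<le> hardy_norm q (peak k b (s m))" for m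
  proof -
    let ?s = "s m"
    let ?f = "peak k b ?s"
    let ?z = "(1 - ?s) *\<^sub>R axis k 1 :: complex ^ 'n"
    have z: "norm ?z = 1 - ?s" using s[of m] by (intro norm_axis_point) simp
    have z1: "norm ?z < 1" unfolding z using s[of m] by simp
    have "?f \<in> hardy_space q" using mem comp by (auto simp: compact_embedding_def)
    then obtain h where h: "0 \<le> h" "hardy_sup q ?f = ennreal h" by (cases "hardy_sup q ?f") (auto simp: hardy_space_def)
    have "ennreal (2 powr (- b * q) * ?s powr (- real CARD('n))) \<le> ennreal (norm (zero_ext ?f ?z) powr q)"
      using peak_ge[OF b s q, of m k] unfolding bq by (rule ennreal_leI)
    also have "\<dots> \<le> ennreal (A * (1 - norm ?z) powr (- real CARD('n))) * integral_mean q (zero_ext ?f) (1 - (1 - norm ?z) / 4)"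
      using pointwise_integral_mean[OF ball_fun_zero_ext[OF hol] q z1] by (simp add: A_def)
    also have "\<dots> = ennreal (A * ?s powr (- real CARD('n))) * integral_mean q ?f (1 - ?s / 4)"
      unfolding z using s[of m] by (simp add: integral_mean_zero_ext)
    also have "\<dots> \<le> ennreal (A * ?s powr (- real CARD('n))) * ennreal h"
      using hardy_sup_le_iff[of q ?f "ennreal h"] s[of m] h by (intro mult_left_mono) auto
    also have "\<dots> = ennreal (A * ?s powr (- real CARD('n)) * h)" using A h by (simp add: ennreal_mult)
    finally have "2 powr (- b * q) * ?s powr (- real CARD('n)) \<le> A * ?s powr (- real CARD('n)) * h"
      using A h by (subst (asm) ennreal_le_iff) auto
    then have "2 powr (- b * q) * ?s powr (- real CARD('n)) \<le> (A * h) * ?s powr (- real CARD('n))" by (simp only: mult_ac)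
    then have "2 powr (- b * q) \<le> A * h" using s[of m] by (subst (asm) mult_le_cancel_right) auto
    then have "2 powr (- b * q) / A \<le> h" using A by (simp add: field_simps)
    then show ?thesis using q A h unfolding hardy_norm_def by (intro powr_mono2) auto
  qed
  from tendsto_0_ge_imp[OF lim this] have "(2 powr (- b * q) / A) powr (1 / q) \<le> 0" .
  moreover have "(2 powr (- b * q) / A) powr (1 / q) > 0" using A by simp
  ultimately show False by linarith
qed

text \<open>
  As before, with the value of the order \<open>s\<^bsup>1-b\<^esup> = s\<^bsup>-n/p\<^esup>\<close>. At the critical exponents this is the order
  \<open>s\<^bsup>-(n+1+\<alpha>)/q\<^esup>\<close> of the pointwise bound in \<open>A\<^sup>q\<^sub>\<alpha>\<close>.
\<close>

lemma hardy_bergman_not_compact: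
  fixes p q \<alpha> :: real
  assumes p: "0 < p" and pq: "p < q" and eq: "CARD('n) / p = (CARD('n) + 1 + \<alpha>) / q"
  shows "\<not> compact_embedding (hardy_space p :: (complex ^ 'n \<Rightarrow> complex) set) (hardy_norm p) (bergman_space q \<alpha>) (bergman_norm q \<alpha>)"
proof
  assume comp: "compact_embedding (hardy_space p :: (complex ^ 'n \<Rightarrow> complex) set) (hardy_norm p) (bergman_space q \<alpha>) (bergman_norm q \<alpha>)"
  obtain k :: 'n where True by blast
  have q: "q > 0" using p pq by simp
  have \<alpha>: "\<alpha> > -1" by (rule hardy_exponent_gt[OF p pq eq_refl[OF eq]])
  define b where "b = CARD('n) / p + 1"
  have b: "b > 0" using p by (simp add: b_def add_pos_pos)
  have bp: "b * p = CARD('n) + p" using p by (simp add: b_def field_simps)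
  have bq: "q - b * q = - (CARD('n) + 1 + \<alpha>)" unfolding b_def eq using q by (simp add: field_simps)
  define s where "s m = 1 / (real m + 2)" for m
  have s: "0 < s m" "s m < 1" for m by (auto simp: s_def field_simps)
  obtain C where C: "C > 0" "\<And>s. 0 < s \<Longrightarrow> s < 1 \<Longrightarrow> hardy_sup p (peak k b s) \<le> ennreal C"
    by (rule peak_hardy_bound[OF p b bp, of k], rule that)
  have hol: "holomorphic_vec_on (peak k b (s m)) unit_ball" for m by (rule holomorphic_peak[OF s])
  have mem: "peak k b (s m) \<in> hardy_space p" for m
    using hol le_less_trans[OF C(2)[OF s] ennreal_less_top] by (auto simp: hardy_space_def)
  have bd: "hardy_norm p (peak k b (s m)) \<le> C powr (1 / p)" for m
  proof -
    have "enn2real (hardy_sup p (peak k b (s m))) \<le> C" using C(1) C(2)[OF s, of m] by (intro enn2real_leI) auto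
    then show ?thesis unfolding hardy_norm_def using p by (intro powr_mono2) auto
  qed
  have lim: "(\<lambda>m. bergman_norm q \<alpha> (peak k b (s m))) \<longlonglongrightarrow> 0"
    by (rule compact_embeddingD[OF comp mem bd]) (unfold s_def, rule peak_uniform_limit[OF b])
  obtain \<kappa> where \<kappa>: "\<kappa> > 0" "\<And>(f :: complex ^ 'n \<Rightarrow> complex). holomorphic_vec_on f unit_ball \<Longrightarrow>
      enn2real (ennreal \<kappa> * bergman_integral q \<alpha> f) powr (1 / q) \<le> bergman_norm q \<alpha> f"
    by (rule bergman_norm_bounds[OF q, of \<alpha>], rule that)
  obtain A where A: "A > 0" "\<And>f :: complex ^ 'n \<Rightarrow> complex. \<And>z. ball_fun f \<Longrightarrow> norm z < 1 \<Longrightarrow>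
    ennreal (norm (f z) powr q) \<le> ennreal (A * (1 - norm z) powr (- (CARD('n) + 1 + \<alpha>))) * weighted_integral q \<alpha> f"
    by (rule pointwise_weighted_integral[OF q, of \<alpha>, where 'n='n], rule that)
  have "(\<kappa> * (2 powr (- b * q) / A)) powr (1 / q) \<le> bergman_norm q \<alpha> (peak k b (s m))" for m
  proof -
    let ?s = "s m"
    let ?f = "peak k b ?s"
    let ?z = "(1 - ?s) *\<^sub>R axis k 1 :: complex ^ 'n"
    let ?e = "- (CARD('n) + 1 + \<alpha>)"
    have z: "norm ?z = 1 - ?s" using s[of m] by (intro norm_axis_point) simp
    have z1: "norm ?z < 1" unfolding z using s[of m] by simp
    have "?f \<in> bergman_space q \<alpha>" using mem comp by (auto simp: compact_embedding_def)
    then have "bergman_integral q \<alpha> ?f < top" by (simp add: bergman_space_iff[OF q])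
    then obtain w where w: "0 \<le> w" "bergman_integral q \<alpha> ?f = ennreal w" by (cases "bergman_integral q \<alpha> ?f") auto
    have "ennreal (2 powr (- b * q) * ?s powr ?e) \<le> ennreal (norm (zero_ext ?f ?z) powr q)"
      using peak_ge[OF b s q, of m k] unfolding bq by (rule ennreal_leI)
    also have "\<dots> \<le> ennreal (A * (1 - norm ?z) powr ?e) * weighted_integral q \<alpha> (zero_ext ?f)"
      by (rule A(2)[OF ball_fun_zero_ext[OF hol] z1])
    also have "\<dots> = ennreal (A * ?s powr ?e * w)"
      unfolding z using w(2) A(1) w(1) unfolding bergman_integral_0[OF \<alpha>] by (simp add: ennreal_mult)
    finally have "2 powr (- b * q) * ?s powr ?e \<le> A * ?s powr ?e * w"
      using A(1) w(1) by (subst (asm) ennreal_le_iff) auto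
    then have "2 powr (- b * q) * ?s powr ?e \<le> (A * w) * ?s powr ?e" by (simp only: mult_ac)
    then have "2 powr (- b * q) \<le> A * w" using s[of m] by (subst (asm) mult_le_cancel_right) auto
    then have "2 powr (- b * q) / A \<le> w" using A(1) by (simp add: field_simps)
    then have "\<kappa> * (2 powr (- b * q) / A) \<le> \<kappa> * w" using \<kappa>(1) by (intro mult_left_mono) auto
    then have "(\<kappa> * (2 powr (- b * q) / A)) powr (1 / q) \<le> (\<kappa> * w) powr (1 / q)"
      using q A(1) \<kappa>(1) by (intro powr_mono2) auto
    also have "\<dots> \<le> bergman_norm q \<alpha> ?f"
      using \<kappa>(2)[OF hol, of m] \<kappa>(1) w by (simp add: ennreal_mult[symmetric])
    finally show ?thesis .
  qed
  from tendsto_0_ge_imp[OF lim this] have "(\<kappa> * (2 powr (- b * q) / A)) powr (1 / q) \<le> 0" .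
  moreover have "(\<kappa> * (2 powr (- b * q) / A)) powr (1 / q) > 0" using A(1) \<kappa>(1) by simp
  ultimately show False by linarith
qed

section \<open>The embedding theorem\<close>

theorem theoremA:
  fixes p q \<alpha> :: real
  assumes "0 < p" and "p < q"
  shows
    "((bergman_space p \<alpha> :: (complex ^ 'n \<Rightarrow> complex) set) \<subseteq> hardy_space q \<longleftrightarrow>
        (real CARD('n) + 1 + \<alpha>) / p \<le> real CARD('n) / q) \<and>
     ((hardy_space p :: (complex ^ 'n \<Rightarrow> complex) set) \<subseteq> bergman_space q \<alpha> \<longleftrightarrow>
        real CARD('n) / p \<le> (real CARD('n) + 1 + \<alpha>) / q) \<and>
     ((bergman_space p \<alpha> :: (complex ^ 'n \<Rightarrow> complex) set) \<subseteq> hardy_space q \<longrightarrow>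
        (compact_embedding (bergman_space p \<alpha> :: (complex ^ 'n \<Rightarrow> complex) set) (bergman_norm p \<alpha>)
           (hardy_space q) (hardy_norm q) \<longleftrightarrow>
         (real CARD('n) + 1 + \<alpha>) / p < real CARD('n) / q)) \<and>
     ((hardy_space p :: (complex ^ 'n \<Rightarrow> complex) set) \<subseteq> bergman_space q \<alpha> \<longrightarrow>
        (compact_embedding (hardy_space p :: (complex ^ 'n \<Rightarrow> complex) set) (hardy_norm p)
           (bergman_space q \<alpha>) (bergman_norm q \<alpha>) \<longleftrightarrow>
         real CARD('n) / p < (real CARD('n) + 1 + \<alpha>) / q))"
proof -
  let ?A = "bergman_space p \<alpha> :: (complex ^ 'n \<Rightarrow> complex) set" and ?H = "hardy_space p :: (complex ^ 'n \<Rightarrow> complex) set"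
  have q: "q > 0" using assms by simp
  have n: "real (CARD('n) + 1) + \<alpha> = real CARD('n) + 1 + \<alpha>" by simp
  note a = bergman_subset_hardy[where 'n='n and \<alpha>=\<alpha>, OF assms, unfolded n]
    bergman_subset_hardy_imp[where 'n='n and \<alpha>=\<alpha>, OF assms(1) q, unfolded n]
  note b = hardy_subset_bergman[where 'n='n and \<alpha>=\<alpha>, OF assms, unfolded n]
    hardy_subset_bergman_imp[where 'n='n and \<alpha>=\<alpha>, OF assms(1) q, unfolded n]
  have ca: "compact_embedding ?A (bergman_norm p \<alpha>) (hardy_space q) (hardy_norm q) \<longleftrightarrow>
      (real CARD('n) + 1 + \<alpha>) / p < real CARD('n) / q" if "?A \<subseteq> hardy_space q"
    using a(2)[OF that] bergman_compact_hardy[where 'n='n and \<alpha>=\<alpha>, OF assms, unfolded n]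
      bergman_hardy_not_compact[where 'n='n and \<alpha>=\<alpha>, OF assms(1) q, unfolded n]
    unfolding le_less by blast
  have cb: "compact_embedding ?H (hardy_norm p) (bergman_space q \<alpha>) (bergman_norm q \<alpha>) \<longleftrightarrow>
      real CARD('n) / p < (real CARD('n) + 1 + \<alpha>) / q" if "?H \<subseteq> bergman_space q \<alpha>"
    using b(2)[OF that] hardy_compact_bergman[where 'n='n and \<alpha>=\<alpha>, OF assms, unfolded n]
      hardy_bergman_not_compact[where 'n='n and \<alpha>=\<alpha>, OF assms, unfolded n]
    unfolding le_less by blast
  show ?thesis using a b ca cb by blast
qed

end
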